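(* Let $\xi\in S^1\subset\mathbb{R}^2$ be a unit vector. Let $a\in\mathcal{M}(\mathbb{R}^2)$ be given, such that the distributional directional derivative $\xi\cdot\nabla a$ belongs to $\mathcal{M}(\mathbb{R}^2)$. Then for every sequence $a_m\in L^1\cap L^\infty(\mathbb{R}^2)$ which converges to $a$ in the narrow sense, and satisfies in addition $$\sup_m\|\xi\cdot\nabla a_m\|_{\mathcal{M}}<\infty,$$ the corresponding sequence $u_m$ of solutions of the two-dimensional Burgers equation ($u_m(t)=S_ta_m$) is precompact in $L^p_{\rm loc}((0,+\infty)\times\mathbb{R}^2)$ for every finite $p$. For a converging subsequence, the limit $u(t,x)$ holds boundedly almost everywhere and is an entropy solution of the Burgers equation.
   Context: $\mathcal{M}(\mathbb{R}^2)$ is the space of bounded (signed, finite) measures over $\mathbb{R}^2$, with total variation norm $\|\cdot\|_{\mathcal M}$; $L^1(\mathbb{R}^2)$ is identified with a subspace of it. A sequence $a_m$ converges to $a$ in the narrow sense if $\int\psi a_m\,dx\to\langle a,\psi\rangle$ for every bounded continuous $\psi$. The two-dimensional Burgers equation is $$\partial_tu+\partial_1\frac{u^2}2+\partial_2\frac{u^3}3=0,\qquad t>0,\ x\in\mathbb{R}^2.$$ Write $f(u)=(u^2/2,u^3/3)$. For $b\in L^1\cap L^\infty(\mathbb{R}^2)$, $S_tb:=u(t)$ denotes Kruzhkov's semigroup, that is, $u\in L^\infty(\mathbb{R}_+\times\mathbb{R}^2)\cap C(\mathbb{R}_+;L^1(\mathbb{R}^2))$ is the unique admissible (Kruzhkov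 entropy) solution with initial data $b$. An entropy solution here is a function $u$ on $(0,+\infty)\times\mathbb{R}^2$, bounded on $(\tau,\infty)\times\mathbb{R}^2$ for every $\tau>0$, such that $$\int_0^\infty\int_{\mathbb{R}^2}(u\,\partial_t\phi+f(u)\cdot\nabla_x\phi)\,dx\,dt=0\quad\text{for all }\phi\in C_c^\infty((0,\infty)\times\mathbb{R}^2),$$ and $$\int_0^\infty\int_{\mathbb{R}^2}\big(|u-k|\,\partial_t\phi+\mathrm{sgn}(u-k)(f(u)-f(k))\cdot\nabla_x\phi\big)\,dx\,dt\ge0$$ for all $k\in\mathbb{R}$ and all non-negative $\phi\in C_c^\infty((0,\infty)\times\mathbb{R}^2)$. No initial condition is part of this notion. That the limit holds boundedly almost everywhere means that the convergence to $u$ is almost everywhere, with a uniform $L^\infty$ bound on each set $(\tau,\infty)\times\mathbb{R}^2$, $\tau>0$. *)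

theory Defs
  imports "HOL-Analysis.Analysis"
begin

section \<open>Finite signed Borel measures\<close>

text \<open>
  A signed measure is a real-valued set function, countably additive on the Borel sets; its values
  on other sets are irrelevant. Finiteness is automatic because the values are real, and
  \<open>\<mu> {} = 0\<close> follows from the constant sequence \<open>A i = {}\<close>.
\<close>

definition signed_measure :: "('a::topological_space set \<Rightarrow> real) \<Rightarrow> bool" where
  "signed_measure \<mu> \<longleftrightarrow>
     (\<forall>A :: nat \<Rightarrow> 'a set. range A \<subseteq> sets borel \<longrightarrow> disjoint_family A \<longrightarrow>
        (\<lambda>i. \<mu> (A i)) sums \<mu> (\<Union>i. A i))"

definition total_variation :: "('a::topological_space set \<Rightarrow> real) \<Rightarrow> ennreal" where
  "total_variation \<mu> =
     (SUP P\<in>{P. finite P \<and> P \<subseteq> sets borel \<and> disjoint P}. \<Sum>A\<in>P. ennreal \<bar>\<mu> A\<bar>)"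

text \<open>
  The two parts of the Jordan decomposition: the positive part of \<open>\<mu>\<close> is
  \<open>A \<mapsto> sup {\<mu> B | B \<subseteq> A Borel}\<close>. Truncation of negative values by \<^term>\<open>ennreal\<close> is harmless,
  as \<open>B = {}\<close> is allowed.
\<close>

definition jordan_pos :: "('a::topological_space set \<Rightarrow> real) \<Rightarrow> 'a measure" where
  "jordan_pos \<mu> =
     measure_of UNIV (sets borel) (\<lambda>A. SUP B\<in>{B \<in> sets borel. B \<subseteq> A}. ennreal (\<mu> B))"

definition jordan_neg :: "('a::topological_space set \<Rightarrow> real) \<Rightarrow> 'a measure" where
  "jordan_neg \<mu> = jordan_pos (\<lambda>A. - \<mu> A)"

definition signed_integral :: "('a::topological_space set \<Rightarrow> real) \<Rightarrow> ('a \<Rightarrow> real) \<Rightarrow> real" where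
  "signed_integral \<mu> \<psi> = integral\<^sup>L (jordan_pos \<mu>) \<psi> - integral\<^sup>L (jordan_neg \<mu>) \<psi>"


section \<open>Test functions and distributional directional derivatives\<close>

primrec C_k :: "nat \<Rightarrow> ('a::euclidean_space \<Rightarrow> real) \<Rightarrow> bool" where
  "C_k 0 \<phi> \<longleftrightarrow> continuous_on UNIV \<phi>"
| "C_k (Suc k) \<phi> \<longleftrightarrow> (\<forall>x. \<phi> differentiable (at x)) \<and>
     (\<forall>b\<in>Basis. C_k k (\<lambda>x. frechet_derivative \<phi> (at x) b))"

text \<open>\<open>C\<^sub>c\<^sup>\<infinity>(\<Omega>)\<close>, its elements being extended by zero to the whole space.\<close>

definition test_functions :: "'a::euclidean_space set \<Rightarrow> ('a \<Rightarrow> real) set" where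
  "test_functions \<Omega> = {\<phi>. (\<forall>k. C_k k \<phi>) \<and>
     compact (closure {x. \<phi> x \<noteq> 0}) \<and> closure {x. \<phi> x \<noteq> 0} \<subseteq> \<Omega>}"

text \<open>
  A distribution is given by its values on test functions. Below, functions and signed measures
  are turned into distributions, and \<open>dir_deriv \<xi> T\<close> is \<open>\<xi> \<cdot> \<nabla>T\<close>.
\<close>

definition fun_distr :: "('a::euclidean_space \<Rightarrow> real) \<Rightarrow> ('a \<Rightarrow> real) \<Rightarrow> real" where
  "fun_distr g \<phi> = (LINT x|lborel. g x * \<phi> x)"

definition measure_distr :: "('a::euclidean_space set \<Rightarrow> real) \<Rightarrow> ('a \<Rightarrow> real) \<Rightarrow> real" where
  "measure_distr \<mu> \<phi> = signed_integral \<mu> \<phi>"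

definition dir_deriv ::
    "'a::euclidean_space \<Rightarrow> (('a \<Rightarrow> real) \<Rightarrow> real) \<Rightarrow> ('a \<Rightarrow> real) \<Rightarrow> real" where
  "dir_deriv \<xi> T \<phi> = - T (\<lambda>x. frechet_derivative \<phi> (at x) \<xi>)"

definition represents :: "('a::euclidean_space set \<Rightarrow> real) \<Rightarrow> (('a \<Rightarrow> real) \<Rightarrow> real) \<Rightarrow> bool" where
  "represents \<nu> T \<longleftrightarrow> signed_measure \<nu> \<and> (\<forall>\<phi>\<in>test_functions UNIV. T \<phi> = measure_distr \<nu> \<phi>)"

definition is_measure_distr :: "(('a::euclidean_space \<Rightarrow> real) \<Rightarrow> real) \<Rightarrow> bool" where
  "is_measure_distr T \<longleftrightarrow> (\<exists>\<nu>. represents \<nu> T)"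

text \<open>
  The total variation norm of a distribution. A representing signed measure is unique on Borel
  sets, so the infimum merely picks its total variation; it is \<open>\<infinity>\<close> if \<open>T\<close> is not a finite signed
  measure.
\<close>

definition distr_norm :: "(('a::euclidean_space \<Rightarrow> real) \<Rightarrow> real) \<Rightarrow> ennreal" where
  "distr_norm T = (INF \<nu>\<in>{\<nu>. represents \<nu> T}. total_variation \<nu>)"

definition narrowly_converges ::
    "(nat \<Rightarrow> 'a::euclidean_space \<Rightarrow> real) \<Rightarrow> ('a set \<Rightarrow> real) \<Rightarrow> bool" where
  "narrowly_converges g \<mu> \<longleftrightarrow>
     (\<forall>\<psi>. continuous_on UNIV \<psi> \<and> bounded (range \<psi>) \<longrightarrow>
        (\<lambda>m. LINT x|lborel. \<psi> x * g m x) \<longlonglongrightarrow> signed_integral \<mu> \<psi>)"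

definition in_L1_Linf :: "('a::euclidean_space \<Rightarrow> real) \<Rightarrow> bool" where
  "in_L1_Linf g \<longleftrightarrow> integrable lborel g \<and> (\<exists>M. AE x in lborel. \<bar>g x\<bar> \<le> M)"


section \<open>The two-dimensional Burgers equation\<close>

type_synonym plane = "real ^ 2"
type_synonym spacetime = "real \<times> plane"

definition flux :: "real \<Rightarrow> plane" where
  "flux u = vector [u ^ 2 / 2, u ^ 3 / 3]"

definition dt :: "(spacetime \<Rightarrow> real) \<Rightarrow> spacetime \<Rightarrow> real" where
  "dt \<phi> p = frechet_derivative \<phi> (at p) (1, 0)"

definition grad_x :: "(spacetime \<Rightarrow> real) \<Rightarrow> spacetime \<Rightarrow> plane" where
  "grad_x \<phi> p = (\<chi> i. frechet_derivative \<phi> (at p) (0, axis i 1))"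

definition half_space :: "spacetime set" where
  "half_space = {0<..} \<times> UNIV"

text \<open>
  Elements of \<open>L\<^sup>\<infinity>\<close>, \<open>L\<^sup>p\<close> are represented by Borel functions on the whole space-time, only whose
  values on the relevant set of times matter.
\<close>

definition entropy_solution :: "(spacetime \<Rightarrow> real) \<Rightarrow> bool" where
  "entropy_solution u \<longleftrightarrow>
     set_borel_measurable lborel half_space u \<and>
     (\<forall>\<tau>>0. \<exists>M. AE p in lborel. fst p > \<tau> \<longrightarrow> \<bar>u p\<bar> \<le> M) \<and>
     (\<forall>\<phi>\<in>test_functions half_space.
        (LINT p:half_space|lborel. u p * dt \<phi> p + flux (u p) \<bullet> grad_x \<phi> p) = 0) \<and>
     (\<forall>k. \<forall>\<phi>\<in>test_functions half_space. (\<forall>p. \<phi> p \<ge> 0) \<longrightarrow>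
        (LINT p:half_space|lborel.
           \<bar>u p - k\<bar> * dt \<phi> p + (sgn (u p - k) *\<^sub>R (flux (u p) - flux k)) \<bullet> grad_x \<phi> p) \<ge> 0)"

text \<open>
  \<open>u(t) = S\<^sub>t b\<close>: the admissible solution in \<open>L\<^sup>\<infinity>(\<real>\<^sub>+ \<times> \<real>\<^sup>2) \<inter> C(\<real>\<^sub>+; L\<^sup>1(\<real>\<^sup>2))\<close> with initial data \<open>b\<close>.
  By Kruzhkov's theorem it exists and \<open>u(t)\<close> is unique almost everywhere for each \<open>t \<ge> 0\<close>.
\<close>

definition kruzhkov_solution :: "(plane \<Rightarrow> real) \<Rightarrow> (spacetime \<Rightarrow> real) \<Rightarrow> bool" where
  "kruzhkov_solution b u \<longleftrightarrow>
     set_borel_measurable lborel ({0..} \<times> UNIV) u \<and>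
     (\<exists>M. AE p in lborel. fst p \<ge> 0 \<longrightarrow> \<bar>u p\<bar> \<le> M) \<and>
     (\<forall>t\<ge>0. integrable lborel (\<lambda>x. u (t, x))) \<and>
     (\<forall>t\<ge>0. ((\<lambda>s. LINT x|lborel. \<bar>u (s, x) - u (t, x)\<bar>) \<longlongrightarrow> 0) (at t within {0..})) \<and>
     (AE x in lborel. u (0, x) = b x) \<and>
     entropy_solution u"


section \<open>Convergence in \<open>L\<^sup>p\<^sub>l\<^sub>o\<^sub>c((0,\<infinity>) \<times> \<real>\<^sup>2)\<close>\<close>

definition Lp_loc :: "real \<Rightarrow> (spacetime \<Rightarrow> real) set" where
  "Lp_loc p = {v. set_borel_measurable lborel half_space v \<and>
     (\<forall>K. compact K \<and> K \<subseteq> half_space \<longrightarrow> set_integrable lborel K (\<lambda>q. \<bar>v q\<bar> powr p))}"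

definition Lp_loc_converges ::
    "real \<Rightarrow> (nat \<Rightarrow> spacetime \<Rightarrow> real) \<Rightarrow> (spacetime \<Rightarrow> real) \<Rightarrow> bool" where
  "Lp_loc_converges p w v \<longleftrightarrow>
     (\<forall>n. w n \<in> Lp_loc p) \<and> v \<in> Lp_loc p \<and>
     (\<forall>K. compact K \<and> K \<subseteq> half_space \<longrightarrow>
        (\<lambda>n. LINT q:K|lborel. \<bar>w n q - v q\<bar> powr p) \<longlonglongrightarrow> 0)"

text \<open>
  The space \<open>L\<^sup>p\<^sub>l\<^sub>o\<^sub>c\<close> is a complete metrizable space, so precompactness can be stated sequentially.
\<close>

definition precompact_Lp_loc :: "real \<Rightarrow> (spacetime \<Rightarrow> real) set \<Rightarrow> bool" where
  "precompact_Lp_loc p F \<longleftrightarrow> F \<subseteq> Lp_loc p \<and>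
     (\<forall>w :: nat \<Rightarrow> spacetime \<Rightarrow> real. range w \<subseteq> F \<longrightarrow>
        (\<exists>r v. strict_mono r \<and> Lp_loc_converges p (w \<circ> r) v))"

definition converges_boundedly_ae ::
    "(nat \<Rightarrow> spacetime \<Rightarrow> real) \<Rightarrow> (spacetime \<Rightarrow> real) \<Rightarrow> bool" where
  "converges_boundedly_ae w v \<longleftrightarrow>
     (AE p in lborel. p \<in> half_space \<longrightarrow> (\<lambda>n. w n p) \<longlonglongrightarrow> v p) \<and>
     (\<forall>\<tau>>0. \<exists>M. \<forall>n. AE p in lborel. fst p > \<tau> \<longrightarrow> \<bar>w n p\<bar> \<le> M)"

end

theory Submission
  imports Defs "HOL-Complex_Analysis.Great_Picard"
begin

text \<open>
  Narrow convergence plays no role: the bound on \<open>\<xi> \<cdot> \<nabla>a_m\<close> alone gives compactness. The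
  \<open>L\<^sup>1\<close>-contraction, obtained by doubling of variables, makes the total variation of \<open>u_m(t)\<close> along
  \<open>\<xi>\<close> bounded uniformly in \<open>t\<close> and \<open>m\<close>. The engine for the rest is an interaction identity for two
  fields with non-positive divergence, a weak form of compensated compactness: tested against an
  averaged kernel along a line it turns the divergence information of two entropy fields into a bound
  on their wedge product, the variation along \<open>\<xi>\<close> controlling the third direction.

  For the sup bound, the supremum of the translates of \<open>u\<close> along \<open>\<xi>\<close> by dyadic numbers is a
  subsolution that does not depend on the coordinate along \<open>\<xi>\<close>; it is a subsolution of a scalar law
  in one space dimension whose flux is convex for large values, and its mass is bounded by the
  variation along \<open>\<xi>\<close>. The interaction identity and a De Giorgi iteration over levels bound it from
  above for \<open>t > \<tau>\<close>. The same applies to \<open>- u\<close>. On bounded solutions the interaction identity,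
  integrated over Kruzhkov's parameter with weight \<open>g''\<close>, where \<open>g\<close> is the flux transversal to \<open>\<xi>\<close>,
  controls \<open>\<integral> |u(p) - u(p - h e)|\<^sup>6\<close> by \<open>C h\<close> in the time and transversal directions, because
  \<open>g\<close> is a polynomial of degree 2 or 3. Compactness follows from the Kolmogorov-Riesz argument, and
  the entropy inequalities pass to the limit by dominated convergence.
\<close>


text \<open>The data are bounded one by one but not uniformly, so every estimate must rest on the
  variation along \<xi>, which controls a single direction; the others have to come from the
  nonlinearity. The averaged kernel is the mollified density of a segment of length h in a direction
  e. Its derivative along e is a difference of two mollifiers, so the doubled inequality compares a
  wedge product on the diagonal with the same product at distance h, with an error proportional to a
  kernel average. Two regimes of h are used. Letting h tend to infinity removes the shifted term and
  bounds the product of the excesses over two levels by the square of the mass: this is the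
  quadratic recursion of the iteration. Small h leaves errors of order h, hence a modulus of
  continuity. The flux transversal to \<xi> is al w^2/2 + be w^3/3 with (al, be) of length 1, so it
  is never affine, whatever \<xi> is. Traces at positive times are avoided: a non-increasing mass is
  compared with its average over an earlier interval, which costs factors 2.\<close>

notation scaleR (infixr "*R" 75)

abbreviation lims :: "(nat => 'a::topological_space) => 'a => bool" (infix "~~>" 60) where
 "f ~~> l == f \<longlonglongrightarrow> l"

abbreviation integ :: "('a::euclidean_space => 'b::{banach, second_countable_topology}) => bool" where
 "integ == integrable lborel"

abbreviation bmeas :: "('a::topological_space => 'b::topological_space) set" where
 "bmeas == borel_measurable borel"

abbreviation lmeas :: "('a::euclidean_space => 'b::topological_space) set" where
 "lmeas == borel_measurable lborel"

abbreviation contU :: "('a::topological_space => 'b::topological_space) => bool" where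
 "contU == continuous_on UNIV"

type_synonym R2 = "real \<times> real"

abbreviation ind :: "'a set => 'a => 'b::zero_neq_one" where
 "ind == indicator"

lemmas B_iadd = Bochner_Integration.integrable_add
  and B_ibound = Bochner_Integration.integrable_bound
  and B_idiff = Bochner_Integration.integrable_diff
  and B_imax = Bochner_Integration.integrable_max
  and B_isum = Bochner_Integration.integrable_sum
  and B_add = Bochner_Integration.integral_add
  and B_cong = Bochner_Integration.integral_cong
  and B_cong_AE = Bochner_Integration.integral_cong_AE
  and B_diff = Bochner_Integration.integral_diff
  and B_minus = Bochner_Integration.integral_minus
  and B_nonneg = Bochner_Integration.integral_nonneg
  and B_sum = Bochner_Integration.integral_sum
  and B_zero = Bochner_Integration.integral_zero

section \<open>Smooth functions\<close>

lemma C_k_Suc_D: "C_k (Suc k) ph ==> C_k k ph"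
proof (induction k arbitrary: ph)
 case 0
 then show ?case
  by (auto intro!: differentiable_imp_continuous_on simp: differentiable_on_def
  intro: differentiable_at_withinI)
next
 case (Suc k)
 then show ?case by auto
qed

text \<open>Accepts any family of derivatives \<open>D\<close>, so that induction steps can use the
  usual derivative rules in place of \<open>frechet_derivative\<close>.\<close>

lemma C_k_SucI:
 assumes "!!x. (ph has_derivative D x) (at x)" "!!b. b : Basis ==> C_k k (%x. D x b)"
 shows "C_k (Suc k) ph"
proof -
 have "frechet_derivative ph (at x) = D x" for x
  using frechet_derivative_at[OF assms(1)] by simp
 then show ?thesis
  using assms by (auto simp: differentiable_def)
qed

lemma C_k_Suc_E:
 assumes "C_k (Suc k) ph"
 obtains D where "!!x. (ph has_derivative D x) (at x)" "!!b. b : Basis ==> C_k k (%x. D x b)"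
proof (rule that[of "%x. frechet_derivative ph (at x)"])
 show "(ph has_derivative frechet_derivative ph (at x)) (at x)" for x
  using assms frechet_derivative_works[of ph "at x"] by simp
qed (use assms in auto)

lemma C_k_const [simp]: "C_k k (%_. c)"
 by (induction k arbitrary: c) auto

lemma C_k_add: "C_k k f ==> C_k k g ==> C_k k (%x. f x + g x)"
proof (induction k arbitrary: f g)
 case 0
 then show ?case by (simp add: continuous_on_add)
next
 case (Suc k)
 obtain D where D: "!!x. (f has_derivative D x) (at x)" "!!b. b : Basis ==> C_k k (%x. D x b)"
  using C_k_Suc_E[OF Suc.prems(1)] by metis
 obtain E where E: "!!x. (g has_derivative E x) (at x)" "!!b. b : Basis ==> C_k k (%x. E x b)"
  using C_k_Suc_E[OF Suc.prems(2)] by metis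
 show ?case
  by (rule C_k_SucI[where D = "%x v. D x v + E x v"])
  (auto intro!: derivative_eq_intros D E Suc.IH)
qed

lemma C_k_mult: "C_k k f ==> C_k k g ==> C_k k (%x. f x * g x)"
proof (induction k arbitrary: f g)
 case 0
 then show ?case by (simp add: continuous_on_mult)
next
 case (Suc k)
 obtain D where D: "!!x. (f has_derivative D x) (at x)" "!!b. b : Basis ==> C_k k (%x. D x b)"
  using C_k_Suc_E[OF Suc.prems(1)] by metis
 obtain E where E: "!!x. (g has_derivative E x) (at x)" "!!b. b : Basis ==> C_k k (%x. E x b)"
  using C_k_Suc_E[OF Suc.prems(2)] by metis
 show ?case
  by (rule C_k_SucI[where D = "%x v. f x * E x v + D x v * g x"])
  (auto intro!: has_derivative_mult D E Suc.IH C_k_add C_k_Suc_D[OF Suc.prems(1)] C_k_Suc_D[OF Suc.prems(2)])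
qed

lemma C_k_inner_right: "C_k k (%x. x \<bullet> a)"
proof (cases k)
 case 0
 then show ?thesis by (simp add: continuous_on_inner)
next
 case (Suc n)
 show ?thesis unfolding Suc
  by (rule C_k_SucI[where D = "%x v. v \<bullet> a"]) (auto intro!: derivative_eq_intros)
qed

lemma C_k_inner_self: "C_k k (%x. x \<bullet> x)"
proof (cases k)
 case 0
 then show ?thesis by (simp add: continuous_on_inner)
next
 case (Suc n)
 show ?thesis unfolding Suc
 proof (rule C_k_SucI[where D = "%x v. x \<bullet> v + v \<bullet> x"])
  show "((%x. x \<bullet> x) has_derivative (%v. x \<bullet> v + v \<bullet> x)) (at x)" for x
  by (rule has_derivative_inner) auto
  show "C_k n (%x. x \<bullet> b + b \<bullet> x)" for b
  using C_k_add[OF C_k_inner_right[of n b] C_k_inner_right[of n b]] by (simp only: inner_commute[of b])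
 qed
qed

text \<open>The whole family (1/x)^n exp(-1/x), extended by 0, in place of exp(-1/x) alone: the
  derivative of a member is a combination of two others, so the induction in \<open>C_k_flat\<close>
  closes for all n at once.\<close>

definition flat :: "nat => real => real" where
 "flat n x = (if x > 0 then (1 / x) ^ n * exp (- (1 / x)) else 0)"

lemma flat_tendsto_0: "((%x. flat n x) \<longlongrightarrow> 0) (at_right 0)"
proof -
 have "((%x::real. (1 / x) ^ n / exp (1 / x)) \<longlongrightarrow> 0) (at_right 0)"
  by (rule filterlim_compose[OF tendsto_power_div_exp_0])
  (simp add: divide_inverse filterlim_inverse_at_top_right)
 then show ?thesis
  by (rule Lim_transform_eventually)
  (auto simp: eventually_at_filter flat_def exp_minus field_simps)
qed

lemma flat_has_derivative:
 "(flat n has_real_derivative flat (n + 2) x - real n * flat (n + 1) x) (at x)"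
proof -
 consider "x > 0" | "x < 0" | "x = 0" by linarith
 then show ?thesis
 proof cases
  case 1
  have "((%x. (1 / x) ^ n * exp (- (1 / x))) has_real_derivative
  flat (n + 2) x - real n * flat (n + 1) x) (at x)"
  using 1 unfolding flat_def
  by (cases n)
  (auto intro!: derivative_eq_intros simp: field_simps power2_eq_square,
  metis One_nat_def Suc_pred neq0_conv power_Suc)
  then show ?thesis
  by (rule has_field_derivative_transform_within_open[where S = "{0<..}"]) (use 1 in "auto simp: flat_def")
 next
  case 2
  have "((%x::real. 0) has_real_derivative flat (n + 2) x - real n * flat (n + 1) x) (at x)"
  using 2 unfolding flat_def by auto
  then show ?thesis
  by (rule has_field_derivative_transform_within_open[where S = "{..<0}"]) (use 2 in "auto simp: flat_def")
 next
  case 3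
  have R: "((%h. (flat n (0 + h) - flat n 0) / h) \<longlongrightarrow> 0) (at_right 0)"
  by (rule Lim_transform_eventually[OF flat_tendsto_0[of "Suc n"]])
  (auto simp: eventually_at_filter flat_def field_simps)
  have L: "((%h. (flat n (0 + h) - flat n 0) / h) \<longlongrightarrow> 0) (at_left 0)"
  by (rule Lim_transform_eventually[OF tendsto_const])
  (auto simp: eventually_at_filter flat_def)
  from L R show ?thesis
  unfolding 3 DERIV_def by (simp add: filterlim_split_at flat_def)
 qed
qed

lemma flat_nonneg: "0 <= flat n x"
 by (auto simp: flat_def)

lemma C_k_flat:
 assumes q: "!!k. C_k k q"
 shows "C_k k (%x. flat n (q x))"
proof (induction k arbitrary: n)
 case 0
 have "contU (flat n)"
  by (meson DERIV_isCont continuous_at_imp_continuous_on flat_has_derivative)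
 then show ?case
  using q[of 0] by (auto intro: continuous_on_compose2)
next
 case (Suc k)
 obtain D where D: "!!x. (q has_derivative D x) (at x)" "!!b. b : Basis ==> C_k k (%x. D x b)"
  using C_k_Suc_E[OF q[of "Suc k"]] by metis
 have "((%x. flat n (q x)) has_derivative
  (%v. D x v * (flat (n + 2) (q x) + (- real n) * flat (n + 1) (q x)))) (at x)" for x
 proof -
  have "(flat n has_derivative (%h. h * (flat (n + 2) (q x) - real n * flat (n + 1) (q x)))) (at (q x))"
  using flat_has_derivative[of n "q x"] by (simp add: has_field_derivative_def mult_commute_abs)
  from has_derivative_compose[OF D(1) this] show ?thesis
  by (simp add: algebra_simps)
 qed
 moreover have "C_k k (%x. D x b * (flat (n + 2) (q x) + (- real n) * flat (n + 1) (q x)))"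
  if "b : Basis" for b
  by (intro C_k_mult C_k_add C_k_const D Suc.IH that)
 ultimately show ?case
  by (rule C_k_SucI)
qed

section \<open>Test functions of class C1\<close>

text \<open>C1 test functions that carry their gradient \<open>g\<close> explicitly. The cutoffs and
  the time primitives constructed below are only C1; \<open>test1_approx\<close> lets inequalities
  known for smooth test functions pass to this class.\<close>

definition test1 :: "'a::euclidean_space set => ('a => real) => ('a => 'a) => bool" where
 "test1 Om ph g \<longleftrightarrow> (ALL p. (ph has_derivative (%v. g p \<bullet> v)) (at p)) & contU g &
  (EX K. compact K & K \<subseteq> Om & (ALL p. p ~: K --> ph p = 0))"

definition grad :: "('a::euclidean_space => real) => 'a => 'a" where
 "grad ph p = (\<Sum>b\<in>Basis. frechet_derivative ph (at p) b *R b)"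

lemma has_derivative_grad:
 assumes "ph differentiable (at p)"
 shows "(ph has_derivative (%v. grad ph p \<bullet> v)) (at p)"
proof -
 have 1: "(ph has_derivative frechet_derivative ph (at p)) (at p)"
  using assms frechet_derivative_works by blast
 then interpret linear "frechet_derivative ph (at p)"
  using has_derivative_linear by blast
 have "frechet_derivative ph (at p) v = grad ph p \<bullet> v" for v
 proof -
  have "frechet_derivative ph (at p) v = frechet_derivative ph (at p) (\<Sum>b\<in>Basis. (v \<bullet> b) *R b)"
  by (simp add: euclidean_representation)
  also have "... = (\<Sum>b\<in>Basis. (v \<bullet> b) * frechet_derivative ph (at p) b)"
  by (simp add: sum scale)
  finally show ?thesis
  by (simp add: grad_def inner_sum_right inner_commute[of _ v] mult.commute)
 qed
 then have "frechet_derivative ph (at p) = (%v. grad ph p \<bullet> v)" by auto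
 with 1 show ?thesis by simp
qed

lemma grad_eq:
 assumes "(ph has_derivative (%v. g \<bullet> v)) (at p)"
 shows "grad ph p = g"
proof -
 have "frechet_derivative ph (at p) = (%v. g \<bullet> v)"
  using frechet_derivative_at[OF assms] by simp
 then show ?thesis by (simp add: grad_def euclidean_representation)
qed

lemma C_k_grad:
 assumes "!!k. C_k k ph"
 shows "(ph has_derivative (%v. grad ph p \<bullet> v)) (at p)" "contU (grad ph)"
  "b : Basis ==> C_k k (%p. grad ph p \<bullet> b)"
proof -
 have d: "ph differentiable (at p)" for p
  using assms[of 1] by auto
 show 1: "(ph has_derivative (%v. grad ph p \<bullet> v)) (at p)" for p
  using d by (rule has_derivative_grad)
 have 2: "frechet_derivative ph (at p) = (%v. grad ph p \<bullet> v)" for p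
  using frechet_derivative_at[OF 1] by simp
 have 3: "C_k k (%p. grad ph p \<bullet> b)" if "b : Basis" for b k
  using assms[of "Suc k"] that 2 by simp
 then show "b : Basis ==> C_k k (%p. grad ph p \<bullet> b)" .
 have "contU (%p. grad ph p \<bullet> b)" if "b : Basis" for b
  using 3[of b 0] that by simp
 then show "contU (grad ph)"
  by (subst continuous_on_componentwise) auto
qed

lemma test1D:
 assumes "test1 Om ph g"
 obtains K where "compact K" "K \<subseteq> Om" "!!p. p ~: K ==> ph p = 0" "!!p. p ~: K ==> g p = 0"
proof -
 obtain K where K: "compact K" "K \<subseteq> Om" "!!p. p ~: K ==> ph p = 0"
  using assms by (auto simp: test1_def)
 have "g p = 0" if "p ~: K" for p
 proof -
  have "open (- K)" using K(1) by (simp add: compact_imp_closed open_Compl)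
  have d: "(ph has_derivative (%v. g p \<bullet> v)) (at p)"
  using assms by (simp add: test1_def)
  have "((%x. 0) has_derivative (%v. g p \<bullet> v)) (at p)"
  by (rule has_derivative_transform_within_open[OF d \<open>open (- K)\<close>]) (use that K(3) in auto)
  from has_derivative_unique[OF this has_derivative_const]
  have "g p \<bullet> g p = 0" by metis
  then show ?thesis by simp
 qed
 with K that show thesis by blast
qed

lemma test1_deriv: "test1 Om ph g ==> (ph has_derivative (%v. g p \<bullet> v)) (at p)"
 by (simp add: test1_def)

lemma test1_cont: "test1 Om ph g ==> contU ph" "test1 Om ph g ==> contU g"
proof -
 show "contU ph" if "test1 Om ph g"
  by (intro continuous_at_imp_continuous_on ballI has_derivative_continuous[OF test1_deriv[OF that]])
qed (simp add: test1_def)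

lemma test1_mono: "test1 Om ph g ==> Om \<subseteq> Om' ==> test1 Om' ph g"
 unfolding test1_def by (auto intro: subset_trans)

lemma test1_bounded:
 assumes "test1 Om ph g"
 obtains C where "C > 0" "!!p. (abs (ph p)) <= C" "!!p. norm (g p) <= C"
proof -
 obtain K where K: "compact K" "!!p. p ~: K ==> ph p = 0" "!!p. p ~: K ==> g p = 0"
  using test1D[OF assms] by metis
 have "compact (ph ` K)" "compact (g ` K)"
  by (intro compact_continuous_image K(1) continuous_on_subset[OF test1_cont(1)[OF assms]]
  continuous_on_subset[OF test1_cont(2)[OF assms]] subset_UNIV)+
 then have "bounded (ph ` K)" "bounded (g ` K)"
  by (auto intro: compact_imp_bounded)
 then obtain a b where a: "!!p. p : K ==> norm (ph p) <= a" and b: "!!p. p : K ==> norm (g p) <= b"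
  unfolding bounded_iff by auto
 show thesis
 proof
  show "(abs a) + (abs b) + 1 > 0" by simp
  show "(abs (ph p)) <= (abs a) + (abs b) + 1" for p using a[of p] K(2)[of p] by (cases "p : K") auto
  show "norm (g p) <= (abs a) + (abs b) + 1" for p using b[of p] K(3)[of p] by (cases "p : K") auto
 qed
qed

lemma test_functions_test1:
 assumes "ph : test_functions Om"
 shows "test1 Om ph (grad ph)"
proof -
 have "ph p = 0" if "p ~: closure {x. ph x ~= 0}" for p
  using that closure_subset[of "{x. ph x ~= 0}"] by auto
 moreover have "compact (closure {x. ph x ~= 0})" "closure {x. ph x ~= 0} \<subseteq> Om" "!!k. C_k k ph"
  using assms by (auto simp: test_functions_def)
 ultimately show ?thesis
  unfolding test1_def by (meson C_k_grad(1) C_k_grad(2))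
qed

lemma test_functionsI:
 assumes "!!k. C_k k ph" "compact K" "K \<subseteq> Om" "!!p. p ~: K ==> ph p = 0"
 shows "ph : test_functions Om"
proof -
 have "closure {x. ph x ~= 0} \<subseteq> K"
  using assms by (intro closure_minimal) (auto simp: compact_imp_closed)
 moreover from this have "compact (closure {x. ph x ~= 0})"
  using compact_Int_closed[OF assms(2) closed_closure, of "{x. ph x ~= 0}"] by (simp add: Int_absorb1)
 ultimately show ?thesis
  using assms(1,3) unfolding test_functions_def by blast
qed

section \<open>Mollifiers\<close>

definition bump :: "real => 'a::euclidean_space => real" where
 "bump e x = flat 0 (e\<^sup>2 - x \<bullet> x)"

lemma bump_C_k: "C_k k (bump e)"
proof -
 have "C_k k (%x::'a. e\<^sup>2 + (-1) * (x \<bullet> x))" for k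
  by (intro C_k_add C_k_mult C_k_const C_k_inner_self)
 then have "C_k k (%x::'a. flat 0 (e\<^sup>2 - x \<bullet> x))"
  by (intro C_k_flat) simp
 then show ?thesis by (simp add: bump_def[abs_def])
qed

lemma bump_nonneg: "0 <= bump e x"
 by (simp add: bump_def flat_nonneg)

lemma bump_pos: "norm x < e ==> 0 < bump e x"
 using power_strict_mono[of "norm x" e 2] by (auto simp: bump_def flat_def power2_norm_eq_inner)

lemma bump_eq_0: "e \<ge> 0 ==> e <= norm x ==> bump e x = 0"
 using power_mono[of e "norm x" 2] by (auto simp: bump_def flat_def power2_norm_eq_inner)

lemma bump_minus: "bump e (- x) = bump e x"
 by (simp add: bump_def)

lemma integrable_compact_support:
 fixes f :: "'a::euclidean_space => 'b::euclidean_space"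
 assumes "contU f" "compact K" "!!p. p ~: K ==> f p = 0"
 shows "integ f"
proof -
 have "set_integrable lborel K f"
  unfolding set_integrable_def
  by (rule borel_integrable_compact) (use assms in "auto intro: continuous_on_subset")
 moreover have "(%x. ind K x *R f x) = f"
  using assms(3) by (auto simp: indicator_def fun_eq_iff)
 ultimately show ?thesis by (simp add: set_integrable_def)
qed

lemma bump_continuous: "contU (bump e)"
 using bump_C_k[of 0 e] by simp

lemma bump_integrable: "e \<ge> 0 ==> integ (bump e :: 'a::euclidean_space => real)"
 by (rule integrable_compact_support[where K = "cball 0 e"]) (auto simp: bump_continuous bump_eq_0)

lemma bump_integral_pos:
 assumes "e > 0"
 shows "0 < (LBINT x. bump e (x::'a::euclidean_space))"
proof (rule ccontr)
 assume "~ 0 < (LBINT x. bump e (x::'a::euclidean_space))"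
 then have "(LBINT x. bump e (x::'a::euclidean_space)) = 0"
  using B_nonneg[of lborel "bump e :: 'a => real"] bump_nonneg
  by (metis antisym_conv2)
 then have "AE x in lborel. bump e (x::'a) = 0"
  using integral_nonneg_eq_0_iff_AE[OF bump_integrable[of e, where 'a='a]] assms bump_nonneg by auto
 then have "AE x in lborel. (x::'a) ~: ball 0 e"
  by eventually_elim (use bump_pos in force)
 then have "emeasure lborel (ball (0::'a) e) = 0"
  by (subst (asm) AE_iff_measurable[OF _ refl]) (auto simp: ball_def)
 then have "measure lborel (ball (0::'a) e) = 0"
  by (simp add: measure_def)
 then show False
  using content_ball_pos[OF assms, of "0::'a"] by simp
qed

definition moll :: "nat => 'a::euclidean_space => real" where
 "moll n x = bump (1 / Suc n) x / (LBINT y. bump (1 / Suc n) (y::'a))"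

lemma moll_C_k: "C_k k (moll n)"
proof -
 have "C_k k (%x::'a. bump (1 / Suc n) x * (1 / (LBINT y. bump (1 / Suc n) (y::'a))))"
  by (intro C_k_mult bump_C_k C_k_const)
 then show ?thesis by (simp add: moll_def[abs_def])
qed

lemma moll_nonneg: "0 <= moll n x"
 using bump_integral_pos[of "1 / Suc n", where 'a='a] by (auto simp: moll_def bump_nonneg)

lemma moll_eq_0: "1 / Suc n <= norm x ==> moll n x = 0"
 by (auto simp: moll_def bump_eq_0)

lemma moll_minus: "moll n (- x) = moll n x"
 by (auto simp: moll_def bump_minus)

lemma moll_integrable: "integ (moll n :: 'a::euclidean_space => real)"
 unfolding moll_def[abs_def] by (intro integrable_divide_zero impI bump_integrable) simp

lemma moll_integral: "(LBINT x. moll n (x::'a::euclidean_space)) = 1"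
 using bump_integral_pos[of "1 / Suc n", where 'a='a] by (simp add: moll_def)

lemma moll_test1: "test1 UNIV (moll n) (grad (moll n))"
 by (rule test_functions_test1)
  (rule test_functionsI[where K = "cball 0 (1 / Suc n)"], auto simp: moll_C_k moll_eq_0)

section \<open>Integration on Euclidean spaces\<close>

text \<open>Bounded at every point, not just almost everywhere: products, compositions and slices
  then stay in the class without any bookkeeping of null sets.\<close>

definition bdb :: "('a::euclidean_space => 'b::euclidean_space) => bool" where
 "bdb f \<longleftrightarrow> f : bmeas & bounded (range f)"

lemma bdbI: "f : bmeas ==> (!!x. norm (f x) <= C) ==> bdb f"
 unfolding bdb_def bounded_iff by blast

lemma bdb_measurable [measurable_dest]: "bdb f ==> f : bmeas"
 by (simp add: bdb_def)

lemma bdb_bound: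
 assumes "bdb f"
 obtains C where "C > 0" "!!x. norm (f x) <= C"
 using assms unfolding bdb_def bounded_pos by auto

lemma integrable_bounded_support:
 fixes f :: "'a::euclidean_space => 'b::euclidean_space"
 assumes [measurable]: "f : bmeas"
  and "!!x. norm (f x) <= C" "compact K" "!!x. x ~: K ==> f x = 0"
 shows "integ f"
proof (rule B_ibound)
 show "integ (%x. C * ind K x :: real)"
  using assms(3) by (intro integrable_mult_right) (auto intro!: integrable_real_indicator emeasure_compact_finite simp: compact_imp_closed)
 show "AE x in lborel. norm (f x) <= norm (C * ind K x :: real)"
 proof (intro AE_I2)
  fix x show "norm (f x) <= norm (C * ind K x :: real)"
  using assms(2)[of x] assms(4)[of x] by (cases "x : K") auto
 qed
qed simp

lemma fubini_bounded_support:
 fixes f :: "'a::euclidean_space \<times> 'b::euclidean_space => real"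
 assumes meas[measurable]: "f : bmeas"
  and bd: "!!x. (abs (f x)) <= C" and K: "compact K" "!!x. x ~: K ==> f x = 0"
 shows "integ f"
  and "integ (%q. f (p, q))" and "integ (%p. f (p, q))"
  and "integ (%p. LBINT q. f (p, q))"
  and "integ (%q. LBINT p. f (p, q))"
  and "(LBINT p. LBINT q. f (p, q)) = (LBINT q. LBINT p. f (p, q))"
  and "(LBINT p. LBINT q. f (p, q)) = (LBINT z. f z)"
proof -
 show 1: "integ f"
  by (rule integrable_bounded_support[OF meas _ K]) (use bd in auto)
 then have 2: "integrable (lborel \<Otimes>\<^sub>M lborel) (case_prod (%p q. f (p, q)))"
  by (simp add: lborel_prod)
 have cf: "compact (fst ` K)" "compact (snd ` K)"
  using K(1) by (auto intro!: compact_continuous_image continuous_on_fst continuous_on_snd continuous_on_id)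
 show "integ (%q. f (p, q))"
  by (rule integrable_bounded_support[where C = C and K = "snd ` K"]) (use bd K cf in "force+")
 show "integ (%p. f (p, q))"
  by (rule integrable_bounded_support[where C = C and K = "fst ` K"]) (use bd K cf in "force+")
 show "integ (%p. LBINT q. f (p, q))"
  using lborel_pair.integrable_fst[OF 2] .
 show "integ (%q. LBINT p. f (p, q))"
  using lborel_pair.integrable_snd[OF 2] .
 show "(LBINT p. LBINT q. f (p, q)) = (LBINT q. LBINT p. f (p, q))"
  using lborel_pair.Fubini_integral[OF 2] by simp
 show "(LBINT p. LBINT q. f (p, q)) = (LBINT z. f z)"
  using lborel_pair.integral_fst'[of f] 1 by (simp add: lborel_prod)
qed



lemma moll_measurable [measurable]: "moll n : bmeas"
 using moll_C_k[of 0 n] by (intro borel_measurable_continuous_onI) simp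

lemma distr_lborel_shift:
 "distr lborel borel (%x. x + v) = (lborel :: 'a::euclidean_space measure)"
proof -
 have "(%x. x + v) = (+) v" by (auto simp: add.commute)
 then show ?thesis using lborel_distr_plus[of v] by simp
qed

lemma distr_lborel_reflect:
 "distr lborel borel (%x. v - x) = (lborel :: 'a::euclidean_space measure)"
 using lborel_affine[of "-1" v] by (simp add: density_1)

lemma lborel_integral_shift:
 fixes f :: "'a::euclidean_space => 'b::{banach, second_countable_topology}"
 assumes [measurable]: "f : bmeas"
 shows "(LBINT x. f (x + v)) = (LBINT x. f x)"
proof -
 have "(LBINT x. f x) = (LINT x|distr lborel borel (%x. x + v). f x)"
  by (simp add: distr_lborel_shift)
 also have "... = (LBINT x. f (x + v))"
  by (rule integral_distr) auto
 finally show ?thesis by simp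
qed

lemma lborel_integral_reflect:
 fixes f :: "'a::euclidean_space => 'b::{banach, second_countable_topology}"
 assumes [measurable]: "f : bmeas"
 shows "(LBINT x. f (v - x)) = (LBINT x. f x)"
proof -
 have "(LBINT x. f x) = (LINT x|distr lborel borel (%x. v - x). f x)"
  by (simp add: distr_lborel_reflect)
 also have "... = (LBINT x. f (v - x))"
  by (rule integral_distr) auto
 finally show ?thesis by simp
qed

lemma lborel_integrable_shift:
 fixes f :: "'a::euclidean_space => 'b::{banach, second_countable_topology}"
 assumes "integ f"
 shows "integ (%x. f (x + v))"
proof -
 have "integrable (distr lborel borel (%x. x + v)) f"
  using assms by (simp add: distr_lborel_shift)
 then show ?thesis
  by (subst (asm) integrable_distr_eq) (use borel_measurable_integrable[OF assms] in auto)
qed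

lemma lborel_integrable_reflect:
 fixes f :: "'a::euclidean_space => 'b::{banach, second_countable_topology}"
 assumes "integ f"
 shows "integ (%x. f (v - x))"
proof -
 have "integrable (distr lborel borel (%x. v - x)) f"
  using assms by (simp add: distr_lborel_reflect)
 then show ?thesis
  by (subst (asm) integrable_distr_eq) (use borel_measurable_integrable[OF assms] in auto)
qed

lemma AE_lborel_shift:
 fixes P :: "'a::euclidean_space => bool"
 assumes "AE x in lborel. P x"
 shows "AE x in lborel. P (x + v)"
proof -
 have "distr lborel lborel (%x. x + v) = (lborel :: 'a measure)"
  using distr_lborel_shift[of v] by (metis distr_cong sets_lborel)
 then have "AE x in distr lborel lborel (%x. x + v). P x"
  using assms by (metis (full_types))
 then show ?thesis
  by (rule AE_distrD[rotated]) auto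
qed

section \<open>Continuity of translations in L1\<close>

text \<open>Induction over integrable functions. Indicators reduce to open sets by outer regularity,
  sums are immediate, and a limit is replaced by a member that is close in L1, the two replacement
  errors being equal by translation invariance.\<close>

lemma translation_L1_seq:
 fixes f :: "'a::euclidean_space => real"
 assumes "integ f"
 shows "v ~~> 0 ==> (%n. LBINT x. (abs (f (x + v n) - f x))) ~~> 0"
 using assms
proof (induction f rule: integrable_induct)
 case (base A c)
 have A[measurable]: "A : sets borel" using base by simp
 have open_case: "(%n. LBINT x. (abs (ind U (x + v n) - ind U x))) ~~> (0::real)"
  if "open U" "emeasure lborel U < \<infinity>" for U :: "'a set"
 proof -
  have [measurable]: "U : sets borel" using that by simp
  have iU: "integ (ind U :: 'a => real)"
  using that by (intro integrable_real_indicator) auto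
  have iUs: "integ (%x. ind U (x + w) :: real)" for w
  by (rule lborel_integrable_shift[OF iU])
  \<comment> \<open>Openness of \<open>U\<close> controls only the points that leave
    \<open>U\<close>. Those that enter contribute the same integral, because the translation
    preserves the measure of \<open>U\<close>; hence the factor 2 further down.\<close>
  have "(%n. LBINT x. max 0 (ind U x - ind U (x + v n))) ~~> (LINT x|(lborel::'a measure). 0::real)"
  proof (rule integral_dominated_convergence[where w = "ind U"])
  show "AE x in lborel. (%n. max 0 (ind U x - ind U (x + v n))) ~~> (0::real)"
  proof (rule AE_I2)
  fix x
  show "(%n. max 0 (ind U x - ind U (x + v n))) ~~> (0::real)"
  proof (cases "x : U")
  case True
  have "(%n. x + v n) ~~> x + 0" by (intro tendsto_intros base)
  then have "eventually (%n. x + v n : U) sequentially"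
  using that(1) True topological_tendstoD by fastforce
  then have "eventually (%n. max 0 (ind U x - ind U (x + v n)) = (0::real)) sequentially"
  by eventually_elim (use True in auto)
  then show ?thesis by (rule tendsto_eventually)
  qed (auto simp: indicator_def)
  qed
  show "AE x in lborel. norm (max 0 (ind U x - ind U (x + v n)) :: real) <= ind U x" for n
  by (auto simp: indicator_def)
  qed (use iU in auto)
  moreover have "(LBINT x. (abs (ind U (x + v n) - ind U x))) =
  2 * (LBINT x. max 0 (ind U x - ind U (x + v n) :: real))" for n
  proof -
  have m: "integ (%x. max 0 (ind U x - ind U (x + v n) :: real))"
  by (intro B_imax integrable_zero B_idiff iU iUs)
  have "(LBINT x. (abs (ind U (x + v n) - ind U x))) =
  (LBINT x. 2 * max 0 (ind U x - ind U (x + v n)) - (ind U x - ind U (x + v n)) :: real)"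
  by (rule B_cong) (auto simp: indicator_def)
  also have "... = 2 * (LBINT x. max 0 (ind U x - ind U (x + v n))) -
  ((LBINT x. ind U x) - (LBINT x. ind U (x + v n)))"
  using m iU iUs[of "v n"] by simp
  also have "(LBINT x. ind U (x + v n)) = (LBINT x. ind U x :: real)"
  by (rule lborel_integral_shift) auto
  finally show ?thesis by simp
  qed
  ultimately show ?thesis by (simp add: tendsto_mult_right_zero)
 qed
 have "(%n. LBINT x. (abs (ind A (x + v n) - ind A x))) ~~> (0::real)"
 proof (rule LIMSEQ_I)
  fix e :: real assume e: "e > 0"
  obtain U where U: "open U" "A \<subseteq> U" "emeasure lborel (U - A) < ennreal (e / 4)"
  using outer_regular_lborel[OF A, of "e / 4"] e by auto
  have [measurable]: "U : sets borel" using U by simp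
  have "emeasure lborel U = emeasure lborel A + emeasure lborel (U - A)"
  using U(2) by (subst plus_emeasure) (auto intro!: arg_cong[where f = "emeasure lborel"])
  then have Uf: "emeasure lborel U < \<infinity>"
  using base U(3) by (auto simp: less_top[symmetric] top_unique)
  have UAf: "emeasure lborel (U - A) < \<infinity>" using U(3) by (auto simp: less_top[symmetric] top_unique)
  have iA: "integ (ind A :: 'a => real)"
  using base by (intro integrable_real_indicator) auto
  have iU: "integ (ind U :: 'a => real)"
  using Uf by (intro integrable_real_indicator) auto
  have iUA: "integ (ind (U - A) :: 'a => real)"
  using UAf by (intro integrable_real_indicator) auto
  have mUA: "(LBINT x. ind (U - A) x :: real) < e / 4"
  using U(3) e UAf by (simp add: emeasure_eq_ennreal_measure ennreal_less_iff)
  obtain N where N: "!!n. n \<ge> N ==> \<bar>LBINT x. (abs (ind U (x + v n) - ind U x :: real))\<bar> < e / 4"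
  using LIMSEQ_D[OF open_case[OF U(1) Uf], of "e / 4"] e by auto
  have "norm ((LBINT x. (abs (ind A (x + v n) - ind A x))) - (0::real)) < e" if "n \<ge> N" for n
  proof -
  have "(LBINT x. (abs (ind A (x + v n) - ind A x :: real))) <=
  (LBINT x. (abs (ind U (x + v n) - ind U x)) + (ind (U - A) (x + v n) + ind (U - A) x))"
  proof (intro integral_mono B_iadd integrable_abs
  B_idiff lborel_integrable_shift iA iU iUA)
  show "(abs (ind A (x + v n) - ind A x)) <= (abs (ind U (x + v n) - ind U x)) +
  (ind (U - A) (x + v n) + ind (U - A) x :: real)" for x
  using U(2) by (auto simp: indicator_def)
  qed
  also have "... = (LBINT x. (abs (ind U (x + v n) - ind U x))) +
  ((LBINT x. ind (U - A) (x + v n)) + (LBINT x. ind (U - A) x))"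
  using lborel_integrable_shift[OF iU, of "v n"] lborel_integrable_shift[OF iUA, of "v n"] iU iUA
  by (subst B_add; (subst B_add)?) auto
  also have "(LBINT x. ind (U - A) (x + v n)) = (LBINT x. ind (U - A) x :: real)"
  by (rule lborel_integral_shift) auto
  finally have "(LBINT x. (abs (ind A (x + v n) - ind A x :: real))) < e"
  using N[OF that] mUA e by simp
  then show ?thesis by simp
  qed
  then show "EX N. \<forall>n\<ge>N. norm ((LBINT x. (abs (ind A (x + v n) - ind A x))) - (0::real)) < e"
  by blast
 qed
 from tendsto_mult_right_zero[OF this, of "(abs c)"]
 have "(%n. LBINT x. (abs c) * (abs (ind A (x + v n) - ind A x))) ~~> 0"
  by simp
 moreover have "(abs c) * (abs (ind A y - ind A x)) = (abs (ind A y *R c - ind A x *R c))" for x y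
  by (auto simp: indicator_def)
 ultimately show ?case by simp
next
 case (add f g)
 note [measurable] = borel_measurable_integrable[OF add(1)] borel_measurable_integrable[OF add(2)]
 have "(%n. (LBINT x. (abs (f (x + v n) - f x))) + (LBINT x. (abs (g (x + v n) - g x)))) ~~> 0 + 0"
  by (intro tendsto_add add)
 then have l: "(%n. (LBINT x. (abs (f (x + v n) - f x))) + (LBINT x. (abs (g (x + v n) - g x)))) ~~> 0" by simp
 show ?case
 proof (rule tendsto_sandwich[OF _ _ tendsto_const l])
  show "\<forall>\<^sub>F n in sequentially. (LBINT x. (abs (f (x + v n) + g (x + v n) - (f x + g x))))
  <= (LBINT x. (abs (f (x + v n) - f x))) + (LBINT x. (abs (g (x + v n) - g x)))"
  proof (intro always_eventually allI)
  fix n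
  note i = lborel_integrable_shift[OF add(1), of "v n"] lborel_integrable_shift[OF add(2), of "v n"] add(1,2)
  have "(LBINT x. (abs (f (x + v n) + g (x + v n) - (f x + g x)))) <=
  (LBINT x. (abs (f (x + v n) - f x)) + (abs (g (x + v n) - g x)))"
  using i by (intro integral_mono) auto
  also have "... = (LBINT x. (abs (f (x + v n) - f x))) + (LBINT x. (abs (g (x + v n) - g x)))"
  using i by (intro B_add) auto
  finally show "(LBINT x. (abs (f (x + v n) + g (x + v n) - (f x + g x))))
  <= (LBINT x. (abs (f (x + v n) - f x))) + (LBINT x. (abs (g (x + v n) - g x)))" .
  qed
 qed (auto intro!: always_eventually)
next
 case (lim f s)
 have "(%i. LBINT x. (abs (s i x - f x))) ~~> (LINT x|(lborel::'a measure). 0::real)"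
 proof (rule integral_dominated_convergence[where w = "%x. 3 * (abs (f x))"])
  show "AE x in lborel. (%i. (abs (s i x - f x))) ~~> 0"
  using lim by (intro AE_I2) (auto intro!: tendsto_rabs_zero simp: LIM_zero_iff)
  show "AE x in lborel. norm (abs (s i x - f x)) <= 3 * (abs (f x))" for i
  proof (intro AE_I2)
  fix x :: 'a
  have "(abs (s i x)) <= 2 * (abs (f x))" using lim(3)[of x i] by simp
  then show "norm (abs (s i x - f x)) <= 3 * (abs (f x))" by simp
  qed
 qed (use lim(1,4) in "auto intro: borel_measurable_integrable")
 then have l: "(%i. LBINT x. (abs (s i x - f x))) ~~> 0" by simp
 show ?case
 proof (rule LIMSEQ_I)
  fix e :: real assume e: "e > 0"
  obtain i where i: "(LBINT x. (abs (s i x - f x))) < e / 3"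
  using LIMSEQ_D[OF l, of "e / 3"] e by force
  obtain N where N: "!!n. n \<ge> N ==> \<bar>LBINT x. (abs (s i (x + v n) - s i x))\<bar> < e / 3"
  using LIMSEQ_D[OF lim(5)[of i, OF lim(6)], of "e / 3"] e by auto
  have "norm ((LBINT x. (abs (f (x + v n) - f x))) - 0) < e" if "n \<ge> N" for n
  proof -
  note ints = lborel_integrable_shift[OF lim(1)[of i], of "v n"] lim(1)[of i]
  lborel_integrable_shift[OF lim(4), of "v n"] lim(4)
  have d: "integ (%x. (abs (s i x - f x)))" using ints by auto
  note ds = lborel_integrable_shift[OF d, of "v n"]
  have "(LBINT x. (abs (f (x + v n) - f x))) <=
  (LBINT x. (abs (s i (x + v n) - s i x)) + ((abs (s i (x + v n) - f (x + v n))) + (abs (s i x - f x))))"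
  using ints ds by (intro integral_mono B_iadd) auto
  also have "... = (LBINT x. (abs (s i (x + v n) - s i x))) +
  ((LBINT x. (abs (s i (x + v n) - f (x + v n)))) + (LBINT x. (abs (s i x - f x))))"
  using ints ds by (subst B_add; (subst B_add)?) auto
  also have "(LBINT x. (abs (s i (x + v n) - f (x + v n)))) = (LBINT x. (abs (s i x - f x)))"
  using lborel_integral_shift[of "%x. (abs (s i x - f x))" "v n"] borel_measurable_integrable[OF d] by simp
  finally show ?thesis using N[OF that] i by simp
  qed
  then show "EX N. \<forall>n\<ge>N. norm ((LBINT x. (abs (f (x + v n) - f x))) - 0) < e" by blast
 qed
qed

lemma translation_L1:
 fixes f :: "'a::euclidean_space => real"
 assumes "integ f" "e > 0"
 obtains d where "d > 0" "!!v. norm v < d ==> (LBINT x. (abs (f (x + v) - f x))) < e"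
proof (rule ccontr)
 assume "~ thesis"
 then have "!!n. EX v. norm v < 1 / Suc n & ~ (LBINT x. (abs (f (x + v) - f x))) < e"
  using that by (metis of_nat_0_less_iff zero_less_Suc zero_less_divide_1_iff)
 then obtain v where v: "!!n. norm (v n) < 1 / Suc n" "!!n. ~ (LBINT x. (abs (f (x + v n) - f x))) < e"
  by metis
 have "v ~~> 0"
  by (rule tendsto_norm_zero_cancel, rule tendsto_sandwich[OF _ _ tendsto_const LIMSEQ_inverse_real_of_nat])
  (use v(1) in "auto intro!: always_eventually less_imp_le simp: inverse_eq_divide")
 from LIMSEQ_D[OF translation_L1_seq[OF assms(1) this] assms(2)] v(2) show False
  by force
qed

lemma translation_L1_local:
 fixes f :: "'a::euclidean_space => real"
 assumes f: "bdb f" and K: "compact K" and e: "e > 0"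
 obtains d where "d > 0" "!!v. norm v < d ==> (LBINT x. ind K x * (abs (f (x + v) - f x))) < e"
proof -
 note [measurable] = bdb_measurable[OF f]
 obtain C where C: "C > 0" "!!x. (abs (f x)) <= C" using bdb_bound[OF f] by auto
 obtain R where R: "R > 0" "!!x. x : K ==> norm x <= R"
  using K compact_imp_bounded bounded_pos by metis
 define g where "g x = ind (cball 0 (R + 1)) x * f x" for x
 have g: "integ g"
  by (rule integrable_bounded_support[where C = C and K = "cball 0 (R + 1)"])
  (use C in "auto simp: g_def[abs_def] indicator_def")
 obtain d where d: "d > 0" "!!v. norm v < d ==> (LBINT x. (abs (g (x + v) - g x))) < e"
  by (rule translation_L1[OF g e]) blast
 show thesis
 proof
  show "min d 1 > 0" using d by simp
  fix v :: 'a assume v: "norm v < min d 1"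
  have "(LBINT x. ind K x * (abs (f (x + v) - f x))) <= (LBINT x. (abs (g (x + v) - g x)))"
  proof (rule integral_mono_AE')
  show "integ (%x. (abs (g (x + v) - g x)))"
  using g lborel_integrable_shift[OF g] by auto
  have "norm (x + v) <= R + 1" if "x : K" for x
  using norm_triangle_ineq[of x v] R(2)[OF that] v by simp
  then show "AE x in lborel. ind K x * (abs (f (x + v) - f x)) <= (abs (g (x + v) - g x))"
  using R(2) by (intro AE_I2) (fastforce simp: g_def indicator_def)
  qed auto
  with d(2)[of v] v show "(LBINT x. ind K x * (abs (f (x + v) - f x))) < e" by simp
 qed
qed

lemma moll_integral_reflect: "(LBINT q. moll n (p - q)) = 1"
 by (simp add: lborel_integral_reflect moll_integral)

lemma moll_bound:
 obtains C where "C > 0" "!!x. moll n x <= C"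
proof -
 obtain C where "C > 0" "!!p::'a. (abs (moll n p)) <= C" using test1_bounded[OF moll_test1] by metis
 then show thesis using that moll_nonneg by (metis abs_of_nonneg)
qed

text \<open>\<open>Ps\<close> may be discontinuous. It depends on \<open>q\<close> only as strongly
  as \<open>v q\<close> does, so the error is an average, over shifts within the radius of the
  mollifier, of the L1 modulus of translation of \<open>v\<close> on \<open>K\<close>.\<close>

lemma approximate_identity:
 fixes Ps :: "'a::euclidean_space \<times> 'a => real"
 assumes Psi: "Ps : bmeas" and C: "!!z. (abs (Ps z)) <= C"
  and K: "compact K" "!!p q. p ~: K ==> Ps (p, q) = 0"
  and v: "bdb v" and L: "!!p q. (abs (Ps (p, q) - Ps (p, p))) <= L * (abs (v q - (v p :: real)))"
 shows "(%n. LBINT p. LBINT q. Ps (p, q) * moll n (p - q)) ~~> (LBINT p. Ps (p, p))"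
proof (rule LIMSEQ_I)
 fix e :: real assume e: "e > 0"
 define L' where "L' = (abs L) + 1"
 have L': "L' > 0" "!!p q. (abs (Ps (p, q) - Ps (p, p))) <= L' * (abs (v q - v p))"
  using L by (auto simp: L'_def) (smt (verit, best) mult_right_mono)
 note [measurable] = bdb_measurable[OF v]
 have [measurable]: "Ps : borel_measurable (borel \<Otimes>\<^sub>M borel)" using Psi by (simp add: borel_prod)
 obtain B where B: "B > 0" "!!x. (abs (v x)) <= B" using bdb_bound[OF v] by auto
 obtain d where d: "d > 0" "!!w. norm w < d ==> (LBINT x. ind K x * (abs (v (x + w) - v x))) < e / (2 * L')"
  using translation_L1_local[OF v K(1), of "e / (2 * L')"] e L' by auto
 obtain N where N: "1 / Suc N < d" using d(1) nat_approx_posE by metis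
 obtain R where R: "R > 0" "!!x. x : K ==> norm x <= R"
  using K compact_imp_bounded bounded_pos by metis
 have "norm ((LBINT p. LBINT q. Ps (p, q) * moll n (p - q)) - (LBINT p. Ps (p, p))) < e"
  if n: "n \<ge> N" for n
 proof -
  have nd: "1 / Suc n < d"
  using n N by (smt (verit, best) frac_le of_nat_0_less_iff of_nat_mono Suc_le_mono zero_less_Suc)
  obtain M where M: "M > 0" "!!x::'a. moll n x <= M" using moll_bound by auto
  have mz: "moll n w = 0" if "norm w > 1" for w :: 'a
  using that moll_eq_0[of n w] by (smt (verit, best) divide_le_eq_1_pos of_nat_0_less_iff of_nat_1 of_nat_mono le_add1 plus_1_eq_Suc zero_less_Suc)
  have out: "Ps (p, q) * moll n (p - q) = 0 & ind K p * moll n (p - q) = 0"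
  if "(p, q) ~: K \<times> cball 0 (R + 1)" for p q
  proof (cases "p : K")
  case True
  then have "norm q > R + 1" using that by auto
  then have "norm (p - q) > 1" using R(2)[OF True] norm_triangle_ineq2[of q p] by (simp add: norm_minus_commute)
  then show ?thesis using mz by simp
  qed (use K in auto)
  have cK: "compact (K \<times> cball (0::'a) (R + 1))" using K by (intro compact_Times) auto
  have abs_le: "(abs (a * b)) <= c * d" if "(abs a) <= c" "0 <= b" "b <= d" for a b c d :: real
  using that by (auto simp: abs_mult intro!: mult_mono)
  define f1 where "f1 z = Ps z * moll n (fst z - snd z)" for z
  define f2 where "f2 z = Ps (fst z, fst z) * moll n (fst z - snd z)" for z
  define f3 where "f3 z = (ind K (fst z) * (abs (v (snd z) - v (fst z)))) * moll n (fst z - snd z)" for z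
  have [measurable]: "K : sets borel" using K(1) by (simp add: compact_imp_closed)
  have m11: "f1 : bmeas"
  unfolding f1_def[abs_def] borel_prod[symmetric] by measurable
  have m12: "f2 : bmeas"
  unfolding f2_def[abs_def] borel_prod[symmetric] by measurable
  have m13: "f3 : bmeas"
  unfolding f3_def[abs_def] borel_prod[symmetric] by measurable
  note m1 = m11 m12 m13
  have b: "(abs (f1 z)) <= C * M" "(abs (f2 z)) <= C * M" "(abs (f3 z)) <= (2 * B) * M" for z
  proof -
  have b3: "\<bar>ind K (fst z) * (abs (v (snd z) - v (fst z)))\<bar> <= 2 * B"
  using B(1) B(2)[of "fst z"] B(2)[of "snd z"] by (auto simp: indicator_def)
  show "(abs (f3 z)) <= (2 * B) * M" unfolding f3_def by (rule abs_le[OF b3 moll_nonneg M(2)])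
  show "(abs (f1 z)) <= C * M" "(abs (f2 z)) <= C * M"
  unfolding f1_def f2_def by (intro abs_le M moll_nonneg C)+
  qed
  have o: "f1 z = 0" "f2 z = 0" "f3 z = 0" if "z ~: K \<times> cball 0 (R + 1)" for z
  using that out[of "fst z" "snd z"] K(2)[of "fst z" "fst z"] unfolding f1_def f2_def f3_def
  by (cases "fst z : K"; auto)+
  note F1 = fubini_bounded_support[OF m1(1) b(1) cK o(1)]
  note F2 = fubini_bounded_support[OF m1(2) b(2) cK o(2)]
  note F3 = fubini_bounded_support[OF m1(3) b(3) cK o(3)]
  have "(LBINT p. LBINT q. Ps (p, q) * moll n (p - q)) - (LBINT p. Ps (p, p))
  = (LBINT p. LBINT q. f1 (p, q)) - (LBINT p. LBINT q. f2 (p, q))"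
  by (simp add: f1_def f2_def moll_integral_reflect)
  also have "... = (LBINT z. f1 z - f2 z)"
  using F1(1,7) F2(1,7) by simp
  finally have eq: "(LBINT p. LBINT q. Ps (p, q) * moll n (p - q)) - (LBINT p. Ps (p, p)) =
  (LBINT z. f1 z - f2 z)" .
  have "(abs (f1 z - f2 z)) <= L' * f3 z" for z
  proof (cases "fst z : K")
  case True
  have "(abs (f1 z - f2 z)) = (abs (Ps z - Ps (fst z, fst z))) * moll n (fst z - snd z)"
  by (simp add: f1_def f2_def left_diff_distrib[symmetric] abs_mult moll_nonneg)
  also have "... <= (L' * (abs (v (snd z) - v (fst z)))) * moll n (fst z - snd z)"
  using L'(2)[of "fst z" "snd z"] by (intro mult_right_mono moll_nonneg) auto
  finally show ?thesis using True by (simp add: f3_def)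
  next
  case False
  then show ?thesis using K(2)[of "fst z"] by (cases z) (auto simp: f1_def f2_def f3_def)
  qed
  then have "\<bar>LBINT z. f1 z - f2 z\<bar> <= (LBINT z. L' * f3 z)"
  using F1(1) F2(1) F3(1) by (intro order_trans[OF integral_abs_bound] integral_mono) auto
  also have "... = L' * (LBINT p. LBINT q. f3 (p, q))"
  using F3(7) by simp
  \<comment> \<open>The substitution q = p - w turns the inner difference into a translation of
    \<open>v\<close> by a fixed vector, so that after Fubini the translation estimate applies for
    each \<open>w\<close>.\<close>
  also have "(LBINT p. LBINT q. f3 (p, q)) = (LBINT p. LBINT w. f3 (p, p - w))"
  by (intro B_cong refl lborel_integral_reflect[symmetric])
  (use m1(3) in "unfold borel_prod[symmetric], measurable")
  also have "... = (LBINT w. LBINT p. f3 (p, p - w))"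
  proof -
  define f4 where "f4 z = f3 (fst z, fst z - snd z)" for z
  have m4: "f4 : bmeas" using m1(3) unfolding f4_def[abs_def] borel_prod[symmetric] by measurable
  have o4: "f4 z = 0" if "z ~: K \<times> cball 0 1" for z
  using that mz[of "snd z"] K(2)[of "fst z"] by (cases z) (auto simp: f4_def f3_def indicator_def)
  have cK4: "compact (K \<times> cball (0::'a) 1)" using K by (intro compact_Times) auto
  show ?thesis
  using fubini_bounded_support(6)[OF m4 b(3)[of "(fst z, fst z - snd z)" for z, folded f4_def] cK4 o4]
  by (simp add: f4_def)
  qed
  also have "... <= (LBINT w. moll n (w::'a) * (e / (2 * L')))"
  proof (rule integral_mono_AE')
  show "integ (%w::'a. moll n w * (e / (2 * L')))"
  by (intro integrable_mult_left moll_integrable)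
  show "AE w in lborel. (LBINT p. f3 (p, p - w)) <= moll n w * (e / (2 * L'))"
  proof (rule AE_I2)
  fix w :: 'a
  have "(LBINT p. f3 (p, p - w)) = moll n w * (LBINT p. ind K p * (abs (v (p + (- w)) - v p)))"
  by (simp add: f3_def mult.commute)
  also have "... <= moll n w * (e / (2 * L'))"
  proof (cases "norm w < d")
  case True
  then show ?thesis using d(2)[of "- w"] by (intro mult_left_mono moll_nonneg) auto
  next
  case False
  then have "moll n w = 0" using nd by (intro moll_eq_0) auto
  then show ?thesis by simp
  qed
  finally show "(LBINT p. f3 (p, p - w)) <= moll n w * (e / (2 * L'))" .
  qed
  show "AE w in lborel. 0 <= moll n w * (e / (2 * L'))"
  using e L'(1) by (auto intro!: mult_nonneg_nonneg simp: moll_nonneg)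
  qed
  also have "(LBINT w. moll n (w::'a) * (e / (2 * L'))) = e / (2 * L')"
  using moll_integral[of n, where 'a = 'a] by simp
  finally have "\<bar>LBINT z. f1 z - f2 z\<bar> <= L' * (e / (2 * L'))"
  using L'(1) by simp
  also have "... < e" using e L'(1) by simp
  finally show ?thesis unfolding eq by simp
 qed
 then show "EX N. \<forall>n\<ge>N. norm ((LBINT p. LBINT q. Ps (p, q) * moll n (p - q)) - (LBINT p. Ps (p, p))) < e"
  by blast
qed

section \<open>Convolutions\<close>

lemma integrable_mult_bounded:
 fixes f :: "'m => real" and h :: "'m => 'b::euclidean_space"
 assumes f: "integrable M f" and [measurable]: "h : borel_measurable M" and h: "!!x. norm (h x) <= C"
 shows "integrable M (%x. f x *R h x)"
proof (rule B_ibound)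
 show "integrable M (%x. C * (abs (f x)))" using f by auto
 show "AE x in M. norm (f x *R h x) <= norm (C * (abs (f x)))"
 proof (intro AE_I2)
  fix x
  have "norm (h x) <= (abs C)" using h[of x] by simp
  then show "norm (f x *R h x) <= norm (C * (abs (f x)))"
  by (simp add: abs_mult mult.commute[of "(abs (f x))"] mult_right_mono)
 qed
qed (use borel_measurable_integrable[OF f] in measurable)

lemma test1_uniform:
 assumes "test1 Om ph g" "e > 0"
 obtains d where "d > 0" "!!x y. dist x y < d ==> dist (g x) (g y) < e"
proof -
 obtain K where K: "compact K" "!!p. p ~: K ==> g p = 0"
  using test1D[OF assms(1)] by metis
 obtain R where R: "R > 0" "!!x. x : K ==> norm x <= R"
  using K(1) compact_imp_bounded bounded_pos by metis
 have "uniformly_continuous_on (cball 0 (R + 1)) g"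
  by (rule compact_uniformly_continuous[OF continuous_on_subset[OF test1_cont(2)[OF assms(1)] subset_UNIV]]) simp
 then obtain d where d: "d > 0" "!!x y. x : cball 0 (R + 1) ==> y : cball 0 (R + 1) ==> dist y x < d ==> dist (g y) (g x) < e"
  using assms(2) unfolding uniformly_continuous_on_def by metis
 show thesis
 proof
  show "min d 1 > 0" using d by simp
  fix x y :: 'a assume xy: "dist x y < min d 1"
  show "dist (g x) (g y) < e"
  proof (cases "norm x <= R | norm y <= R")
  case True
  then have "norm x <= R + 1" "norm y <= R + 1"
  using xy norm_triangle_ineq2[of x y] norm_triangle_ineq2[of y x] by (auto simp: dist_norm norm_minus_commute)
  then show ?thesis using d(2)[of y x] xy by simp
  next
  case False
  then have "x ~: K" "y ~: K" using R(2) by auto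
  then show ?thesis using K(2) assms(2) by simp
  qed
 qed
qed

lemma test1_taylor:
 assumes t: "test1 Om ph g" and d: "!!x y. dist x y < d ==> dist (g x) (g y) < e" and v: "norm v < d"
 shows "(abs (ph (p + v) - ph p - g p \<bullet> v)) <= e * norm v"
proof -
 have d0: "d > 0" using v norm_ge_zero[of v] by linarith
 have "norm ((%x. ph x - g p \<bullet> x) (p + v) - (%x. ph x - g p \<bullet> x) p) <= e * norm ((p + v) - p)"
 proof (rule differentiable_bound)
  show "convex (ball p d)" by simp
  show "((%x. ph x - g p \<bullet> x) has_derivative (%w. g x \<bullet> w - g p \<bullet> w)) (at x within ball p d)" for x
  by (intro has_derivative_diff has_derivative_at_withinI[OF test1_deriv[OF t]]
  has_derivative_inner_right has_derivative_ident)
  show "onorm (%w. g x \<bullet> w - g p \<bullet> w) <= e" if "x : ball p d" for x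
  proof (rule onorm_le)
  fix w
  have "norm (g x \<bullet> w - g p \<bullet> w) <= norm (g x - g p) * norm w"
  by (metis Cauchy_Schwarz_ineq2 inner_diff_left real_norm_def)
  also have "... <= e * norm w"
  using d[of x p] that by (intro mult_right_mono) (auto simp: dist_norm norm_minus_commute)
  finally show "norm (g x \<bullet> w - g p \<bullet> w) <= e * norm w" .
  qed
  show "p + v : ball p d" "p : ball p d" using v d0 by (auto simp: dist_norm)
 qed
 then show ?thesis by (simp add: inner_add_right algebra_simps)
qed

text \<open>The measure space and the points \<open>Y r\<close> are arbitrary in order to cover both
  convolutions (\<open>Y r = r\<close>) and averages of a kernel along a segment (\<open>f\<close>
  the indicator of an interval, \<open>Y r = r *R e\<close>). The derivative passes under the
  integral because the gradient of \<open>rh\<close> is uniformly continuous.\<close>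

lemma conv_gen:
 fixes f :: "'m => real" and rh :: "'a::euclidean_space => real"
 assumes f: "integrable M f" and Y[measurable]: "Y : borel_measurable M" and t: "test1 Om rh g"
 shows "((%p. LINT r|M. f r * rh (p - Y r)) has_derivative (%v. (LINT r|M. f r *R g (p - Y r)) \<bullet> v)) (at p)"
  and "contU (%p. LINT r|M. f r *R g (p - Y r))"
  and "integrable M (%r. f r * rh (p - Y r))" "integrable M (%r. f r *R g (p - Y r))"
proof -
 obtain C where C: "!!p. (abs (rh p)) <= C" "!!p. norm (g p) <= C" using test1_bounded[OF t] by metis
 have [measurable]: "rh : bmeas" "g : bmeas"
  using test1_cont[OF t] by (auto intro: borel_measurable_continuous_onI)
 have fm[measurable]: "f : borel_measurable M" using f by auto
 show i1: "integrable M (%r. f r * rh (p - Y r))" for p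
  using integrable_mult_bounded[OF f, of "%r. rh (p - Y r)" C] C by simp
 show i2: "integrable M (%r. f r *R g (p - Y r))" for p
  using integrable_mult_bounded[OF f, of "%r. g (p - Y r)" C] C by simp
 define F where "F = (LINT r|M. (abs (f r))) + 1"
 have F: "F > 0" "(LINT r|M. (abs (f r))) <= F" unfolding F_def by (auto intro: add_nonneg_pos)
 have fabs: "integrable M (%r. (abs (f r)))" using f by auto
 show "((%p. LINT r|M. f r * rh (p - Y r)) has_derivative (%v. (LINT r|M. f r *R g (p - Y r)) \<bullet> v)) (at p)"
  unfolding has_derivative_at_alt
 proof (intro conjI allI impI)
  show "bounded_linear (%v. (LINT r|M. f r *R g (p - Y r)) \<bullet> v)" by (rule bounded_linear_inner_right)
  fix e :: real assume e: "e > 0"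
  obtain d where d: "d > 0" "!!x y. dist x y < d ==> dist (g x) (g y) < e / F"
  using test1_uniform[OF t, of "e / F"] e F by auto
  have "norm ((LINT r|M. f r * rh (y - Y r)) - (LINT r|M. f r * rh (p - Y r)) -
  (LINT r|M. f r *R g (p - Y r)) \<bullet> (y - p)) <= e * norm (y - p)" if y: "norm (y - p) < d" for y
  proof -
  have i3: "integrable M (%r. (f r *R g (p - Y r)) \<bullet> (y - p))"
  by (rule integrable_inner_left[OF i2])
  have e3: "(LINT r|M. f r *R g (p - Y r)) \<bullet> (y - p) = (LINT r|M. (f r *R g (p - Y r)) \<bullet> (y - p))"
  using i2 by (simp only: integral_inner_left)
  have "(LINT r|M. f r * rh (y - Y r)) - (LINT r|M. f r * rh (p - Y r)) -
  (LINT r|M. f r *R g (p - Y r)) \<bullet> (y - p) =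
  (LINT r|M. f r * rh (y - Y r) - f r * rh (p - Y r) - (f r *R g (p - Y r)) \<bullet> (y - p))"
  unfolding e3
  by (simp only: B_diff B_idiff i1 i3)
  also have "\<bar>...\<bar> <= (LINT r|M. (abs (f r)) * (e / F * norm (y - p)))"
  proof (intro order_trans[OF integral_abs_bound] integral_mono)
  show "integrable M (%r. (abs (f r * rh (y - Y r) - f r * rh (p - Y r) - (f r *R g (p - Y r)) \<bullet> (y - p))))"
  by (intro integrable_abs B_idiff i1 i3)
  show "integrable M (%r. (abs (f r)) * (e / F * norm (y - p)))" using fabs by auto
  fix r
  have "(abs (f r * rh (y - Y r) - f r * rh (p - Y r) - (f r *R g (p - Y r)) \<bullet> (y - p)))
  = (abs (f r)) * (abs (rh ((p - Y r) + (y - p)) - rh (p - Y r) - g (p - Y r) \<bullet> (y - p)))"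
  by (simp add: abs_mult[symmetric] algebra_simps)
  also have "... <= (abs (f r)) * (e / F * norm (y - p))"
  by (rule mult_left_mono[OF test1_taylor[OF t d(2) y]]) auto
  finally show "(abs (f r * rh (y - Y r) - f r * rh (p - Y r) - (f r *R g (p - Y r)) \<bullet> (y - p)))
  <= (abs (f r)) * (e / F * norm (y - p))" .
  qed
  also have "... = (LINT r|M. (abs (f r))) * (e / F * norm (y - p))" by simp
  also have "... <= F * (e / F * norm (y - p))"
  using F e by (intro mult_right_mono) auto
  also have "... = e * norm (y - p)" using F by simp
  finally show ?thesis by simp
  qed
  with d(1) show "\<exists>d>0. ALL y. norm (y - p) < d --> norm ((LINT r|M. f r * rh (y - Y r)) - (LINT r|M. f r * rh (p - Y r)) -
  (LINT r|M. f r *R g (p - Y r)) \<bullet> (y - p)) <= e * norm (y - p)" by blast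
 qed
 show "contU (%p. LINT r|M. f r *R g (p - Y r))"
  unfolding continuous_on_iff
 proof (intro ballI allI impI)
  fix x :: 'a and e :: real assume e: "e > 0"
  obtain d where d: "d > 0" "!!x y. dist x y < d ==> dist (g x) (g y) < e / (2 * F)"
  using test1_uniform[OF t, of "e / (2 * F)"] e F by auto
  have "dist (LINT r|M. f r *R g (y - Y r)) (LINT r|M. f r *R g (x - Y r)) < e" if "dist y x < d" for y
  proof -
  have "norm ((LINT r|M. f r *R g (y - Y r)) - (LINT r|M. f r *R g (x - Y r))) =
  norm (LINT r|M. f r *R g (y - Y r) - f r *R g (x - Y r))"
  using i2 by simp
  also have "... <= (LINT r|M. norm (f r *R g (y - Y r) - f r *R g (x - Y r)))"
  by (rule integral_norm_bound)
  also have "... <= (LINT r|M. (abs (f r)) * (e / (2 * F)))"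
  proof (rule integral_mono)
  show "integrable M (%r. norm (f r *R g (y - Y r) - f r *R g (x - Y r)))" using i2 by auto
  fix r
  have "dist (g (y - Y r)) (g (x - Y r)) < e / (2 * F)" using d(2)[of "y - Y r" "x - Y r"] that by (simp add: dist_norm)
  then show "norm (f r *R g (y - Y r) - f r *R g (x - Y r)) <= (abs (f r)) * (e / (2 * F))"
  by (simp add: scaleR_diff_right[symmetric] dist_norm mult_left_mono del: times_divide_eq_right)
  qed (use fabs in auto)
  also have "... = (LINT r|M. (abs (f r))) * (e / (2 * F))" by simp
  also have "... <= F * (e / (2 * F))" using F e by (intro mult_right_mono) auto
  also have "... < e" using F e by simp
  finally show ?thesis by (simp add: dist_norm)
  qed
  then show "\<exists>d>0. \<forall>x'\<in>UNIV. dist x' x < d --> dist (LINT r|M. f r *R g (x' - Y r)) (LINT r|M. f r *R g (x - Y r)) < e"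
  using d(1) by blast
 qed
qed

lemma conv_C_k:
 fixes f :: "'a::euclidean_space => real"
 assumes f: "integ f"
 shows "(!!k. C_k k rh) ==> compact K ==> (!!p. p ~: K ==> rh p = 0) ==>
  C_k k (%p. LBINT q. f q * rh (p - q))"
proof (induction k arbitrary: rh)
 case 0
 have t: "test1 UNIV rh (grad rh)"
  unfolding test1_def using 0 C_k_grad[of rh] by auto
 have "continuous (at p) (%p. LBINT q. f q * rh (p - q))" for p
  by (rule has_derivative_continuous[OF conv_gen(1)[OF f _ t]]) simp
 then show ?case by (simp add: continuous_at_imp_continuous_on)
next
 case (Suc k)
 have t: "test1 UNIV rh (grad rh)"
  unfolding test1_def using Suc.prems C_k_grad[of rh] by auto
 have g0: "grad rh p = 0" if "p ~: K" for p
 proof -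
  have "open (- K)" using Suc.prems(2) by (simp add: compact_imp_closed open_Compl)
  then have "((%x. 0) has_derivative (%v. grad rh p \<bullet> v)) (at p)"
  by (rule has_derivative_transform_within_open[OF test1_deriv[OF t]]) (use that Suc.prems(3) in auto)
  from has_derivative_unique[OF this has_derivative_const] have "grad rh p \<bullet> grad rh p = 0" by metis
  then show ?thesis by simp
 qed
 show ?case
 proof (rule C_k_SucI)
  show "((%p. LBINT q. f q * rh (p - q)) has_derivative (%v. (LBINT q. f q *R grad rh (p - q)) \<bullet> v)) (at p)" for p
  by (rule conv_gen(1)[OF f _ t]) simp
  fix b :: 'a assume b: "b : Basis"
  have "(LBINT q. f q *R grad rh (p - q)) \<bullet> b = (LBINT q. f q * (grad rh (p - q) \<bullet> b))" for p
  using conv_gen(4)[OF f _ t, of "%x. x" p] by (simp flip: integral_inner_left)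
  moreover have "C_k k (%p. LBINT q. f q * (grad rh (p - q) \<bullet> b))"
  by (rule Suc.IH[of "%p. grad rh p \<bullet> b"]) (use C_k_grad(3)[OF Suc.prems(1) b] Suc.prems(2) g0 in auto)
  ultimately show "C_k k (%p. (LBINT q. f q *R grad rh (p - q)) \<bullet> b)" by simp
 qed
qed

section \<open>Approximation of C1 test functions by smooth ones\<close>

lemma compact_cball_subset_open:
 fixes K :: "'a::euclidean_space set"
 assumes "compact K" "open Om" "K \<subseteq> Om"
 obtains e where "e > 0" "{x + y |x y. x : K & y : cball 0 e} \<subseteq> Om"
proof (cases "K = {}")
 case True
 then show ?thesis using that[of 1] by auto
next
 case False
 obtain e where e: "e > 0" "{x. infdist x K <= e} \<subseteq> Om"
  using compact_in_open_separated[OF False assms] .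
 have "infdist (x + y) K <= e" if "x : K" "norm y <= e" for x y
  using infdist_le[OF that(1), of "x + y"] that(2) by (simp add: dist_norm)
 then have "{x + y |x y. x : K & y : cball 0 e} \<subseteq> {x. infdist x K <= e}" by auto
 with e that show ?thesis by blast
qed

lemma test1_integrable:
 assumes "test1 Om ph g"
 shows "integ ph" "integ g"
proof -
 obtain K where "compact K" "!!p. p ~: K ==> ph p = 0" "!!p. p ~: K ==> g p = 0"
  using test1D[OF assms] by metis
 then show "integ ph" "integ g"
  using integrable_compact_support test1_cont[OF assms] by blast+
qed

lemma Suc_inverse_small: assumes "e > 0" obtains N where "!!n. n \<ge> N ==> 1 / real (Suc n) < e"
proof -
 obtain N where N: "1 / Suc N < e" using assms nat_approx_posE by metis
 have "1 / real (Suc n) < e" if "n \<ge> N" for n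
  using that N by (smt (verit, best) frac_le of_nat_0_less_iff of_nat_mono Suc_le_mono zero_less_Suc)
 then show thesis using that by blast
qed

text \<open>Convolution with a mollifier keeps the sign and every sup bound, and the gradients
  converge uniformly because the limit gradient is uniformly continuous.\<close>

lemma test1_approx:
 assumes t: "test1 Om ph g" and Om: "open Om"
 obtains ps :: "nat => 'a::euclidean_space => real" and K where "!!n. ps n : test_functions Om" "(ALL p. 0 <= ph p) --> (ALL n p. 0 <= ps n p)"
  "ALL B. (ALL p. (abs (ph p)) <= B) --> (ALL n p. (abs (ps n p)) <= B)"
  "compact K" "K \<subseteq> Om" "!!n p. p ~: K ==> grad (ps n) p = 0" "!!p. p ~: K ==> g p = 0"
  "!!e. e > 0 ==> EX N. \<forall>n\<ge>N. ALL p. norm (grad (ps n) p - g p) <= e"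
proof -
 obtain K where K: "compact K" "K \<subseteq> Om" "!!p. p ~: K ==> ph p = 0" "!!p. p ~: K ==> g p = 0"
  using test1D[OF t] by metis
 obtain e0 where e0: "e0 > 0" "{x + y |x y. x : K & y : cball 0 e0} \<subseteq> Om"
  using compact_cball_subset_open[OF K(1) Om K(2)] .
 define K' where "K' = {x + y |x y. x : K & y : cball (0::'a) e0}"
 have K': "compact K'" "K' \<subseteq> Om" unfolding K'_def using e0 compact_sums[OF K(1) compact_cball] by blast+
 obtain N where N: "!!n. n \<ge> N ==> 1 / real (Suc n) < e0" using Suc_inverse_small[OF e0(1)] by metis
 have [measurable]: "ph : bmeas" "g : bmeas"
  using test1_cont[OF t] by (auto intro: borel_measurable_continuous_onI)
 define ps where "ps n p = (LBINT q. moll n q * ph (p - q))" for n p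
 define G where "G n p = (LBINT q. moll n q *R g (p - q))" for n p
 have D: "(ps n has_derivative (%v. G n p \<bullet> v)) (at p)" for n p
  unfolding ps_def[abs_def] G_def by (rule conv_gen(1)[OF moll_integrable _ t]) simp
 have gr: "grad (ps n) p = G n p" for n p using grad_eq[OF D] .
 have sym: "ps n p = (LBINT q. ph q * moll n (p - q))" for n p
 proof -
  have "(%q. moll n q * ph (p - q)) : bmeas" by measurable
  from lborel_integral_reflect[OF this, of p] show ?thesis
  unfolding ps_def by (simp add: mult.commute)
 qed
 have Ck: "C_k k (ps n)" for k n
  unfolding sym[abs_def]
  by (rule conv_C_k[where K = "cball 0 (1 / Suc n)"])
  (auto simp: test1_integrable[OF t] moll_C_k moll_eq_0)
 have mz: "moll n q = 0" if "n \<ge> N" "e0 < norm q" for n and q :: 'a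
  using N[OF that(1)] that(2) by (intro moll_eq_0) simp
 have z: "ps n p = 0 & G n p = 0" if "p ~: K'" "n \<ge> N" for n p
 proof -
  have "moll n q = 0 | p - q ~: K" for q
  proof (rule ccontr)
  assume "~ (moll n q = 0 | p - q ~: K)"
  then have "p - q : K" "norm q <= e0" using mz[OF that(2), of q] by (auto simp: not_less[symmetric])
  then have "(p - q) + q : K'" unfolding K'_def by fastforce
  then show False using that by simp
  qed
  then have "moll n q * ph (p - q) = 0" "moll n q *R g (p - q) = 0" for q using K(3,4) by (metis mult_eq_0_iff, metis scaleR_eq_0_iff)
  then have "(%q. moll n q * ph (p - q)) = (%q. 0)" "(%q. moll n q *R g (p - q)) = (%q. 0)" by auto
  then show ?thesis unfolding ps_def G_def by simp
 qed
 have un: "EX N. \<forall>n\<ge>N. ALL p. norm (G n p - g p) <= e" if e: "e > 0" for e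
 proof -
  obtain d where d: "d > 0" "!!x y. dist x y < d ==> dist (g x) (g y) < e" using test1_uniform[OF t e] by metis
  obtain M where M: "!!n. n \<ge> M ==> 1 / real (Suc n) < d" using Suc_inverse_small[OF d(1)] by metis
  have "norm (G n p - g p) <= e" if n: "n \<ge> M" for n p
  proof -
  have i: "integ (%q. moll n q *R g (p - q))" by (rule conv_gen(4)[OF moll_integrable _ t]) simp
  have i': "integ (%q::'a. moll n q *R g p)" using moll_integrable[of n] by auto
  have "G n p - g p = (LBINT q. moll n q *R g (p - q)) - (LBINT q. moll n (q::'a) *R g p)"
  unfolding G_def by (subst integral_scaleR_left) (auto simp: moll_integral moll_integrable)
  also have "... = (LBINT q. moll n q *R g (p - q) - moll n q *R g p)" using i i' by simp
  also have "norm (LBINT q. moll n q *R g (p - q) - moll n q *R g p) <= (LBINT q. moll n (q::'a) * e)"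
  proof (intro order_trans[OF integral_norm_bound] integral_mono)
  show "integ (%q. norm (moll n q *R g (p - q) - moll n q *R g p))" using i i' by auto
  show "integ (%q::'a. moll n q * e)" using moll_integrable[of n] by auto
  fix q :: 'a
  have "norm (moll n q *R (g (p - q) - g p)) <= moll n q * e"
  proof (cases "norm q < d")
  case True
  then have "norm (g (p - q) - g p) <= e" using d(2)[of "p - q" p] by (simp add: dist_norm)
  then show ?thesis using moll_nonneg[of n q] by (simp add: mult_left_mono)
  next
  case False
  then have "moll n q = 0" using M[OF n] by (intro moll_eq_0) simp
  then show ?thesis by simp
  qed
  then show "norm (moll n q *R g (p - q) - moll n q *R g p) <= moll n q * e"
  by (simp add: scaleR_diff_right)
  qed
  also have "... = e" using moll_integral[of n, where 'a = 'a] by simp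
  finally show ?thesis .
  qed
  then show ?thesis by blast
 qed
 show thesis
 \<comment> \<open>The first \<open>N\<close> mollifications are dropped: from then on the radius is
   below \<open>e0\<close>, and all supports lie in the fixed compact set \<open>K'\<close>.\<close>
 proof (rule that[of "%n. ps (n + N)" K'])
  show "ps (n + N) : test_functions Om" for n
  by (rule test_functionsI[OF Ck K']) (use z in auto)
  show "(ALL p. 0 <= ph p) --> (ALL n p. 0 <= ps (n + N) p)"
  unfolding ps_def by (auto intro!: B_nonneg mult_nonneg_nonneg moll_nonneg)
  show "ALL B. (ALL p. (abs (ph p)) <= B) --> (ALL n p. (abs (ps (n + N) p)) <= B)"
  proof (intro allI impI)
  fix B n p assume B: "ALL p. (abs (ph p)) <= B"
  have i: "integ (%q. moll (n + N) q * ph (p - q))" by (rule conv_gen(3)[OF moll_integrable _ t]) simp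
  have "(abs (ps (n + N) p)) <= (LBINT q. moll (n + N) (q::'a) * B)"
  unfolding ps_def
  proof (intro order_trans[OF integral_abs_bound] integral_mono integrable_abs i integrable_mult_left moll_integrable)
  show "(abs (moll (n + N) q * ph (p - q))) <= moll (n + N) q * B" for q
  using B moll_nonneg[of "n + N" q] by (simp add: abs_mult mult_left_mono)
  qed
  also have "... = B" using moll_integral[of "n + N", where 'a = 'a] by simp
  finally show "(abs (ps (n + N) p)) <= B" .
  qed
  show "grad (ps (n + N)) p = 0" if "p ~: K'" for n p using z[OF that] gr by simp
  show "g p = 0" if "p ~: K'" for p
  proof (rule K(4))
  have "p + 0 : K'" if "p : K" using that e0(1) unfolding K'_def by fastforce
  then show "p ~: K" using \<open>p ~: K'\<close> by auto
  qed
  show "EX M. \<forall>n\<ge>M. ALL p. norm (grad (ps (n + N)) p - g p) <= e" if "e > 0" for e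
  using un[OF that] gr by (metis trans_le_add1)
 qed (use K' in auto)
qed

lemma test1_limit:
 fixes X :: "'a::euclidean_space => 'a"
 assumes X: "integ (%p. ind K p *R X p)"
  and G: "!!n p. p ~: K ==> G n p = 0" "!!p. p ~: K ==> g p = 0"
  and [measurable]: "!!n. G n : bmeas" "g : bmeas"
  and g: "!!p. norm (g p) <= C"
  and un: "!!e. e > 0 ==> EX N. \<forall>n\<ge>N. ALL p. norm (G n p - g p) <= e"
 shows "(%n. LBINT p. X p \<bullet> G n p) ~~> (LBINT p. X p \<bullet> g p)"
proof -
 define X' where "X' p = ind K p *R X p" for p
 have X': "integ X'" using X by (simp add: X'_def[abs_def])
 have [measurable]: "X' : bmeas" using borel_measurable_integrable[OF X'] by simp
 have eq: "X p \<bullet> G n p = X' p \<bullet> G n p" "X p \<bullet> g p = X' p \<bullet> g p" for n p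
  using G by (auto simp: X'_def indicator_def)
 obtain N where N: "!!n p. n \<ge> N ==> norm (G n p - g p) <= 1" using un[of 1] by auto
 have "(%n. LBINT p. X' p \<bullet> G (n + N) p) ~~> (LBINT p. X' p \<bullet> g p)"
 proof (rule integral_dominated_convergence[where w = "%p. norm (X' p) * (C + 1)"])
  show "integ (%p. norm (X' p) * (C + 1))" using X' by auto
  have "(%n. G n p) ~~> g p" for p
  unfolding LIMSEQ_iff by (meson dense un order.strict_trans1)
  then show "AE p in lborel. (%n. X' p \<bullet> G (n + N) p) ~~> X' p \<bullet> g p"
  by (intro AE_I2 tendsto_intros LIMSEQ_ignore_initial_segment)
  show "AE p in lborel. norm (X' p \<bullet> G (n + N) p) <= norm (X' p) * (C + 1)" for n
  proof (intro AE_I2)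
  fix p
  have "norm (G (n + N) p) <= norm (G (n + N) p - g p) + norm (g p)"
  using norm_triangle_ineq[of "G (n + N) p - g p" "g p"] by simp
  also have "... <= C + 1" using N[of "n + N" p] g[of p] by simp
  finally show "norm (X' p \<bullet> G (n + N) p) <= norm (X' p) * (C + 1)"
  using Cauchy_Schwarz_ineq2[of "X' p" "G (n + N) p"] by (smt (verit, best) mult_left_mono norm_ge_zero real_norm_def)
  qed
 qed measurable
 then show ?thesis unfolding eq by (rule LIMSEQ_offset)
qed

section \<open>Fields with nonpositive divergence\<close>

definition nonpos_div :: "'a::euclidean_space set => ('a => 'a) => bool" where
 "nonpos_div Om X \<longleftrightarrow>
  (ALL ph g. test1 Om ph g --> (ALL p. 0 <= ph p) --> 0 <= (LBINT p. X p \<bullet> g p))"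

lemma nonpos_divD: "nonpos_div Om X ==> test1 Om ph g ==> (!!p. 0 <= ph p) ==> 0 <= (LBINT p. X p \<bullet> g p)"
 unfolding nonpos_div_def by blast

lemma test1_measurable:
 "test1 Om ph g ==> ph : bmeas" "test1 Om ph g ==> g : bmeas"
 using test1_cont by (blast intro: borel_measurable_continuous_onI)+

lemma test1_bdb: "test1 Om ph g ==> bdb ph" "test1 Om ph g ==> bdb g"
proof -
 assume t: "test1 Om ph g"
 obtain C where C: "!!p. (abs (ph p)) <= C" "!!p. norm (g p) <= C" using test1_bounded[OF t] by metis
 show "bdb ph" "bdb g"
  using C test1_measurable[OF t] by (auto intro!: bdbI[where C = C])
qed

lemma bdb_integrable:
 assumes "bdb f" "compact K" "!!x. x ~: K ==> f x = 0"
 shows "integ f"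
proof -
 obtain C where "!!x. norm (f x) <= C" using bdb_bound[OF assms(1)] by metis
 then show ?thesis
  by (intro integrable_bounded_support[OF bdb_measurable[OF assms(1)] _ assms(2,3)])
qed

lemma bdb_abs_bound:
 fixes f :: "'a::euclidean_space => real"
 assumes "bdb f"
 obtains C where "C > 0" "!!x. (abs (f x)) <= C"
 using bdb_bound[OF assms] by (metis real_norm_def)

lemma bdb_const [simp]: "bdb (%_. c)"
 by (rule bdbI[where C = "norm c"]) auto

lemma bdb_add: "bdb f ==> bdb g ==> bdb (%x. f x + g x)"
proof -
 assume f: "bdb f" and g: "bdb g"
 obtain C D where "!!x. norm (f x) <= C" "!!x. norm (g x) <= D" using bdb_bound[OF f] bdb_bound[OF g] by metis
 then show ?thesis using f g
  by (intro bdbI[where C = "C + D"]) (auto intro!: norm_triangle_le add_mono dest: bdb_measurable)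
qed

lemma bdb_minus: "bdb f ==> bdb (%x. - f x)"
proof -
 assume f: "bdb f"
 obtain C where "!!x. norm (f x) <= C" using bdb_bound[OF f] by metis
 then show ?thesis using f by (intro bdbI[where C = C]) (auto dest: bdb_measurable)
qed

lemma bdb_diff: "bdb f ==> bdb g ==> bdb (%x. f x - g x)"
 using bdb_add[of f "%x. - g x"] bdb_minus[of g] by simp

lemma bdb_scaleR: "bdb f ==> bdb g ==> bdb (%x. f x *R g x)"
proof -
 assume f: "bdb f" and g: "bdb g"
 obtain C D where C: "!!x. norm (f x) <= C" "!!x. norm (g x) <= D" using bdb_bound[OF f] bdb_bound[OF g] by metis
 have "norm (f x *R g x) <= C * D" for x
  using mult_mono[OF C(1)[of x] C(2)[of x]] C(1)[of x] norm_ge_zero[of "f x"] by simp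
 then show ?thesis
  by (rule bdbI[rotated]) (use bdb_measurable[OF f] bdb_measurable[OF g] in measurable)
qed

lemma bdb_mult: "bdb f ==> bdb g ==> bdb (%x. f x * g x :: real)"
 using bdb_scaleR[of f g] by simp

lemma bdb_inner: "bdb f ==> bdb g ==> bdb (%x. f x \<bullet> g x)"
proof -
 assume f: "bdb f" and g: "bdb g"
 obtain C D where C: "!!x. norm (f x) <= C" "!!x. norm (g x) <= D" using bdb_bound[OF f] bdb_bound[OF g] by metis
 have "norm (f x \<bullet> g x) <= C * D" for x
  using Cauchy_Schwarz_ineq2[of "f x" "g x"] mult_mono[OF C(1)[of x] C(2)[of x]] C(1)[of x] norm_ge_zero[of "f x"] by simp
 then show ?thesis
  by (rule bdbI[rotated]) (use bdb_measurable[OF f] bdb_measurable[OF g] in measurable)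
qed

lemma bdb_comp: "bdb f ==> h : bmeas ==> bdb (%x. f (h x))"
 unfolding bdb_def by (auto intro: measurable_compose bounded_subset[of "range f"])

lemma bdb_comp_continuous:
 assumes u: "bdb u" and c: "contU Gam"
 shows "bdb (%p. Gam (u p))"
proof -
 have "bounded (Gam ` closure (range u))"
  using u by (intro compact_imp_bounded compact_continuous_image continuous_on_subset[OF c])
  (auto simp: bdb_def)
 then have "bounded (range (%p. Gam (u p)))"
  by (rule bounded_subset) (use closure_subset[of "range u"] in auto)
 moreover have "(%p. Gam (u p)) : bmeas"
  by (rule measurable_compose[OF bdb_measurable[OF u] borel_measurable_continuous_onI[OF c]])
 ultimately show ?thesis by (simp add: bdb_def)
qed

lemma bdb_Pair:
 assumes "bdb f" "bdb g" shows "bdb (%x. (f x, g x))"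
proof -
 obtain C D where C: "!!x. norm (f x) <= C" "!!x. norm (g x) <= D" using bdb_bound[OF assms(1)] bdb_bound[OF assms(2)] by metis
 have "norm (f x, g x) <= C + D" for x
  using norm_Pair_le[of "f x" "g x"] C[of x] by simp
 then show ?thesis
  by (rule bdbI[rotated]) (use bdb_measurable[OF assms(1)] bdb_measurable[OF assms(2)] in "rule borel_measurable_Pair")
qed

lemma bdb_fst: "bdb f ==> bdb (%z. f (fst z))" and bdb_snd: "bdb f' ==> bdb (%z. f' (snd z))"
 by (rule bdb_comp; auto intro!: borel_measurable_continuous_onI continuous_on_fst continuous_on_snd continuous_on_id)+

lemma bdb_fst_minus_snd: "bdb k ==> bdb (%z. k (fst z - snd z))"
 by (rule bdb_comp; auto intro!: borel_measurable_continuous_onI continuous_on_fst continuous_on_snd continuous_on_id continuous_on_diff)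

lemma bdb_indicator: "compact K ==> bdb (ind K :: 'a::euclidean_space => real)"
 by (rule bdbI[where C = 1]) (auto simp: compact_imp_closed indicator_def)

lemma moll_eq_0_1: "x ~: cball 0 1 ==> moll n x = 0"
proof (rule moll_eq_0)
 assume "x ~: cball 0 1"
 then have "1 * 1 <= norm x * (1 + real n)" by (intro mult_mono) auto
 then show "1 / real (Suc n) <= norm x" by (simp add: divide_le_eq)
qed

lemma test1_int: "bdb X ==> test1 Om ph g ==> integ (%p. X p \<bullet> g p)"
proof -
 assume X: "bdb X" and t: "test1 Om ph g"
 obtain K where "compact K" "!!p. p ~: K ==> g p = 0" using test1D[OF t] by metis
 then show ?thesis
  by (intro bdb_integrable[OF bdb_inner[OF X test1_bdb(2)[OF t]], where K = K]) auto
qed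

lemma nonpos_divI_smooth:
 assumes Om: "open Om" and X: "bdb X"
  and h: "!!ph. ph : test_functions Om ==> (!!p. 0 <= ph p) ==> 0 <= (LBINT p. X p \<bullet> grad ph p)"
 shows "nonpos_div Om X"
 unfolding nonpos_div_def
proof (intro allI impI)
 fix ph g assume t: "test1 Om ph g" and p: "ALL p. 0 <= ph p"
 obtain ps :: "nat => 'a => real" and K where K: "!!n. ps n : test_functions Om" "(ALL p. 0 <= ph p) --> (ALL n p. 0 <= ps n p)"
  "compact K" "K \<subseteq> Om" "!!n p. p ~: K ==> grad (ps n) p = 0" "!!p. p ~: K ==> g p = 0"
  "!!e. e > 0 ==> EX N. \<forall>n\<ge>N. ALL p. norm (grad (ps n) p - g p) <= e"
  using test1_approx[OF t Om] by metis
 obtain C where C: "!!p. norm (g p) <= C" using test1_bounded[OF t] by metis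
 have mK: "K : sets borel" using K(3) by (simp add: compact_imp_closed)
 have iX: "integ (%p. ind K p *R X p)"
  by (rule bdb_integrable[OF bdb_scaleR[OF _ X] K(3)])
  (auto intro!: bdbI[where C = 1] borel_measurable_indicator mK)
 have "(%n. LBINT p. X p \<bullet> grad (ps n) p) ~~> (LBINT p. X p \<bullet> g p)"
  by (rule test1_limit[OF iX K(5,6) _ _ C K(7)])
  (use test1_measurable(2)[OF test_functions_test1[OF K(1)]] test1_measurable(2)[OF t] in auto)
 moreover have "0 <= (LBINT p. X p \<bullet> grad (ps n) p)" for n
  using h K(1,2) p by blast
 ultimately show "0 <= (LBINT p. X p \<bullet> g p)"
  by (simp add: LIMSEQ_le_const)
qed

lemma nonpos_div_add:
 assumes "nonpos_div Om X" "nonpos_div Om Y" "bdb X" "bdb Y"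
 shows "nonpos_div Om (%p. X p + Y p)"
 unfolding nonpos_div_def
proof (intro allI impI)
 fix ph g assume t: "test1 Om ph g" and p: "ALL p. 0 <= ph p"
 have "(LBINT p. (X p + Y p) \<bullet> g p) = (LBINT p. X p \<bullet> g p) + (LBINT p. Y p \<bullet> g p)"
  using test1_int[OF assms(3) t] test1_int[OF assms(4) t] by (simp add: inner_add_left)
 then show "0 <= (LBINT p. (X p + Y p) \<bullet> g p)"
  using nonpos_divD[OF assms(1) t] nonpos_divD[OF assms(2) t] p by simp
qed

lemma nonpos_div_scale:
 assumes "nonpos_div Om X" "c \<ge> 0"
 shows "nonpos_div Om (%p. c *R X p)"
 using assms unfolding nonpos_div_def by simp

text \<open>The integral of \<open>ph (p - q)\<close> over \<open>q\<close> is independent of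
  \<open>p\<close> by translation invariance, so its derivative at 0, the integral of
  \<open>g\<close>, vanishes. The indicator of a large ball makes the convolution factor integrable
  and has no effect for \<open>p\<close> near 0.\<close>

lemma test1_integral_const:
 assumes t: "test1 Om ph g"
 shows "(LBINT p. c \<bullet> g p) = 0"
proof -
 obtain K where K: "compact K" "!!p. p ~: K ==> ph p = 0" "!!p. p ~: K ==> g p = 0"
  using test1D[OF t] by metis
 obtain R where R: "R > 0" "!!x. x : K ==> norm x <= R"
  using K(1) compact_imp_bounded bounded_pos by metis
 have f: "integ (ind (cball 0 (R + 1)) :: 'a => real)"
  by (rule bdb_integrable[where K = "cball 0 (R + 1)"]) (auto intro: bdb_indicator)
 note D = conv_gen(1)[OF f _ t, of "%x. x" 0]
 have in_ball: "p - q ~: K" if "norm q > R + 1" "norm p <= 1" for p q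
  using R(2)[of "p - q"] norm_triangle_ineq2[of q p] that by (auto simp: norm_minus_commute)
 have 1: "(LBINT q. ind (cball 0 (R + 1)) q * ph (p - q)) = (LBINT q. ph q)" if "norm p <= 1" for p
 proof -
  have "ind (cball 0 (R + 1)) q * ph (p - q) = ph (p - q)" for q
  using in_ball[OF _ that] K(2) by (auto simp: indicator_def)
  then show ?thesis using lborel_integral_reflect[OF test1_measurable(1)[OF t], of p] by (simp only:)
 qed
 have 2: "(LBINT q. ind (cball 0 (R + 1)) q *R g (0 - q)) = (LBINT q. g q)"
 proof -
  have "ind (cball 0 (R + 1)) q *R g (0 - q) = g (0 - q)" for q
  using in_ball[of q 0] K(3) by (auto simp: indicator_def)
  then show ?thesis using lborel_integral_reflect[OF test1_measurable(2)[OF t], of 0] by (simp only:)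
 qed
 have "((%p. LBINT q. ph q) has_derivative (%v. (LBINT q. g q) \<bullet> v)) (at 0)"
  by (rule has_derivative_transform_within_open[OF D[unfolded 2], of "ball 0 1"]) (auto simp: 1)
 from has_derivative_unique[OF this has_derivative_const]
 have "(LBINT q. g q) \<bullet> c = 0" by metis
 then show ?thesis
  using test1_integrable(2)[OF t] by (simp add: inner_commute[of c])
qed

lemma nonpos_div_const [simp]: "nonpos_div Om (%p. c)"
 unfolding nonpos_div_def using test1_integral_const[of Om _ _ c] by simp

lemma nonpos_div_AE_cong:
 assumes "nonpos_div Om X" "AE p in lborel. p : Om --> X p = Y p" "bdb X" "bdb Y"
 shows "nonpos_div Om Y"
 unfolding nonpos_div_def
proof (intro allI impI)
 fix ph g assume t: "test1 Om ph g" and p: "ALL p. 0 <= ph p"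
 obtain K where K: "K \<subseteq> Om" "!!p. p ~: K ==> g p = 0" using test1D[OF t] by metis
 have "(LBINT p. X p \<bullet> g p) = (LBINT p. Y p \<bullet> g p)"
 proof (rule integral_cong_AE)
  show "AE p in lborel. X p \<bullet> g p = Y p \<bullet> g p"
  using assms(2) by eventually_elim (use K in "metis inner_zero_right subsetD")
 qed (use test1_int[OF assms(3) t] test1_int[OF assms(4) t] in auto)
 then show "0 <= (LBINT p. Y p \<bullet> g p)"
  using nonpos_divD[OF assms(1) t] p by simp
qed

lemma test1_shift:
 assumes t: "test1 Om ph g" and w: "!!p. p : Om ==> p + w : Om'"
 shows "test1 Om' (%p. ph (p - w)) (%p. g (p - w))"
proof -
 obtain K where K: "compact K" "K \<subseteq> Om" "!!p. p ~: K ==> ph p = 0" using test1D[OF t] by metis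
 have "((%p. ph (p - w)) has_derivative (%v. g (p - w) \<bullet> v)) (at p)" for p
 proof -
  have "((%p. p - w) has_derivative (%v. v)) (at p)" by (auto intro!: derivative_eq_intros)
  from has_derivative_compose[OF this test1_deriv[OF t]] show ?thesis .
 qed
 moreover have "contU (%p. g (p - w))"
  by (rule continuous_on_compose2[OF test1_cont(2)[OF t]]) (auto intro!: continuous_on_diff continuous_on_id continuous_on_const)
 moreover have "compact ((%p. w + p) ` K)" "(%p. w + p) ` K \<subseteq> Om'"
  using K w compact_translation[OF K(1), of w] by (auto simp: add.commute[of w])
 moreover have "ph (p - w) = 0" if "p ~: (%p. w + p) ` K" for p
  using that K(3)[of "p - w"] by (auto simp: image_iff) (metis add.commute diff_add_cancel)
 ultimately show ?thesis unfolding test1_def by blast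
qed

lemma nonpos_div_shift:
 assumes "nonpos_div Om X" "!!p. p : Om' ==> p + w : Om" "bdb X"
 shows "nonpos_div Om' (%p. X (p + w))"
 unfolding nonpos_div_def
proof (intro allI impI)
 fix ph g assume t: "test1 Om' ph g" and p: "ALL p. 0 <= ph p"
 have t': "test1 Om (%p. ph (p - w)) (%p. g (p - w))"
  by (rule test1_shift[OF t assms(2)])
 have "0 <= (LBINT p. X p \<bullet> g (p - w))"
  by (rule nonpos_divD[OF assms(1) t']) (use p in auto)
 also have "... = (LBINT p. X (p + w) \<bullet> g (p + w - w))"
  using borel_measurable_integrable[OF test1_int[OF assms(3) t']]
  by (intro lborel_integral_shift[symmetric]) simp
 finally show "0 <= (LBINT p. X (p + w) \<bullet> g p)" by simp
qed

lemma nonpos_div_limit: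
 assumes X: "!!n. nonpos_div Om (X n)" "!!n. X n : bmeas" "Y : bmeas"
  and C: "!!n p. norm (X n p) <= C"
  and l: "AE p in lborel. p : Om --> (%n. X n p) ~~> Y p"
 shows "nonpos_div Om Y"
 unfolding nonpos_div_def
proof (intro allI impI)
 fix ph g assume t: "test1 Om ph g" and p: "ALL p. 0 <= ph p"
 obtain K where K: "K \<subseteq> Om" "!!p. p ~: K ==> g p = 0" using test1D[OF t] by metis
 note [measurable] = X(2,3) test1_measurable[OF t]
 have "(%n. LBINT p. X n p \<bullet> g p) ~~> (LBINT p. Y p \<bullet> g p)"
 proof (rule integral_dominated_convergence[where w = "%p. C * norm (g p)"])
  show "integ (%p. C * norm (g p))" using test1_integrable(2)[OF t] by auto
  show "AE p in lborel. (%n. X n p \<bullet> g p) ~~> Y p \<bullet> g p"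
  using l
  proof eventually_elim
  case (elim p)
  show ?case
  proof (cases "p : K")
  case True
  then show ?thesis using elim K by (intro tendsto_intros) auto
  qed (use K in simp)
  qed
  show "AE p in lborel. norm (X n p \<bullet> g p) <= C * norm (g p)" for n
  using C by (intro AE_I2) (smt (verit, best) Cauchy_Schwarz_ineq2 mult_right_mono norm_ge_zero real_norm_def)
 qed measurable
 moreover have "0 <= (LBINT p. X n p \<bullet> g p)" for n
  using nonpos_divD[OF X(1) t] p by blast
 ultimately show "0 <= (LBINT p. Y p \<bullet> g p)"
  by (simp add: LIMSEQ_le_const)
qed

section \<open>Doubling of variables\<close>

lemma kernel_fubini:
 fixes G :: "'a::euclidean_space => real"
 assumes G: "bdb G" "compact K" "!!p. p ~: K ==> G p = 0"
  and k: "bdb k" "compact S" "!!p. p ~: S ==> k p = 0" and B: "bdb B"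
 shows "integ (%z. G (fst z) * B z * k (fst z - snd z))"
  "(LBINT z. G (fst z) * B z * k (fst z - snd z)) = (LBINT p. LBINT q. G p * B (p, q) * k (p - q))"
  "(LBINT z. G (fst z) * B z * k (fst z - snd z)) = (LBINT q. LBINT p. G p * B (p, q) * k (p - q))"
  "integ (%p. LBINT q. G p * B (p, q) * k (p - q))"
proof -
 define f where "f z = G (fst z) * B z * k (fst z - snd z)" for z
 have bf: "bdb f" unfolding f_def[abs_def]
  by (intro bdb_mult bdb_fst G(1) B bdb_fst_minus_snd k(1))
 obtain C where C: "!!z. (abs (f z)) <= C" using bdb_abs_bound[OF bf] by metis
 have cK: "compact (K \<times> {x - y |x y. x : K & y : S})"
  using G(2) k(2) by (intro compact_Times compact_differences)
 have f0: "f z = 0" if "z ~: K \<times> {x - y |x y. x : K & y : S}" for z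
 proof (cases "fst z : K & fst z - snd z : S")
  case True
  then have "snd z = fst z - (fst z - snd z)" "fst z : K" "fst z - snd z : S" by auto
  then have "snd z : {x - y |x y. x : K & y : S}" by blast
  with True have "z : K \<times> {x - y |x y. x : K & y : S}" by (simp add: mem_Times_iff)
  then show ?thesis using that by simp
 qed (use G(3) k(3) in "auto simp: f_def")
 note F = fubini_bounded_support[OF bdb_measurable[OF bf] C cK f0]
 show "integ (%z. G (fst z) * B z * k (fst z - snd z))"
  using F(1) by (simp add: f_def)
 show "(LBINT z. G (fst z) * B z * k (fst z - snd z)) = (LBINT p. LBINT q. G p * B (p, q) * k (p - q))"
  using F(7) by (simp add: f_def)
 show "(LBINT z. G (fst z) * B z * k (fst z - snd z)) = (LBINT q. LBINT p. G p * B (p, q) * k (p - q))"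
  using F(6,7) by (simp add: f_def)
 show "integ (%p. LBINT q. G p * B (p, q) * k (p - q))"
  using F(4) by (simp add: f_def)
qed

lemma test1_product:
 assumes t: "test1 Om th g" and k: "test1 UNIV ka h"
 shows "test1 Om (%p. th p * ka (p - q)) (%p. ka (p - q) *R g p + th p *R h (p - q))"
proof -
 have k': "test1 UNIV (%p. ka (p - q)) (%p. h (p - q))"
  by (rule test1_shift[OF k]) simp
 obtain K where K: "compact K" "K \<subseteq> Om" "!!p. p ~: K ==> th p = 0" using test1D[OF t] by metis
 have "((%p. th p * ka (p - q)) has_derivative (%v. (ka (p - q) *R g p + th p *R h (p - q)) \<bullet> v)) (at p)" for p
  using has_derivative_mult[OF test1_deriv[OF t] test1_deriv[OF k']]
  by (rule has_derivative_eq_rhs) (auto simp: inner_add_left algebra_simps)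
 moreover have "contU (%p. ka (p - q) *R g p + th p *R h (p - q))"
  by (intro continuous_intros test1_cont[OF t] test1_cont[OF k'])
 ultimately show ?thesis unfolding test1_def using K by (metis mult_zero_left)
qed

text \<open>The test function \<open>th p * ka (p - q)\<close> is used in \<open>p\<close> for
  \<open>A\<close> with \<open>q\<close> frozen, and in \<open>q\<close> for \<open>B\<close> with
  \<open>p\<close> frozen. The gradient of \<open>ka\<close> enters with opposite signs, so only the
  difference \<open>A - B\<close> meets it.\<close>

lemma doubling:
 assumes t: "test1 Om th g" "!!p. 0 <= th p" "compact K" "!!p. p ~: K ==> th p = 0" "!!p. p ~: K ==> g p = 0"
  and k: "test1 UNIV ka h" "!!p. 0 <= ka p" "compact S" "!!p. p ~: S ==> ka p = 0" "!!p. p ~: S ==> h p = 0"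
  and KS: "!!p s. p : K ==> s : S ==> p - s : Om"
  and A: "bdb A" "!!q. nonpos_div Om (%p. A (p, q))"
  and B: "bdb B" "!!p. nonpos_div Om (%q. B (p, q))"
 shows "integ (%z. ka (fst z - snd z) * (A z \<bullet> g (fst z)) + th (fst z) * ((A z - B z) \<bullet> h (fst z - snd z)))"
  and "0 <= (LBINT z. ka (fst z - snd z) * (A z \<bullet> g (fst z)) + th (fst z) * ((A z - B z) \<bullet> h (fst z - snd z)))"
proof -
 define T where "T = K \<times> {x - y |x y. x : K & y : S}"
 have T: "compact T" unfolding T_def
  using t(3) k(3) by (intro compact_Times compact_differences)
 have out: "(th (fst z) = 0 & g (fst z) = 0) | (ka (fst z - snd z) = 0 & h (fst z - snd z) = 0)" if "z ~: T" for z
 proof (cases "fst z : K & fst z - snd z : S")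
  case True
  then have "snd z = fst z - (fst z - snd z)" "fst z : K" "fst z - snd z : S" by auto
  then have "snd z : {x - y |x y. x : K & y : S}" by blast
  with True have "z : T" by (simp add: mem_Times_iff T_def)
  then show ?thesis using that by simp
 qed (use t k in auto)
 note bd = test1_bdb[OF t(1)] test1_bdb[OF k(1)]
 define f1 where "f1 z = A z \<bullet> (ka (fst z - snd z) *R g (fst z) + th (fst z) *R h (fst z - snd z))" for z
 define f2 where "f2 z = B z \<bullet> (- (th (fst z) *R h (fst z - snd z)))" for z
 have b1: "bdb f1" unfolding f1_def[abs_def]
  by (intro bdb_inner bdb_add bdb_scaleR A bd bdb_fst[of g] bdb_fst[of th] bdb_fst_minus_snd[of h] bdb_fst_minus_snd[of ka])
 have b2: "bdb f2" unfolding f2_def[abs_def]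
  by (intro bdb_inner bdb_minus bdb_scaleR B bd bdb_fst[of th] bdb_fst_minus_snd[of h])
 have z1: "f1 z = 0" "f2 z = 0" if "z ~: T" for z using out[OF that] by (auto simp: f1_def f2_def)
 obtain C where C: "!!z. (abs (f1 z)) <= C" using bdb_abs_bound[OF b1] by metis
 obtain D where D: "!!z. (abs (f2 z)) <= D" using bdb_abs_bound[OF b2] by metis
 note F1 = fubini_bounded_support[OF bdb_measurable[OF b1] C T z1(1)]
 note F2 = fubini_bounded_support[OF bdb_measurable[OF b2] D T z1(2)]
 have eq: "ka (fst z - snd z) * (A z \<bullet> g (fst z)) + th (fst z) * ((A z - B z) \<bullet> h (fst z - snd z)) = f1 z + f2 z" for z
  by (simp add: f1_def f2_def inner_add_right inner_diff_left algebra_simps)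
 show "integ (%z. ka (fst z - snd z) * (A z \<bullet> g (fst z)) + th (fst z) * ((A z - B z) \<bullet> h (fst z - snd z)))"
  unfolding eq using F1(1) F2(1) by simp
 have "0 <= (LBINT q. LBINT p. f1 (p, q))"
 proof (rule B_nonneg)
  fix q
  show "0 <= (LBINT p. f1 (p, q))"
  using nonpos_divD[OF A(2) test1_product[OF t(1) k(1), of q], of q] t(2) k(2) by (simp add: f1_def)
 qed
 moreover have "0 <= (LBINT p. LBINT q. f2 (p, q))"
 proof (rule B_nonneg)
  fix p
  show "0 <= (LBINT q. f2 (p, q))"
  proof (cases "p : K")
  case False
  then show ?thesis using t(4) by (simp add: f2_def)
  next
  case True
  have "test1 Om (%q. th p * ka (p - q)) (%q. - (th p *R h (p - q)))"
  unfolding test1_def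
  proof (intro conjI allI)
  fix q
  have "((%q. ka (p - q)) has_derivative (%v. h (p - q) \<bullet> (- v))) (at q)"
  proof -
  have "((%q. p - q) has_derivative (%v. - v)) (at q)" by (auto intro!: derivative_eq_intros)
  from has_derivative_compose[OF this test1_deriv[OF k(1)]] show ?thesis .
  qed
  from has_derivative_mult_right[OF this, of "th p"]
  show "((%q. th p * ka (p - q)) has_derivative (%v. - (th p *R h (p - q)) \<bullet> v)) (at q)" by simp
  have "contU (%q. h (p - q))"
  by (rule continuous_on_compose2[OF test1_cont(2)[OF k(1)]]) (auto intro!: continuous_on_diff continuous_on_id continuous_on_const)
  then show "contU (%q. - (th p *R h (p - q)))" by (intro continuous_intros)
  show "EX K. compact K & K \<subseteq> Om & (ALL q. q ~: K --> th p * ka (p - q) = 0)"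
  proof (intro exI conjI allI impI)
  show "compact ((%s. p - s) ` S)" using k(3) by (intro compact_continuous_image) (auto intro!: continuous_intros)
  show "(%s. p - s) ` S \<subseteq> Om" using KS[OF True] by auto
  show "th p * ka (p - q) = 0" if "q ~: (%s. p - s) ` S" for q
  using that k(4)[of "p - q"] by (auto simp: image_iff) (metis diff_diff_eq2 add_diff_cancel_left')
  qed
  qed
  from nonpos_divD[OF B(2)[of p] this] t(2) k(2) show ?thesis by (simp add: f2_def)
  qed
 qed
 moreover have "(LBINT z. f1 z + f2 z) = (LBINT q. LBINT p. f1 (p, q)) + (LBINT p. LBINT q. f2 (p, q))"
  using F1(1,6,7) F2(1,7) by simp
 ultimately show "0 <= (LBINT z. ka (fst z - snd z) * (A z \<bullet> g (fst z)) + th (fst z) * ((A z - B z) \<bullet> h (fst z - snd z)))"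
  unfolding eq by simp
qed

lemma moll_grad_eq_0: "1 / Suc n < norm x ==> grad (moll n) x = 0"
proof -
 assume x: "1 / Suc n < norm x"
 have "open {y::'a. 1 / Suc n < norm y}" by (intro open_Collect_less continuous_intros)
 then have "((%x. 0) has_derivative (%v. grad (moll n) x \<bullet> v)) (at x)"
  by (rule has_derivative_transform_within_open[OF test1_deriv[OF moll_test1]]) (use x in "auto simp: moll_eq_0")
 from has_derivative_unique[OF this has_derivative_const] have "grad (moll n) x \<bullet> grad (moll n) x = 0" by metis
 then show ?thesis by simp
qed

text \<open>Kruzhkov's argument: with \<open>A = B\<close> in \<open>doubling\<close> the terms
  containing the singular gradient of the mollifier cancel, and the rest converges to the diagonal
  by \<open>approximate_identity\<close>. It serves both the L1 contraction and the closure of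
  subsolutions under maxima.\<close>

theorem nonpos_div_diagonal:
 fixes u v :: "'a::euclidean_space => real" and X :: "real => real => 'a"
 assumes Om: "open Om" and u: "bdb u" "!!p. (abs (u p)) <= M" and v: "bdb v" "!!p. (abs (v p)) <= M"
  and Xc: "contU (%z. X (fst z) (snd z))"
  and L: "!!a b b'. (abs a) <= M ==> (abs b) <= M ==> (abs b') <= M ==> norm (X a b - X a b') <= L * (abs (b - b'))"
  and 1: "!!b. nonpos_div Om (%p. X (u p) b)"
  and 2: "!!a. nonpos_div Om (%p. X a (v p))"
 shows "nonpos_div Om (%p. X (u p) (v p))"
 unfolding nonpos_div_def
proof (intro allI impI)
 fix th g assume t: "test1 Om th g" and pos: "ALL p. 0 <= th p"
 obtain K where K: "compact K" "K \<subseteq> Om" "!!p. p ~: K ==> th p = 0" "!!p. p ~: K ==> g p = 0"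
  using test1D[OF t] by metis
 obtain e0 where e0: "e0 > 0" "{x + y |x y. x : K & y : cball 0 e0} \<subseteq> Om"
  using compact_cball_subset_open[OF K(1) Om K(2)] .
 obtain N where N: "!!n. n \<ge> N ==> 1 / real (Suc n) < e0" using Suc_inverse_small[OF e0(1)] by metis
 define A where "A z = X (u (fst z)) (v (snd z))" for z
 have A: "bdb A" unfolding A_def[abs_def]
  using bdb_comp_continuous[OF bdb_Pair[OF bdb_fst[OF u(1)] bdb_snd[OF v(1)]] Xc] by simp
 obtain C where C: "C > 0" "!!p. norm (g p) <= C" using test1_bounded[OF t] by metis
 define Ps where "Ps z = A z \<bullet> g (fst z)" for z
 have Ps: "bdb Ps" unfolding Ps_def[abs_def] by (intro bdb_inner A bdb_fst[of g] test1_bdb[OF t])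
 obtain D where D: "!!z. (abs (Ps z)) <= D" using bdb_abs_bound[OF Ps] by metis
 have lim: "(%n. LBINT p. LBINT q. Ps (p, q) * moll n (p - q)) ~~> (LBINT p. Ps (p, p))"
 proof (rule approximate_identity[OF bdb_measurable[OF Ps] D K(1) _ v(1)])
  show "Ps (p, q) = 0" if "p ~: K" for p q using K(4)[OF that] by (simp add: Ps_def)
  show "(abs (Ps (p, q) - Ps (p, p))) <= L * C * (abs (v q - v p))" for p q
  proof -
  have "(abs (Ps (p, q) - Ps (p, p))) <= norm (X (u p) (v q) - X (u p) (v p)) * norm (g p)"
  unfolding Ps_def A_def by (simp add: inner_diff_left[symmetric] Cauchy_Schwarz_ineq2)
  also have "... <= (L * (abs (v q - v p))) * C"
  by (rule mult_mono[OF L[OF u(2) v(2) v(2)] C(2) order_trans[OF norm_ge_zero L[OF u(2) v(2) v(2)]] norm_ge_zero])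
  finally show ?thesis by (simp add: algebra_simps)
  qed
 qed
 have "0 <= (LBINT p. LBINT q. Ps (p, q) * moll n (p - q))" if n: "n \<ge> N" for n
 proof -
  have "0 <= (LBINT z. moll n (fst z - snd z) * (A z \<bullet> g (fst z)) + th (fst z) * ((A z - A z) \<bullet> grad (moll n) (fst z - snd z)))"
  proof (rule doubling(2)[where Om = Om and S = "cball 0 e0", OF t _ K(1,3,4) moll_test1 moll_nonneg])
  show "p - s : Om" if "p : K" "s : cball 0 e0" for p s
  using e0(2) that by (auto simp: subset_iff) (metis diff_conv_add_uminus norm_minus_cancel)
  show "moll n p = 0" "grad (moll n) p = 0" if "p ~: cball 0 e0" for p :: 'a
  using that N[OF n] by (auto intro!: moll_eq_0 moll_grad_eq_0)
  show "bdb A" "bdb A" by (rule A)+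
  show "nonpos_div Om (%p. A (p, q))" for q using 1 by (simp add: A_def)
  show "nonpos_div Om (%q. A (p, q))" for p using 2 by (simp add: A_def)
  qed (use pos in auto)
  also have "... = (LBINT z. 1 * Ps z * moll n (fst z - snd z))"
  by (simp add: Ps_def mult.commute)
  also have "... = (LBINT z. ind K (fst z) * Ps z * moll n (fst z - snd z))"
  using K(4) by (intro B_cong) (auto simp: Ps_def indicator_def)
  also have "... = (LBINT p. LBINT q. ind K p * Ps (p, q) * moll n (p - q))"
  by (rule kernel_fubini(2)[of _ K _ "cball 0 1"])
  (simp_all add: K(1) Ps test1_bdb(1)[OF moll_test1] moll_eq_0_1 bdb_indicator del: mem_cball)
  also have "... = (LBINT p. LBINT q. Ps (p, q) * moll n (p - q))"
  using K(4) by (intro B_cong refl) (auto simp: Ps_def indicator_def)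
  finally show ?thesis .
 qed
 then have "0 <= (LBINT p. Ps (p, p))"
  by (intro LIMSEQ_le_const[OF lim]) blast
 then show "0 <= (LBINT p. X (u p) (v p) \<bullet> g p)" by (simp add: Ps_def A_def)
qed

section \<open>The interaction inequality\<close>

lemma moll_limit:
 fixes G z :: "'a::euclidean_space => real"
 assumes G: "bdb G" "compact K" "!!p. p ~: K ==> G p = 0" and z: "bdb z"
 shows "(%n. LBINT p. LBINT q. G p * z q * moll n (p - q)) ~~> (LBINT p. G p * z p)"
proof -
 obtain C where C: "!!p. (abs (G p)) <= C" using bdb_abs_bound[OF G(1)] by metis
 have b: "bdb (%w. G (fst w) * z (snd w))"
  by (intro bdb_mult bdb_fst[of G] bdb_snd[of z] G z)
 obtain D where D: "!!w. (abs (G (fst w) * z (snd w))) <= D" using bdb_abs_bound[OF b] by metis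
 have "(abs (G (fst (p, q)) * z (snd (p, q)) - G (fst (p, p)) * z (snd (p, p)))) <= C * (abs (z q - z p))" for p q
  using C[of p] by (simp add: right_diff_distrib[symmetric] abs_mult mult_right_mono)
 from approximate_identity[OF bdb_measurable[OF b] D G(2) _ z this]
 show ?thesis using G(3) by simp
qed

lemma moll_shift_limit:
 fixes G z :: "'a::euclidean_space => real"
 assumes G: "bdb G" "compact K" "!!p. p ~: K ==> G p = 0" and z: "bdb z"
 shows "(%n. LBINT p. LBINT q. G p * z q * moll n (p - q - s)) ~~> (LBINT p. G p * z (p - s))"
proof -
 have "(LBINT q. G p * z q * moll n (p - q - s)) = (LBINT q. G p * z (q - s) * moll n (p - q))" for p n
 proof -
  have [measurable]: "z : bmeas" using z by (rule bdb_measurable)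
  have "(%q. G p * z q * moll n (p - q - s)) : bmeas" by measurable
  from lborel_integral_shift[OF this, of "- s"] have
  "(LBINT q. G p * z (q + - s) * moll n (p - (q + - s) - s)) = (LBINT q. G p * z q * moll n (p - q - s))" .
  moreover have "p - (q + - s) - s = p - q" for q by simp
  ultimately show ?thesis by (simp only: diff_conv_add_uminus[symmetric])
 qed
 moreover have "bdb (%q. z (q - s))" by (rule bdb_comp[OF z]) simp
 ultimately show ?thesis using moll_limit[OF G, of "%q. z (q - s)"] by simp
qed

text \<open>The mollified length density of the segment from 0 to \<open>h *R e\<close>; its total
  mass is \<open>h\<close>. The kernel \<open>kapg\<close> is its gradient, and
  \<open>ksupp d h e\<close> is the closed d-neighbourhood of the segment.\<close>

definition kap :: "nat => real => 'a::euclidean_space => 'a => real" where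
 "kap n h e w = (LBINT r. ind {0..h} r * moll n (w - r *R e))"

definition kapg :: "nat => real => 'a::euclidean_space => 'a => 'a" where
 "kapg n h e w = (LBINT r. ind {0..h} r *R grad (moll n) (w - r *R e))"

definition ksupp :: "real => real => 'a::euclidean_space => 'a set" where
 "ksupp d h e = {x + y |x y. x : cball 0 d & y : (%r. r *R e) ` {0..h}}"

lemma compact_ksupp: "compact (ksupp d h e)"
 unfolding ksupp_def by (intro compact_sums compact_continuous_image) (auto intro!: continuous_intros)

lemma indicator_Icc_integrable: "integ (ind {0..h::real} :: real => real)"
 by (rule bdb_integrable[where K = "{0..h}"]) (auto intro: bdb_indicator)

lemma kap_test1: "test1 UNIV (kap n h e) (kapg n h e)"
 and kap_eq_0: "1 / Suc n < d ==> w ~: ksupp d h e ==> kap n h e w = 0"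
 and kapg_eq_0: "1 / Suc n < d ==> w ~: ksupp d h e ==> kapg n h e w = 0"
proof -
 have Y: "(%r. r *R e) : lmeas" by simp
 have z: "ind {0..h} r * moll n (w - r *R e) = 0" "ind {0..h} r *R grad (moll n) (w - r *R e) = 0"
  if "w ~: ksupp d h e" "1 / Suc n < d" for w r d
 proof -
  have "norm (w - r *R e) > 1 / Suc n" if "r : {0..h}"
  proof (rule ccontr)
  assume "~ ?thesis"
  then have "w - r *R e : cball 0 d" "r *R e : (%r. r *R e) ` {0..h}"
  using that \<open>1 / Suc n < d\<close> by auto
  moreover have "w = (w - r *R e) + r *R e" by simp
  ultimately have "w : ksupp d h e" unfolding ksupp_def by blast
  then show False using \<open>w ~: ksupp d h e\<close> by simp
  qed
  then show "ind {0..h} r * moll n (w - r *R e) = 0" "ind {0..h} r *R grad (moll n) (w - r *R e) = 0"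
  by (auto simp: indicator_def moll_eq_0 moll_grad_eq_0)
 qed
 show 1: "kap n h e w = 0" if "1 / Suc n < d" "w ~: ksupp d h e" for d w
  unfolding kap_def z[OF that(2,1)] by simp
 show "kapg n h e w = 0" if "1 / Suc n < d" "w ~: ksupp d h e" for d w
  unfolding kapg_def z[OF that(2,1)] by simp
 show "test1 UNIV (kap n h e) (kapg n h e)"
  unfolding test1_def
 proof (intro conjI allI)
  show "(kap n h e has_derivative (%v. kapg n h e p \<bullet> v)) (at p)" for p
  unfolding kap_def[abs_def] kapg_def by (rule conv_gen(1)[OF indicator_Icc_integrable Y moll_test1])
  show "contU (kapg n h e)"
  unfolding kapg_def[abs_def] by (rule conv_gen(2)[OF indicator_Icc_integrable Y moll_test1])
  show "EX K. compact K & K \<subseteq> UNIV & (ALL p. p ~: K --> kap n h e p = 0)"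
  using compact_ksupp 1[of 2] by (intro exI[of _ "ksupp 2 h e"]) (auto simp: divide_less_eq)
 qed
qed

lemma kap_nonneg: "0 <= kap n h e w"
 unfolding kap_def by (intro B_nonneg mult_nonneg_nonneg moll_nonneg) simp

text \<open>Along the segment the derivative in direction \<open>e\<close> is minus the derivative
  in the parameter \<open>r\<close>, so the integral over \<open>r\<close> telescopes to the two end
  points.\<close>

lemma kapg_inner:
 assumes "0 <= h"
 shows "e \<bullet> kapg n h e w = moll n w - moll n (w - h *R e)"
proof -
 have i: "integ (%r. ind {0..h} r *R grad (moll n) (w - r *R e))"
  by (rule conv_gen(4)[OF indicator_Icc_integrable _ moll_test1]) simp
 have "e \<bullet> kapg n h e w = (LBINT r. ind {0..h} r *R (grad (moll n) (w - r *R e) \<bullet> e))"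
  unfolding kapg_def using i by (subst inner_commute) (simp flip: integral_inner_left)
 also have "... = - moll n (w - h *R e) - (- moll n (w - 0 *R e))"
 proof (rule integral_FTC_Icc[OF assms])
  fix r :: real
  have "((%r. w - r *R e) has_derivative (%t. - (t *R e))) (at r)"
  by (auto intro!: derivative_eq_intros)
  from has_derivative_minus[OF has_derivative_compose[OF this test1_deriv[OF moll_test1]]]
  have "((%r. - moll n (w - r *R e)) has_derivative (%t. t *R (grad (moll n) (w - r *R e) \<bullet> e))) (at r)"
  by simp
  then show "((%r. - moll n (w - r *R e)) has_vector_derivative grad (moll n) (w - r *R e) \<bullet> e) (at r within {0..h})"
  unfolding has_vector_derivative_def by (rule has_derivative_at_withinI)
 next
  have "continuous_on {0..h} (%r. grad (moll n) (w - r *R e))"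
  by (rule continuous_on_compose2[OF test1_cont(2)[OF moll_test1]]) (auto intro!: continuous_intros)
  then show "continuous_on {0..h} (%r. grad (moll n) (w - r *R e) \<bullet> e)"
  by (intro continuous_on_inner continuous_on_const)
 qed
 finally show ?thesis by simp
qed

text \<open>Doubling of \<open>z q\<close> times the first field against \<open>x p\<close> times
  the second, with the segment kernel. The components along \<open>c\<close> cancel, and those along
  \<open>e\<close> meet a difference of two mollifiers and produce the wedge
  \<open>x Ze - z Xe\<close> on the diagonal minus its version with shifted second field. The
  direction \<open>f\<close> is left to the hypothesis on \<open>Bf\<close>, and the cutoff gradient
  costs a kernel average of \<open>z\<close>.\<close>

theorem interaction:
 fixes x z Xe Ze Xf Zf :: "'a::euclidean_space => real" and c e f :: 'a
 assumes Om: "open Om" and t: "test1 Om th g" "!!p. 0 <= th p"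
  and K: "compact K" "!!p. p ~: K ==> th p = 0" "!!p. p ~: K ==> g p = 0"
  and h: "0 <= h" and seg: "!!p r. p : K ==> 0 <= r ==> r <= h ==> p - r *R e : Om"
  and bd: "bdb x" "bdb z" "bdb Xe" "bdb Ze" "bdb Xf" "bdb Zf"
  and pos: "!!p. 0 <= x p" "!!p. 0 <= z p"
  and X: "nonpos_div Om (%p. x p *R c + Xe p *R e + Xf p *R f)"
  and Z: "nonpos_div Om (%p. z p *R c + Ze p *R e + Zf p *R f)"
  and Bz: "!!n p. n \<ge> N0 ==> p : K ==> (LBINT q. z q * kap n h e (p - q)) <= Bz"
  and Bf: "!!n. n \<ge> N0 ==>
  \<bar>LBINT p. LBINT q. th p * (z q * Xf p - x p * Zf q) * (f \<bullet> kapg n h e (p - q))\<bar> <= Bf"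
 shows "(LBINT p. th p * (x p * Ze p - z p * Xe p)) <=
  (LBINT p. th p * (x p * Ze (p - h *R e) - z (p - h *R e) * Xe p)) +
  Bz * (LBINT p. (abs ((x p *R c + Xe p *R e + Xf p *R f) \<bullet> g p))) + Bf"
proof -
 define XX where "XX p = x p *R c + Xe p *R e + Xf p *R f" for p
 define ZZ where "ZZ p = z p *R c + Ze p *R e + Zf p *R f" for p
 have bXX: "bdb XX" and bZZ: "bdb ZZ"
  unfolding XX_def[abs_def] ZZ_def[abs_def] by (intro bdb_add bdb_scaleR bd bdb_const)+
 have bth: "bdb th" "bdb g" using test1_bdb[OF t(1)] by auto
 have compL: "compact ((%w. fst w - snd w *R e) ` (K \<times> {0..h}))"
  by (intro compact_continuous_image compact_Times K(1)) (auto intro!: continuous_intros)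
 obtain d where d: "d > 0" "{a + y |a y. a : (%w. fst w - snd w *R e) ` (K \<times> {0..h}) & y : cball 0 d} \<subseteq> Om"
 proof (rule compact_cball_subset_open[OF compL Om])
  show "(%w. fst w - snd w *R e) ` (K \<times> {0..h}) \<subseteq> Om" using seg by auto
 qed (rule that)
 have KS: "p - s : Om" if pK: "p : K" and sS: "s : ksupp d h e" for p s
 proof -
  obtain a r where s: "s = a + r *R e" "norm a <= d" "0 <= r" "r <= h"
  using sS by (auto simp: ksupp_def)
  have "p - s = (p - r *R e) + (- a)" using s(1) by simp
  moreover have "p - r *R e : (%w. fst w - snd w *R e) ` (K \<times> {0..h})" using pK s by force
  moreover have "- a : cball 0 d" using s(2) by simp
  ultimately have "p - s : {a + y |a y. a : (%w. fst w - snd w *R e) ` (K \<times> {0..h}) & y : cball 0 d}" by blast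
  then show ?thesis using d(2) by blast
 qed
 obtain N1 where N1: "!!n. n \<ge> N1 ==> 1 / real (Suc n) < d" using Suc_inverse_small[OF d(1)] by metis
 define s where "s = h *R e"
 define a1 where "a1 n = (LBINT p. LBINT q. (th p * Xe p) * z q * moll n (p - q))" for n
 define a2 where "a2 n = (LBINT p. LBINT q. (th p * x p) * Ze q * moll n (p - q))" for n
 define a3 where "a3 n = (LBINT p. LBINT q. (th p * Xe p) * z q * moll n (p - q - s))" for n
 define a4 where "a4 n = (LBINT p. LBINT q. (th p * x p) * Ze q * moll n (p - q - s))" for n
 define I where "I = (LBINT p. (abs (XX p \<bullet> g p)))"
 have main: "0 <= Bz * I + a1 n - a2 n - a3 n + a4 n + Bf" if n: "n \<ge> N0" "n \<ge> N1" for n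
 proof -
  define ka where "ka = kap n h e"
  define et where "et = kapg n h e"
  have tk: "test1 UNIV ka et" unfolding ka_def et_def by (rule kap_test1)
  have k0: "ka w = 0" "et w = 0" if "w ~: ksupp d h e" for w
  unfolding ka_def et_def using kap_eq_0 kapg_eq_0 N1[OF n(2)] that by blast+
  have m0: "moll n w = 0" if "w ~: cball 0 1" for w :: 'a using moll_eq_0_1 that .
  have bm: "bdb (moll n :: 'a => real)" "bdb (%w::'a. moll n (w - s))"
  using test1_bdb(1)[OF moll_test1] by (auto intro: bdb_comp[OF test1_bdb(1)[OF moll_test1]])
  have ms0: "moll n (w - s) = 0" if "w ~: cball s 1" for w
  using that by (intro moll_eq_0_1) (auto simp: dist_norm norm_minus_commute)
  \<comment> \<open>Each field is multiplied by a nonnegative function of the other variable, which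
    preserves the sign of its divergence.\<close>
  define A where "A w = z (snd w) *R XX (fst w)" for w
  define B where "B w = x (fst w) *R ZZ (snd w)" for w
  have bA: "bdb A" "bdb B" unfolding A_def[abs_def] B_def[abs_def]
  by (intro bdb_scaleR bdb_fst[of XX] bdb_snd[of z] bdb_fst[of x] bdb_snd[of ZZ] bd bXX bZZ)+
  have 0: "0 <= (LBINT w. ka (fst w - snd w) * (A w \<bullet> g (fst w)) + th (fst w) * ((A w - B w) \<bullet> et (fst w - snd w)))"
  proof (rule doubling(2)[where Om = Om and S = "ksupp d h e", OF t K tk _ compact_ksupp k0 KS])
  show "nonpos_div Om (%p. A (p, q))" for q
  unfolding A_def using nonpos_div_scale[OF X pos(2)] by (simp add: XX_def)
  show "nonpos_div Om (%q. B (p, q))" for p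
  unfolding B_def using nonpos_div_scale[OF Z pos(1)] by (simp add: ZZ_def)
  qed (auto simp: bA ka_def kap_nonneg)
  define P where "P p = XX p \<bullet> g p" for p
  have bP: "bdb P" unfolding P_def[abs_def] by (intro bdb_inner bXX bth)
  have P0: "P p = 0" if "p ~: K" for p using K(3)[OF that] by (simp add: P_def)
  define f1 where "f1 w = P (fst w) * z (snd w) * ka (fst w - snd w)" for w
  define f2 where "f2 w = (th (fst w) * Xe (fst w)) * z (snd w) * moll n (fst w - snd w)" for w
  define f3 where "f3 w = (th (fst w) * x (fst w)) * Ze (snd w) * moll n (fst w - snd w)" for w
  define f4 where "f4 w = (th (fst w) * Xe (fst w)) * z (snd w) * moll n (fst w - snd w - s)" for w
  define f5 where "f5 w = (th (fst w) * x (fst w)) * Ze (snd w) * moll n (fst w - snd w - s)" for w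
  define f6 where "f6 w = th (fst w) * (z (snd w) * Xf (fst w) - x (fst w) * Zf (snd w)) * (f \<bullet> et (fst w - snd w))" for w
  have eq: "ka (fst w - snd w) * (A w \<bullet> g (fst w)) + th (fst w) * ((A w - B w) \<bullet> et (fst w - snd w))
  = f1 w + f2 w - f3 w - f4 w + f5 w + f6 w" for w
  proof -
  have e: "e \<bullet> et (fst w - snd w) = moll n (fst w - snd w) - moll n (fst w - snd w - s)"
  unfolding et_def s_def by (rule kapg_inner[OF h])
  \<comment> \<open>No term along \<open>c\<close> is left: both products have the component
    \<open>x (fst w) * z (snd w)\<close>.\<close>
  have "(A w - B w) \<bullet> et (fst w - snd w) =
  (z (snd w) * Xe (fst w) - x (fst w) * Ze (snd w)) * (e \<bullet> et (fst w - snd w)) +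
  (z (snd w) * Xf (fst w) - x (fst w) * Zf (snd w)) * (f \<bullet> et (fst w - snd w))"
  by (simp add: A_def B_def XX_def ZZ_def inner_diff_left inner_add_left algebra_simps)
  then show ?thesis
  unfolding e by (simp only: f1_def f2_def f3_def f4_def f5_def f6_def) (simp add: P_def A_def algebra_simps)
  qed
  have bt: "bdb (%p. th p * Xe p)" "bdb (%p. th p * x p)" by (intro bdb_mult bth bd)+
  have t0: "th p * Xe p = 0" "th p * x p = 0" if "p ~: K" for p using K(2)[OF that] by auto
  have bf6: "bdb (%w. z (snd w) * Xf (fst w) - x (fst w) * Zf (snd w))"
  by (intro bdb_mult bdb_diff bdb_fst[of x] bdb_fst[of Xf] bdb_snd[of z] bdb_snd[of Zf] bd)
  have bet: "bdb (%w. f \<bullet> et w)" by (intro bdb_inner bdb_const test1_bdb[OF tk])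
  have et0: "f \<bullet> et w = 0" if "w ~: ksupp d h e" for w using k0(2)[OF that] by simp
  note F1 = kernel_fubini[OF bP K(1) P0 test1_bdb(1)[OF tk] compact_ksupp[of d h e] k0(1) bdb_snd[OF bd(2)]]
  note F2 = kernel_fubini[where G = "%p. th p * Xe p" and B = "%w. z (snd w)" and k = "moll n", OF bt(1) K(1) t0(1) bm(1) compact_cball[of 0 1] m0 bdb_snd[OF bd(2)]]
  note F3 = kernel_fubini[where G = "%p. th p * x p" and B = "%w. Ze (snd w)" and k = "moll n", OF bt(2) K(1) t0(2) bm(1) compact_cball[of 0 1] m0 bdb_snd[OF bd(4)]]
  note F4 = kernel_fubini[where G = "%p. th p * Xe p" and B = "%w. z (snd w)" and k = "%w. moll n (w - s)", OF bt(1) K(1) t0(1) bm(2) compact_cball[of s 1] ms0 bdb_snd[OF bd(2)]]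
  note F5 = kernel_fubini[where G = "%p. th p * x p" and B = "%w. Ze (snd w)" and k = "%w. moll n (w - s)", OF bt(2) K(1) t0(2) bm(2) compact_cball[of s 1] ms0 bdb_snd[OF bd(4)]]
  note F6 = kernel_fubini[where G = "th" and B = "%w. z (snd w) * Xf (fst w) - x (fst w) * Zf (snd w)" and k = "%w. f \<bullet> et w", OF bth(1) K(1,2) bet compact_ksupp[of d h e] et0 bf6]
  have i: "integ f1" "integ f2" "integ f3" "integ f4"
  "integ f5" "integ f6"
  unfolding f1_def[abs_def] f2_def[abs_def] f3_def[abs_def] f4_def[abs_def] f5_def[abs_def] f6_def[abs_def]
  by (rule F1(1) F2(1) F3(1) F4(1) F5(1) F6(1) | assumption)+
  have e1: "(LBINT w. f2 w) = a1 n" unfolding f2_def a1_def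
  using F2(2) by simp
  have e2: "(LBINT w. f3 w) = a2 n" unfolding f3_def a2_def
  using F3(2) by simp
  have e3: "(LBINT w. f4 w) = a3 n" unfolding f4_def a3_def
  using F4(2) by simp
  have e4: "(LBINT w. f5 w) = a4 n" unfolding f5_def a4_def
  using F5(2) by simp
  note e = e1 e2 e3 e4
  have "(LBINT w. f6 w) <= Bf"
  using Bf[OF n(1)] F6(2) unfolding f6_def et_def by simp
  moreover have "(LBINT w. f1 w) <= Bz * I"
  proof -
  have "(LBINT w. f1 w) = (LBINT p. LBINT q. P p * z q * ka (p - q))"
  unfolding f1_def using F1(2) by simp
  also have "... <= (LBINT p. Bz * (abs (P p)))"
  proof (rule integral_mono)
  show "integ (%p. LBINT q. P p * z q * ka (p - q))" using F1(4) by simp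
  show "integ (%p. Bz * (abs (P p)))" using bdb_integrable[OF bP K(1) P0] by auto
  fix p
  have 1: "(LBINT q. P p * z q * ka (p - q)) = P p * (LBINT q. z q * ka (p - q))"
  by (simp add: mult.assoc)
  have 2: "0 <= (LBINT q. z q * ka (p - q))"
  by (intro B_nonneg mult_nonneg_nonneg pos) (simp add: ka_def kap_nonneg)
  show "(LBINT q. P p * z q * ka (p - q)) <= Bz * (abs (P p))"
  proof (cases "p : K")
  case True
  have "P p * (LBINT q. z q * ka (p - q)) <= (abs (P p)) * (LBINT q. z q * ka (p - q))"
  using 2 by (intro mult_right_mono) auto
  also have "... <= (abs (P p)) * Bz" using Bz[OF n(1) True] by (intro mult_left_mono) (auto simp: ka_def)
  finally show ?thesis unfolding 1 by (simp add: mult.commute)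
  qed (use P0 in simp)
  qed
  finally show ?thesis by (simp add: I_def P_def)
  qed
  moreover have "(LBINT w. f1 w + f2 w - f3 w - f4 w + f5 w + f6 w) =
  (LBINT w. f1 w) + (LBINT w. f2 w) - (LBINT w. f3 w) - (LBINT w. f4 w) + (LBINT w. f5 w) + (LBINT w. f6 w)"
  using i by simp
  ultimately show ?thesis using 0 unfolding eq e by linarith
 qed
 have bt: "bdb (%p. th p * Xe p)" "bdb (%p. th p * x p)" by (intro bdb_mult bth bd)+
 have t0: "th p * Xe p = 0" "th p * x p = 0" if "p ~: K" for p using K(2)[OF that] by auto
 have l: "a1 ~~> (LBINT p. (th p * Xe p) * z p)" "a2 ~~> (LBINT p. (th p * x p) * Ze p)"
  "a3 ~~> (LBINT p. (th p * Xe p) * z (p - s))" "a4 ~~> (LBINT p. (th p * x p) * Ze (p - s))"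
  unfolding a1_def[abs_def] a2_def[abs_def] a3_def[abs_def] a4_def[abs_def]
  using moll_limit[OF bt(1) K(1) t0(1) bd(2)] moll_limit[OF bt(2) K(1) t0(2) bd(4)]
  moll_shift_limit[OF bt(1) K(1) t0(1) bd(2)] moll_shift_limit[OF bt(2) K(1) t0(2) bd(4)] by auto
 have "0 <= Bz * I + (LBINT p. (th p * Xe p) * z p) - (LBINT p. (th p * x p) * Ze p)
  - (LBINT p. (th p * Xe p) * z (p - s)) + (LBINT p. (th p * x p) * Ze (p - s)) + Bf"
  by (rule LIMSEQ_le_const[where X = "%n. Bz * I + a1 n - a2 n - a3 n + a4 n + Bf"])
  (intro tendsto_intros l, use main in \<open>auto intro!: exI[of _ "max N0 N1"]\<close>)
 moreover have bs: "bdb (%p. z (p - s))" "bdb (%p. Ze (p - s))"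
  by (rule bdb_comp[OF bd(2)], simp) (rule bdb_comp[OF bd(4)], simp)
 have i: "integ (%p. (th p * Xe p) * z p)" "integ (%p. (th p * x p) * Ze p)"
  "integ (%p. (th p * Xe p) * z (p - s))" "integ (%p. (th p * x p) * Ze (p - s))"
  using bdb_integrable[OF bdb_mult[OF bt(1) bd(2)] K(1)] bdb_integrable[OF bdb_mult[OF bt(2) bd(4)] K(1)]
  bdb_integrable[OF bdb_mult[OF bt(1) bs(1)] K(1)] bdb_integrable[OF bdb_mult[OF bt(2) bs(2)] K(1)]
  by (simp_all add: K(2))
 have "(LBINT p. th p * (x p * Ze p - z p * Xe p)) = (LBINT p. (th p * x p) * Ze p - (th p * Xe p) * z p)"
  "(LBINT p. th p * (x p * Ze (p - s) - z (p - s) * Xe p)) = (LBINT p. (th p * x p) * Ze (p - s) - (th p * Xe p) * z (p - s))"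
  by (simp_all add: algebra_simps)
 then have "(LBINT p. th p * (x p * Ze p - z p * Xe p)) = (LBINT p. (th p * x p) * Ze p) - (LBINT p. (th p * Xe p) * z p)"
  "(LBINT p. th p * (x p * Ze (p - s) - z (p - s) * Xe p)) = (LBINT p. (th p * x p) * Ze (p - s)) - (LBINT p. (th p * Xe p) * z (p - s))"
  using i by simp_all
 ultimately show ?thesis unfolding I_def XX_def s_def by linarith
qed

section \<open>Monotonicity of mass\<close>

lemma cumulative_derivative:
 fixes k :: "real => real"
 assumes k: "contU k" "!!t. t ~: {a..b} ==> k t = 0" and ab: "a <= b"
 defines "F == %t. integral {a - 1..t} k"
 shows "(F has_derivative (%v. k t * v)) (at t)" "t <= a ==> F t = 0" "t \<ge> b ==> F t = (LBINT s. k s)"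
proof -
 have kc: "continuous_on S k" for S using k(1) continuous_on_subset by blast
 show z: "F t = 0" if "t <= a" for t
 proof -
  have "k s = 0" if "s < a" for s using k(2)[of s] that by auto
  moreover have "k a = 0"
  proof -
  have "(k \<longlongrightarrow> k a) (at_left a)"
  using k(1) by (meson UNIV_I continuous_on_def filterlim_at_split isCont_def continuous_on_eq_continuous_at open_UNIV)
  moreover have "eventually (%s. k s = 0) (at_left a)"
  using \<open>!!s. s < a ==> k s = 0\<close> by (auto simp: eventually_at_filter)
  ultimately show ?thesis
  by (metis tendsto_eventually tendsto_unique trivial_limit_at_left_real)
  qed
  ultimately have "k s = 0" if "s : {a - 1..t}" for s
  using that \<open>t <= a\<close> by (cases "s = a") auto
  then have "integral {a - 1..t} k = integral {a - 1..t} (%_. 0)"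
  by (rule Henstock_Kurzweil_Integration.integral_cong)
  then show ?thesis unfolding F_def by simp
 qed
 show "(F has_derivative (%v. k t * v)) (at t)" for t
 proof (cases "t < a")
  case True
  have "k t = 0" using k(2)[of t] True by auto
  moreover have "((%t. 0) has_derivative (%v. 0)) (at t)" by simp
  then have "(F has_derivative (%v. 0)) (at t)"
  by (rule has_derivative_transform_within_open[of _ _ _ _ "{..<a}"]) (use z True in auto)
  ultimately show ?thesis by simp
 next
  case False
  have "(F has_vector_derivative k t) (at t within {a - 1..t + 1})"
  unfolding F_def by (rule integral_has_vector_derivative[OF kc]) (use False in auto)
  then have "(F has_vector_derivative k t) (at t)"
  by (subst (asm) at_within_Icc_at) (use False in auto)
  then show ?thesis by (simp add: has_vector_derivative_def mult.commute)
 qed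
 show "F t = (LBINT s. k s)" if t: "t \<ge> b" for t
 proof -
  have "(LBINT s. k s) = (LINT s:{a - 1..t}|lborel. k s)"
  unfolding set_lebesgue_integral_def
  proof (rule B_cong[OF refl])
  show "k s = ind {a - 1..t} s *R k s" for s
  using k(2)[of s] t by (cases "s : {a..b}") (auto simp: indicator_def)
  qed
  also have "... = integral {a - 1..t} k"
  by (intro set_borel_integral_eq_integral borel_integrable_atLeastAtMost')
  (rule kc)
  finally show ?thesis by (simp add: F_def)
 qed
qed

text \<open>Test with the indicator \<open>G\<close> of the part of a compact interval where
  \<open>m > c\<close>: in the limit the integral of \<open>G * (m - c)\<close> is at most 0
  although the integrand is nonnegative.\<close>

lemma AE_le_of_moll:
 fixes m :: "real => real"
 assumes m: "bdb m" and H: "!!n t0. s < t0 - 1 / Suc n ==> t0 + 1 / Suc n < T ==> (LBINT q. m q * moll n (t0 - q)) <= c"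
 shows "AE t in lborel. s < t & t < T --> m t <= c"
proof -
 note [measurable] = bdb_measurable[OF m]
 have "AE t in lborel. a <= t & t <= b --> m t <= c" if ab: "s < a" "b < T" for a b
 proof -
  define G :: "real => real" where "G t = ind {a..b} t * ind {t. m t > c} t" for t
  have G: "bdb G" unfolding G_def[abs_def]
  by (rule bdbI[where C = 1]) (auto simp: indicator_def)
  have G0: "G t = 0" if "t ~: {a..b}" for t using that by (simp add: G_def)
  have lim: "(%n. LBINT p. LBINT q. G p * m q * moll n (p - q)) ~~> (LBINT p. G p * m p)"
  by (rule moll_limit[OF G, of "{a..b}"]) (use G0 m in auto)
  obtain N where N: "!!n. n \<ge> N ==> 1 / real (Suc n) < min (a - s) (T - b)"
  using Suc_inverse_small[of "min (a - s) (T - b)"] ab by auto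
  have iG: "integ G" by (rule bdb_integrable[OF G, of "{a..b}"]) (use G0 in auto)
  have "(LBINT p. LBINT q. G p * m q * moll n (p - q)) <= (LBINT p. G p * c)" if n: "n \<ge> N" for n
  proof (rule integral_mono)
  have "integ (%p. LBINT q. G p * (%w. m (snd w)) (p, q) * moll n (p - q))"
  proof (rule kernel_fubini(4)[where K = "{a..b}" and S = "cball 0 1"])
  show "moll n w = 0" if "w ~: cball 0 1" for w :: real by (rule moll_eq_0_1[OF that])
  qed (use G G0 test1_bdb(1)[OF moll_test1] bdb_snd[OF m] in simp_all)
  then show "integ (%p. LBINT q. G p * m q * moll n (p - q))" by simp
  show "integ (%p. G p * c)" using iG by auto
  fix p
  have "(LBINT q. G p * m q * moll n (p - q)) = G p * (LBINT q. m q * moll n (p - q))"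
  by (simp add: mult.assoc)
  also have "... <= G p * c"
  proof (cases "p : {a..b}")
  case True
  have "(LBINT q. m q * moll n (p - q)) <= c"
  by (rule H) (use True N[OF n] in auto)
  then show ?thesis by (intro mult_left_mono) (auto simp: G_def)
  qed (simp add: G0)
  finally show "(LBINT q. G p * m q * moll n (p - q)) <= G p * c" .
  qed
  then have "(LBINT p. G p * m p) <= (LBINT p. G p * c)"
  by (intro LIMSEQ_le_const2[OF lim]) blast
  moreover have iGm: "integ (%p. G p * m p)"
  by (rule bdb_integrable[OF bdb_mult[OF G m], of "{a..b}"]) (auto simp: G0)
  ultimately have "(LBINT p. G p * (m p - c)) <= 0"
  using iG by (simp add: right_diff_distrib)
  moreover have nn: "0 <= G p * (m p - c)" for p by (auto simp: G_def indicator_def)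
  moreover have "0 <= (LBINT p. G p * (m p - c))"
  by (rule B_nonneg) (rule nn)
  ultimately have "(LBINT p. G p * (m p - c)) = 0" by linarith
  moreover have "integ (%p. G p * (m p - c))"
  using iG iGm by (simp add: right_diff_distrib)
  ultimately have "AE p in lborel. G p * (m p - c) = 0"
  by (subst (asm) integral_nonneg_eq_0_iff_AE) (use nn in auto)
  then show ?thesis by eventually_elim (auto simp: G_def indicator_def split: if_splits)
 qed
 then have "AE t in lborel. \<forall>j::nat. s + 1 / Suc j <= t & t <= T - 1 / Suc j --> m t <= c"
  by (subst AE_all_countable) simp
 then show ?thesis
 proof eventually_elim
  case (elim t)
  show ?case
  proof (intro impI)
  assume t: "s < t & t < T"
  then obtain j where "1 / real (Suc j) < min (t - s) (T - t)"
  using nat_approx_posE[of "min (t - s) (T - t)"] by auto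
  then have "s + 1 / real (Suc j) <= t & t <= T - 1 / real (Suc j)" by auto
  then show "m t <= c" using elim by blast
  qed
 qed
qed

text \<open>The hypothesis says that \<open>m\<close> is non-increasing as a distribution. The test
  function is the primitive of \<open>k1 - k2\<close>, with \<open>k1\<close> a probability density
  on \<open>[s1, s2]\<close> and \<open>k2\<close> a mollifier about a later time. It is nonnegative
  with compact support because the mass of \<open>k1\<close> comes first, and it yields that the
  mean of \<open>m\<close> against \<open>k2\<close> is at most the one against
  \<open>k1\<close>.\<close>

lemma decreasing_average:
 fixes m :: "real => real"
 assumes m: "bdb m" "!!t. 0 <= m t" and s: "0 < s1" "s1 < s2"
  and H: "!!th g. test1 {0<..<T} th g ==> (!!t. 0 <= th t) ==> 0 <= (LBINT t. m t * g t)"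
 shows "AE t in lborel. s2 < t & t < T --> m t <= 2 / (s2 - s1) * (LBINT t. ind {s1..s2} t * m t)"
proof (rule AE_le_of_moll[OF m(1)])
 fix n and t0 :: real
 assume t0: "s2 < t0 - 1 / Suc n" "t0 + 1 / Suc n < T"
 define e where "e = 1 / real (Suc n)"
 have e: "e > 0" by (simp add: e_def)
 have t0': "s2 < t0 - e" "t0 + e < T" using t0 by (simp_all add: e_def)
 define c where "c = (s1 + s2) / 2"
 define r where "r = (s2 - s1) / 2"
 have r: "r > 0" using s by (simp add: r_def)
 define ze where "ze t = max 0 (1 - ((t - c) / r)\<^sup>2)" for t
 have ze0: "ze t = 0" if "t ~: {s1..s2}" for t
 proof -
  have "r <= (abs (t - c))" using that by (auto simp: r_def c_def abs_if field_simps)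
  then have "1 <= (abs ((t - c) / r))" using r by simp
  then have "1 <= ((t - c) / r)\<^sup>2" by (metis one_le_power power2_abs)
  then show ?thesis by (simp add: ze_def)
 qed
 have zein: "ze t = 1 - ((t - c) / r)\<^sup>2" if "t : {s1..s2}" for t
 proof -
  have "(abs (t - c)) <= r" using that by (auto simp: r_def c_def abs_if field_simps)
  then have "(abs ((t - c) / r)) <= 1" using r by simp
  then have "((t - c) / r)\<^sup>2 <= 1" by (metis abs_square_le_1 )
  then show ?thesis by (simp add: ze_def)
 qed
 have zec: "contU ze" unfolding ze_def[abs_def] using r by (intro continuous_intros) auto
 have zeb: "0 <= ze t" "ze t <= 1" for t by (auto simp: ze_def)
 have ize: "integ ze"
  by (rule integrable_compact_support[OF zec, of "{s1..s2}"]) (use ze0 in auto)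
 have Ize: "(LBINT t. ze t) = 4 * r / 3"
 proof -
  define P where "P t = t - r / 3 * ((t - c) / r) ^ 3" for t
  have "(LBINT t. ze t) = (LBINT t. ind {s1..s2} t *R (1 - ((t - c) / r)\<^sup>2))"
  using ze0 zein by (intro B_cong) (auto simp: indicator_def)
  also have "... = P s2 - P s1"
  proof (rule integral_FTC_Icc)
  show "(P has_vector_derivative 1 - ((t - c) / r)\<^sup>2) (at t within {s1..s2})" for t
  unfolding has_real_derivative_iff_has_vector_derivative[symmetric] P_def[abs_def]
  using r by (auto intro!: derivative_eq_intros simp: power2_eq_square)
  qed (use s r in "auto intro!: continuous_intros")
  also have "(s2 - c) / r = 1" "(s1 - c) / r = -1" using s by (auto simp: c_def r_def field_simps)
  then have "P s2 - P s1 = (s2 - s1) - 2 * r / 3" unfolding P_def by simp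
  also have "s2 - s1 = 2 * r" by (simp add: r_def)
  also have "2 * r - 2 * r / 3 = 4 * r / 3" by simp
  finally show ?thesis .
 qed
 \<comment> \<open>The integral of the parabola \<open>ze\<close>, which is continuous and so has a
   C1 primitive. It equals 2 (s2 - s1) / 3, and 1 / J = 3 / (2 (s2 - s1)) is rounded up to the
   constant 2 / (s2 - s1) of the claim.\<close>
 define J where "J = 4 * r / 3"
 have J: "J > 0" "J \<ge> (s2 - s1) / 2" using r by (auto simp: J_def r_def)
 define k1 where "k1 t = ze t / J" for t
 define k2 where "k2 t = moll n (t0 - t)" for t :: real
 have k1: "contU k1" "!!t. t ~: {s1..s2} ==> k1 t = 0" "(LBINT t. k1 t) = 1"
  unfolding k1_def using zec ze0 Ize J by (auto intro!: continuous_intros simp: J_def)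
 have k2: "contU k2" "!!t. t ~: {t0 - e..t0 + e} ==> k2 t = 0" "(LBINT t. k2 t) = 1" "!!t. 0 <= k2 t"
 proof -
  show "contU k2" unfolding k2_def
  by (rule continuous_on_compose2[OF test1_cont(1)[OF moll_test1]]) (auto intro!: continuous_intros)
  show "k2 t = 0" if "t ~: {t0 - e..t0 + e}" for t
  unfolding k2_def using that by (intro moll_eq_0) (auto simp: e_def abs_if)
  show "(LBINT t. k2 t) = 1" unfolding k2_def by (rule moll_integral_reflect)
 qed (simp add: k2_def moll_nonneg)
 define Z where "Z t = integral {s1 - 1..t} k1" for t
 define M where "M t = integral {t0 - e - 1..t} k2" for t
 have s12: "s1 <= s2" "t0 - e <= t0 + e" using s e by auto
 note Z = cumulative_derivative[OF k1(1,2) s12(1), folded Z_def]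
 note M = cumulative_derivative[OF k2(1,2) s12(2), folded M_def]
 have Zn: "0 <= Z t" for t unfolding Z_def
  using zeb J by (intro Henstock_Kurzweil_Integration.integral_nonneg integrable_continuous_real continuous_on_subset[OF k1(1)]) (auto simp: k1_def)
 have M1: "M t <= 1" for t
 proof -
  have "M t <= M (max t (t0 + e))" unfolding M_def
  by (intro integral_subset_le integrable_continuous_real continuous_on_subset[OF k2(1)]) (auto simp: k2(4))
  also have "... = 1" using M(3)[of "max t (t0 + e)"] k2(3) by simp
  finally show ?thesis .
 qed
 define th where "th t = Z t - M t" for t
 define g where "g t = k1 t - k2 t" for t
 have "test1 {0<..<T} th g"
  unfolding test1_def
 proof (intro conjI allI exI impI)
  show "(th has_derivative (%v. g t \<bullet> v)) (at t)" for t
  unfolding th_def g_def using has_derivative_diff[OF Z(1) M(1)] by (simp add: left_diff_distrib)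
  show "contU g" unfolding g_def by (intro continuous_intros k1 k2)
  show "compact {s1..t0 + e}" by simp
  show "{s1..t0 + e} \<subseteq> {0<..<T}" using s t0 by (auto simp: e_def)
  show "th t = 0" if "t ~: {s1..t0 + e}" for t
  proof (cases "t < s1")
  case True
  then show ?thesis using Z(2)[of t] M(2)[of t] t0 s by (simp add: th_def e_def)
  next
  case False
  then have "t \<ge> t0 + e" using that by auto
  moreover then have "t \<ge> s2" using t0' e by linarith
  ultimately show ?thesis using Z(3)[of t] M(3)[of t] k1(3) k2(3) by (simp add: th_def)
  qed
 qed
 moreover have "0 <= th t" for t
 proof (cases "t <= t0 - e")
  case True
  then show ?thesis using M(2)[of t] Zn[of t] by (simp add: th_def)
 next
  case False
  then have "t \<ge> s2" using t0 by (simp add: e_def)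
  then show ?thesis using Z(3)[of t] k1(3) M1[of t] by (simp add: th_def)
 qed
 ultimately have 0: "0 <= (LBINT t. m t * g t)" by (rule H)
 note [measurable] = bdb_measurable[OF m(1)]
 obtain C where C: "!!t. (abs (m t)) <= C" using bdb_abs_bound[OF m(1)] by metis
 have i1: "integ (%t. m t * k1 t)" and i2: "integ (%t. m t * k2 t)"
 proof -
  have a: "integ k1" using ize by (simp add: k1_def[abs_def])
  have b: "integ k2"
  by (rule integrable_compact_support[OF k2(1), of "{t0 - e..t0 + e}"]) (use k2(2) in auto)
  show "integ (%t. m t * k1 t)" "integ (%t. m t * k2 t)"
  using integrable_mult_bounded[OF a, of m C] integrable_mult_bounded[OF b, of m C] C by (simp_all add: mult.commute)
 qed
 have "(LBINT t. m t * moll n (t0 - t)) <= (LBINT t. m t * k1 t)"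
  using 0 i1 i2 by (simp add: g_def k2_def right_diff_distrib)
 also have "... <= (LBINT t. 1 / J * (ind {s1..s2} t * m t))"
 proof (rule integral_mono[OF i1])
  have "integ (%t. ind {s1..s2} t * m t)"
  using integrable_mult_bounded[of lborel "ind {s1..s2}" m C] C
  bdb_integrable[OF bdb_indicator[of "{s1..s2}"], of "{s1..s2}"] by simp
  then show "integ (%t. 1 / J * (ind {s1..s2} t * m t))" by auto
  show "m t * k1 t <= 1 / J * (ind {s1..s2} t * m t)" for t
  using ze0[of t] mult_left_mono[OF zeb(2)[of t] m(2)[of t]] J(1)
  by (cases "t : {s1..s2}") (auto simp: k1_def divide_right_mono)
 qed
 also have "... = 1 / J * (LBINT t. ind {s1..s2} t * m t)" by simp
 also have "... <= 2 / (s2 - s1) * (LBINT t. ind {s1..s2} t * m t)"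
 proof (rule mult_right_mono)
  show "1 / J <= 2 / (s2 - s1)" using J s by (simp add: field_simps)
  show "0 <= (LBINT t. ind {s1..s2} t * m t)"
  using m(2) by (intro B_nonneg) simp
 qed
 finally show "(LBINT q. m q * moll n (t0 - q)) <= 2 / (s2 - s1) * (LBINT t. ind {s1..s2} t * m t)" .
qed

text \<open>Squaring the positive part makes the function C1 across the sphere of radius R, with a
  gradient given by a closed formula and bounded by 4 / R.\<close>

definition cutoff :: "real => 'b::euclidean_space => real" where
 "cutoff R y = (max 0 (1 - (y \<bullet> y) / R\<^sup>2))\<^sup>2"

definition cutoff_grad :: "real => 'b::euclidean_space => 'b" where
 "cutoff_grad R y = (- (4 * max 0 (1 - (y \<bullet> y) / R\<^sup>2)) / R\<^sup>2) *R y"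

lemma pos_part_sq_derivative: "((%s::real. (max 0 s)\<^sup>2) has_real_derivative 2 * max 0 s) (at s)"
proof -
 consider "s > 0" | "s < 0" | "s = 0" by linarith
 then show ?thesis
 proof cases
  case 1
  have "((%s::real. s\<^sup>2) has_real_derivative 2 * max 0 s) (at s)"
  using 1 by (auto intro!: derivative_eq_intros)
  then show ?thesis
  by (rule has_field_derivative_transform_within_open[where S = "{0<..}"]) (use 1 in auto)
 next
  case 2
  have "((%s::real. 0) has_real_derivative 2 * max 0 s) (at s)"
  using 2 by auto
  then show ?thesis
  by (rule has_field_derivative_transform_within_open[where S = "{..<0}"]) (use 2 in auto)
 next
  case 3
  have "((%h::real. max 0 h) \<longlongrightarrow> max 0 0) (at 0)" by (intro tendsto_intros)
  then have "((%h::real. max 0 h) \<longlongrightarrow> 0) (at 0)" by simp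
  then have "((%h::real. (max 0 (0 + h))\<^sup>2 / h) \<longlongrightarrow> 0) (at 0)"
  by (rule Lim_transform_eventually) (auto simp: eventually_at_filter power2_eq_square max_def)
  then show ?thesis unfolding 3 DERIV_def by simp
 qed
qed

lemma cutoff_test1:
 fixes y :: "'b::euclidean_space"
 assumes R: "R > 0"
 shows "test1 UNIV (cutoff R :: 'b => real) (cutoff_grad R)"
  "0 <= cutoff R y" "cutoff R y <= 1" "norm (cutoff_grad R y) <= 4 / R" "norm y \<ge> R ==> cutoff R y = 0"
proof -
 have out: "max 0 (1 - (y \<bullet> y) / R\<^sup>2) = 0" if "norm y \<ge> R" for y :: 'b
  using power_mono[OF that, of 2] R by (simp add: power2_norm_eq_inner)
 show "cutoff R y = 0" if "norm y \<ge> R" using out[OF that] by (simp add: cutoff_def)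
 have z: "cutoff R y = 0" if "y ~: cball 0 R" for y :: 'b using that out[of y] by (simp add: cutoff_def)
 show "0 <= cutoff R y" by (simp add: cutoff_def)
 have l: "0 <= max 0 (1 - (y \<bullet> y) / R\<^sup>2)" "max 0 (1 - (y \<bullet> y) / R\<^sup>2) <= 1" for y :: 'b using R by auto
 show "cutoff R y <= 1" unfolding cutoff_def using power_mono[OF l(2)[of y] l(1)[of y], of 2] by simp
 show "norm (cutoff_grad R y) <= 4 / R"
 proof (cases "norm y \<ge> R")
  case True
  then show ?thesis using out[OF True] R by (simp add: cutoff_grad_def)
 next
  case False
  have "norm (cutoff_grad R y) = 4 * max 0 (1 - (y \<bullet> y) / R\<^sup>2) / R\<^sup>2 * norm y"
  using l(1)[of y] by (simp add: cutoff_grad_def abs_mult)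
  also have "... <= 4 * 1 / R\<^sup>2 * R"
  using l[of y] False R by (intro mult_mono divide_right_mono) auto
  also have "... = 4 / R" using R by (simp add: power2_eq_square)
  finally show ?thesis .
 qed
 show "test1 UNIV (cutoff R) (cutoff_grad R :: 'b => 'b)"
  unfolding test1_def
 proof (intro conjI allI exI impI)
  fix y :: 'b
  have 1: "((%y. 1 - (y \<bullet> y) / R\<^sup>2) has_derivative (%v. - (2 * (y \<bullet> v) / R\<^sup>2))) (at y)"
  using R by (auto intro!: derivative_eq_intros simp: inner_commute field_simps)
  have 2: "((%s::real. (max 0 s)\<^sup>2) has_derivative (%v. v * (2 * max 0 (1 - (y \<bullet> y) / R\<^sup>2)))) (at (1 - (y \<bullet> y) / R\<^sup>2))"
  using pos_part_sq_derivative by (simp add: has_field_derivative_def mult_commute_abs)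
  show "(cutoff R has_derivative (%v. cutoff_grad R y \<bullet> v)) (at y)"
  using has_derivative_compose[OF 1 2] unfolding cutoff_def[abs_def] cutoff_grad_def
  by (rule has_derivative_eq_rhs) (auto simp: algebra_simps)
  show "contU (cutoff_grad R :: 'b => 'b)"
  unfolding cutoff_grad_def[abs_def] using R by (intro continuous_intros) auto
  show "compact (cball 0 R :: 'b set)" by simp
  show "cutoff R y = 0" if "y ~: cball 0 R" for y :: 'b using z[OF that] .
 qed simp
qed

lemma cutoff_tendsto: "(%n. cutoff (real (Suc n)) y) ~~> 1"
proof -
 have "(%n. (max 0 (1 - (y \<bullet> y) * (1 / real (Suc n)) ^ 2))\<^sup>2) ~~> (max 0 (1 - (y \<bullet> y) * 0 ^ 2))\<^sup>2"
  using LIMSEQ_inverse_real_of_nat by (intro tendsto_intros) (simp add: inverse_eq_divide)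
 then show ?thesis by (simp add: cutoff_def power_divide)
qed

lemma test1_time_space:
 fixes S :: "'a::euclidean_space set" and om :: "'b::euclidean_space => real"
 assumes t: "test1 S th g" and k: "test1 UNIV om h"
 shows "test1 (S \<times> UNIV) (%p. th (fst p) * om (snd p)) (%p. (om (snd p) *R g (fst p), th (fst p) *R h (snd p)))"
 unfolding test1_def
proof (intro conjI allI)
 fix p :: "'a \<times> 'b"
 have 1: "((%p. th (fst p)) has_derivative (%v. g (fst p) \<bullet> fst v)) (at p)"
  using has_derivative_compose[OF has_derivative_fst[OF has_derivative_ident] test1_deriv[OF t]] .
 have 2: "((%p. om (snd p)) has_derivative (%v. h (snd p) \<bullet> snd v)) (at p)"
  using has_derivative_compose[OF has_derivative_snd[OF has_derivative_ident] test1_deriv[OF k]] .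
 show "((%p. th (fst p) * om (snd p)) has_derivative (%v. (om (snd p) *R g (fst p), th (fst p) *R h (snd p)) \<bullet> v)) (at p)"
  by (rule has_derivative_eq_rhs[OF has_derivative_mult[OF 1 2]]) (auto simp: inner_prod_def algebra_simps)
 have c: "contU (%p. th (fst p))" "contU (%p. g (fst p))"
  "contU (%p. om (snd p))" "contU (%p. h (snd p))"
  by (rule continuous_on_compose2[OF test1_cont(1)[OF t]] continuous_on_compose2[OF test1_cont(2)[OF t]]
  continuous_on_compose2[OF test1_cont(1)[OF k]] continuous_on_compose2[OF test1_cont(2)[OF k]];
  auto intro: continuous_on_fst continuous_on_snd continuous_on_id)+
 show "contU (%p. (om (snd p) *R g (fst p), th (fst p) *R h (snd p)))"
  by (intro continuous_on_Pair continuous_on_scaleR c)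
 obtain K L where "compact K" "K \<subseteq> S" "!!p. p ~: K ==> th p = 0" "compact L" "!!p. p ~: L ==> om p = 0"
  using test1D[OF t] test1D[OF k] by metis
 then show "EX K. compact K & K \<subseteq> S \<times> UNIV & (ALL p. p ~: K --> th (fst p) * om (snd p) = 0)"
  by (intro exI[of _ "K \<times> L"]) (auto intro: compact_Times)
qed

text \<open>The test function is localised in space by \<open>cutoff R\<close>. The flux is
  dominated by a multiple of the integrable density \<open>x\<close>, so its contribution is O(1/R),
  and only the time derivative survives as R grows.\<close>

lemma mass_inequality:
 fixes x :: "real \<times> 'b::euclidean_space => real" and Y :: "real \<times> 'b => 'b"
 assumes bd: "bdb x" "bdb Y" and X: "nonpos_div (S \<times> UNIV) (%p. (x p, Y p))"
  and x: "!!p. 0 <= x p" and Y: "!!p. norm (Y p) <= C * x p"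
  and t: "test1 S th g" "!!s. 0 <= th s"
  and K: "!!s. s ~: K ==> th s = 0" "!!s. s ~: K ==> g s = 0"
  and int: "integ (%p. ind (K \<times> UNIV) p * x p)"
 shows "integ (%p. x p * g (fst p))" "0 <= (LBINT p. x p * g (fst p))"
proof -
 note [measurable] = bdb_measurable[OF bd(1)] bdb_measurable[OF bd(2)]
 note bt = test1_bdb[OF t(1)]
 obtain D where D: "D > 0" "!!s. (abs (th s)) <= D" "!!s. (abs (g s)) <= D" using test1_bounded[OF t(1)] by auto
 define x' where "x' p = ind (K \<times> UNIV) p * x p" for p
 have x': "integ x'" using int by (simp add: x'_def[abs_def])
 have eq: "x p * g (fst p) = x' p * g (fst p)" for p using K by (cases "fst p : K") (auto simp: x'_def indicator_def mem_Times_iff)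
 have mg: "(%p. g (fst p)) : borel_measurable (borel :: (real \<times> 'b) measure)"
  "(%p. th (fst p)) : borel_measurable (borel :: (real \<times> 'b) measure)"
  using bdb_measurable[OF bdb_fst[OF bt(2)]] bdb_measurable[OF bdb_fst[OF bt(1)]] by auto
 show i: "integ (%p. x p * g (fst p))"
  unfolding eq using integrable_mult_bounded[OF x', of "%p. g (fst p)" D] D(3) mg by simp
 define om where "om n = (cutoff (real (Suc n)) :: 'b => real)" for n
 define om' where "om' n = (cutoff_grad (real (Suc n)) :: 'b => 'b)" for n
 have T: "test1 UNIV (om n) (om' n)" for n unfolding om_def om'_def by (rule cutoff_test1) simp
 have bm: "bdb (%p::real \<times> 'b. om n (snd p))" "bdb (%p::real \<times> 'b. om' n (snd p))" for n
  by (intro bdb_snd test1_bdb[OF T])+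
 have ob: "0 <= om n y" "om n y <= 1" for n y
  unfolding om_def by (rule cutoff_test1; simp)+
 note mk = bdb_measurable[OF bm(1)] bdb_measurable[OF bm(2)]
 have nn: "0 <= (LBINT p. om n (snd p) * (x p * g (fst p))) + (LBINT p. x' p) * (C * D * 4 / real (Suc n))" for n
 proof -
  have i1: "integ (%p. om n (snd p) * (x p * g (fst p)))"
  using integrable_mult_bounded[OF i, of "%p. om n (snd p)" 1] mk(1) ob by (simp add: mult.commute)
  have b2: "(abs (th (fst p) * (Y p \<bullet> om' n (snd p)))) <= x' p * (C * D * 4 / real (Suc n))" for p
  proof (cases "fst p : K")
  case True
  have Cx: "0 <= C * x p" using Y[of p] norm_ge_zero order_trans by blast
  have "(abs (Y p \<bullet> om' n (snd p))) <= norm (Y p) * norm (om' n (snd p))" by (rule Cauchy_Schwarz_ineq2)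
  also have "... <= (C * x p) * (4 / real (Suc n))"
  by (rule mult_mono[OF Y _ Cx norm_ge_zero]) (simp only: om'_def, rule cutoff_test1(4), simp)
  finally have "(abs (th (fst p))) * (abs (Y p \<bullet> om' n (snd p))) <= D * ((C * x p) * (4 / real (Suc n)))"
  using D by (intro mult_mono) auto
  then show ?thesis using True by (simp add: abs_mult x'_def indicator_def mem_Times_iff algebra_simps)
  next
  case False
  then show ?thesis using K by (simp add: x'_def indicator_def mem_Times_iff)
  qed
  have ix: "integ (%p. x' p * (C * D * 4 / real (Suc n)))" using x' by (intro integrable_mult_left) 
  have m2: "(%p. th (fst p) * (Y p \<bullet> om' n (snd p))) : lmeas"
  using bdb_measurable[OF bdb_mult[OF bdb_fst[OF bt(1)] bdb_inner[OF bd(2) bm(2)]]] by simp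
  have i2: "integ (%p. th (fst p) * (Y p \<bullet> om' n (snd p)))"
  proof (rule B_ibound[OF ix m2], rule AE_I2)
  show "norm (th (fst p) * (Y p \<bullet> om' n (snd p))) <= norm (x' p * (C * D * 4 / real (Suc n)))" for p
  unfolding real_norm_def by (rule order_trans[OF b2 abs_ge_self])
  qed
  have "0 <= (LBINT p. (x p, Y p) \<bullet> (om n (snd p) *R g (fst p), th (fst p) *R om' n (snd p)))"
  by (rule nonpos_divD[OF X test1_time_space[OF t(1) T]])
  (intro mult_nonneg_nonneg t(2) ob)
  also have "... = (LBINT p. om n (snd p) * (x p * g (fst p)) + th (fst p) * (Y p \<bullet> om' n (snd p)))"
  by (intro B_cong) (auto simp: inner_prod_def)
  also have "... = (LBINT p. om n (snd p) * (x p * g (fst p))) + (LBINT p. th (fst p) * (Y p \<bullet> om' n (snd p)))"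
  using i1 i2 by simp
  also have "(LBINT p. th (fst p) * (Y p \<bullet> om' n (snd p))) <= (LBINT p. x' p * (C * D * 4 / real (Suc n)))"
  by (rule integral_mono[OF i2 ix]) (rule order_trans[OF abs_ge_self b2])
  finally show ?thesis by simp
 qed
 have l1: "(%n. LBINT p. om n (snd p) * (x p * g (fst p))) ~~> (LBINT p. x p * g (fst p))"
 proof (rule integral_dominated_convergence[where w = "%p. (abs (x p * g (fst p)))"])
  show "AE p in lborel. (%n. om n (snd p) * (x p * g (fst p))) ~~> x p * g (fst p)"
  proof (rule AE_I2)
  fix p
  have "(%n. om n (snd p) * (x p * g (fst p))) ~~> 1 * (x p * g (fst p))"
  unfolding om_def by (intro tendsto_mult cutoff_tendsto tendsto_const)
  then show "(%n. om n (snd p) * (x p * g (fst p))) ~~> x p * g (fst p)" by simp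
  qed
  show "AE p in lborel. norm (om n (snd p) * (x p * g (fst p))) <= (abs (x p * g (fst p)))" for n
  using ob by (intro AE_I2) (simp add: abs_mult mult_left_le_one_le)
  show "(%p. om n (snd p) * (x p * g (fst p))) : lmeas" for n
  using borel_measurable_times[OF mk(1)[of n], of "%p. x p * g (fst p)"] borel_measurable_integrable[OF i] by simp
 qed (use i in "auto intro: borel_measurable_integrable")
 have l2: "(%n. (LBINT p. x' p) * (C * D * 4 * inverse (real (Suc n)))) ~~> (LBINT p. x' p) * (C * D * 4 * 0)"
  by (intro tendsto_intros LIMSEQ_inverse_real_of_nat)
 have "0 <= (LBINT p. x p * g (fst p)) + (LBINT p. x' p) * (C * D * 4 * 0)"
  by (rule LIMSEQ_le_const[OF tendsto_add[OF l1 l2]]) (use nn in "simp add: divide_inverse")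
 then show "0 <= (LBINT p. x p * g (fst p))" by simp
qed

lemma AE_fst:
 assumes "AE t in (lborel :: 'a::euclidean_space measure). P t"
 shows "AE p in (lborel :: ('a \<times> 'b::euclidean_space) measure). P (fst p)"
proof -
 obtain N where N: "{t : space lborel. ~ P t} \<subseteq> N" "N : null_sets lborel" using assms by (auto elim: AE_E simp: null_sets_def)
 have "N \<times> (UNIV :: 'b set) : null_sets (lborel \<Otimes>\<^sub>M lborel)"
  using N(2) lborel.emeasure_pair_measure_Times[of N lborel "UNIV :: 'b set"] by (auto simp: null_sets_def)
 then have "N \<times> (UNIV :: 'b set) : null_sets lborel" by (simp only: lborel_prod)
 then show ?thesis by (rule AE_I') (use N(1) in auto)
qed

lemma AE_lborel_reflect:
 fixes P :: "'a::euclidean_space => bool"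
 assumes "AE x in lborel. P x"
 shows "AE x in lborel. P (v - x)"
proof -
 have "distr lborel lborel (%x. v - x) = (lborel :: 'a measure)"
  using distr_lborel_reflect[of v] by (metis distr_cong sets_lborel)
 then have "AE x in distr lborel lborel (%x. v - x). P x"
  using assms by (metis (full_types))
 then show ?thesis by (rule AE_distrD[rotated]) auto
qed

text \<open>By \<open>mass_inequality\<close> the mass is non-increasing as a distribution in time,
  so later values are at most twice the average over the earlier interval
  \<open>[s1, s2]\<close>.\<close>

lemma mass_average:
 fixes x :: "real \<times> 'b::euclidean_space => real"
 assumes bd: "bdb x" "bdb Y" and X: "nonpos_div ({0<..} \<times> UNIV) (%p. (x p, Y p))"
  and x0: "!!p. 0 <= x p" and Yx: "!!p. norm (Y p) <= C * x p" and s: "0 < s1" "s1 < s2" "s2 < T"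
  and N: "AE t in lborel. 0 < t & t < T --> integ (%y. x (t, y)) & (LBINT y. x (t, y)) <= N"
 shows "AE t in lborel. s2 < t & t < T -->
  (LBINT y. x (t, y)) <= 2 / (s2 - s1) * (LBINT t. ind {s1..s2} t * (LBINT y. x (t, y)))"
proof -
 note [measurable] = bdb_measurable[OF bd(1), folded borel_prod]
 define m where "m t = (LBINT y. x (t, y))" for t
 have mm[measurable]: "m : bmeas" unfolding m_def[abs_def] by measurable
 have m0: "0 <= m t" for t unfolding m_def by (intro B_nonneg x0)
 define N' where "N' = max 0 N"
 \<comment> \<open>A version of \<open>m\<close> that is bounded everywhere, as
   \<open>decreasing_average\<close> expects; it agrees with \<open>m\<close> at almost every time
   in (0, T).\<close>
 define m' where "m' t = (if 0 < t & t < T then min (m t) N' else 0)" for t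
 have m'm: "AE t in lborel. 0 < t & t < T --> m' t = m t"
  using N by eventually_elim (auto simp: m'_def N'_def m_def)
 have mm': "m' : bmeas" unfolding m'_def[abs_def] by measurable
 have bm': "bdb m'"
  by (rule bdbI[OF mm', where C = N']) (use m0 in "auto simp: m'_def N'_def")
 have m'0: "0 <= m' t" for t using m0[of t] by (auto simp: m'_def N'_def)
 have "AE t in lborel. s2 < t & t < T --> m' t <= 2 / (s2 - s1) * (LBINT t. ind {s1..s2} t * m' t)"
 proof (rule decreasing_average[OF bm' m'0 s(1,2)])
  fix th g assume t: "test1 {0<..<T} th g" and pos: "!!t. 0 <= th t"
  obtain K where K: "compact K" "K \<subseteq> {0<..<T}" "!!p. p ~: K ==> th p = 0" "!!p. p ~: K ==> g p = 0"
  using test1D[OF t] by metis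
  have mK[measurable]: "K : sets borel" using K(1) by (simp add: compact_imp_closed)
  have t': "test1 {0<..} th g" by (rule test1_mono[OF t]) auto
  have ix: "integrable (lborel \<Otimes>\<^sub>M lborel) (%p. ind (K \<times> UNIV) p * x p)"
  proof (rule lborel_pair.Fubini_integrable)
  show "AE t in lborel. integ (%y. ind (K \<times> UNIV) (t, y) * x (t, y))"
  using N by eventually_elim (use K(2) in "auto simp: indicator_def subset_iff")
  have eq: "(LBINT y. norm (ind (K \<times> UNIV) (t, y) * x (t, y))) = ind K t * m t" for t
  using x0 by (simp add: m_def indicator_def)
  have "integ (%t. ind K t * m' t)"
  by (rule bdb_integrable[OF bdb_mult[OF bdb_indicator[OF K(1)] bm'] K(1)]) simp
  then show "integ (%t. LBINT y. norm (ind (K \<times> UNIV) (t, y) * x (t, y)))"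
  unfolding eq
  proof (rule integrable_cong_AE_imp)
  show "AE t in lborel. ind K t * m' t = ind K t * m t"
  using m'm by eventually_elim (use K(2) in "auto simp: indicator_def subset_iff")
  qed simp
  have "K \<times> (UNIV :: 'b set) : sets borel" by (rule borel_Times[OF mK]) simp
  then show "(%p. ind (K \<times> UNIV) p * x p) : borel_measurable (lborel \<Otimes>\<^sub>M lborel)"
  using bdb_measurable[OF bd(1)] by (simp add: lborel_prod)
  qed
  then have ix': "integ (%p. ind (K \<times> UNIV) p * x p)" by (simp add: lborel_prod)
  note mi = mass_inequality[OF bd X x0 Yx t' pos K(3,4) ix']
  have "0 <= (LBINT p. x p * g (fst p))" by (rule mi(2))
  also have "... = (LBINT t. LBINT y. x (t, y) * g t)"
  using mi(1) lborel_pair.integral_fst'[of "%p. x p * g (fst p)"] by (simp add: lborel_prod)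
  also have "... = (LBINT t. m t * g t)" by (simp add: m_def)
  also have "... = (LBINT t. m' t * g t)"
  proof (rule integral_cong_AE)
  show "AE t in lborel. m t * g t = m' t * g t"
  using m'm
  proof eventually_elim
  case (elim t)
  then show ?case using K(2) K(4)[of t] by (cases "t : K") (auto simp: subset_iff)
  qed
  show "(%t. m t * g t) : lmeas" "(%t. m' t * g t) : lmeas"
  using mm mm' test1_measurable(2)[OF t] by simp_all
  qed
  finally show "0 <= (LBINT t. m' t * g t)" .
 qed
 moreover have "(LBINT t. ind {s1..s2} t * m' t) = (LBINT t. ind {s1..s2} t * m t)"
 proof (rule integral_cong_AE)
  show "AE t in lborel. ind {s1..s2} t * m' t = ind {s1..s2} t * m t"
  using m'm by eventually_elim (use s in "auto simp: indicator_def")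
 qed (use mm mm' in simp_all)
 ultimately have "AE t in lborel. s2 < t & t < T --> m' t <= 2 / (s2 - s1) * (LBINT t. ind {s1..s2} t * m t)" by simp
 then show ?thesis using m'm unfolding m_def by eventually_elim (use s in auto)
qed

section \<open>Directional variation of the initial data\<close>

lemma kap_integral:
 assumes "0 <= h"
 shows "(LBINT w. kap n h (e::'a::euclidean_space) w) = h"
proof -
 define f where "f z = ind {0..h} (fst z) * moll n (snd z - fst z *R e)" for z :: "real \<times> 'a"
 have m: "f : bmeas"
  unfolding f_def[abs_def] borel_prod[symmetric] by measurable
 obtain M where M: "M > 0" "!!x::'a. moll n x <= M" using moll_bound by metis
 have b: "(abs (f z)) <= M" for z
  using M(1) M(2)[of "snd z - fst z *R e"] moll_nonneg[of n "snd z - fst z *R e"] by (auto simp: f_def indicator_def)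
 have "f z = 0" if "z ~: {0..h} \<times> ksupp 2 h e" for z
 proof (cases "fst z : {0..h}")
  case True
  then have s: "snd z ~: ksupp 2 h e" using that by (auto simp: mem_Times_iff)
  have "snd z - fst z *R e ~: cball 0 1"
  proof
  assume "snd z - fst z *R e : cball 0 1"
  then have "snd z - fst z *R e : cball 0 2" "fst z *R e : (%r. r *R e) ` {0..h}" using True by auto
  moreover have "snd z = (snd z - fst z *R e) + fst z *R e" by simp
  ultimately show False using s unfolding ksupp_def by blast
  qed
  from moll_eq_0_1[OF this] show ?thesis by (simp add: f_def)
 qed (simp add: f_def)
 note F = fubini_bounded_support[OF m b compact_Times[OF compact_Icc compact_ksupp] this]
 have "(LBINT w. kap n h e w) = (LBINT w. LBINT r. f (r, w))"
  by (simp add: kap_def f_def)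
 also have "... = (LBINT r. LBINT w. f (r, w))" using F(6) by simp
 also have "... = (LBINT r. ind {0..h} r * (LBINT w. moll n (w - r *R e)))" by (simp add: f_def)
 also have "(LBINT w. moll n (w - r *R e)) = 1" for r
  using lborel_integral_shift[of "moll n" "- (r *R e)"] moll_integral[of n, where 'a = 'a] by simp
 then have "(LBINT r. ind {0..h} r * (LBINT w. moll n (w - r *R e))) = h"
  using assms by simp
 finally show ?thesis .
qed

lemma kap_integrable: "integ (kap n h e)"
 by (rule test1_integrable(1)[OF kap_test1])

lemma kap_integral_reflect: "0 <= h ==> (LBINT q. kap n h e (p - q)) = h"
 using lborel_integral_reflect[OF test1_measurable(1)[OF kap_test1], of n h e p] kap_integral[of h n e] by simp

text \<open>Extends the weak bound to the C1 functions that \<open>BV_duality\<close> uses for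
  testing. The approximation by smooth functions keeps the sup bound \<open>B\<close>, hence the
  constant.\<close>

lemma BV_weak_C1:
 fixes a :: "'a::euclidean_space => real"
 assumes a: "integ a"
  and H: "!!ph B. ph : test_functions UNIV ==> (!!x. (abs (ph x)) <= B) ==> \<bar>LBINT x. a x * (\<xi> \<bullet> grad ph x)\<bar> <= C * B"
  and t: "test1 UNIV ph g" "!!x. (abs (ph x)) <= B"
 shows "\<bar>LBINT x. a x * (\<xi> \<bullet> g x)\<bar> <= C * B"
proof -
 obtain ps :: "nat => 'a => real" and K where K: "!!n. ps n : test_functions UNIV"
  "ALL B. (ALL p. (abs (ph p)) <= B) --> (ALL n p. (abs (ps n p)) <= B)"
  "compact K" "!!n p. p ~: K ==> grad (ps n) p = 0" "!!p. p ~: K ==> g p = 0"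
  "!!e. e > 0 ==> EX N. \<forall>n\<ge>N. ALL p. norm (grad (ps n) p - g p) <= e"
  using test1_approx[OF t(1) open_UNIV] by metis
 obtain D where D: "!!p. norm (g p) <= D" using test1_bounded[OF t(1)] by metis
 have [measurable]: "a : bmeas" using borel_measurable_integrable[OF a] by simp
 have mK[measurable]: "K : sets borel" using K(3) by (simp add: compact_imp_closed)
 have i: "integ (%p. ind K p *R (a p *R \<xi>))"
 proof (rule B_ibound)
  show "integ (%p. a p *R \<xi>)" using a by simp
 qed (auto simp: indicator_def)
 have "(%n. LBINT p. (a p *R \<xi>) \<bullet> grad (ps n) p) ~~> (LBINT p. (a p *R \<xi>) \<bullet> g p)"
  by (rule test1_limit[OF i K(4,5) _ _ D K(6)])
  (use test1_measurable(2)[OF test_functions_test1[OF K(1)]] test1_measurable(2)[OF t(1)] in auto)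
 then have "(%n. \<bar>LBINT p. a p * (\<xi> \<bullet> grad (ps n) p)\<bar>) ~~> \<bar>LBINT p. a p * (\<xi> \<bullet> g p)\<bar>"
  by (intro tendsto_rabs) simp
 moreover have "\<bar>LBINT p. a p * (\<xi> \<bullet> grad (ps n) p)\<bar> <= C * B" for n
  using K(2) t(2) by (intro H[OF K(1)]) blast
 ultimately show ?thesis by (intro LIMSEQ_le_const2) auto
qed

text \<open>The derivative bound is tested with the convolution of \<open>ps\<close> with the
  segment kernel. Its sup norm is at most the kernel mass \<open>h\<close>, and its derivative along
  \<open>e\<close> is a difference of two mollifications of \<open>ps\<close>, which tends to the
  increment of \<open>a\<close> under the integral.\<close>

lemma BV_duality:
 fixes a :: "'a::euclidean_space => real"
 assumes a: "integ a" "bdb a"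
  and H: "!!ph B. ph : test_functions UNIV ==> (!!x. (abs (ph x)) <= B) ==> \<bar>LBINT x. a x * (e \<bullet> grad ph x)\<bar> <= C * B"
  and h: "0 <= h" and C: "0 <= C" and ps: "bdb ps" "!!x. (abs (ps x)) <= 1" "compact K" "!!x. x ~: K ==> ps x = 0"
 shows "\<bar>LBINT x. ps x * (a x - a (x + h *R e))\<bar> <= C * h"
proof -
 have ips: "integ ps" by (rule bdb_integrable[OF ps(1,3,4)])
 have [measurable]: "ps : bmeas" using ps(1) by (rule bdb_measurable)
 have bas: "bdb (%x. a (x + h *R e))" by (rule bdb_comp[OF a(2)]) simp
 have cball_shift: "w - (- (h *R e)) : cball 0 1 \<longleftrightarrow> w : cball (- (h *R e)) 1" for w
  using norm_minus_cancel[of "w + h *R e"] by (simp add: dist_norm norm_minus_commute[of "- (h *R e)"])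
 define b1 where "b1 n = (LBINT x. LBINT y. ps x * a y * moll n (x - y))" for n
 define b2 where "b2 n = (LBINT x. LBINT y. ps x * a y * moll n (x - y - (- (h *R e))))" for n
 have l1: "b1 ~~> (LBINT x. ps x * a x)"
  unfolding b1_def[abs_def] by (rule moll_limit[OF ps(1,3,4) a(2)])
 have l2: "b2 ~~> (LBINT x. ps x * a (x - (- (h *R e))))"
  unfolding b2_def[abs_def] by (rule moll_shift_limit[OF ps(1,3,4) a(2)])
 have "(abs (b1 n - b2 n)) <= C * h" for n
 proof -
  define ph where "ph y = (LBINT x. ps x * kap n h e (y - x))" for y
  define g where "g y = (LBINT x. ps x *R kapg n h e (y - x))" for y
  have d: "(ph has_derivative (%v. g y \<bullet> v)) (at y)" for y
  unfolding ph_def[abs_def] g_def by (rule conv_gen(1)[OF ips _ kap_test1]) simp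
  have gi: "integ (%x. ps x *R kapg n h e (y - x))" for y
  by (rule conv_gen(4)[OF ips _ kap_test1]) simp
  have z: "ph y = 0" if "y ~: {x + s |x s. x : K & s : ksupp 2 h e}" for y
  proof -
  have "ps x * kap n h e (y - x) = 0" for x
  proof (rule ccontr)
  assume "ps x * kap n h e (y - x) ~= 0"
  then have "x : K" "y - x : ksupp 2 h e"
  using ps(4)[of x] kap_eq_0[of n 2 "y - x" h e] by (auto simp: divide_less_eq)
  moreover have "y = x + (y - x)" by simp
  ultimately show False using that by blast
  qed
  then show ?thesis by (simp only: ph_def B_zero)
  qed
  have t: "test1 UNIV ph g"
  unfolding test1_def
  proof (intro conjI allI exI impI)
  show "(ph has_derivative (%v. g y \<bullet> v)) (at y)" for y by (rule d)
  show "contU g" unfolding g_def[abs_def] by (rule conv_gen(2)[OF ips _ kap_test1]) simp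
  show "compact {x + s |x s. x : K & s : ksupp 2 h e}" by (intro compact_sums ps(3) compact_ksupp)
  qed (use z in auto)
  have bd: "(abs (ph y)) <= h" for y
  proof -
  have ik: "integ (%x. kap n h e (y - x))" by (rule lborel_integrable_reflect[OF kap_integrable])
  have "(abs (ph y)) <= (LBINT x. kap n h e (y - x))"
  unfolding ph_def
  proof (intro order_trans[OF integral_abs_bound] integral_mono)
  show "integ (%x. (abs (ps x * kap n h e (y - x))))"
  by (intro integrable_abs conv_gen(3)[OF ips _ kap_test1]) simp
  show "(abs (ps x * kap n h e (y - x))) <= kap n h e (y - x)" for x
  using mult_right_mono[OF ps(2)[of x] kap_nonneg[of n h e "y - x"]] by (simp add: abs_mult kap_nonneg)
  qed (rule ik)
  then show ?thesis using kap_integral_reflect[OF h, of n e y] by simp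
  qed
  have "e \<bullet> g y = (LBINT x. ps x * (moll n (x - y) - moll n (x - y - (- (h *R e)))))" for y
  proof -
  have "e \<bullet> g y = (LBINT x. ps x * (e \<bullet> kapg n h e (y - x)))"
  using gi[of y] unfolding g_def by (subst inner_commute) (simp flip: integral_inner_left add: inner_commute[of e])
  moreover have "moll n (y - x) = moll n (x - y)" "moll n (y - x - h *R e) = moll n (x - y - (- (h *R e)))" for x
  using moll_minus[of n "x - y"] moll_minus[of n "x - y - (- (h *R e))"] by (simp_all add: algebra_simps)
  ultimately show ?thesis by (simp only: kapg_inner[OF h])
  qed
  then have "(LBINT y. a y * (e \<bullet> g y)) = (LBINT y. LBINT x. ps x * a y * (moll n (x - y) - moll n (x - y - (- (h *R e)))))"
  by (simp add: algebra_simps del: minus_diff_eq flip: integral_mult_right_zero)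
  also have "... = (LBINT z. ps (fst z) * a (snd z) * (moll n (fst z - snd z) - moll n (fst z - snd z - (- (h *R e)))))"
  proof -
  have bm: "bdb (%w::'a. moll n w - moll n (w - (- (h *R e))))"
  by (intro bdb_diff test1_bdb(1)[OF moll_test1] bdb_comp[OF test1_bdb(1)[OF moll_test1]]) simp
  have c: "compact (cball 0 1 \<union> cball (- (h *R e)) 1)" by (intro compact_Un compact_cball)
  have m0: "moll n w - moll n (w - (- (h *R e))) = 0" if "w ~: cball 0 1 \<union> cball (- (h *R e)) 1" for w
  proof -
  have "w ~: cball 0 1" "w - (- (h *R e)) ~: cball 0 1"
  using that cball_shift[of w] by auto
  from moll_eq_0_1[OF this(1)] moll_eq_0_1[OF this(2)] show ?thesis by (simp only: diff_self)
  qed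
  show ?thesis using kernel_fubini(3)[OF ps(1,3,4) bm c m0 bdb_snd[OF a(2)]] by simp
  qed
  also have "... = (LBINT z. ps (fst z) * a (snd z) * moll n (fst z - snd z) - ps (fst z) * a (snd z) * moll n (fst z - snd z - (- (h *R e))))"
  by (simp add: right_diff_distrib)
  also have "... = b1 n - b2 n"
  proof -
  have m1: "moll n w = 0" if "w ~: cball 0 1" for w :: 'a using that by (rule moll_eq_0_1)
  have m2: "moll n (w - (- (h *R e))) = 0" if "w ~: cball (- (h *R e)) 1" for w
  using that cball_shift[of w] by (intro moll_eq_0_1) auto
  have bm2: "bdb (%w::'a. moll n (w - (- (h *R e))))" by (intro bdb_comp[OF test1_bdb(1)[OF moll_test1]]) simp
  note F1 = kernel_fubini[OF ps(1,3,4) test1_bdb(1)[OF moll_test1] compact_cball[of 0 1] m1 bdb_snd[OF a(2)]]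
  note F2 = kernel_fubini[OF ps(1,3,4) bm2 compact_cball[of "- (h *R e)" 1] m2 bdb_snd[OF a(2)]]
  show ?thesis using F1(1,2) F2(1,2) by (simp add: b1_def b2_def)
  qed
  finally show ?thesis using BV_weak_C1[OF a(1) H t bd] by simp
 qed
 then have "(abs ((LBINT x. ps x * a x) - (LBINT x. ps x * a (x - (- (h *R e)))))) <= C * h"
  by (intro LIMSEQ_le_const2[OF tendsto_rabs[OF tendsto_diff[OF l1 l2]]]) auto
 moreover have "integ (%x. ps x * a x)" "integ (%x. ps x * a (x + h *R e))"
  using bdb_integrable[OF bdb_mult[OF ps(1) a(2)] ps(3)] bdb_integrable[OF bdb_mult[OF ps(1) bas] ps(3)] ps(4) by auto
 ultimately show ?thesis by (simp add: right_diff_distrib)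
qed

text \<open>Duality with the sign of the increment, restricted to growing balls. For negative
  \<open>h\<close> a translation reduces the increments to those for \<open>- h\<close>.\<close>

lemma BV_translation:
 fixes a :: "'a::euclidean_space => real"
 assumes a: "integ a" "bdb a"
  and H: "!!ph B. ph : test_functions UNIV ==> (!!x. (abs (ph x)) <= B) ==> \<bar>LBINT x. a x * (e \<bullet> grad ph x)\<bar> <= C * B"
  and C: "0 <= C"
 shows "(LBINT x. (abs (a (x + h *R e) - a x))) <= C * (abs h)"
proof -
 note [measurable] = bdb_measurable[OF a(2)]
 have pos: "(LBINT x. (abs (a (x + h *R e) - a x))) <= C * h" if h: "0 <= h" for h
 proof -
  define f where "f x = (abs (a (x + h *R e) - a x))" for x
  have f: "integ f" unfolding f_def[abs_def]
  using a(1) lborel_integrable_shift[OF a(1)] by auto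
  note [measurable] = borel_measurable_integrable[OF f]
  have "(%n. LBINT x. ind (cball 0 (real n)) x * f x) ~~> (LBINT x. f x)"
  proof (rule integral_dominated_convergence[where w = "%x. (abs (f x))"])
  show "AE x in lborel. (%n. ind (cball 0 (real n)) x * f x) ~~> f x"
  proof (rule AE_I2)
  fix x :: 'a
  obtain N where "norm x <= real N" using real_arch_simple by blast
  then have "eventually (%n. ind (cball 0 (real n)) x * f x = f x) sequentially"
  by (intro eventually_sequentiallyI[of N]) (auto simp: indicator_def)
  then show "(%n. ind (cball 0 (real n)) x * f x) ~~> f x" by (rule tendsto_eventually)
  qed
  qed (use f in "auto simp: indicator_def")
  moreover have "(LBINT x. ind (cball 0 (real n)) x * f x) <= C * h" for n
  proof -
  define ps where "ps x = ind (cball 0 (real n)) x * sgn (a x - a (x + h *R e))" for x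
  have "\<bar>LBINT x. ps x * (a x - a (x + h *R e))\<bar> <= C * h"
  proof (rule BV_duality[OF a H h C, where K = "cball 0 (real n)"])
  show "bdb ps" unfolding ps_def[abs_def]
  by (rule bdbI[where C = 1]) (auto simp: indicator_def sgn_real_def)
  qed (auto simp: ps_def indicator_def sgn_real_def)
  moreover have "ps x * (a x - a (x + h *R e)) = ind (cball 0 (real n)) x * f x" for x
  by (auto simp: ps_def f_def sgn_real_def)
  ultimately show ?thesis by simp
  qed
  ultimately show ?thesis unfolding f_def by (intro LIMSEQ_le_const2) auto
 qed
 show ?thesis
 proof (cases "h \<ge> 0")
  case True
  then show ?thesis using pos[of h] by simp
 next
  case False
  have "(LBINT x. (abs (a (x + h *R e) - a x))) = (LBINT x. (abs (a ((x + (- h) *R e) + h *R e) - a (x + (- h) *R e))))"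
  by (rule lborel_integral_shift[symmetric]) measurable
  also have "... = (LBINT x. (abs (a (x + (- h) *R e) - a x)))"
  by (simp add: abs_minus_commute)
  finally show ?thesis using pos[of "- h"] False by simp
 qed
qed

text \<open>Each Jordan part has total mass at most \<open>S\<close>, since every value of the
  signed measure is bounded by the total variation; the two parts are estimated separately, whence
  the factor 2.\<close>

lemma signed_integral_bound:
 assumes tv: "total_variation \<nu> < ennreal S" and S: "0 <= S" and ph: "!!x. (abs (ph x)) <= B"
 shows "(abs (signed_integral \<nu> ph)) <= 2 * S * B"
proof -
 have B: "0 <= B" using ph[of undefined] by linarith
 have one: "ennreal (abs (\<nu> A)) <= ennreal S" if "A : sets borel" for A
 proof -
  have "(\<Sum>A\<in>{A}. ennreal (abs (\<nu> A))) <= total_variation \<nu>"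
  unfolding total_variation_def using that by (intro SUP_upper) auto
  then show ?thesis using tv by simp
 qed
 have *: "(abs (integral\<^sup>L (jordan_pos \<mu>) ph)) <= S * B" if \<mu>: "!!A. A : sets borel ==> ennreal (abs (\<mu> A)) <= ennreal S" for \<mu> :: "'a set => real"
 proof -
  have le: "emeasure (jordan_pos \<mu>) UNIV <= ennreal S"
  \<comment> \<open>For a set function that is not a measure, \<open>measure_of\<close> yields the
    zero measure. The bound on the total mass holds in both cases.\<close>
  proof (cases "measure_space UNIV (sigma_sets UNIV (sets borel)) (%A. SUP B\<in>{B : sets borel. B \<subseteq> A}. ennreal (\<mu> B))")
  case True
  have "emeasure (jordan_pos \<mu>) UNIV = (SUP B\<in>{B : sets borel. B \<subseteq> UNIV}. ennreal (\<mu> B))"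
  unfolding jordan_pos_def using True
  by (subst emeasure_measure_of_conv) (auto simp: sigma_sets_top)
  also have "... <= ennreal S"
  using \<mu> by (intro SUP_least) (auto intro: order_trans[OF ennreal_leI[OF abs_ge_self]])
  finally show ?thesis .
  next
  case False
  then show ?thesis unfolding jordan_pos_def by (subst emeasure_measure_of_conv) auto
  qed
  have sp: "space (jordan_pos \<mu>) = UNIV" unfolding jordan_pos_def by (rule space_measure_of) auto
  interpret finite_measure "jordan_pos \<mu>"
  by (rule finite_measureI) (use le sp in "auto simp: top_unique")
  have m: "measure (jordan_pos \<mu>) UNIV <= S"
  using le S by (simp add: measure_def enn2real_leI)
  have "(abs (integral\<^sup>L (jordan_pos \<mu>) ph)) <= (LINT x|jordan_pos \<mu>. (abs (ph x)))" by (rule integral_abs_bound)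
  also have "... <= (LINT x|jordan_pos \<mu>. B)"
  by (rule integral_mono') (use ph B in auto)
  also have "... = measure (jordan_pos \<mu>) UNIV * B" by (simp add: sp)
  also have "... <= S * B" using m B by (rule mult_right_mono)
  finally show ?thesis .
 qed
 have "(abs (integral\<^sup>L (jordan_pos \<nu>) ph)) <= S * B" "(abs (integral\<^sup>L (jordan_neg \<nu>) ph)) <= S * B"
  unfolding jordan_neg_def using one by (auto intro!: *)
 then show ?thesis unfolding signed_integral_def by linarith
qed

lemma distr_norm_translation:
 fixes a :: "'a::euclidean_space => real"
 assumes a: "integ a" "AE x in lborel. (abs (a x)) <= M"
  and n: "distr_norm (dir_deriv \<xi> (fun_distr a)) < ennreal S" and S: "0 <= S"
 shows "(LBINT x. (abs (a (x + h *R \<xi>) - a x))) <= 2 * S * (abs h)"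
proof -
 have [measurable]: "a : bmeas" using borel_measurable_integrable[OF a(1)] by simp
 obtain \<nu> where \<nu>: "represents \<nu> (dir_deriv \<xi> (fun_distr a))" "total_variation \<nu> < ennreal S"
  using n unfolding distr_norm_def by (auto simp: INF_less_iff)
 \<comment> \<open>A representative of \<open>a\<close> bounded at every point; it has the same
   integrals against test functions and almost everywhere the same increments.\<close>
 define a' where "a' x = max (- (abs M)) (min (abs M) (a x))" for x
 have ae: "AE x in lborel. a x = a' x"
  using a(2) by eventually_elim (auto simp: a'_def)
 have ba: "bdb a'" unfolding a'_def[abs_def] by (rule bdbI[where C = "(abs M)"]) auto
 note [measurable] = bdb_measurable[OF ba]
 have ia: "integ a'" by (rule integrable_cong_AE_imp[OF a(1)]) (use ae in auto)
 have H: "\<bar>LBINT x. a' x * (\<xi> \<bullet> grad ph x)\<bar> <= (2 * S) * B"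
  if ph: "ph : test_functions UNIV" "!!x. (abs (ph x)) <= B" for ph B
 proof -
  have t: "test1 UNIV ph (grad ph)" by (rule test_functions_test1[OF ph(1)])
  have fr: "frechet_derivative ph (at x) \<xi> = \<xi> \<bullet> grad ph x" for x
  using frechet_derivative_at[OF test1_deriv[OF t]] by (metis inner_commute)
  have [measurable]: "grad ph : bmeas" by (rule test1_measurable(2)[OF t])
  have "(LBINT x. a' x * (\<xi> \<bullet> grad ph x)) = (LBINT x. a x * (\<xi> \<bullet> grad ph x))"
  by (rule integral_cong_AE) (use ae in auto)
  also have "... = - dir_deriv \<xi> (fun_distr a) ph"
  by (simp add: dir_deriv_def fun_distr_def fr)
  also have "... = - signed_integral \<nu> ph"
  using \<nu>(1) ph(1) by (simp add: represents_def measure_distr_def)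
  finally show ?thesis using signed_integral_bound[OF \<nu>(2) S ph(2)] by simp
 qed
 have "(LBINT x. (abs (a (x + h *R \<xi>) - a x))) = (LBINT x. (abs (a' (x + h *R \<xi>) - a' x)))"
  by (rule integral_cong_AE) (use ae AE_lborel_shift[OF ae, of "h *R \<xi>"] in auto)
 also have "... <= 2 * S * (abs h)" by (rule BV_translation[OF ia ba H]) (use S in auto)
 finally show ?thesis .
qed

section \<open>Kruzhkov solutions\<close>

text \<open>The space-time flux curve: the equation says that the field \<open>Gam (u p)\<close> is
  divergence free, and the entropies become inequalities for \<open>Gam (max u k)\<close> and
  \<open>Gam (min u k)\<close>.\<close>

definition Gam :: "real => spacetime" where
 "Gam a = (a, flux a)"

lemma flux_eq: "flux a = (a\<^sup>2 / 2) *R axis 1 1 + (a ^ 3 / 3) *R axis 2 1"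
 unfolding flux_def by (simp add: vec_eq_iff forall_2 axis_def)

lemma continuous_flux [continuous_intros]:
 "continuous_on S f ==> continuous_on S (%x. flux (f x))"
 unfolding flux_eq by (intro continuous_intros) auto

lemma continuous_Gamma [continuous_intros]:
 "continuous_on S f ==> continuous_on S (%x. Gam (f x))"
 unfolding Gam_def by (intro continuous_intros)

lemma flux_Lipschitz:
 assumes "(abs a) <= M" "(abs b) <= M"
 shows "norm (flux a - flux b) <= (M + M\<^sup>2) * (abs (a - b))"
proof -
 have M: "0 <= M" using assms by linarith
 have 1: "(abs (a\<^sup>2 / 2 - b\<^sup>2 / 2)) <= M * (abs (a - b))"
 proof -
  have "a\<^sup>2 / 2 - b\<^sup>2 / 2 = ((a + b) / 2) * (a - b)" by (simp add: power2_eq_square algebra_simps)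
  moreover have "(abs ((a + b) / 2)) <= M" using assms by (auto simp: abs_le_iff)
  then have "(abs ((a + b) / 2)) * (abs (a - b)) <= M * (abs (a - b))" by (rule mult_right_mono) simp
  ultimately show ?thesis by (simp only: abs_mult)
 qed
 have 2: "(abs (a ^ 3 / 3 - b ^ 3 / 3)) <= M\<^sup>2 * (abs (a - b))"
 proof -
  have "a ^ 3 / 3 - b ^ 3 / 3 = ((a * a + a * b + b * b) / 3) * (a - b)" by (simp add: power3_eq_cube algebra_simps)
  moreover have "(abs (a * a)) <= M * M" "(abs (a * b)) <= M * M" "(abs (b * b)) <= M * M"
  unfolding abs_mult by (intro mult_mono assms M abs_ge_zero)+
  then have "(abs (a * a + a * b + b * b)) <= 3 * (M * M)" by linarith
  then have "(abs ((a * a + a * b + b * b) / 3)) <= M\<^sup>2" by (simp add: power2_eq_square)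
  then have "(abs ((a * a + a * b + b * b) / 3)) * (abs (a - b)) <= M\<^sup>2 * (abs (a - b))" by (rule mult_right_mono) simp
  ultimately show ?thesis by (simp only: abs_mult)
 qed
 have "flux a - flux b = (a\<^sup>2 / 2 - b\<^sup>2 / 2) *R axis 1 1 + (a ^ 3 / 3 - b ^ 3 / 3) *R axis 2 1"
  unfolding flux_eq by (simp add: scaleR_left_diff_distrib)
 also have "norm ... <= (abs (a\<^sup>2 / 2 - b\<^sup>2 / 2)) + (abs (a ^ 3 / 3 - b ^ 3 / 3))"
  by (rule norm_triangle_le) (simp add: norm_axis_1)
 also have "... <= (M + M\<^sup>2) * (abs (a - b))" using 1 2 by (simp add: algebra_simps)
 finally show ?thesis .
qed

lemma Gamma_Lipschitz:
 assumes "(abs a) <= M" "(abs b) <= M"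
 shows "norm (Gam a - Gam b) <= (1 + M + M\<^sup>2) * (abs (a - b))"
proof -
 have "norm (Gam a - Gam b) <= (abs (a - b)) + norm (flux a - flux b)"
  unfolding Gam_def using norm_Pair_le[of "a - b" "flux a - flux b"] by simp
 with flux_Lipschitz[OF assms] show ?thesis by (simp add: algebra_simps)
qed

lemma open_half_space: "open half_space"
 unfolding half_space_def by (intro open_Times) auto

text \<open>
 A version of a Kruzhkov solution that is Borel and bounded everywhere. Since \<open>-Gam(min u k)\<close>
 is \<open>Gam'(max (-u) (-k))\<close> for the curve \<open>Gam'(a) = -Gam(-a)\<close>, the two entropy conditions say that
 \<open>u\<close> and \<open>-u\<close> are subsolutions.
\<close>

definition regular_solution :: "plane => real => (spacetime => real) => bool" where
 "regular_solution \<xi> B U \<longleftrightarrow> bdb U &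
  (ALL k. nonpos_div half_space (%p. Gam (max (U p) k))) &
  (ALL k. nonpos_div half_space (%p. - Gam (min (U p) k))) &
  (AE t in lborel. 0 < t --> integ (%x. U (t, x))) &
  (ALL h. AE t in lborel. 0 < t --> (LBINT x. (abs (U (t, x + h *R \<xi>) - U (t, x)))) <= B * (abs h))"

lemma bdb_Gamma: "bdb u ==> bdb (%p. Gam (u p))"
 by (rule bdb_comp_continuous[of u Gam]) (auto intro!: continuous_Gamma continuous_on_id)

lemma bdb_max: "bdb u ==> bdb v ==> bdb (%p. max (u p) (v p :: real))"
 and bdb_min: "bdb u ==> bdb v ==> bdb (%p. min (u p) (v p :: real))"
proof -
 assume u: "bdb u" and v: "bdb v"
 obtain C D where C: "!!x. (abs (u x)) <= C" "!!x. (abs (v x)) <= D" using bdb_abs_bound[OF u] bdb_abs_bound[OF v] by metis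
 have "(abs (max (u x) (v x))) <= max C D" "(abs (min (u x) (v x))) <= max C D" for x
  using C(1)[of x] C(2)[of x] by (auto simp: max_def min_def abs_le_iff)
 then show "bdb (%p. max (u p) (v p))" "bdb (%p. min (u p) (v p))"
  using bdb_measurable[OF u] bdb_measurable[OF v] by (auto intro!: bdbI[where C = "max C D"])
qed

text \<open>The field \<open>X a c\<close> is Kruzhkov's entropy pair for |a - c|. It has
  non-positive divergence in each variable separately, so \<open>nonpos_div_diagonal\<close> applies
  to \<open>U\<close> and its translate, and the mass of the difference does not increase. The
  constant is 2 and not 1 because the mass is compared with its averages near time 0.\<close>

lemma L1_contraction_translation:
 fixes U :: "spacetime => real" and b :: "plane => real"
 assumes U: "bdb U" and sub: "!!k. nonpos_div half_space (%p. Gam (max (U p) k))"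
  and super: "!!k. nonpos_div half_space (%p. - Gam (min (U p) k))"
  and L1: "!!T. EX N. AE t in lborel. 0 < t & t < T --> integ (%x. U (t, x)) & (LBINT x. (abs (U (t, x)))) <= N"
  and b: "integ b"
  and ini: "!!e. e > 0 ==> \<exists>d>0. AE t in lborel. 0 < t & t < d --> (LBINT x. (abs (U (t, x) - b x))) <= e"
  and B: "(LBINT x. (abs (b (x + w) - b x))) <= B"
 shows "AE t in lborel. 0 < t --> (LBINT x. (abs (U (t, x + w) - U (t, x)))) <= 2 * B"
proof -
 note [measurable] = bdb_measurable[OF U, folded borel_prod]
 obtain M where M: "M > 0" "!!p. (abs (U p)) <= M" using bdb_abs_bound[OF U] by metis
 define V where "V p = U (p + (0, w))" for p
 have V: "bdb V" unfolding V_def[abs_def] by (rule bdb_comp[OF U]) simp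
 have VM: "(abs (V p)) <= M" for p unfolding V_def by (rule M)
 have sh: "p + (0, w) : half_space" if "p : half_space" for p using that by (auto simp: half_space_def mem_Times_iff)
 have subV: "nonpos_div half_space (%p. Gam (max (V p) k))" for k
  unfolding V_def by (rule nonpos_div_shift[OF sub sh]) (auto intro!: bdb_Gamma bdb_max U)
 have superV: "nonpos_div half_space (%p. - Gam (min (V p) k))" for k
  unfolding V_def by (rule nonpos_div_shift[OF super sh]) (auto intro!: bdb_minus bdb_Gamma bdb_min U)
 define X where "X a c = Gam (max a c) + - Gam (min a c)" for a c
 have XX: "nonpos_div half_space (%p. X (U p) (V p))"
 proof (rule nonpos_div_diagonal[OF open_half_space U M(2) V VM])
  show "contU (%z. X (fst z) (snd z))"
  unfolding X_def by (intro continuous_intros continuous_on_fst continuous_on_snd continuous_on_id)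
  define L where "L = 1 + M + M\<^sup>2"
  have L: "0 <= L" using M by (simp add: L_def)
  show "norm (X a c - X a c') <= 2 * L * (abs (c - c'))" if "(abs a) <= M" "(abs c) <= M" "(abs c') <= M" for a c c'
  proof -
  have "(abs (max a c)) <= M" "(abs (max a c')) <= M" "(abs (min a c)) <= M" "(abs (min a c')) <= M"
  using that by (auto simp: max_def min_def)
  then have 1: "norm (Gam (max a c) - Gam (max a c')) <= L * (abs (max a c - max a c'))"
  "norm (Gam (min a c) - Gam (min a c')) <= L * (abs (min a c - min a c'))"
  using Gamma_Lipschitz[of "max a c" M "max a c'", folded L_def] Gamma_Lipschitz[of "min a c" M "min a c'", folded L_def] by blast+
  have "X a c - X a c' = (Gam (max a c) - Gam (max a c')) - (Gam (min a c) - Gam (min a c'))"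
  by (simp add: X_def)
  also have "norm ... <= L * (abs (max a c - max a c')) + L * (abs (min a c - min a c'))"
  by (rule norm_triangle_le_diff[OF add_mono[OF 1]])
  also have "... <= L * (abs (c - c')) + L * (abs (c - c'))"
  using L by (intro add_mono mult_left_mono) (auto simp: max_def min_def)
  finally show ?thesis by simp
  qed
  show "nonpos_div half_space (%p. X (U p) c)" for c
  unfolding X_def by (intro nonpos_div_add sub super bdb_minus bdb_Gamma bdb_min bdb_max U bdb_const)
  show "nonpos_div half_space (%p. X a (V p))" for a
  unfolding X_def max.commute[of a] min.commute[of a]
  by (intro nonpos_div_add subV superV bdb_minus bdb_Gamma bdb_min bdb_max V bdb_const)
 qed
 define x where "x p = (abs (U p - V p))" for p
 define Y where "Y p = flux (max (U p) (V p)) - flux (min (U p) (V p))" for p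
 have Xe: "X (U p) (V p) = (x p, Y p)" for p
  unfolding X_def Gam_def x_def Y_def by (auto simp: max_def min_def)
 have bx: "bdb x" unfolding x_def[abs_def] using bdb_comp_continuous[OF bdb_diff[OF U V], of abs]
  by (simp add: continuous_on_rabs continuous_on_id)
 have bY: "bdb Y" unfolding Y_def[abs_def]
  by (intro bdb_diff bdb_comp_continuous[where Gam = flux] bdb_max bdb_min U V continuous_flux continuous_on_id)
 have Yx: "norm (Y p) <= (M + M\<^sup>2) * x p" for p
 proof -
  have "norm (Y p) <= (M + M\<^sup>2) * (abs (max (U p) (V p) - min (U p) (V p)))"
  unfolding Y_def using M(2)[of p] VM[of p] by (intro flux_Lipschitz) (auto simp: max_def min_def)
  also have "(abs (max (U p) (V p) - min (U p) (V p))) = x p" by (auto simp: x_def max_def min_def)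
  finally show ?thesis .
 qed
 note [measurable] = bdb_measurable[OF bx, folded borel_prod]
 define m where "m t = (LBINT y. x (t, y))" for t
 have mm[measurable]: "m : bmeas" unfolding m_def[abs_def] by measurable
 have m_eq: "m t = (LBINT y. (abs (U (t, y + w) - U (t, y))))" for t
  by (simp add: m_def x_def V_def abs_minus_commute)
 have m0: "0 <= m t" for t unfolding m_def by (intro B_nonneg) (simp add: x_def)
 have ishift: "integ (%y. V (t, y))" "(LBINT y. (abs (V (t, y)))) = (LBINT y. (abs (U (t, y))))"
  if i: "integ (%y. U (t, y))" for t
 proof -
  show "integ (%y. V (t, y))" using lborel_integrable_shift[OF i, of w] by (simp add: V_def)
  show "(LBINT y. (abs (V (t, y)))) = (LBINT y. (abs (U (t, y))))"
  using lborel_integral_shift[of "%y. (abs (U (t, y)))" w] borel_measurable_integrable[OF i] by (simp add: V_def)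
 qed
 have decay: "AE t in lborel. s2 < t & t < T --> m t <= 2 * C"
  if s: "0 < s2" "s2 < T" and C: "AE t in lborel. 0 < t & t <= s2 --> m t <= C" for s2 T C
 proof -
  obtain N where N: "AE t in lborel. 0 < t & t < T --> integ (%x. U (t, x)) & (LBINT x. (abs (U (t, x)))) <= N"
  using L1[of T] by auto
  have N2: "AE t in lborel. 0 < t & t < T --> integ (%y. x (t, y)) & (LBINT y. x (t, y)) <= 2 * N"
  using N
  proof eventually_elim
  case (elim t)
  show ?case
  proof (intro impI)
  assume t: "0 < t & t < T"
  then have i: "integ (%y. U (t, y))" "(LBINT x. (abs (U (t, x)))) <= N" using elim by auto
  note iV = ishift[OF i(1)]
  have "(LBINT y. x (t, y)) <= (LBINT y. (abs (U (t, y))) + (abs (V (t, y))))"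
  unfolding x_def using i iV by (intro integral_mono) auto
  also have "... <= 2 * N" using i iV by simp
  finally show "integ (%y. x (t, y)) & (LBINT y. x (t, y)) <= 2 * N" using i iV by (simp add: x_def)
  qed
  qed
  have Xf: "nonpos_div ({0<..} \<times> UNIV) (%p. (x p, Y p))" using XX by (simp add: Xe half_space_def)
  have x0: "0 <= x p" for p by (simp add: x_def)
  \<comment> \<open>On this interval the mass is at most \<open>C\<close>, and
    \<open>mass_average\<close> returns twice the average.\<close>
  define J where "J = {s2 / 2..s2}"
  have "AE t in lborel. s2 < t & t < T --> m t <= 2 / (s2 - s2 / 2) * (LBINT t. ind J t * m t)"
  unfolding m_def J_def by (rule mass_average[OF bx bY Xf x0 Yx _ _ _ N2]) (use s in auto)
  moreover have "(LBINT t. ind J t * m t) <= (LBINT t. ind J t * C)"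
  proof (rule integral_mono_AE)
  show iC: "integ (%t. ind J t * C)"
  by (intro integrable_mult_left bdb_integrable[OF bdb_indicator[of J], of J]) (auto simp: J_def)
  show le: "AE t in lborel. ind J t * m t <= ind J t * C"
  using C by eventually_elim (use s in "auto simp: indicator_def J_def")
  show "integ (%t. ind J t * m t)"
  proof (rule B_ibound[OF iC])
  show "AE t in lborel. norm (ind J t * m t) <= norm (ind J t * C)"
  using le by eventually_elim (use m0 in "auto simp: indicator_def split: if_splits")
  show "(%t. ind J t * m t) : lmeas"
  using mm by (simp add: J_def)
  qed
  qed
  then have "2 / (s2 - s2 / 2) * (LBINT t. ind J t * m t) <= 2 / (s2 - s2 / 2) * (s2 / 2 * C)"
  using s by (intro mult_left_mono) (auto simp: J_def)
  moreover have "2 / (s2 - s2 / 2) * (s2 / 2 * C) = 2 * C" using s by (simp add: field_simps)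
  ultimately show ?thesis by (auto elim!: eventually_mono)
 qed
 have small: "\<exists>d>0. AE t in lborel. 0 < t & t < d --> m t <= B + 2 * e" if e: "e > 0" for e
 proof -
  obtain d where d: "d > 0" "AE t in lborel. 0 < t & t < d --> (LBINT x. (abs (U (t, x) - b x))) <= e"
  using ini[OF e] by auto
  obtain N where N: "AE t in lborel. 0 < t & t < d --> integ (%x. U (t, x)) & (LBINT x. (abs (U (t, x)))) <= N"
  using L1[of d] by auto
  have "AE t in lborel. 0 < t & t < d --> m t <= B + 2 * e"
  using d(2) N
  proof eventually_elim
  case (elim t)
  show ?case
  proof (intro impI)
  assume t: "0 < t & t < d"
  then have i: "integ (%y. U (t, y))" and l: "(LBINT x. (abs (U (t, x) - b x))) <= e" using elim by auto
  note ii = i lborel_integrable_shift[OF i, of w] b lborel_integrable_shift[OF b, of w]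
  have dd: "integ (%y. (abs (U (t, y) - b y)))" using ii by auto
  note ds = lborel_integrable_shift[OF dd, of w]
  have bb: "integ (%y. (abs (b (y + w) - b y)))" using ii by auto
  have "m t <= (LBINT y. (abs (U (t, y + w) - b (y + w))) + ((abs (b (y + w) - b y)) + (abs (U (t, y) - b y))))"
  unfolding m_eq using ii ds dd bb by (intro integral_mono B_iadd) auto
  also have "... = (LBINT y. (abs (U (t, y + w) - b (y + w)))) + ((LBINT y. (abs (b (y + w) - b y))) + (LBINT y. (abs (U (t, y) - b y))))"
  by (simp only: B_add B_iadd ds dd bb)
  also have "(LBINT y. (abs (U (t, y + w) - b (y + w)))) = (LBINT y. (abs (U (t, y) - b y)))"
  using lborel_integral_shift[of "%y. (abs (U (t, y) - b y))" w] borel_measurable_integrable[OF dd] by simp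
  finally show "m t <= B + 2 * e" using B l by linarith
  qed
  qed
  with d(1) show ?thesis by blast
 qed
 \<comment> \<open>The bound near time 0 with error 1/(n + 1) is carried up to time n by
   \<open>decay\<close>. Countably many n cover all positive times, and the error disappears in the
   limit.\<close>
 have "AE t in lborel. 1 / Suc n < t & t < real n --> m t <= 2 * (B + 2 * (1 / Suc n))" for n
 proof -
  obtain d where d: "d > 0" "AE t in lborel. 0 < t & t < d --> m t <= B + 2 * (1 / Suc n)"
  using small[of "1 / Suc n"] by auto
  show ?thesis
  proof (cases "1 / Suc n < real n")
  case True
  have "AE t in lborel. min (d / 2) (1 / Suc n) < t & t < real n --> m t <= 2 * (B + 2 * (1 / Suc n))"
  proof (rule decay)
  show "AE t in lborel. 0 < t & t <= min (d / 2) (1 / real (Suc n)) --> m t <= B + 2 * (1 / Suc n)"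
  using d(2) by eventually_elim (use d(1) in auto)
  qed (use d(1) True in auto)
  then show ?thesis by eventually_elim auto
  qed (auto intro!: AE_I2)
 qed
 then have "AE t in lborel. ALL n. 1 / Suc n < t & t < real n --> m t <= 2 * (B + 2 * (1 / Suc n))"
  by (simp add: AE_all_countable)
 then show ?thesis
 proof eventually_elim
  case (elim t)
  show ?case
  proof (intro impI)
  assume t: "0 < t"
  have "(%n. 2 * (B + 2 * inverse (real (Suc n)))) ~~> 2 * (B + 2 * 0)"
  by (intro tendsto_intros LIMSEQ_inverse_real_of_nat)
  moreover obtain N1 where N1: "!!n. n \<ge> N1 ==> 1 / real (Suc n) < t" using Suc_inverse_small[OF t] by metis
  moreover obtain N2 where N2: "t < real N2" using reals_Archimedean2 by blast
  ultimately have "m t <= 2 * (B + 2 * 0)"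
  using elim by (intro LIMSEQ_le_const) (auto simp: divide_inverse intro!: exI[of _ "max N1 N2"])
  then show "(LBINT x. (abs (U (t, x + w) - U (t, x)))) <= 2 * B" by (simp add: m_eq)
  qed
 qed
qed

lemma dt_grad_x_eq:
 assumes "test1 Om ph g"
 shows "dt ph p = fst (g p)" "grad_x ph p = snd (g p)"
proof -
 have "frechet_derivative ph (at p) = (%v. g p \<bullet> v)"
  using frechet_derivative_at[OF test1_deriv[OF assms]] by simp
 then show "dt ph p = fst (g p)" "grad_x ph p = snd (g p)"
  by (auto simp: dt_def grad_x_def inner_prod_def vec_eq_iff inner_axis)
qed

lemma entropy_field: "((abs (a - k)), sgn (a - k) *R (flux a - flux k)) = Gam (max a k) + - Gam (min a k)"
 by (auto simp: Gam_def max_def min_def sgn_real_def)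

lemma Gam_max_min: "Gam (max a k) + Gam (min a k) = Gam a + Gam k"
 by (auto simp: max_def min_def)

text \<open>Truncation gives a representative that is bounded everywhere. The entropy inequality
  bounds the difference of the fields \<open>Gam (max u k)\<close> and \<open>Gam (min u k)\<close>,
  while the weak equation makes their sum divergence free; together they give the two one-sided
  conditions. The constant \<open>B\<close> doubles through
  \<open>L1_contraction_translation\<close>.\<close>

lemma regular_version:
 assumes u: "kruzhkov_solution b u" and b: "in_L1_Linf b"
  and B: "!!h. (LBINT x. (abs (b (x + h *R \<xi>) - b x))) <= B * (abs h)"
 obtains U where "regular_solution \<xi> (2 * B) U" "AE p in lborel. p : half_space --> U p = u p"
proof -
 have um: "(%p. ind ({0..} \<times> UNIV) p *R u p) : lmeas"
  using u by (simp add: kruzhkov_solution_def set_borel_measurable_def)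
 have uL1: "!!t. t \<ge> 0 ==> integ (%x. u (t, x))"
  and ucont: "!!t. t \<ge> 0 ==> ((%s. LBINT x. (abs (u (s, x) - u (t, x)))) \<longlongrightarrow> 0) (at t within {0..})"
  and u0: "AE x in lborel. u (0, x) = b x" and ent: "entropy_solution u"
  using u by (auto simp: kruzhkov_solution_def)
 obtain M0 where M0: "AE p in lborel. fst p \<ge> 0 --> (abs (u p)) <= M0"
  using u by (auto simp: kruzhkov_solution_def)
 define M where "M = (abs M0)"
 define v where "v p = ind ({0..} \<times> UNIV) p *R u p" for p
 have [measurable]: "v : bmeas" using um by (simp add: v_def[abs_def])
 have vu: "v p = u p" if "p : half_space" for p
  using that by (auto simp: v_def half_space_def indicator_def mem_Times_iff)
 have hs[measurable]: "half_space : sets borel" using open_half_space by simp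
 define U where "U p = ind half_space p * max (- M) (min M (v p))" for p
 have mU: "U : bmeas" unfolding U_def[abs_def] by measurable
 have bU: "bdb U" by (rule bdbI[OF mU, where C = M]) (auto simp: U_def indicator_def M_def)
 have ae: "AE p in lborel. p : half_space --> U p = u p"
  using M0 by eventually_elim (use vu in "auto simp: U_def M_def half_space_def mem_Times_iff")
 have int_eq: "(LBINT p:half_space. F (u p) \<bullet> g p) = (LBINT p. F (U p) \<bullet> g p)"
  if t: "test1 half_space ph g" and F: "F : bmeas" for F :: "real => spacetime" and ph g
 proof -
  obtain K where K: "K \<subseteq> half_space" "!!p. p ~: K ==> g p = 0" using test1D[OF t] by metis
  note [measurable] = test1_measurable(2)[OF t] F mU
  have "(LBINT p:half_space. F (u p) \<bullet> g p) = (LBINT p. F (v p) \<bullet> g p)"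
  unfolding set_lebesgue_integral_def
  proof (rule B_cong[OF refl])
  show "ind half_space p *R (F (u p) \<bullet> g p) = F (v p) \<bullet> g p" for p
  using vu[of p] K(1) K(2)[of p] by (cases "p : K") auto
  qed
  also have "... = (LBINT p. F (U p) \<bullet> g p)"
  proof (rule integral_cong_AE)
  show "AE p in lborel. F (v p) \<bullet> g p = F (U p) \<bullet> g p"
  using ae
  proof eventually_elim
  case (elim p)
  show ?case using elim vu[of p] K(1) K(2)[of p] by (cases "p : K") auto
  qed
  qed measurable
  finally show ?thesis .
 qed
 have cG: "(%a. Gam (max a k)) : bmeas" "(%a. Gam (min a k)) : bmeas" "Gam : bmeas" for k
  by (intro borel_measurable_continuous_onI continuous_Gamma continuous_intros continuous_on_id)+
 have ents: "0 <= (LBINT p. Gam (max (U p) k) \<bullet> g p) & 0 <= (LBINT p. - Gam (min (U p) k) \<bullet> g p)"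
  if ph: "ph : test_functions half_space" "!!p. 0 <= ph p" and g: "g = grad ph" for ph g k
 proof -
  have t: "test1 half_space ph g" unfolding g by (rule test_functions_test1[OF ph(1)])
  note d = dt_grad_x_eq[OF t]
  have "(LBINT p:half_space. u p * dt ph p + flux (u p) \<bullet> grad_x ph p) = 0"
  using ent ph(1) by (auto simp: entropy_solution_def)
  moreover have "u p * dt ph p + flux (u p) \<bullet> grad_x ph p = Gam (u p) \<bullet> g p" for p
  by (simp add: Gam_def inner_prod_def d)
  ultimately have 1: "(LBINT p. Gam (U p) \<bullet> g p) = 0"
  using int_eq[OF t cG(3)] by simp
  have "0 <= (LBINT p:half_space. (abs (u p - k)) * dt ph p + (sgn (u p - k) *R (flux (u p) - flux k)) \<bullet> grad_x ph p)"
  using ent ph by (auto simp: entropy_solution_def)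
  moreover have "(abs (u p - k)) * dt ph p + (sgn (u p - k) *R (flux (u p) - flux k)) \<bullet> grad_x ph p
  = (Gam (max (u p) k) + - Gam (min (u p) k)) \<bullet> g p" for p
  unfolding entropy_field[symmetric] by (simp add: inner_prod_def d)
  ultimately have 2: "0 <= (LBINT p. (Gam (max (U p) k) + - Gam (min (U p) k)) \<bullet> g p)"
  using int_eq[OF t, of "%a. Gam (max a k) + - Gam (min a k)"] cG by simp
  have i: "integ (%p. Gam (max (U p) k) \<bullet> g p)" "integ (%p. Gam (min (U p) k) \<bullet> g p)"
  "integ (%p. Gam (U p) \<bullet> g p)"
  by (intro test1_int[OF _ t] bdb_Gamma bdb_max bdb_min bU bdb_const)+
  have 3: "(LBINT p. Gam k \<bullet> g p) = 0" by (rule test1_integral_const[OF t])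
  have "(LBINT p. Gam (max (U p) k) \<bullet> g p) + (LBINT p. Gam (min (U p) k) \<bullet> g p) =
  (LBINT p. (Gam (max (U p) k) + Gam (min (U p) k)) \<bullet> g p)" using i by (simp add: inner_add_left)
  also have "... = (LBINT p. Gam (U p) \<bullet> g p) + (LBINT p. Gam k \<bullet> g p)"
  unfolding Gam_max_min inner_add_left
  by (rule B_add[OF i(3)]) (intro test1_int[OF _ t] bdb_const)
  finally have 4: "(LBINT p. Gam (max (U p) k) \<bullet> g p) + (LBINT p. Gam (min (U p) k) \<bullet> g p) = 0"
  using 1 3 by simp
  \<comment> \<open>Sum zero and difference nonnegative: the first integral is nonnegative and the
    second non-positive.\<close>
  have "0 <= (LBINT p. Gam (max (U p) k) \<bullet> g p) - (LBINT p. Gam (min (U p) k) \<bullet> g p)"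
  using 2 i by (simp add: inner_diff_left)
  with 4 show ?thesis by simp
 qed
 have sub: "nonpos_div half_space (%p. Gam (max (U p) k))" for k
  by (rule nonpos_divI_smooth[OF open_half_space])
  (intro bdb_Gamma bdb_max bU bdb_const, use ents in blast)
 have super: "nonpos_div half_space (%p. - Gam (min (U p) k))" for k
  by (rule nonpos_divI_smooth[OF open_half_space])
  (intro bdb_minus bdb_Gamma bdb_min bU bdb_const, use ents in blast)
 have slice: "AE t in lborel. 0 < t --> (AE x in lborel. U (t, x) = u (t, x))"
 proof -
  have "AE p in lborel \<Otimes>\<^sub>M lborel. p : half_space --> U p = u p" unfolding lborel_prod by (rule ae)
  from lborel_pair.AE_pair[OF this] show ?thesis
  by eventually_elim (auto simp: half_space_def)
 qed
 have mUt: "(%x. U (t, x)) : bmeas" for t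
  using measurable_compose[OF _ mU, of "%x. (t, x)"] by simp
 have iU: "AE t in lborel. 0 < t --> integ (%x. U (t, x))"
  using slice
 proof eventually_elim
  case (elim t)
  show ?case
  proof
  assume t: "0 < t"
  show "integ (%x. U (t, x))"
  by (rule integrable_cong_AE_imp[OF uL1[of t]]) (use t elim mUt in auto)
  qed
 qed
 have Ueq: "(LBINT x. (abs (U (t, x) - c x))) = (LBINT x. (abs (u (t, x) - c' x)))"
  if "0 < t" "AE x in lborel. U (t, x) = u (t, x)" "AE x in lborel. c x = c' x"
  "c : bmeas" "c' : bmeas" for t c c'
  using that uL1[of t] mUt[of t] borel_measurable_integrable[OF uL1[of t]]
  by (intro integral_cong_AE) auto
 define N where "N t = (LBINT x. (abs (u (t, x))))" for t
 \<comment> \<open>Continuity of the L1 norm in time provides a bound for it on every bounded time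
   interval.\<close>
 have Nc: "continuous_on {0..} N"
  unfolding continuous_on_def
 proof
  fix t :: real assume t: "t : {0..}"
  have "((%s. N s - N t) \<longlongrightarrow> 0) (at t within {0..})"
  proof (rule Lim_null_comparison[OF _ ucont])
  show "\<forall>\<^sub>F s in at t within {0..}. norm (N s - N t) <= (LBINT x. (abs (u (s, x) - u (t, x))))"
  unfolding eventually_at_filter
  proof (intro always_eventually allI impI)
  fix s :: real assume s: "s ~= t" "s : {0..}"
  have i: "integ (%x. u (s, x))" "integ (%x. u (t, x))" using uL1 s t by auto
  have "N s - N t = (LBINT x. (abs (u (s, x))) - (abs (u (t, x))))" unfolding N_def using i by simp
  also have "\<bar>...\<bar> <= (LBINT x. (abs (u (s, x) - u (t, x))))"
  using i by (intro order_trans[OF integral_abs_bound] integral_mono) auto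
  finally show "norm (N s - N t) <= (LBINT x. (abs (u (s, x) - u (t, x))))" by simp
  qed
  qed (use t in auto)
  then show "(N \<longlongrightarrow> N t) (at t within {0..})" by (simp add: LIM_zero_iff)
 qed
 have L1: "EX C. AE t in lborel. 0 < t & t < T --> integ (%x. U (t, x)) & (LBINT x. (abs (U (t, x)))) <= C" for T
 proof -
  have "compact (N ` {0..T})" by (rule compact_continuous_image[OF continuous_on_subset[OF Nc]]) auto
  then obtain C where C: "!!t. t : {0..T} ==> norm (N t) <= C"
  unfolding bounded_iff[of "N ` {0..T}"] by (metis bounded_iff compact_imp_bounded imageI)
  have "AE t in lborel. 0 < t & t < T --> integ (%x. U (t, x)) & (LBINT x. (abs (U (t, x)))) <= C"
  using iU slice
  proof eventually_elim
  case (elim t)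
  show ?case using elim C[of t] Ueq[of t "%x. 0" "%x. 0"] by (auto simp: N_def)
  qed
  then show ?thesis by blast
 qed
 have bm: "b : bmeas" "integ b"
  using b borel_measurable_integrable[of lborel b] by (auto simp: in_L1_Linf_def)
 have ini: "\<exists>d>0. AE t in lborel. 0 < t & t < d --> (LBINT x. (abs (U (t, x) - b x))) <= e" if e: "e > 0" for e
 proof -
  obtain d where d: "d > 0" "!!s. s : {0..} ==> 0 < dist s 0 & dist s 0 < d ==> dist (LBINT x. (abs (u (s, x) - u (0, x)))) 0 < e"
  using ucont[of 0] e unfolding Lim_within by auto
  have "AE t in lborel. 0 < t & t < d --> (LBINT x. (abs (U (t, x) - b x))) <= e"
  using slice
  proof eventually_elim
  case (elim t)
  show ?case
  proof (intro impI)
  assume t: "0 < t & t < d"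
  have "(LBINT x. (abs (U (t, x) - b x))) = (LBINT x. (abs (u (t, x) - u (0, x))))"
  by (rule Ueq) (use t elim u0 bm borel_measurable_integrable[OF uL1[of 0]] in auto)
  also have "... <= e" using d(2)[of t] t by (auto simp: dist_real_def)
  finally show "(LBINT x. (abs (U (t, x) - b x))) <= e" .
  qed
  qed
  with d(1) show ?thesis by blast
 qed
 have "AE t in lborel. 0 < t --> (LBINT x. (abs (U (t, x + h *R \<xi>) - U (t, x)))) <= 2 * B * (abs h)" for h
  using L1_contraction_translation[OF bU sub super L1 bm(2) ini B] by (simp add: mult.assoc)
 then have "regular_solution \<xi> (2 * B) U"
  unfolding regular_solution_def using bU sub super iU by auto
 then show thesis using ae by (rule that)
qed

section \<open>Decay of one-dimensional subsolutions\<close>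

text \<open>After Fubini, the kernel integrates \<open>z\<close> along a piece of a vertical line,
  and this is at most the mass \<open>B\<close> of the whole line. The bound does not grow with the
  length \<open>h\<close>, so segments can be taken arbitrarily long.\<close>

lemma kap_mass_bound:
 fixes z :: "R2 => real"
 assumes z: "bdb z" "!!p. 0 <= z p"
  and B: "AE t in lborel. ta < t --> integ (%y. z (t, y)) & (LBINT y. z (t, y)) <= B"
  and p: "ta < fst p - 1 / Suc n" and h: "0 <= h"
 shows "(LBINT q. z q * kap n h (0, 1) (p - q)) <= B"
proof -
 define e :: "R2" where "e = (0, 1)"
 note [measurable] = bdb_measurable[OF z(1)]
 obtain C where C: "!!p. (abs (z p)) <= C" using bdb_abs_bound[OF z(1)] by metis
 obtain M where M: "M > 0" "!!w::R2. moll n w <= M" using moll_bound by metis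
 have mz: "bdb (%v. z (p - v))" by (rule bdb_comp[OF z(1)]) simp
 define f1 where "f1 w = z (p - fst w) * (ind {0..h} (snd w) * moll n (fst w - snd w *R e))" for w :: "(R2) \<times> real"
 define f2 where "f2 w = z (p - fst w - snd w *R e) * (ind {0..h} (snd w) * moll n (fst w))" for w :: "(R2) \<times> real"
 have cw: "(%w::(R2) \<times> real. fst w - snd w *R e) : bmeas"
  "(%w::(R2) \<times> real. p - fst w - snd w *R e) : bmeas"
  by (intro borel_measurable_continuous_onI continuous_intros)+
 have bi: "bdb (%w::(R2) \<times> real. ind {0..h} (snd w) :: real)"
  by (rule bdb_snd[OF bdb_indicator]) simp
 have b1: "bdb f1" unfolding f1_def[abs_def]
  by (intro bdb_mult bi bdb_fst[OF mz] bdb_comp[OF test1_bdb(1)[OF moll_test1] cw(1)])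
 have b2: "bdb f2" unfolding f2_def[abs_def]
  by (intro bdb_mult bi bdb_fst[OF test1_bdb(1)[OF moll_test1]] bdb_comp[OF z(1) cw(2)])
 obtain C1 where C1: "!!w. (abs (f1 w)) <= C1" using bdb_abs_bound[OF b1] by metis
 obtain C2 where C2: "!!w. (abs (f2 w)) <= C2" using bdb_abs_bound[OF b2] by metis
 have z1: "f1 w = 0" if "w ~: ksupp 1 h e \<times> {0..h}" for w
 proof (cases "snd w : {0..h} & fst w - snd w *R e : cball 0 1")
  case True
  then have "snd w *R e : (%r. r *R e) ` {0..h}" by blast
  moreover have "fst w = (fst w - snd w *R e) + snd w *R e" by simp
  ultimately have "fst w : ksupp 1 h e" using True unfolding ksupp_def by blast
  then show ?thesis using that True by (simp add: mem_Times_iff)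
 next
  case False
  then show ?thesis using moll_eq_0_1[of "fst w - snd w *R e" n] by (auto simp: f1_def)
 qed
 have z2: "f2 w = 0" if "w ~: cball 0 1 \<times> {0..h}" for w
  using that moll_eq_0_1[of "fst w" n] by (auto simp: f2_def mem_Times_iff)
 note F1 = fubini_bounded_support[OF bdb_measurable[OF b1] C1 compact_Times[OF compact_ksupp compact_Icc] z1]
 note F2 = fubini_bounded_support[OF bdb_measurable[OF b2] C2 compact_Times[OF compact_cball compact_Icc] z2]
 have mk: "(%q. z q * kap n h e (p - q)) : bmeas"
 proof -
  have [measurable]: "kap n h e : bmeas" by (rule test1_measurable(1)[OF kap_test1])
  show ?thesis by measurable
 qed
 have "(LBINT q. z q * kap n h e (p - q)) = (LBINT w. z (p - w) * kap n h e w)"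
  using lborel_integral_reflect[OF mk, of p] by simp
 also have "... = (LBINT w. LBINT r. f1 (w, r))"
  by (simp add: f1_def kap_def)
 also have "... = (LBINT r. LBINT w. f1 (w, r))" by (rule F1(6))
 also have "... = (LBINT r. LBINT w. f2 (w, r))"
 proof (rule B_cong[OF refl])
  fix r
  have "(%w. f1 (w, r)) : bmeas"
  using measurable_compose[OF _ bdb_measurable[OF b1], of "%w. (w, r)"] by simp
  from lborel_integral_shift[OF this, of "r *R e"]
  show "(LBINT w. f1 (w, r)) = (LBINT w. f2 (w, r))"
  by (simp add: f1_def f2_def diff_diff_eq)
 qed
 also have "... = (LBINT w. LBINT r. f2 (w, r))" by (rule F2(6)[symmetric])
 also have "... <= (LBINT w. moll n (w :: R2) * B)"
 proof (rule integral_mono_AE)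
  show "integ (%w. LBINT r. f2 (w, r))" by (rule F2(4))
  show "integ (%w :: R2. moll n w * B)" by (intro integrable_mult_left moll_integrable)
  show "AE w in lborel. (LBINT r. f2 (w, r)) <= moll n w * B"
  using AE_fst[OF AE_lborel_reflect[OF B, of "fst p"]]
  proof eventually_elim
  case (elim w)
  show ?case
  proof (cases "moll n w = 0")
  case True
  then show ?thesis by (simp add: f2_def)
  next
  case False
  then have "norm w < 1 / Suc n" using moll_eq_0[of n w] by (meson not_le)
  then have "(abs (fst w)) < 1 / Suc n" using norm_fst_le[of "fst w" "snd w"] by simp
  then have "ta < fst p - fst w" using p by linarith
  then have i: "integ (%y. z (fst p - fst w, y))" "(LBINT y. z (fst p - fst w, y)) <= B"
  using elim by auto
  have pe: "p - w - r *R e = (fst p - fst w, snd p - snd w - r)" for r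
  by (simp add: e_def prod_eq_iff)
  have i': "integ (%r. z (fst p - fst w, snd p - snd w - r))"
  by (rule lborel_integrable_reflect[OF i(1)])
  have "f2 (w, r) = moll n w * (ind {0..h} r * z (fst p - fst w, snd p - snd w - r))" for r
  by (simp add: f2_def pe)
  then have "(LBINT r. f2 (w, r)) = moll n w * (LBINT r. ind {0..h} r * z (fst p - fst w, snd p - snd w - r))"
  by (simp only: integral_mult_right_zero)
  also have "... <= moll n w * (LBINT r. z (fst p - fst w, snd p - snd w - r))"
  proof (intro mult_left_mono moll_nonneg integral_mono_AE' i' AE_I2)
  show "ind {0..h} r * z (fst p - fst w, snd p - snd w - r) <= z (fst p - fst w, snd p - snd w - r)" for r
  using z(2) by (simp add: indicator_def)
  qed (rule z(2))
  also have "(LBINT r. z (fst p - fst w, snd p - snd w - r)) = (LBINT y. z (fst p - fst w, y))"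
  using borel_measurable_integrable[OF i(1)] by (intro lborel_integral_reflect) simp
  also have "moll n w * ... <= moll n w * B" using i(2) by (intro mult_left_mono moll_nonneg)
  finally show ?thesis .
  qed
  qed
 qed
 also have "... = B" using moll_integral[of n, where 'a = "R2"] by simp
 finally show ?thesis by (simp add: e_def)
qed

lemma test1_restrict:
 "test1 UNIV ph g ==> compact K ==> K \<subseteq> Om ==> (!!p. p ~: K ==> ph p = 0) ==> test1 Om ph g"
 unfolding test1_def by blast

lemma Icc_integrable: "integ (%t. ind {a..b::real} t * (c::real))"
 by (intro integrable_mult_left bdb_integrable[OF bdb_indicator[of "{a..b}"], of "{a..b}"]) auto

text \<open>The convexity condition is stated as a lower bound for the wedge product of the entropy
  pairs at two levels k < k', namely \<open>E k * F k' - E k' * F k\<close>, since this is the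
  quantity that the interaction estimate bounds from above. It is imposed only above
  \<open>k0\<close>, where a cubic flux with positive leading coefficient is convex.\<close>

locale subsolution_1d =
 fixes W :: "R2 => real" and g :: "real => real" and k0 c M :: real
 assumes W: "bdb W" and g: "contU g"
  and gL: "!!R. \<exists>L\<ge>0. ALL a b. (abs a) <= R --> (abs b) <= R --> (abs (g a - g b)) <= L * (abs (a - b))"
  and sub: "!!k. k0 <= k ==> nonpos_div ({0<..} \<times> UNIV) (%p. (max (W p) k, g (max (W p) k)))"
  and convex: "!!k k' w. k0 <= k ==> k < k' ==> k' <= w ==>
  c * (k' - k) * ((w - k) * (w - k')) <= (w - k) * (g w - g k') - (w - k') * (g w - g k)"
  and c: "0 < c" and k0: "0 <= k0"
  and mass: "AE t in lborel. 0 < t --> integ (%y. max 0 (W (t, y))) & (LBINT y. max 0 (W (t, y))) <= M"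
begin

definition E :: "real => R2 => real" where "E k p = max (W p) k - k"
definition F :: "real => R2 => real" where "F k p = g (max (W p) k) - g k"

lemma E_nonneg: "0 <= E k p" by (simp add: E_def)

lemma E_antimono: "k <= k' ==> E k' p <= E k p" by (auto simp: E_def)

lemma bdb_E: "bdb (E k)" and bdb_F: "bdb (F k)"
 unfolding E_def[abs_def] F_def[abs_def]
 by (intro bdb_diff bdb_max W bdb_const bdb_comp_continuous[OF _ g])+

lemma F_le_E: obtains C where "0 <= C" "!!p. (abs (F k p)) <= C * E k p"
proof -
 obtain D where D: "D > 0" "!!p. (abs (W p)) <= D" using bdb_abs_bound[OF W] by metis
 obtain L where L: "L \<ge> 0" "!!a b. (abs a) <= D + (abs k) ==> (abs b) <= D + (abs k) ==> (abs (g a - g b)) <= L * (abs (a - b))" using gL by metis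
 have "(abs (F k p)) <= L * E k p" for p
  using L(2)[of "max (W p) k" k] D(1) D(2)[of p] by (auto simp: F_def E_def max_def)
 with L(1) that show thesis by blast
qed

lemma div_E: "k0 <= k ==> nonpos_div ({0<..} \<times> UNIV) (%p. (E k p, F k p))"
proof -
 assume k: "k0 <= k"
 have "bdb (%p. (max (W p) k, g (max (W p) k)))"
  by (intro bdb_Pair bdb_max W bdb_const bdb_comp_continuous[OF _ g])
 from nonpos_div_add[OF sub[OF k] nonpos_div_const this bdb_const, of "(- k, - g k)"]
 show ?thesis by (simp add: E_def F_def)
qed

lemma E_slice_measurable: "(%y. E k (t, y)) : bmeas"
 using measurable_compose[OF _ bdb_measurable[OF bdb_E], of "%y. (t, y)"] by simp

lemma E_slice:
 assumes "k <= k'" "integ (%y. E k (t, y))"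
 shows "integ (%y. E k' (t, y))" "(LBINT y. E k' (t, y)) <= (LBINT y. E k (t, y))"
proof -
 show "integ (%y. E k' (t, y))"
  by (rule B_ibound[OF assms(2)])
  (use E_slice_measurable E_nonneg E_antimono[OF assms(1)] in "auto intro!: AE_I2")
 then show "(LBINT y. E k' (t, y)) <= (LBINT y. E k (t, y))"
  by (intro integral_mono assms E_antimono)
qed

text \<open>\<open>interaction\<close> along the space axis, with nothing in the third direction.
  The kernel average is at most \<open>B\<close> for every length L, and by integrability of the
  excess some large L makes the shifted product arbitrarily small. What remains is the cutoff term,
  a multiple of B^2.\<close>

lemma interaction_1d:
 assumes k: "k0 <= k" "k < k'" and ta: "0 <= ta" and r: "0 < r" "ta < c0 - r" and R: "0 < R"
  and B: "AE t in lborel. ta < t --> integ (%y. E k (t, y)) & (LBINT y. E k (t, y)) <= B"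
  and C: "0 <= C" "!!p. (abs (F k p)) <= C * E k p"
 shows "c * (k' - k) * (LBINT p. cutoff r (fst p - c0) * cutoff R (snd p) * (E k p * E k' p)) <= B\<^sup>2 * (8 + 8 * C * r / R)"
proof -
 define e :: "R2" where "e = (0, 1)"
 define I where "I = {c0 - r..c0 + r}"
 define K where "K = I \<times> cball (0::real) R"
 define th where "th p = cutoff r (fst p - c0) * cutoff R (snd p)" for p :: "R2"
 define gth where "gth p = (cutoff R (snd p) *R cutoff_grad r (fst p - c0), cutoff r (fst p - c0) *R cutoff_grad R (snd p))" for p :: "R2"
 have out: "cutoff r (t - c0) = 0" if "t ~: I" for t
  using that by (intro cutoff_test1(5) r) (auto simp: I_def abs_if)
 have tr: "test1 {0<..} (%t. cutoff r (t - c0)) (%t. cutoff_grad r (t - c0))"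
  by (rule test1_restrict[OF test1_shift[OF cutoff_test1(1)[OF r(1)]], of _ I]) (use out r ta in "auto simp: I_def")
 have t: "test1 ({0<..} \<times> UNIV) th gth"
  unfolding th_def[abs_def] gth_def[abs_def] by (rule test1_time_space[OF tr cutoff_test1(1)[OF R]])
 have th0: "0 <= th p" for p unfolding th_def by (intro mult_nonneg_nonneg cutoff_test1(2) r R)
 have gI: "cutoff_grad r (t - c0) = 0" if "t ~: I" for t :: real
 proof -
  have "r <= (abs (t - c0))" using that by (auto simp: I_def abs_if)
  then have "r\<^sup>2 <= (t - c0)\<^sup>2" using r(1) by (simp add: abs_le_square_iff[symmetric])
  then show ?thesis using r(1) by (simp add: cutoff_grad_def power2_eq_square)
 qed
 have gR: "cutoff_grad R y = 0" if "y ~: cball 0 R" for y :: real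
 proof -
  have "R\<^sup>2 <= y\<^sup>2" using that R by (simp add: abs_le_square_iff[symmetric])
  then show ?thesis using R by (simp add: cutoff_grad_def power2_eq_square)
 qed
 have cR: "cutoff R y = 0" if "y ~: cball 0 R" for y :: real
  using that by (intro cutoff_test1(5) R) auto
 have K: "compact K" "!!p. p ~: K ==> th p = 0" "!!p. p ~: K ==> gth p = 0"
  using out gI gR cR unfolding K_def I_def th_def gth_def
  by (auto simp: mem_Times_iff zero_prod_def intro!: compact_Times)
 have B': "AE t in lborel. ta < t --> integ (%y. E k' (t, y)) & (LBINT y. E k' (t, y)) <= B"
  using B by eventually_elim (use E_slice[of k k'] k in force)
 obtain N0 where N0: "!!n. n \<ge> N0 ==> 1 / real (Suc n) < c0 - r - ta" using Suc_inverse_small[of "c0 - r - ta"] r by auto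
 have Bz: "(LBINT q. E k' q * kap n L e (p - q)) <= B" if "n \<ge> N0" "p : K" "0 <= L" for n p L
  unfolding e_def by (rule kap_mass_bound[OF bdb_E E_nonneg B' _ that(3)])
  (use N0[OF that(1)] that(2) in "auto simp: K_def I_def mem_Times_iff")
 obtain C' where C': "0 <= C'" "!!p. (abs (F k' p)) <= C' * E k' p" using F_le_E[of k'] by metis
 define G where "G p = th p * E k p" for p
 have bG: "bdb G" unfolding G_def[abs_def] by (intro bdb_mult test1_bdb(1)[OF t] bdb_E)
 have G0: "G p = 0" if "p ~: K" for p using K(2)[OF that] by (simp add: G_def)
 have Gn: "0 <= G p" for p unfolding G_def by (intro mult_nonneg_nonneg th0 E_nonneg)
 have iG: "integ G" by (rule bdb_integrable[OF bG K(1) G0])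
 define S where "S L = (LBINT p. G p * E k' (p - L *R e))" for L
 define D where "D = B * (LBINT p. G p)"
 \<comment> \<open>Mean value argument: by Fubini the integral of \<open>S\<close> over all shifts
   in the interval is at most \<open>D\<close>, and the summand 1 makes the contradiction
   strict.\<close>
 have ex: "\<exists>L\<in>{0..\<Lambda>}. S L <= (D + 1) / \<Lambda>" if \<Lambda>: "\<Lambda> > 0" for \<Lambda>
 proof (rule ccontr)
  assume "~ ?thesis"
  then have gt: "(D + 1) / \<Lambda> <= S L" if "L : {0..\<Lambda>}" for L using that by (meson not_le order_less_imp_le)
  define f where "f w = G (fst w) * (ind {0..\<Lambda>} (snd w) * E k' (fst w - snd w *R e))" for w
  have bf: "bdb f" unfolding f_def[abs_def]
  proof (intro bdb_mult bdb_fst[OF bG] bdb_snd[OF bdb_indicator] bdb_comp[OF bdb_E])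
  show "(%w::(R2) \<times> real. fst w - snd w *R e) : bmeas"
  by (intro borel_measurable_continuous_onI continuous_intros)
  qed simp
  obtain C1 where C1: "!!w. (abs (f w)) <= C1" using bdb_abs_bound[OF bf] by metis
  have f0: "f w = 0" if "w ~: K \<times> {0..\<Lambda>}" for w using that G0[of "fst w"] by (cases "fst w : K") (auto simp: f_def mem_Times_iff)
  note Ff = fubini_bounded_support[OF bdb_measurable[OF bf] C1 compact_Times[OF K(1) compact_Icc] f0]
  have S_eq: "(LBINT p. f (p, L)) = ind {0..\<Lambda>} L * S L" for L
  unfolding f_def S_def by (subst integral_mult_right_zero[symmetric]) (simp add: mult.left_commute)
  have "D + 1 = (LBINT L. ind {0..\<Lambda>} L * ((D + 1) / \<Lambda>))" using \<Lambda> by simp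
  also have "... <= (LBINT L. LBINT p. f (p, L))"
  by (rule integral_mono[OF Icc_integrable Ff(5)]) (use gt in "auto simp: S_eq indicator_def")
  also have "... = (LBINT p. LBINT L. f (p, L))" by (rule Ff(6)[symmetric])
  also have "... <= (LBINT p. B * G p)"
  proof (rule integral_mono_AE[OF Ff(4)])
  show "integ (%p. B * G p)" using iG by auto
  show "AE p in lborel. (LBINT L. f (p, L)) <= B * G p"
  using AE_fst[OF B', where 'b = real]
  proof eventually_elim
  case (elim p)
  show ?case
  proof (cases "p : K")
  case True
  then have "ta < fst p" using r by (auto simp: K_def I_def mem_Times_iff)
  then have i: "integ (%y. E k' (fst p, y))" "(LBINT y. E k' (fst p, y)) <= B" using elim by auto
  have pe: "p - L *R e = (fst p, snd p - L)" for L by (simp add: e_def prod_eq_iff)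
  have "f (p, L) = G p * (ind {0..\<Lambda>} L * E k' (fst p, snd p - L))" for L by (simp add: f_def pe)
  then have "(LBINT L. f (p, L)) = G p * (LBINT L. ind {0..\<Lambda>} L * E k' (fst p, snd p - L))"
  by (simp only: integral_mult_right_zero)
  also have "... <= G p * (LBINT L. E k' (fst p, snd p - L))"
  proof (intro mult_left_mono Gn integral_mono_AE' lborel_integrable_reflect i(1) AE_I2)
  show "ind {0..\<Lambda>} L * E k' (fst p, snd p - L) <= E k' (fst p, snd p - L)" for L
  using E_nonneg by (simp add: indicator_def)
  qed (rule E_nonneg)
  also have "(LBINT L. E k' (fst p, snd p - L)) = (LBINT y. E k' (fst p, y))"
  by (intro lborel_integral_reflect E_slice_measurable)
  also have "G p * ... <= G p * B" using i(2) by (intro mult_left_mono Gn)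
  finally show ?thesis by (simp add: mult.commute)
  qed (simp add: f_def G0)
  qed
  qed
  also have "... = D" by (simp add: D_def)
  finally show False by simp
 qed
 define A where "A = c * (k' - k) * (LBINT p. th p * (E k p * E k' p))"
 have bh: "bdb (%p. h (p - L *R e))" if "bdb h" for h :: "R2 => real" and L by (rule bdb_comp[OF that]) simp
 have ct: "bdb th" using test1_bdb(1)[OF t] .
 have iK: "integ (%p. th p * h p)" if "bdb h" for h
  by (rule bdb_integrable[OF bdb_mult[OF ct that] K(1)]) (simp add: K(2))
 have grad_bound: "(LBINT p. (abs ((E k p, F k p) \<bullet> gth p))) <= B * (8 + 8 * C * r / R)"
 proof -
  \<comment> \<open>The gradient bounds of the cutoffs in time and in space, the latter weighted by
    the bound of the flux by the density. Integration over the time interval of length 2 r turns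
    \<open>be\<close> into 8 + 8 C r / R.\<close>
  define be where "be = 4 / r + 4 * C / R"
  have be0: "0 <= be" using C r R by (simp add: be_def)
  have pw: "(abs ((E k p, F k p) \<bullet> gth p)) <= ind K p * (E k p * be)" for p
  proof (cases "p : K")
  case True
  have "(abs ((E k p, F k p) \<bullet> gth p)) <= E k p * ((abs (cutoff R (snd p))) * (abs (cutoff_grad r (fst p - c0)))) + (abs (F k p)) * ((abs (cutoff r (fst p - c0))) * (abs (cutoff_grad R (snd p))))"
  unfolding gth_def using E_nonneg[of k p] by (auto simp: inner_prod_def abs_mult intro!: order_trans[OF abs_triangle_ineq])
  also have "... <= E k p * (1 * (4 / r)) + (C * E k p) * (1 * (4 / R))"
  proof (intro add_mono mult_mono C(2) E_nonneg)
  show "(abs (cutoff R (snd p))) <= 1" "(abs (cutoff r (fst p - c0))) <= 1"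
  using cutoff_test1(2,3)[OF R, of "snd p"] cutoff_test1(2,3)[OF r(1), of "fst p - c0"] by auto
  show "(abs (cutoff_grad r (fst p - c0))) <= 4 / r" "(abs (cutoff_grad R (snd p))) <= 4 / R"
  using cutoff_test1(4)[OF R, of "snd p"] cutoff_test1(4)[OF r(1), of "fst p - c0"] by auto
  qed (use C E_nonneg in auto)
  finally show ?thesis using True by (simp add: be_def algebra_simps)
  qed (simp add: K(3))
  have iE: "integ (%p. ind K p * (E k p * be))"
  by (rule bdb_integrable[OF bdb_mult[OF bdb_indicator[OF K(1)] bdb_mult[OF bdb_E bdb_const]] K(1)]) simp
  have "(LBINT p. (abs ((E k p, F k p) \<bullet> gth p))) <= (LBINT p. ind K p * (E k p * be))"
  by (rule integral_mono[OF integrable_abs[OF test1_int[OF bdb_Pair[OF bdb_E bdb_F] t]] iE pw])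
  also have "... = (LBINT t. LBINT y. ind K (t, y) * (E k (t, y) * be))"
  using lborel_pair.integral_fst'[of "%p. ind K p * (E k p * be)"] iE by (simp add: lborel_prod)
  also have "... <= (LBINT t. ind I t * (B * be))"
  proof (rule integral_mono_AE)
  show "integ (%t. LBINT y. ind K (t, y) * (E k (t, y) * be))"
  using lborel_pair.integrable_fst'[of "%p. ind K p * (E k p * be)"] iE by (simp add: lborel_prod)
  show "integ (%t. ind I t * (B * be))" unfolding I_def by (rule Icc_integrable)
  show "AE t in lborel. (LBINT y. ind K (t, y) * (E k (t, y) * be)) <= ind I t * (B * be)"
  using B
  proof eventually_elim
  case (elim t)
  show ?case
  proof (cases "t : I")
  case True
  then have i: "integ (%y. E k (t, y))" "(LBINT y. E k (t, y)) <= B" using elim r by (auto simp: I_def)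
  have "(LBINT y. ind K (t, y) * (E k (t, y) * be)) <= (LBINT y. E k (t, y) * be)"
  using i(1) be0 E_nonneg by (intro integral_mono_AE' AE_I2) (auto simp: indicator_def)
  also have "... <= B * be" using i be0 by (simp add: mult_right_mono)
  finally show ?thesis using True by simp
  qed (simp add: K_def)
  qed
  qed
  also have "... = 2 * r * (B * be)" using r by (simp add: I_def)
  also have "... = B * (8 + 8 * C * r / R)" using r by (simp add: be_def field_simps)
  finally show ?thesis .
 qed
 have main: "A <= (C + C') * S L + B * (B * (8 + 8 * C * r / R))" if L: "0 <= L" for L
 proof -
  \<comment> \<open>The sign of \<open>B\<close> is recovered from the hypothesis, because a mass is
    nonnegative at some time after \<open>ta\<close>.\<close>
  have Bp: "0 <= B"
  proof -
  have "AE t in lborel. ta < t --> 0 <= B"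
  using B by eventually_elim (use B_nonneg[OF E_nonneg] in "force intro: order_trans")
  then have "AE t in lborel. t ~: {ta<..<ta + 1} | 0 <= B" by eventually_elim auto
  show ?thesis
  proof (rule ccontr)
  assume "~ 0 <= B"
  with \<open>AE t in lborel. t ~: {ta<..<ta + 1} | 0 <= B\<close> have "{ta<..<ta + 1} : null_sets lborel"
  by (subst AE_iff_null_sets) auto
  then show False by (simp add: null_sets_def)
  qed
  qed
  have X: "nonpos_div ({0<..} \<times> UNIV) (%p. E j p *R (1, 0) + F j p *R e + 0 *R (0 :: R2))" if "k0 <= j" for j
  using div_E[OF that] by (simp add: e_def)
  have "(LBINT p. th p * (E k p * F k' p - E k' p * F k p)) <=
  (LBINT p. th p * (E k p * F k' (p - L *R e) - E k' (p - L *R e) * F k p)) +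
  B * (LBINT p. (abs ((E k p *R (1, 0) + F k p *R e + 0 *R (0 :: R2)) \<bullet> gth p))) + 0"
  proof (rule interaction[OF _ t th0 K L _ bdb_E bdb_E bdb_F bdb_F bdb_const bdb_const E_nonneg E_nonneg X X Bz])
  show "open ({0<..} \<times> UNIV :: (R2) set)" by (intro open_Times) auto
  show "p - s *R e : {0<..} \<times> UNIV" if "p : K" for p s
  using that r ta by (auto simp: K_def I_def e_def mem_Times_iff)
  qed (use k L in auto)
  also have "(LBINT p. (abs ((E k p *R (1, 0) + F k p *R e + 0 *R (0 :: R2)) \<bullet> gth p))) = (LBINT p. (abs ((E k p, F k p) \<bullet> gth p)))"
  by (simp add: e_def)
  finally have 1: "(LBINT p. th p * (E k p * F k' p - E k' p * F k p)) <=
  (LBINT p. th p * (E k p * F k' (p - L *R e) - E k' (p - L *R e) * F k p)) +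
  B * (LBINT p. (abs ((E k p, F k p) \<bullet> gth p)))" by simp
  have 2: "A <= (LBINT p. th p * (E k p * F k' p - E k' p * F k p))"
  proof -
  have "A = (LBINT p. th p * (c * (k' - k) * (E k p * E k' p)))"
  unfolding A_def by (subst integral_mult_right_zero[symmetric]) (simp add: algebra_simps)
  also have "... <= (LBINT p. th p * (E k p * F k' p - E k' p * F k p))"
  proof (intro integral_mono iK bdb_diff bdb_mult bdb_const bdb_E bdb_F mult_left_mono th0)
  fix p
  show "c * (k' - k) * (E k p * E k' p) <= E k p * F k' p - E k' p * F k p"
  proof (cases "k' <= W p")
  case True
  then show ?thesis using convex[OF k True] k by (simp add: E_def F_def max_def)
  next
  case False
  then show ?thesis by (simp add: E_def F_def max_def)
  qed
  qed
  finally show ?thesis .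
  qed
  have 3: "(LBINT p. th p * (E k p * F k' (p - L *R e) - E k' (p - L *R e) * F k p)) <= (C + C') * S L"
  proof -
  have "(LBINT p. th p * (E k p * F k' (p - L *R e) - E k' (p - L *R e) * F k p)) <=
  (LBINT p. th p * ((C + C') * (E k p * E k' (p - L *R e))))"
  proof (intro integral_mono iK bdb_diff bdb_mult bdb_const bdb_E bdb_F bh mult_left_mono th0)
  fix p
  have "E k p * F k' (p - L *R e) <= E k p * (C' * E k' (p - L *R e))"
  by (intro mult_left_mono E_nonneg order_trans[OF abs_ge_self C'(2)])
  moreover have "E k' (p - L *R e) * (- F k p) <= E k' (p - L *R e) * (C * E k p)"
  by (intro mult_left_mono E_nonneg order_trans[OF _ C(2)]) simp
  ultimately show "E k p * F k' (p - L *R e) - E k' (p - L *R e) * F k p <= (C + C') * (E k p * E k' (p - L *R e))"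
  by (simp add: algebra_simps)
  qed
  also have "... = (C + C') * S L"
  unfolding S_def G_def by (subst integral_mult_right_zero[symmetric]) (simp add: algebra_simps)
  finally show ?thesis .
  qed
  have "B * (LBINT p. (abs ((E k p, F k p) \<bullet> gth p))) <= B * (B * (8 + 8 * C * r / R))"
  by (rule mult_left_mono[OF grad_bound Bp])
  with 1 2 3 show ?thesis by linarith
 qed
 have "A <= B * (B * (8 + 8 * C * r / R)) + (C + C') * (D + 1) * inverse (real (Suc n))" for n
 proof -
  obtain L where L: "L : {0..real (Suc n)}" "S L <= (D + 1) / real (Suc n)" using ex[of "real (Suc n)"] by auto
  have "(C + C') * S L <= (C + C') * ((D + 1) / real (Suc n))" using L(2) C C' by (intro mult_left_mono) auto
  then show ?thesis using main[of L] L(1) by (simp add: divide_inverse)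
 qed
 moreover have "(%n. B * (B * (8 + 8 * C * r / R)) + (C + C') * (D + 1) * inverse (real (Suc n))) ~~>
  B * (B * (8 + 8 * C * r / R)) + (C + C') * (D + 1) * 0"
  by (intro tendsto_intros LIMSEQ_inverse_real_of_nat)
 ultimately have "A <= B * (B * (8 + 8 * C * r / R)) + (C + C') * (D + 1) * 0"
  by (intro LIMSEQ_le_const) auto
 then show ?thesis by (simp add: A_def th_def power2_eq_square)
qed

text \<open>Where \<open>W\<close> exceeds \<open>k + d\<close>, the excess over \<open>k\<close> is
  at least \<open>d\<close> and the one over \<open>k + d / 2\<close> dominates the one over
  \<open>k + d\<close>. The interaction of the levels \<open>k\<close> and \<open>k + d / 2\<close>
  therefore bounds the mass above \<open>k + d\<close>, integrated over part of the time step, by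
  B^2; monotonicity carries the bound to all later times.\<close>

lemma level_step:
 assumes k: "k0 <= k" and ta: "0 <= ta" and d: "0 < d" and de: "0 < de"
  and B: "AE t in lborel. ta < t --> integ (%y. E k (t, y)) & (LBINT y. E k (t, y)) <= B"
 shows "AE t in lborel. ta + de < t --> integ (%y. E (k + d) (t, y)) &
  (LBINT y. E (k + d) (t, y)) <= 256 * B\<^sup>2 / (c * de * d\<^sup>2)"
proof -
 define k'' where "k'' = k + d"
 \<comment> \<open>The time cutoff of radius de / 4 about the middle of the step vanishes up to
   \<open>ta\<close>. On its inner half \<open>[s1, s2]\<close>, of length de / 4, it is at least
   (3/4)^2 >= 1/2, and \<open>s2\<close> comes before \<open>ta + de\<close>.\<close>
 define c0 where "c0 = ta + de / 2"
 define r where "r = de / 4"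
 define s1 where "s1 = c0 - de / 8"
 define s2 where "s2 = c0 + de / 8"
 define I where "I = {s1..s2}"
 have r: "0 < r" "ta < c0 - r" and s: "0 < s1" "s1 < s2" "ta < s1" "s2 < ta + de" "s2 - s1 = de / 4"
  using de ta by (auto simp: r_def c0_def s1_def s2_def)
 obtain C where C: "0 <= C" "!!p. (abs (F k p)) <= C * E k p" using F_le_E[of k] by metis
 have B'': "AE t in lborel. ta < t --> integ (%y. E k'' (t, y)) & (LBINT y. E k'' (t, y)) <= B"
  using B by eventually_elim (use E_slice[of k k''] d in "force simp: k''_def")
 define m where "m t = (LBINT y. E k'' (t, y))" for t
 have mE: "E k'' : borel_measurable (lborel \<Otimes>\<^sub>M lborel)" using bdb_measurable[OF bdb_E] by (simp add: lborel_prod)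
 have mm: "m : bmeas"
  using lborel.borel_measurable_lebesgue_integral[of "%t y. E k'' (t, y)" lborel] mE unfolding m_def[abs_def] by simp
 have m0: "0 <= m t" for t unfolding m_def by (intro B_nonneg E_nonneg)
 have iIm: "integ (%t. ind I t * m t)"
 proof (rule B_ibound[OF Icc_integrable])
  show "AE t in lborel. norm (ind I t * m t) <= norm (ind {s1..s2} t * B)"
  using B'' by eventually_elim (use s m0 in "auto simp: I_def indicator_def m_def")
 qed (use mm in "simp add: I_def")
 have iE: "integ (%p. ind I (fst p) * E k'' p)"
 proof -
  have "integrable (lborel \<Otimes>\<^sub>M lborel) (%p. ind I (fst p) * E k'' p)"
  proof (rule lborel_pair.Fubini_integrable)
  show "AE t in lborel. integ (%y. ind I (fst (t, y)) * E k'' (t, y))"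
  using B'' by eventually_elim (use s in "auto simp: indicator_def I_def")
  show "integ (%t. LBINT y. norm (ind I (fst (t, y)) * E k'' (t, y)))"
  using iIm E_nonneg by (simp add: m_def abs_mult)
  show "(%p. ind I (fst p) * E k'' p) : borel_measurable (lborel \<Otimes>\<^sub>M lborel)"
  using bdb_measurable[OF bdb_mult[OF bdb_fst[OF bdb_indicator[of I]] bdb_E]] by (simp add: lborel_prod I_def)
  qed
  then show ?thesis by (simp add: lborel_prod)
 qed
 define Q where "Q = (LBINT p. ind I (fst p) * E k'' p)"
 have Qm: "Q = (LBINT t. ind I t * m t)"
  unfolding Q_def m_def using lborel_pair.integral_fst'[of "%p. ind I (fst p) * E k'' p"] iE by (simp add: lborel_prod)
 have "c * (d / 2) * (d / 2) * (LBINT p. cutoff (real (Suc n)) (snd p) * (ind I (fst p) * E k'' p))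
  <= B\<^sup>2 * (8 + 8 * C * r * inverse (real (Suc n)))" for n
 proof -
  have ob: "0 <= cutoff (real (Suc n)) y" "cutoff (real (Suc n)) y <= 1" for y :: real by (rule cutoff_test1; simp)+
  have rb: "0 <= cutoff r t" "cutoff r t <= 1" for t :: real by (rule cutoff_test1[OF r(1)])+
  let ?f = "%p. cutoff r (fst p - c0) * cutoff (real (Suc n)) (snd p) * (E k p * E (k + d / 2) p)"
  have bc: "bdb (%p::R2. cutoff r (fst p - c0))" "bdb (%p::R2. cutoff (real (Suc n)) (snd p))"
  by (rule bdb_fst[of "%t. cutoff r (t - c0)"], rule bdb_comp[OF test1_bdb(1)[OF cutoff_test1(1)[OF r(1)]]], simp)
  (rule bdb_snd[OF test1_bdb(1)[OF cutoff_test1(1)]], simp)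
  have i1: "integ ?f"
  proof (rule bdb_integrable[of _ "{c0 - r..c0 + r} \<times> cball 0 (real (Suc n))"])
  show "bdb ?f" by (intro bdb_mult bc bdb_E)
  show "?f p = 0" if "p ~: {c0 - r..c0 + r} \<times> cball 0 (real (Suc n))" for p
  proof (cases "fst p : {c0 - r..c0 + r}")
  case True
  then have "real (Suc n) <= norm (snd p)" using that by (auto simp: mem_Times_iff)
  then have "cutoff (real (Suc n)) (snd p) = 0" by (intro cutoff_test1(5)) auto
  then show ?thesis by (simp only: mult_zero_right mult_zero_left)
  next
  case False
  then have "r <= norm (fst p - c0)" by (auto simp: abs_if)
  then have "cutoff r (fst p - c0) = 0" by (intro cutoff_test1(5) r)
  then show ?thesis by (simp only: mult_zero_left)
  qed
  qed (auto intro!: compact_Times)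
  have i2: "integ (%p. cutoff (real (Suc n)) (snd p) * (ind I (fst p) * E k'' p))"
  using integrable_mult_bounded[OF iE, of "%p. cutoff (real (Suc n)) (snd p)" 1] bdb_measurable[OF bc(2)] ob by (simp add: mult.commute)
  have le: "(d / 2) * (cutoff (real (Suc n)) (snd p) * (ind I (fst p) * E k'' p)) <= ?f p" for p
  proof (cases "fst p : I & k'' < W p")
  case True
  have "(abs (fst p - c0)) <= r / 2" using True by (auto simp: I_def s1_def s2_def r_def abs_if)
  then have "(abs ((fst p - c0) / r)) <= 1 / 2" using r by (simp add: field_simps abs_if split: if_splits)
  then have "((fst p - c0) / r)\<^sup>2 <= (1 / 2)\<^sup>2" by (metis abs_ge_zero power2_abs power_mono)
  moreover have "((fst p - c0) / r)\<^sup>2 = ((fst p - c0) \<bullet> (fst p - c0)) / r\<^sup>2" "(1 / 2 :: real)\<^sup>2 = 1 / 4"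
  by (simp_all add: power_divide power2_eq_square)
  ultimately have "((fst p - c0) \<bullet> (fst p - c0)) / r\<^sup>2 <= 1 / 4" by linarith
  then have "3 / 4 <= max 0 (1 - ((fst p - c0) \<bullet> (fst p - c0)) / r\<^sup>2)" by (intro max.coboundedI2) linarith
  then have "(3 / 4)\<^sup>2 <= cutoff r (fst p - c0)" unfolding cutoff_def by (rule power_mono) simp
  then have 1: "1 / 2 <= cutoff r (fst p - c0)" by (simp add: power2_eq_square)
  have 2: "d <= E k p" "E k'' p <= E (k + d / 2) p" using True d by (auto simp: E_def k''_def)
  have "1 / 2 * (d * E k'' p) <= cutoff r (fst p - c0) * (E k p * E (k + d / 2) p)"
  using 1 2 d E_nonneg rb by (intro mult_mono mult_nonneg_nonneg) auto
  from mult_left_mono[OF this ob(1)[of "snd p"]] show ?thesis using True by (simp add: algebra_simps)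
  next
  case False
  then have "ind I (fst p) * E k'' p = 0" by (auto simp: E_def)
  moreover have "0 <= ?f p" by (intro mult_nonneg_nonneg ob rb E_nonneg)
  ultimately show ?thesis by (metis mult_zero_right)
  qed
  have "c * (d / 2) * ((d / 2) * (LBINT p. cutoff (real (Suc n)) (snd p) * (ind I (fst p) * E k'' p))) <= c * (d / 2) * (LBINT p. ?f p)"
  proof (rule mult_left_mono)
  have "(LBINT p. (d / 2) * (cutoff (real (Suc n)) (snd p) * (ind I (fst p) * E k'' p))) <= (LBINT p. ?f p)"
  by (rule integral_mono[OF integrable_mult_right[OF i2] i1 le])
  then show "(d / 2) * (LBINT p. cutoff (real (Suc n)) (snd p) * (ind I (fst p) * E k'' p)) <= (LBINT p. ?f p)" by simp
  qed (use c d in simp)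
  also have "... <= B\<^sup>2 * (8 + 8 * C * r / real (Suc n))"
  proof -
  have *: "c * (k + d / 2 - k) * (LBINT p. ?f p) <= B\<^sup>2 * (8 + 8 * C * r / real (Suc n))"
  by (rule interaction_1d[OF k _ ta r _ B C]) (use d in simp_all)
  have "k + d / 2 - k = d / 2" by simp
  from *[unfolded this] show ?thesis .
  qed
  finally show ?thesis unfolding divide_inverse[of _ "real (Suc n)"] mult.assoc .
 qed
 moreover have "(%n. LBINT p. cutoff (real (Suc n)) (snd p) * (ind I (fst p) * E k'' p)) ~~> Q"
  unfolding Q_def
 proof (rule integral_dominated_convergence[where w = "%p. (abs (ind I (fst p) * E k'' p))"])
  show "AE p in lborel. (%n. cutoff (real (Suc n)) (snd p) * (ind I (fst p) * E k'' p)) ~~> ind I (fst p) * E k'' p"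
  proof (rule AE_I2)
  fix p :: "R2"
  have "(%n. cutoff (real (Suc n)) (snd p) * (ind I (fst p) * E k'' p)) ~~> 1 * (ind I (fst p) * E k'' p)"
  by (intro tendsto_mult cutoff_tendsto tendsto_const)
  then show "(%n. cutoff (real (Suc n)) (snd p) * (ind I (fst p) * E k'' p)) ~~> ind I (fst p) * E k'' p"
  by (simp only: mult_1)
  qed
  show "AE p in lborel. norm (cutoff (real (Suc n)) (snd p) * (ind I (fst p) * E k'' p)) <= (abs (ind I (fst p) * E k'' p))" for n
  proof (rule AE_I2)
  fix p :: "R2"
  have "0 <= cutoff (real (Suc n)) (snd p)" "cutoff (real (Suc n)) (snd p) <= 1" by (rule cutoff_test1; simp)+
  then show "norm (cutoff (real (Suc n)) (snd p) * (ind I (fst p) * E k'' p)) <= (abs (ind I (fst p) * E k'' p))"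
  unfolding real_norm_def abs_mult by (intro mult_left_le_one_le) auto
  qed
  show "(%p. cutoff (real (Suc n)) (snd p) * (ind I (fst p) * E k'' p)) : lmeas" for n
  using borel_measurable_times[OF bdb_measurable[OF bdb_snd[OF test1_bdb(1)[OF cutoff_test1(1)[of "real (Suc n)"]]]], of "%p. ind I (fst p) * E k'' p"]
  borel_measurable_integrable[OF iE] by simp
 qed (use iE in auto)
 ultimately have "c * (d / 2) * (d / 2) * Q <= B\<^sup>2 * (8 + 8 * C * r * 0)"
  by (intro LIMSEQ_le[OF tendsto_mult_left tendsto_mult_left[OF tendsto_add[OF tendsto_const tendsto_mult_left[OF LIMSEQ_inverse_real_of_nat]]]]) auto
 \<comment> \<open>One factor d / 2 is the gap between the levels, the other is the excess
   \<open>d\<close> times the lower bound 1/2 of the cutoff; with the interaction constant 8 this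
   gives 32. The time average contributes 2 / (de / 4), so the final constant is 256.\<close>
 then have Q: "Q <= 32 * B\<^sup>2 / (c * d\<^sup>2)" using c d by (simp add: field_simps power2_eq_square)
 have "AE t in lborel. s2 < t & t < real n --> m t <= 256 * B\<^sup>2 / (c * de * d\<^sup>2)" for n
 proof (cases "s2 < real n")
  case True
  obtain C'' where C'': "0 <= C''" "!!p. (abs (F k'' p)) <= C'' * E k'' p" using F_le_E[of k''] by metis
  have sh: "AE t in lborel. 0 < t & t < real n --> integ (%y. E k'' (t, y)) & (LBINT y. E k'' (t, y)) <= M"
  using mass
  proof eventually_elim
  case (elim t)
  show ?case
  proof (intro impI)
  assume t: "0 < t & t < real n"
  have le: "E k'' (t, y) <= max 0 (W (t, y))" for y using k k0 d by (auto simp: E_def k''_def)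
  have i: "integ (%y. E k'' (t, y))"
  by (rule B_ibound[of _ "%y. max 0 (W (t, y))"])
  (use elim t E_slice_measurable E_nonneg le in "auto intro!: AE_I2 simp: abs_of_nonneg")
  then show "integ (%y. E k'' (t, y)) & (LBINT y. E k'' (t, y)) <= M"
  using elim t by (auto intro!: order_trans[OF integral_mono[OF i _ le]])
  qed
  qed
  have "AE t in lborel. s2 < t & t < real n --> m t <= 2 / (s2 - s1) * (LBINT t. ind {s1..s2} t * m t)"
  unfolding m_def
  by (rule mass_average[OF bdb_E bdb_F div_E E_nonneg _ s(1,2) True sh])
  (use k d C'' in "auto simp: k''_def")
  moreover have "2 / (s2 - s1) * (LBINT t. ind {s1..s2} t * m t) <= 256 * B\<^sup>2 / (c * de * d\<^sup>2)"
  proof -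
  have "2 / (de / 4) * Q <= 2 / (de / 4) * (32 * B\<^sup>2 / (c * d\<^sup>2))" using Q de by (intro mult_left_mono) auto
  moreover have "2 / (de / 4) * (32 * B\<^sup>2 / (c * d\<^sup>2)) = 256 * B\<^sup>2 / (c * de * d\<^sup>2)" using de c d by (simp add: field_simps)
  ultimately show ?thesis unfolding s(5) by (simp only: Qm I_def)
  qed
  ultimately show ?thesis by (auto elim!: eventually_mono)
 qed (auto intro!: AE_I2)
 then have "AE t in lborel. ALL n. s2 < t & t < real n --> m t <= 256 * B\<^sup>2 / (c * de * d\<^sup>2)" unfolding AE_all_countable by blast
 then show ?thesis using B''
 proof eventually_elim
  case (elim t)
  show ?case
  proof
  assume t: "ta + de < t"
  obtain n where "t < real n" using reals_Archimedean2 by blast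
  then show "integ (%y. E (k + d) (t, y)) & (LBINT y. E (k + d) (t, y)) <= 256 * B\<^sup>2 / (c * de * d\<^sup>2)"
  using elim t s de by (auto simp: m_def k''_def)
  qed
 qed
qed

text \<open>
 With \<open>T / 2^(n + 1)\<close> and \<open>K / 2^(n + 1)\<close> for the steps in time and level, the mass above the level
 decays like \<open>M / 16^n\<close>; the constant is chosen so that this propagates through the quadratic recursion.
\<close>

theorem upper_bound:
 assumes T: "0 < T" and K: "0 < K" and M: "0 <= M" "32768 * M <= c * T * K\<^sup>2"
 shows "AE p in lborel. T < fst p --> W p <= k0 + K"
proof -
 define q :: "nat => real" where "q n = 1 - 1 / 2 ^ n" for n
 have q1: "q n <= 1" "q (Suc n) = q n + 1 / 2 ^ Suc n" "0 <= q n" for n by (auto simp: q_def)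
 have P: "AE t in lborel. T * q n < t --> integ (%y. E (k0 + K * q n) (t, y)) &
  (LBINT y. E (k0 + K * q n) (t, y)) <= M / 16 ^ n" for n
 proof (induction n)
  case 0
  show ?case using mass
  proof eventually_elim
  case (elim t)
  show ?case
  proof
  assume t: "T * q 0 < t"
  have le: "E k0 (t, y) <= max 0 (W (t, y))" for y using k0 by (auto simp: E_def)
  have i: "integ (%y. E k0 (t, y))"
  by (rule B_ibound[of _ "%y. max 0 (W (t, y))"])
  (use elim t E_slice_measurable E_nonneg le in "auto intro!: AE_I2 simp: abs_of_nonneg q_def")
  then show "integ (%y. E (k0 + K * q 0) (t, y)) & (LBINT y. E (k0 + K * q 0) (t, y)) <= M / 16 ^ 0"
  using elim t by (auto simp: q_def intro!: order_trans[OF integral_mono[OF i _ le]])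
  qed
  qed
 next
  case (Suc n)
  have *: "AE t in lborel. T * q n + T / 2 ^ Suc n < t --> integ (%y. E (k0 + K * q n + K / 2 ^ Suc n) (t, y)) &
  (LBINT y. E (k0 + K * q n + K / 2 ^ Suc n) (t, y)) <= 256 * (M / 16 ^ n)\<^sup>2 / (c * (T / 2 ^ Suc n) * (K / 2 ^ Suc n)\<^sup>2)"
  by (rule level_step[OF _ _ _ _ Suc.IH]) (use K T q1 in auto)
  have le: "256 * (M / 16 ^ n)\<^sup>2 / (c * (T / 2 ^ Suc n) * (K / 2 ^ Suc n)\<^sup>2) <= M / 16 ^ Suc n"
  proof -
  \<comment> \<open>In terms of \<open>a\<close> the recursion produces 2048 M^2 / (a^5 c T K^2),
    with 2048 = 256 * 8. Comparison with M / (16 a^4) explains 32768 = 16 * 2048 and leaves a factor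
    a >= 1 to spare.\<close>
  define a where "a = (2::real) ^ n"
  have a: "a \<ge> 1" by (simp add: a_def)
  have p: "(16::real) ^ n = a ^ 4" "(2::real) ^ Suc n = 2 * a" "(16::real) ^ Suc n = 16 * a ^ 4"
  by (simp_all add: a_def power_mult[symmetric] mult.commute[of n] power_mult)
  have cTK: "c * T * K\<^sup>2 > 0" using c T K by simp
  have "256 * (M / 16 ^ n)\<^sup>2 / (c * (T / 2 ^ Suc n) * (K / 2 ^ Suc n)\<^sup>2)
  = 256 * M\<^sup>2 * (8 * a ^ 3) / (a ^ 8 * (c * T * K\<^sup>2))"
  unfolding p by (simp add: power_mult_distrib power_divide power_numeral_reduce[of a] numeral_eq_Suc)
  also have "a ^ 8 = a ^ 3 * a ^ 5" by (simp flip: power_add)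
  also have "256 * M\<^sup>2 * (8 * a ^ 3) / (a ^ 3 * a ^ 5 * (c * T * K\<^sup>2)) = 2048 * M\<^sup>2 / (a ^ 5 * (c * T * K\<^sup>2))"
  using a by (simp add: divide_simps)
  also have "... <= M / (16 * a ^ 4)"
  proof -
  have "2048 * M\<^sup>2 * (16 * a ^ 4) = ((32768 * M) * M) * a ^ 4" by (simp add: power2_eq_square)
  also have "... <= ((c * T * K\<^sup>2) * M) * (a ^ 4 * a)"
  by (rule mult_mono[OF mult_right_mono[OF M(2) M(1)]]) (use M a cTK in auto)
  also have "... = M * (a ^ 5 * (c * T * K\<^sup>2))" by (simp add: eval_nat_numeral)
  finally have "2048 * M\<^sup>2 * (16 * a ^ 4) <= M * (a ^ 5 * (c * T * K\<^sup>2))" .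
  moreover have "0 < a ^ 5 * (c * T * K\<^sup>2)" "0 < 16 * a ^ 4" using cTK a by auto
  ultimately show ?thesis by (simp only: times_divide_eq_left pos_divide_le_eq pos_le_divide_eq)
  qed
  finally show ?thesis unfolding p .
  qed
  have "T * q n + T / 2 ^ Suc n = T * q (Suc n)" "k0 + K * q n + K / 2 ^ Suc n = k0 + K * q (Suc n)"
  unfolding q1(2) by (simp_all add: algebra_simps)
  then have "AE t in lborel. T * q (Suc n) < t --> integ (%y. E (k0 + K * q (Suc n)) (t, y)) &
  (LBINT y. E (k0 + K * q (Suc n)) (t, y)) <= 256 * (M / 16 ^ n)\<^sup>2 / (c * (T / 2 ^ Suc n) * (K / 2 ^ Suc n)\<^sup>2)"
  using * by (simp only:)
  then show ?case by eventually_elim (use le in "blast intro: order_trans")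
 qed
 then have "AE t in lborel. ALL n. T * q n < t --> integ (%y. E (k0 + K * q n) (t, y)) &
  (LBINT y. E (k0 + K * q n) (t, y)) <= M / 16 ^ n" unfolding AE_all_countable by blast
 then have sl: "AE t in lborel. AE y in lborel. T < t --> W (t, y) <= k0 + K"
 proof eventually_elim
  case (elim t)
  show ?case
  proof (cases "T < t")
  case True
  define k where "k = k0 + K"
  have Tq: "T * q n < t" for n using mult_left_mono[OF q1(1)[of n], of T] T True by linarith
  have kq: "k0 + K * q n <= k" for n using mult_left_mono[OF q1(1)[of n], of K] K by (simp add: k_def)
  have el: "integ (%y. E (k0 + K * q n) (t, y))" "(LBINT y. E (k0 + K * q n) (t, y)) <= M / 16 ^ n" for n
  by (rule conjunct1[OF elim[rule_format, OF Tq]], rule conjunct2[OF elim[rule_format, OF Tq]])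
  have i: "integ (%y. E k (t, y))" by (rule E_slice(1)[OF kq el(1)])
  have le: "(LBINT y. E k (t, y)) <= M * (1 / 16) ^ n" for n
  proof -
  have "(LBINT y. E k (t, y)) <= (LBINT y. E (k0 + K * q n) (t, y))"
  by (rule E_slice(2)[OF kq el(1)])
  also have "... <= M / 16 ^ n" by (rule el)
  finally show ?thesis by (simp add: power_divide)
  qed
  have "(%n. M * (1 / 16) ^ n) ~~> M * 0" by (rule tendsto_mult_left[OF LIMSEQ_realpow_zero]) simp_all
  then have "(LBINT y. E k (t, y)) <= M * 0" by (rule LIMSEQ_le_const) (intro exI allI impI le)
  moreover have "0 <= (LBINT y. E k (t, y))" by (intro B_nonneg E_nonneg)
  ultimately have "(LBINT y. E k (t, y)) = 0" by simp
  then have "AE y in lborel. E k (t, y) = 0"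
  using integral_nonneg_eq_0_iff_AE[OF i] E_nonneg by simp
  then show ?thesis
  proof eventually_elim
  case (elim y)
  then have "max (W (t, y)) k = k" by (simp add: E_def)
  then show ?case by (simp add: k_def max_def split: if_splits)
  qed
  qed simp
 qed
 have "AE p in lborel \<Otimes>\<^sub>M lborel. T < fst p --> W p <= k0 + K"
 proof (rule lborel_pair.AE_pair_measure)
  have [measurable]: "W : borel_measurable (borel \<Otimes>\<^sub>M borel)" using bdb_measurable[OF W] by (simp add: borel_prod)
  show "{p : space (lborel \<Otimes>\<^sub>M lborel). T < fst p --> W p <= k0 + K} : sets (lborel \<Otimes>\<^sub>M lborel)"
  by measurable
  show "AE t in lborel. AE y in lborel. T < fst (t, y) --> W (t, y) <= k0 + K" using sl by simp
 qed
 then show ?thesis unfolding lborel_prod .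
qed

end

section \<open>Coordinates along the distinguished direction\<close>

lemma lborel_distr_to_prod: "distr lborel lborel (%v :: real ^ 2. (v $ 1, v $ 2)) = lborel"
proof (rule lborel_eqI[symmetric])
 fix l u :: "R2" assume lu: "!!b. b : Basis ==> l \<bullet> b <= u \<bullet> b"
 have m: "(%v :: real ^ 2. (v $ 1, v $ 2)) : bmeas"
  by (intro borel_measurable_continuous_onI continuous_intros)
 define l' u' :: "real ^ 2" where "l' = vector [fst l, snd l]" and "u' = vector [fst u, snd u]"
 have B2: "(Basis :: (real ^ 2) set) = {axis 1 1, axis 2 1}" by (auto simp: Basis_vec_def UNIV_2)
 have ne: "axis 1 1 ~= (axis 2 1 :: real ^ 2)" by (simp add: axis_eq_axis)
 have lu': "fst l <= fst u" "snd l <= snd u" using lu[of "(1, 0)"] lu[of "(0, 1)"] by (auto simp: Basis_prod_def inner_prod_def)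
 have "(%v :: real ^ 2. (v $ 1, v $ 2)) -` box l u = box l' u'"
  by (auto simp: box_def B2 Basis_prod_def l'_def u'_def inner_axis inner_prod_def)
 then have "emeasure (distr lborel lborel (%v :: real ^ 2. (v $ 1, v $ 2))) (box l u) = emeasure lborel (box l' u')"
  using m by (simp add: emeasure_distr)
 also have "... = (\<Prod>b\<in>Basis. (u' - l') \<bullet> b)"
  by (rule emeasure_lborel_box) (use lu' in "auto simp: B2 l'_def u'_def inner_axis")
 also have "(\<Prod>b\<in>Basis. (u' - l') \<bullet> b) = (\<Prod>b\<in>Basis. (u - l) \<bullet> b)"
  using ne by (simp add: B2 l'_def u'_def inner_axis Basis_prod_def inner_prod_def)
 finally show "emeasure (distr lborel lborel (%v :: real ^ 2. (v $ 1, v $ 2))) (box l u) = (\<Prod>b\<in>Basis. (u - l) \<bullet> b)" .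
qed simp

lemma lborel_distr_orthogonal:
 fixes f :: "plane => plane"
 assumes f: "orthogonal_transformation f"
 shows "distr lborel lborel f = lborel"
proof (rule lborel_eqI[symmetric])
 fix l u :: plane assume lu: "!!b. b : Basis ==> l \<bullet> b <= u \<bullet> b"
 have g: "orthogonal_transformation (inv f)" by (rule orthogonal_transformation_inv[OF f])
 have m: "f : bmeas"
  by (intro borel_measurable_continuous_onI linear_continuous_on linear_conv_bounded_linear[THEN iffD1] orthogonal_transformation_linear f)
 have im: "f -` box l u = inv f ` box l u"
  by (simp add: bij_vimage_eq_inv_image orthogonal_transformation_bij f)
 have lm: "box l u : lmeasurable" by simp
 have s: "inv f ` box l u : sets borel"
  using measurable_sets[OF m, of "box l u"] im by simp
 have "inv f ` box l u : lmeasurable" by (rule measurable_orthogonal_image[OF g lm])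
 then have "emeasure lborel (inv f ` box l u) = measure lebesgue (inv f ` box l u)"
  using s emeasure_eq_measure2[of "inv f ` box l u" lebesgue] by simp
 also have "... = measure lebesgue (box l u)" by (simp add: measure_orthogonal_image[OF g lm])
 also have "... = emeasure lborel (box l u)" by (simp add: emeasure_eq_measure2)
 also have "... = (\<Prod>b\<in>Basis. (u - l) \<bullet> b)" by (rule emeasure_lborel_box[OF lu])
 finally show "emeasure (distr lborel lborel f) (box l u) = (\<Prod>b\<in>Basis. (u - l) \<bullet> b)"
  using m im by (simp add: emeasure_distr)
qed simp

locale plane_frame =
 fixes \<xi> et :: plane
 assumes norm_xi: "norm \<xi> = 1" and norm_eta: "norm et = 1" and orth: "\<xi> \<bullet> et = 0"
begin

lemma inner_frame: "\<xi> \<bullet> \<xi> = 1" "et \<bullet> et = 1" "\<xi> \<bullet> et = 0" "et \<bullet> \<xi> = 0"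
 using norm_xi norm_eta orth by (simp_all add: dot_square_norm inner_commute)

lemma frame_expand: "x = (x \<bullet> \<xi>) *R \<xi> + (x \<bullet> et) *R et"
proof -
 have "orthogonal \<xi> et" using orth by (simp add: orthogonal_def)
 have s: "span {\<xi>, et} = UNIV"
 proof -
  have ne: "\<xi> ~= et" using inner_frame by force
  have "pairwise orthogonal {\<xi>, et}" using inner_frame by (auto simp: pairwise_def orthogonal_def inner_commute)
  moreover have "0 ~: {\<xi>, et}" using norm_xi norm_eta by auto
  ultimately have i: "independent {\<xi>, et}" by (rule pairwise_orthogonal_independent)
  then show ?thesis using ne by (intro dim_eq_full[THEN iffD1]) (simp add: dim_eq_card_independent)
 qed
 then have "x : span {\<xi>, et}" by simp
 then obtain a b where "x = a *R \<xi> + b *R et" by (auto simp: span_insert span_empty algebra_simps)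
 then show ?thesis by (simp add: inner_left_distrib inner_frame)
qed

text \<open>The argument is ((t, y), s) with s the coordinate along \<xi> and y the one along
  \<open>et\<close>. The grouping lets Fubini separate s from the pair on which the reduced
  subsolution lives.\<close>

definition pt :: "(R2) \<times> real => spacetime" where
 "pt z = (fst (fst z), snd z *R \<xi> + snd (fst z) *R et)"

lemma pt_measurable [measurable]: "pt : bmeas"
 unfolding pt_def[abs_def] by (intro borel_measurable_continuous_onI continuous_intros)

lemma lborel_distr_plane: "distr lborel lborel (%z::R2. snd z *R \<xi> + fst z *R et) = lborel" (is "distr _ _ ?T = _")
proof -
 let ?J = "%v :: real ^ 2. (v $ 1, v $ 2)"
 have T: "?T : bmeas" and J: "?J : bmeas"
  by (intro borel_measurable_continuous_onI continuous_intros)+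
 have "orthogonal_transformation (%v. ?T (?J v))"
  unfolding orthogonal_transformation_def
 proof
  show "linear (%v. ?T (?J v))" by (rule linearI) (simp_all add: algebra_simps)
  have "?T (?J v) \<bullet> ?T (?J w) = v $ 1 * w $ 1 + v $ 2 * w $ 2" for v w
  by (simp add: inner_left_distrib inner_right_distrib inner_frame)
  then show "ALL v w. ?T (?J v) \<bullet> ?T (?J w) = v \<bullet> w" by (simp add: inner_vec_def UNIV_2)
 qed
 from lborel_distr_orthogonal[OF this] have "lborel = distr lborel lborel (?T \<circ> ?J)" by (simp add: o_def)
 also have "... = distr (distr lborel lborel ?J) lborel ?T"
  using T J by (intro distr_distr[symmetric]) simp_all
 finally show ?thesis by (simp add: lborel_distr_to_prod)
qed

lemma lborel_distr_pt: "distr lborel lborel pt = lborel"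
proof (rule measure_eqI)
 fix A :: "spacetime set" assume "A : sets (distr lborel lborel pt)"
 then have A1 [measurable]: "A : sets borel" by simp
 let ?T = "%z::R2. snd z *R \<xi> + fst z *R et"
 have T: "?T : bmeas" by (intro borel_measurable_continuous_onI continuous_intros)
 have m1: "(%z. ind A (pt z) :: ennreal) : borel_measurable (lborel \<Otimes>\<^sub>M lborel)"
  unfolding lborel_prod by (simp add: measurable_compose[OF pt_measurable])
 have m2: "(%y. \<integral>\<^sup>+s. ind A (pt (y, s)) \<partial>lborel) : borel_measurable (lborel \<Otimes>\<^sub>M lborel)"
  unfolding lborel_prod by (rule lborel.borel_measurable_nn_integral_fst[OF m1])
 have "emeasure (distr lborel lborel pt) A = (\<integral>\<^sup>+z. ind A z \<partial>distr lborel lborel pt)"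
  by simp
 also have "... = (\<integral>\<^sup>+z. ind A (pt z) \<partial>(lborel \<Otimes>\<^sub>M lborel))"
  unfolding lborel_prod by (rule nn_integral_distr) simp_all
 also have "... = (\<integral>\<^sup>+y. \<integral>\<^sup>+s. ind A (pt (y, s)) \<partial>lborel \<partial>lborel)"
  by (rule lborel.nn_integral_fst[symmetric, OF m1])
 also have "... = (\<integral>\<^sup>+t. \<integral>\<^sup>+y. \<integral>\<^sup>+s. ind A (pt ((t, y), s)) \<partial>lborel \<partial>lborel \<partial>lborel)"
  using lborel.nn_integral_fst[OF m2] by (simp add: lborel_prod)
 also have "... = (\<integral>\<^sup>+t. \<integral>\<^sup>+x. ind A (t, x) \<partial>lborel \<partial>lborel)"
 proof (rule nn_integral_cong)
  fix t :: real
  have s: "(%x. ind A (t, x) :: ennreal) : bmeas"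
  using measurable_compose[of "%x. (t, x)" borel borel "ind A :: _ => ennreal" borel] A1
  by (simp add: borel_measurable_continuous_onI continuous_intros)
  have m3: "(%z. ind A (t, ?T z) :: ennreal) : borel_measurable (lborel \<Otimes>\<^sub>M lborel)"
  using measurable_compose[OF T s] by (simp add: lborel_prod)
  have "(\<integral>\<^sup>+x. ind A (t, x) \<partial>lborel) = (\<integral>\<^sup>+x. ind A (t, x) \<partial>distr lborel lborel ?T)"
  by (simp only: lborel_distr_plane)
  also have "... = (\<integral>\<^sup>+z. ind A (t, ?T z) \<partial>lborel)" by (rule nn_integral_distr) (use T s in simp_all)
  also have "... = (\<integral>\<^sup>+z. ind A (t, ?T z) \<partial>(lborel \<Otimes>\<^sub>M lborel))" by (simp add: lborel_prod)
  also have "... = (\<integral>\<^sup>+y. \<integral>\<^sup>+s. ind A (t, ?T (y, s)) \<partial>lborel \<partial>lborel)"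
  by (rule lborel.nn_integral_fst[symmetric, OF m3])
  finally show "(\<integral>\<^sup>+y. \<integral>\<^sup>+s. ind A (pt ((t, y), s)) \<partial>lborel \<partial>lborel) = (\<integral>\<^sup>+x. ind A (t, x) \<partial>lborel)"
  by (simp add: pt_def)
 qed
 also have "... = (\<integral>\<^sup>+z. ind A z \<partial>(lborel \<Otimes>\<^sub>M lborel))"
  by (rule lborel.nn_integral_fst) (simp add: lborel_prod)
 also have "... = emeasure lborel A" by (simp add: lborel_prod)
 finally show "emeasure (distr lborel lborel pt) A = emeasure lborel A" .
qed simp

lemma pt_integral:
 fixes F :: "spacetime => real"
 assumes "F : bmeas"
 shows "(LBINT p. F p) = (LBINT z. F (pt z))"
proof -
 have "(LBINT p. F p) = (LINT p|distr lborel lborel pt. F p)" by (simp only: lborel_distr_pt)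
 also have "... = (LBINT z. F (pt z))" by (rule integral_distr) (use assms in simp_all)
 finally show ?thesis .
qed

lemma pt_AE:
 assumes "AE z in lborel. P (pt z)" "{p. ~ P p} : sets borel"
 shows "AE p in lborel. P p"
proof -
 have "{p : space lborel. P p} : sets lborel" using sets.compl_sets[OF assms(2)] by (simp add: Compl_eq_Diff_UNIV[symmetric] Collect_neg_eq)
 then have "AE p in distr lborel lborel pt. P p" using assms(1) by (subst AE_distr_iff) simp_all
 then show ?thesis by (simp only: lborel_distr_pt)
qed

lemma plane_integral:
 fixes F :: "plane => 'b::{banach, second_countable_topology}"
 assumes "F : bmeas"
 shows "integ (%z::R2. F (snd z *R \<xi> + fst z *R et)) \<longleftrightarrow> integ F"
  and "(LBINT z. F (snd (z::R2) *R \<xi> + fst z *R et)) = (LBINT x. F x)"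
proof -
 have T: "(%z::R2. snd z *R \<xi> + fst z *R et) : bmeas" by (intro borel_measurable_continuous_onI continuous_intros)
 show "integ (%z::R2. F (snd z *R \<xi> + fst z *R et)) \<longleftrightarrow> integ F"
  using integrable_distr_eq[of "%z::R2. snd z *R \<xi> + fst z *R et" lborel lborel F] T assms lborel_distr_plane by simp
 show "(LBINT z. F (snd (z::R2) *R \<xi> + fst z *R et)) = (LBINT x. F x)"
  using integral_distr[of "%z::R2. snd z *R \<xi> + fst z *R et" lborel lborel F] T assms lborel_distr_plane by simp
qed

end

section \<open>Dyadic translations of the line\<close>

definition grid :: "nat => real set" where
 "grid n = (%i. real i / 2 ^ n - real n) ` {..2 * n * 2 ^ n}"

text \<open>Written as a union of nested finite sets, so that suprema over dyadic shifts are
  monotone limits of finite maxima.\<close>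

definition dyadics :: "real set" where
 "dyadics = (\<Union>n. grid n)"

lemma finite_grid: "finite (grid n)" and grid_nonempty: "grid n ~= {}"
 by (auto simp: grid_def)

lemma grid_mono: "m <= n ==> grid m \<subseteq> grid n"
proof (rule lift_Suc_mono_le[of grid])
 show "grid n <= grid (Suc n)" for n
 proof
  fix q assume "q : grid n"
  then obtain i where i: "i <= 2 * n * 2 ^ n" "q = real i / 2 ^ n - real n" by (auto simp: grid_def)
  have "q = real (2 * i + 2 * 2 ^ n) / 2 ^ Suc n - real (Suc n)" using i by (simp add: field_simps)
  moreover have "2 * i + 2 * 2 ^ n <= 2 * Suc n * 2 ^ Suc n" using i by (simp add: algebra_simps)
  ultimately show "q : grid (Suc n)" unfolding grid_def by blast
 qed
qed

lemma dyadics_iff: "q : dyadics \<longleftrightarrow> (\<exists>(i::int) n. q = of_int i / 2 ^ n)"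
proof
 assume "q : dyadics"
 then obtain n i where "q = real i / 2 ^ n - real n" by (auto simp: dyadics_def grid_def)
 then have "q = of_int (int i - int n * 2 ^ n) / 2 ^ n" by (simp add: field_simps)
 then show "\<exists>(i::int) n. q = of_int i / 2 ^ n" by blast
next
 assume "\<exists>(i::int) n. q = of_int i / 2 ^ n"
 then obtain i :: int and n where q: "q = of_int i / 2 ^ n" by blast
 obtain N0 :: nat where "(abs q) <= real N0" using real_arch_simple by blast
 then obtain N where N: "n <= N" "(abs q) <= real N" by (metis max.cobounded1 max.cobounded2 of_nat_le_iff order_trans)
 define j where "j = i * 2 ^ (N - n) + int N * 2 ^ N"
 have "(2::real) ^ N = 2 ^ (N - n) * 2 ^ n" using N(1) by (simp flip: power_add)
 then have qj: "q = of_int j / 2 ^ N - real N" by (simp add: j_def q field_simps)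
 then have jq: "of_int j = (q + real N) * 2 ^ N" by (simp add: field_simps)
 have "0 <= (q + real N) * 2 ^ N" using N(2) by (intro mult_nonneg_nonneg) auto
 then have j0: "0 <= j" unfolding jq[symmetric] by simp
 have "(q + real N) * 2 ^ N <= (2 * real N) * 2 ^ N" using N(2) by (intro mult_right_mono) auto
 then have "real_of_int j <= real_of_int (2 * int N * 2 ^ N)" unfolding jq[symmetric] by simp
 then have "j <= 2 * int N * 2 ^ N" by (simp only: of_int_le_iff)
 then have "nat j <= 2 * N * 2 ^ N" using j0 by (simp add: nat_le_iff)
 moreover have "q = real (nat j) / 2 ^ N - real N" using qj j0 by simp
 ultimately have "q : grid N" unfolding grid_def by blast
 then show "q : dyadics" by (auto simp: dyadics_def)
qed

lemma dyadics_add: assumes "q : dyadics" "r : dyadics" shows "q + r : dyadics"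
proof -
 obtain i j :: int and m n where "q = of_int i / 2 ^ m" "r = of_int j / 2 ^ n" using assms dyadics_iff by meson
 then have "q + r = of_int (i * 2 ^ n + j * 2 ^ m) / 2 ^ (m + n)" by (simp add: add_frac_eq power_add)
 then show ?thesis unfolding dyadics_iff by blast
qed

lemma dyadics_uminus: assumes "q : dyadics" shows "- q : dyadics"
proof -
 obtain i :: int and m where "q = of_int i / 2 ^ m" using assms dyadics_iff by meson
 then have "- q = of_int (- i) / 2 ^ m" by simp
 then show ?thesis unfolding dyadics_iff by blast
qed

lemma dyadics_0: "0 : dyadics" unfolding dyadics_iff by (intro exI[of _ 0]) simp

lemma dyadics_dense: assumes "d > 0" obtains q where "q : dyadics" "(abs (v - q)) < d"
proof -
 obtain n where n: "(1 / 2) ^ n < d" using real_arch_pow_inv[OF assms, of "1 / 2"] by auto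
 define q :: real where "q = of_int \<lfloor>v * 2 ^ n\<rfloor> / 2 ^ n"
 have "(abs (v - q)) * 2 ^ n = (abs ((v - q) * 2 ^ n))" by (simp add: abs_mult)
 also have "... = (abs (v * 2 ^ n - of_int \<lfloor>v * 2 ^ n\<rfloor>))" by (simp add: q_def left_diff_distrib)
 also have "... < 1" by linarith
 finally have "(abs (v - q)) < 1 / 2 ^ n" by (simp add: field_simps)
 then have "(abs (v - q)) < d" using n by (simp add: power_one_over)
 moreover have "q : dyadics" unfolding q_def dyadics_iff by blast
 ultimately show ?thesis using that by blast
qed

text \<open>By continuity of translations in L1, invariance under a dense set of shifts implies
  invariance almost everywhere under each real shift. Fubini in the pair (point, shift) then shows
  that almost every value equals almost every value on the unit interval, hence the average
  there.\<close>

lemma dyadic_invariant_constant: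
 fixes f :: "real => real"
 assumes f: "bdb f" and inv: "!!q s. q : dyadics ==> f (s + q) = f s"
 shows "AE s in lborel. f s = (LBINT r. ind {0..1} r * f r)"
proof -
 have I0: "(LBINT s. ind (cball 0 R) s * (abs (f (s + v) - f s))) = 0" for R v :: real
 proof (rule antisym[OF field_le_epsilon])
  fix e :: real assume "0 < e"
  obtain d where d: "d > 0" "!!v. norm v < d ==> (LBINT x. ind (cball 0 R) x * (abs (f (x + v) - f x))) < e"
  using translation_L1_local[OF f compact_cball \<open>0 < e\<close>, of 0 R] by metis
  obtain q where q: "q : dyadics" "(abs (v - q)) < d" using dyadics_dense[OF d(1)] .
  \<comment> \<open>A nearby dyadic is subtracted, which leaves a shift smaller than
    \<open>d\<close>.\<close>
  have "f (s + v) = f (s + (v - q))" for s using inv[OF q(1), of "s + (v - q)"] by (simp add: algebra_simps)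
  then show "(LBINT s. ind (cball 0 R) s * (abs (f (s + v) - f s))) <= 0 + e"
  using d(2)[of "v - q"] q(2) by simp
 qed simp
 have main: "AE s in lborel. s : cball 0 R --> f s = (LBINT r. ind {0..1} r * f r)" for R :: real
 proof -
  obtain C where C: "!!x. (abs (f x)) <= C" using bdb_abs_bound[OF f] by metis
  have C0: "0 <= C" using C[of 0] by linarith
  note [measurable] = bdb_measurable[OF f]
  define G where "G z = ind (cball 0 R) (fst z) * ind {0..1} (fst z + snd z) * (abs (f (fst z + snd z) - f (fst z)))" for z :: "R2"
  have c: "(%z::R2. fst z + snd z) : bmeas"
  by (intro borel_measurable_continuous_onI continuous_intros)
  have "bdb G" unfolding G_def[abs_def]
  proof (intro bdb_mult)
  show "bdb (%z::R2. ind (cball 0 R) (fst z) :: real)" by (rule bdb_fst[OF bdb_indicator]) simp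
  show "bdb (%z::R2. ind {0..1} (fst z + snd z) :: real)" by (rule bdb_comp[OF bdb_indicator c]) simp
  show "bdb (%z. (abs (f (fst z + snd z) - f (fst z))))"
  by (rule bdb_comp_continuous[OF bdb_diff[OF bdb_comp[OF f c] bdb_fst[OF f]], of abs]) (intro continuous_intros)
  qed
  note Gm = bdb_measurable[OF this]
  have GC: "(abs (G z)) <= 2 * C" for z
  using C[of "fst z + snd z"] C[of "fst z"] by (auto simp: G_def indicator_def)
  have GK: "G z = 0" if "z ~: cball 0 R \<times> cball 0 ((abs R) + 1)" for z
  using that by (auto simp: G_def indicator_def mem_Times_iff abs_if split: if_splits)
  note F = fubini_bounded_support[OF Gm GC compact_Times[OF compact_cball compact_cball] GK]
  have Gh: "(LBINT s. G (s, h)) = 0" for h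
  proof (rule antisym)
  have "(LBINT s. G (s, h)) <= (LBINT s. ind (cball 0 R) s * (abs (f (s + h) - f s)))"
  by (rule integral_mono[OF F(3)])
  (auto simp: G_def indicator_def C0 intro!: integrable_bounded_support[of _ "2 * C" "cball 0 R"] order_trans[OF abs_triangle_ineq4] add_mono[OF C C, simplified])
  then show "(LBINT s. G (s, h)) <= 0" by (simp only: I0)
  qed (simp add: G_def)
  have "(LBINT s. LBINT h. G (s, h)) = (LINT h|(lborel :: real measure). 0)"
  by (rule trans[OF F(6) B_cong[OF refl Gh]])
  then have "(LBINT s. LBINT h. G (s, h)) = 0" by simp
  then have "AE s in lborel. (LBINT h. G (s, h)) = 0"
  by (subst (asm) integral_nonneg_eq_0_iff_AE[OF F(4)]) (auto simp: G_def)
  then show ?thesis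
  proof eventually_elim
  case (elim s)
  show ?case
  proof
  assume s: "s : cball 0 R"
  have m: "(%r. ind {0..1} r * (abs (f r - f s))) : bmeas" by measurable
  have "(LBINT r. ind {0..1} r * (abs (f r - f s))) = (LBINT h. G (s, h))"
  using lborel_integral_shift[OF m, of s] s by (simp add: G_def add.commute)
  then have z: "(LBINT r. ind {0..1} r * (abs (f r - f s))) = 0" using elim by simp
  have i1: "integ (%r. ind {0..1} r * f r)"
  by (rule bdb_integrable[of _ "{0..1}"]) (auto intro!: bdb_mult bdb_indicator f)
  have i2: "integ (%r::real. ind {0..1} r * f s)" by (rule Icc_integrable)
  have eq: "(LBINT r. ind {0..1} r * f r) - f s = (LBINT r. ind {0..1} r * f r - ind {0..1} r * f s)"
  using B_diff[OF i1 i2] by simp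
  have "(abs ((LBINT r. ind {0..1} r * f r) - f s)) <= (LBINT r. (abs (ind {0..1} r * f r - ind {0..1} r * f s)))"
  unfolding eq by (rule integral_abs_bound)
  also have "... = 0" using z by (simp add: right_diff_distrib[symmetric] abs_mult)
  finally show "f s = (LBINT r. ind {0..1} r * f r)" by simp
  qed
  qed
 qed
 have "AE s in lborel. \<forall>n::nat. s : cball 0 (real n) --> f s = (LBINT r. ind {0..1} r * f r)"
  unfolding AE_all_countable using main by blast
 then show ?thesis by eventually_elim (metis mem_cball_0 real_arch_simple)
qed

text \<open>The discrete form of the bound of a supremum by an end value and the total
  variation.\<close>

lemma Max_chain_bound:
 fixes a :: "nat => real"
 shows "Max (a ` {..m}) <= (abs (a 0)) + (\<Sum>i<m. (abs (a (Suc i) - a i)))"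
proof -
 have "a j <= (abs (a 0)) + (\<Sum>i<j. (abs (a (Suc i) - a i)))" for j
  by (induction j) (auto simp: abs_if split: if_splits)
 moreover have "(\<Sum>i<j. (abs (a (Suc i) - a i))) <= (\<Sum>i<m. (abs (a (Suc i) - a i)))" if "j <= m" for j
  using that by (intro sum_mono2) auto
 ultimately have "a j <= (abs (a 0)) + (\<Sum>i<m. (abs (a (Suc i) - a i)))" if "j <= m" for j
  using that by (meson add_left_mono order_trans)
 then show ?thesis by (intro Max.boundedI) auto
qed

text \<open>Unit windows shifted by multiples of 2^-n overlap at most 2^n + 1 times at any point.
  This multiplicity is what the mesh size of the increments has to compensate in
  \<open>mass_W_slice\<close>.\<close>

lemma card_window:
 "(\<Sum>i<m. ind {0..1} (s + L - real i / 2 ^ n)) <= (2 ^ n + 1 :: real)"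
proof -
 define j where "j = nat \<lceil>(s + L - 1) * 2 ^ n\<rceil>"
 have "(\<Sum>i<m. ind {0..1} (s + L - real i / 2 ^ n)) = (\<Sum>i<m. of_bool (s + L - real i / 2 ^ n : {0..1}) :: real)"
  by (simp add: indicator_def of_bool_def)
 also have "... = real (card ({..<m} \<inter> {i. s + L - real i / 2 ^ n : {0..1}}))"
  by (simp add: sum_of_bool_eq)
 also have "... <= real (card {j..j + 2 ^ n})"
 proof (intro of_nat_mono card_mono)
  show "{..<m} \<inter> {i. s + L - real i / 2 ^ n : {0..1}} \<subseteq> {j..j + 2 ^ n}"
  proof
  fix i assume "i : {..<m} \<inter> {i. s + L - real i / 2 ^ n : {0..1}}"
  then have "(s + L - 1) * 2 ^ n <= real i" "real i <= (s + L - 1) * 2 ^ n + 2 ^ n" by (auto simp: field_simps)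
  then have 1: "\<lceil>(s + L - 1) * 2 ^ n\<rceil> <= int i"
  and "real i <= real_of_int \<lceil>(s + L - 1) * 2 ^ n\<rceil> + 2 ^ n"
  using le_of_int_ceiling[of "(s + L - 1) * 2 ^ n"] by (simp add: ceiling_le_iff, linarith)
  then have "real_of_int (int i) <= real_of_int (\<lceil>(s + L - 1) * 2 ^ n\<rceil> + 2 ^ n)" by simp
  then have "int i <= \<lceil>(s + L - 1) * 2 ^ n\<rceil> + 2 ^ n" by (simp only: of_int_le_iff)
  also have "... <= int (j + 2 ^ n)" by (simp add: j_def)
  finally show "i : {j..j + 2 ^ n}" using 1 by (simp only: of_nat_le_iff) (simp add: j_def nat_le_iff)
  qed
 qed simp
 also have "... = 2 ^ n + 1" by simp
 finally show ?thesis .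
qed

section \<open>Suprema of dyadic translates\<close>

lemma test1_linear_iso:
 fixes A :: "'a::euclidean_space => 'b::euclidean_space"
 assumes t: "test1 Om ph g" and A: "bounded_linear A" and A': "bounded_linear A'" "!!x. A' (A x) = x"
  and adj: "bounded_linear A\<^sub>t" "!!x y. A\<^sub>t y \<bullet> x = y \<bullet> A x" and Om': "!!y. y : Om ==> A' y : Om'"
 shows "test1 Om' (%x. ph (A x)) (%x. A\<^sub>t (g (A x)))"
 unfolding test1_def
proof (intro conjI allI)
 show "((%x. ph (A x)) has_derivative (%v. A\<^sub>t (g (A x)) \<bullet> v)) (at x)" for x
  using has_derivative_compose[OF bounded_linear.has_derivative[OF A has_derivative_ident] test1_deriv[OF t]] by (simp add: adj)
 show "contU (%x. A\<^sub>t (g (A x)))"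
  by (rule bounded_linear.continuous_on[OF adj(1) continuous_on_compose2[OF test1_cont(2)[OF t] linear_continuous_on[OF A]]]) simp
 obtain K where K: "compact K" "K \<subseteq> Om" "!!p. p ~: K ==> ph p = 0" using test1D[OF t] by metis
 have "ph (A x) = 0" if "x ~: A' ` K" for x using that A'(2)[of x] by (intro K(3)) force
 then show "EX K. compact K & K \<subseteq> Om' & (ALL p. p ~: K --> ph (A p) = 0)"
  using K Om' compact_continuous_image[OF linear_continuous_on[OF A'(1)] K(1)] by (intro exI[of _ "A' ` K"]) auto
qed

text \<open>The flux \<open>G\<close> is kept general so that both \<open>U\<close> with
  \<open>flux\<close> and \<open>- U\<close> with the reflected flux fit. Only its component along
  \<open>et\<close> has a prescribed form, since the component along \<xi> disappears in the
  reduction.\<close>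

locale directional_subsolution = plane_frame +
 fixes U :: "spacetime => real" and G :: "real => plane" and B al be :: real
 assumes U: "bdb U" and G: "contU G"
  and GL: "!!R. \<exists>L\<ge>0. ALL a b. (abs a) <= R --> (abs b) <= R --> norm (G a - G b) <= L * (abs (a - b))"
  and sub: "!!k. nonpos_div half_space (%p. (max (U p) k, G (max (U p) k)))"
  and L1: "AE t in lborel. 0 < t --> integ (%x. U (t, x))"
  and BV: "!!h. AE t in lborel. 0 < t --> (LBINT x. (abs (U (t, x + h *R \<xi>) - U (t, x)))) <= B * (abs h)"
  and g: "!!w. et \<bullet> G w = al * w\<^sup>2 / 2 + be * w ^ 3 / 3"
begin

definition translates :: "spacetime => real => real" where
 "translates p q = U (p + (0, q *R \<xi>))"

text \<open>Dyadic shifts are countable, which keeps the supremum measurable, and they form a dense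
  group, which makes it constant almost everywhere on lines along \<xi>. The average over a unit
  interval in \<open>W\<close> picks this constant for every (t, y).\<close>

definition V :: "spacetime => real" where "V p = (SUP q\<in>dyadics. translates p q)"

definition W :: "R2 => real" where
 "W z = (LBINT s. ind {0..1} s * V (pt (z, s)))"

lemma GL': "\<exists>L\<ge>0. ALL a b. (abs a) <= R --> (abs b) <= R --> norm ((a, G a) - (b, G b)) <= L * (abs (a - b))"
proof -
 obtain L where L: "L \<ge> 0" "!!a b. (abs a) <= R ==> (abs b) <= R ==> norm (G a - G b) <= L * (abs (a - b))" using GL[of R] by blast
 have "norm ((a, G a) - (b, G b)) <= (1 + L) * (abs (a - b))" if "(abs a) <= R" "(abs b) <= R" for a b
  using norm_Pair_le[of "a - b" "G a - G b"] L(2)[OF that] by (simp add: algebra_simps)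
 then show ?thesis using L(1) by (intro exI[of _ "1 + L"]) auto
qed

lemma continuous_pair_G: "contU (%a. (a, G a))"
 by (intro continuous_on_Pair continuous_on_id G)

text \<open>Elements are added one at a time with \<open>nonpos_div_diagonal\<close>. The level
  \<open>k\<close> is carried along because freezing one argument of \<open>max (max a b) k\<close>
  only raises the level of the other.\<close>

lemma nonpos_div_Max:
 assumes F: "finite F" "F ~= {}" and M: "!!p. (abs (U p)) <= M"
 shows "bdb (%p. Max (translates p ` F)) & (ALL p. (abs (Max (translates p ` F))) <= M) &
  (ALL k. nonpos_div half_space (%p. (max (Max (translates p ` F)) k, G (max (Max (translates p ` F)) k))))"
 using F
proof (induction rule: finite_ne_induct)
 case (singleton q)
 have "nonpos_div half_space (%p. (max (U (p + (0, q *R \<xi>))) k, G (max (U (p + (0, q *R \<xi>))) k)))" for k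
  by (rule nonpos_div_shift[OF sub])
  (auto simp: half_space_def mem_Times_iff intro!: bdb_comp_continuous[OF bdb_max[OF U bdb_const] continuous_pair_G])
 moreover have "bdb (%p. U (p + (0, q *R \<xi>)))" by (rule bdb_comp[OF U]) simp
 ultimately show ?case using M by (simp add: translates_def)
next
 case (insert q F)
 define X where "X a b = (max a b, G (max a b))" for a b
 define u where "u p = translates p q" for p
 define v where "v p = Max (translates p ` F)" for p
 have u: "bdb u" "!!p. (abs (u p)) <= M" "!!k. nonpos_div half_space (%p. X (u p) k)"
 proof -
  show "bdb u" unfolding u_def[abs_def] translates_def by (rule bdb_comp[OF U]) simp
  show "(abs (u p)) <= M" for p by (simp add: u_def translates_def M)
  show "nonpos_div half_space (%p. X (u p) k)" for k unfolding X_def u_def translates_def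
  by (rule nonpos_div_shift[OF sub])
  (auto simp: half_space_def mem_Times_iff intro!: bdb_comp_continuous[OF bdb_max[OF U bdb_const] continuous_pair_G])
 qed
 have v: "bdb v" "!!p. (abs (v p)) <= M" "!!k. nonpos_div half_space (%p. X (v p) k)"
  using insert.IH unfolding v_def[abs_def] X_def by blast+
 have e: "Max (translates p ` insert q F) = max (u p) (v p)" for p using insert by (simp add: u_def v_def)
 have "nonpos_div half_space (%p. X (max (u p) (v p)) k)" for k
 proof -
  obtain L where L: "L \<ge> 0" "!!a b. (abs a) <= M + (abs k) ==> (abs b) <= M + (abs k) ==> norm ((a, G a) - (b, G b)) <= L * (abs (a - b))"
  using GL'[of "M + (abs k)"] by blast
  show ?thesis
  proof (rule nonpos_div_diagonal[OF open_half_space u(1,2) v(1,2), of "%a b. X (max a b) k" L])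
  show "contU (%z. X (max (fst z) (snd z)) k)" unfolding X_def
  by (rule continuous_on_compose2[OF continuous_pair_G]) (auto intro!: continuous_intros)
  show "norm (X (max a b) k - X (max a b') k) <= L * (abs (b - b'))" if "(abs a) <= M" "(abs b) <= M" "(abs b') <= M" for a b b'
  proof -
  have "norm (X (max a b) k - X (max a b') k) <= L * (abs (max (max a b) k - max (max a b') k))"
  unfolding X_def using that by (intro L(2)) (auto simp: max_def abs_if split: if_splits)
  also have "... <= L * (abs (b - b'))" using L(1) by (intro mult_left_mono) (auto simp: max_def)
  finally show ?thesis .
  qed
  show "nonpos_div half_space (%p. X (max (u p) b) k)" for b using u(3)[of "max b k"] by (simp add: X_def max.assoc)
  show "nonpos_div half_space (%p. X (max a (v p)) k)" for a using v(3)[of "max a k"] by (simp add: X_def ac_simps)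
  qed
 qed
 then show ?case unfolding e using u v bdb_max[OF u(1) v(1)] by (auto simp: X_def max_def)
qed

lemma translates_bounded: "bdd_above (translates p ` F)"
proof -
 obtain M where "!!p. (abs (U p)) <= M" using bdb_abs_bound[OF U] by metis
 then have "U p <= M" for p using abs_le_D1 by blast
 then show ?thesis unfolding bdd_above_def translates_def by (intro exI[of _ M]) blast
qed

lemma Max_grid_tendsto: "(%n. Max (translates p ` grid n)) ~~> V p"
 and Max_grid_mono: "m <= n ==> Max (translates p ` grid m) <= Max (translates p ` grid n)"
proof -
 have le: "Max (translates p ` grid n) <= V p" for n
  using finite_grid grid_nonempty unfolding V_def
  by (intro Max.boundedI) (auto intro!: cSUP_upper translates_bounded simp: dyadics_def)
 show "m <= n ==> Max (translates p ` grid m) <= Max (translates p ` grid n)"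
  using grid_mono[of m n] finite_grid grid_nonempty by (intro Max_mono) auto
 show "(%n. Max (translates p ` grid n)) ~~> V p"
 proof (rule order_tendstoI)
  fix a assume "a < V p"
  then obtain q where q: "q : dyadics" "a < translates p q"
  unfolding V_def using less_cSUP_iff[OF _ translates_bounded, of dyadics] dyadics_0 by blast
  then obtain m where "q : grid m" by (auto simp: dyadics_def)
  then have "translates p q <= Max (translates p ` grid n)" if "m <= n" for n
  using grid_mono[OF that] finite_grid by (intro Max_ge) auto
  then show "\<forall>\<^sub>F n in sequentially. a < Max (translates p ` grid n)"
  using q(2) unfolding eventually_sequentially by (meson less_le_trans)
 next
  fix a assume "V p < a"
  then show "\<forall>\<^sub>F n in sequentially. Max (translates p ` grid n) < a" using le by (auto intro: le_less_trans always_eventually)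
 qed
qed

lemma U_le_V: "U p <= V p"
proof -
 have "translates p 0 <= V p" unfolding V_def by (intro cSUP_upper dyadics_0 translates_bounded)
 then show ?thesis by (simp add: translates_def zero_prod_def[symmetric])
qed

lemma bdb_V: "bdb V" and sub_V: "nonpos_div half_space (%p. (max (V p) k, G (max (V p) k)))"
proof -
 obtain M where M: "!!p. (abs (U p)) <= M" using bdb_abs_bound[OF U] by metis
 note N = nonpos_div_Max[OF finite_grid grid_nonempty M]
 have m: "V : bmeas"
  by (rule borel_measurable_LIMSEQ_real[OF Max_grid_tendsto]) (use N bdb_measurable in blast)
 have VM: "(abs (V p)) <= M" for p
  by (rule LIMSEQ_le_const2[OF tendsto_rabs[OF Max_grid_tendsto]]) (intro exI allI impI, use N in blast)
 show V: "bdb V" using m VM by (intro bdbI) auto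
 obtain L where L: "L \<ge> 0" "!!a b. (abs a) <= M + (abs k) ==> (abs b) <= M + (abs k) ==> norm ((a, G a) - (b, G b)) <= L * (abs (a - b))"
  using GL'[of "M + (abs k)"] by blast
 have M0: "0 <= M" using M[of 0] by linarith
 have bd: "norm ((max a k, G (max a k))) <= norm (0::real, G 0) + L * (M + (abs k))" if "(abs a) <= M" for a
 proof -
  have b: "(abs (max a k)) <= M + (abs k)" using that M0 by (auto simp: max_def)
  have "norm ((max a k, G (max a k)) - (0, G 0)) <= L * (abs (max a k - 0))" using b M0 by (intro L(2)) auto
  also have "... <= L * (M + (abs k))" using b L(1) by (intro mult_left_mono) auto
  finally show ?thesis using norm_triangle_ineq2[of "(max a k, G (max a k))" "(0, G 0)"] by linarith
 qed
 show "nonpos_div half_space (%p. (max (V p) k, G (max (V p) k)))"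
 proof (rule nonpos_div_limit[where X = "%n p. (max (Max (translates p ` grid n)) k, G (max (Max (translates p ` grid n)) k))"])
  show "nonpos_div half_space (%p. (max (Max (translates p ` grid n)) k, G (max (Max (translates p ` grid n)) k)))" for n
  using N by blast
  show "(%p. (max (Max (translates p ` grid n)) k, G (max (Max (translates p ` grid n)) k))) : bmeas" for n
  by (rule bdb_measurable[OF bdb_comp_continuous[OF bdb_max[OF _ bdb_const] continuous_pair_G]]) (use N in blast)
  show "(%p. (max (V p) k, G (max (V p) k))) : bmeas"
  by (rule bdb_measurable[OF bdb_comp_continuous[OF bdb_max[OF V bdb_const] continuous_pair_G]])
  show "norm (max (Max (translates p ` grid n)) k, G (max (Max (translates p ` grid n)) k)) <= norm (0::real, G 0) + L * (M + (abs k))" for n p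
  using N by (intro bd) blast
  have "(%n. (%a. (a, G a)) (max (Max (translates p ` grid n)) k)) ~~> (%a. (a, G a)) (max (V p) k)" for p
  by (rule continuous_on_tendsto_compose[OF continuous_pair_G tendsto_max[OF Max_grid_tendsto tendsto_const]]) auto
  then show "AE p in lborel. p : half_space --> (%n. (max (Max (translates p ` grid n)) k, G (max (Max (translates p ` grid n)) k))) ~~> (max (V p) k, G (max (V p) k))"
  by simp
 qed
qed

lemma V_shift: assumes "q : dyadics" shows "V (p + (0, q *R \<xi>)) = V p"
proof -
 have "(%r. q + r) ` dyadics = dyadics"
 proof safe
  fix r assume "r : dyadics"
  then have "r + - q : dyadics" by (intro dyadics_add dyadics_uminus assms)
  then show "r : (%r. q + r) ` dyadics" by (intro image_eqI[of _ _ "r + - q"]) auto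
 qed (intro dyadics_add assms)
 moreover have "translates (p + (0, q *R \<xi>)) r = translates p (q + r)" for r
  by (simp add: translates_def algebra_simps)
 ultimately show ?thesis unfolding V_def by (metis (no_types, lifting) image_image SUP_cong)
qed

lemma pt_shift: "pt (z, s + q) = pt (z, s) + (0, q *R \<xi>)"
 by (simp add: pt_def algebra_simps)

lemma bdb_V_pt: "bdb (%z. V (pt z))" and bdb_V_pt': "bdb (%s. V (pt (z, s)))"
proof -
 show "bdb (%z. V (pt z))" by (rule bdb_comp[OF bdb_V pt_measurable])
 have "(%s. pt (z, s)) : bmeas"
  unfolding pt_def by (intro borel_measurable_continuous_onI continuous_intros)
 then show "bdb (%s. V (pt (z, s)))" by (rule bdb_comp[OF bdb_V])
qed

lemma V_eq_W: "AE s in lborel. V (pt (z, s)) = W z"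
 unfolding W_def using dyadic_invariant_constant[OF bdb_V_pt', of z] by (simp add: pt_shift V_shift)

lemma bdb_W: "bdb W"
proof -
 obtain M where M: "!!p. (abs (V p)) <= M" using bdb_abs_bound[OF bdb_V] by metis
 have "(%x. ind {0..1} (snd x) * V (pt x)) : borel_measurable (lborel \<Otimes>\<^sub>M lborel)"
  unfolding lborel_prod using bdb_measurable[OF bdb_mult[OF bdb_snd[OF bdb_indicator[of "{0..1::real}"]] bdb_V_pt]] by simp
 then have m: "W : bmeas"
  using lborel.borel_measurable_lebesgue_integral[of "%z s. ind {0..1} s * V (pt (z, s))" lborel] unfolding W_def[abs_def]
  by (simp add: case_prod_beta')
 have "(abs (W z)) <= M" for z
 proof -
  obtain s where "V (pt (z, s)) = W z"
  using eventually_happens'[OF _ V_eq_W[of z]] by (auto simp: ae_filter_eq_bot_iff)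
  then show ?thesis using M by metis
 qed
 then show ?thesis using m by (intro bdbI) auto
qed

lemma V_pt_eq_W: "AE z in lborel. V (pt z) = W (fst z)"
proof -
 have "AE z in lborel \<Otimes>\<^sub>M lborel. V (pt z) = W (fst z)"
 proof (rule lborel_pair.AE_pair_measure)
  have "(%z. V (pt z) - W (fst z)) : bmeas"
  by (rule bdb_measurable[OF bdb_diff[OF bdb_V_pt bdb_fst[OF bdb_W]]])
  then have "{z : space borel. V (pt z) - W (fst z) = 0} : sets borel" by measurable
  then show "{z : space (lborel \<Otimes>\<^sub>M lborel). V (pt z) = W (fst z)} : sets (lborel \<Otimes>\<^sub>M lborel)"
  unfolding lborel_prod by simp
  show "AE z in lborel. AE s in lborel. V (pt (z, s)) = W (fst (z, s))" using V_eq_W by simp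
 qed
 then show ?thesis unfolding lborel_prod .
qed

end

context directional_subsolution
begin

definition frame_coord :: "spacetime => (R2) \<times> real" where
 "frame_coord p = ((fst p, snd p \<bullet> et), snd p \<bullet> \<xi>)"

lemma frame_coord_pt: "frame_coord (pt z) = z"
 by (simp add: frame_coord_def pt_def inner_left_distrib inner_frame)

lemma pt_frame_coord: "pt (frame_coord p) = p"
 using frame_expand[of "snd p"] by (simp add: frame_coord_def pt_def prod_eq_iff)

text \<open>The subsolution property of \<open>V\<close> is tested with the product of
  \<open>ph\<close> and a mollifier \<open>om\<close> of the coordinate along \<xi>. Since
  \<open>V\<close> does not depend on that coordinate, the integral 1 of \<open>om\<close>
  reproduces the claim, and the integral 0 of its derivative removes the flux along \<xi>.\<close>

lemma sub_W: "nonpos_div ({0<..} \<times> UNIV) (%z. (max (W z) k, et \<bullet> G (max (W z) k)))"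
 unfolding nonpos_div_def
proof (intro allI impI)
 fix ph :: "R2 => real" and ga :: "R2 => R2"
 assume t: "test1 ({0<..} \<times> UNIV) ph ga" and pos: "ALL p. 0 <= ph p"
 define X where "X z = (max (W z) k, G (max (W z) k))" for z
 define om where "om = (moll 0 :: real => real)"
 have om: "test1 UNIV om (grad om)" unfolding om_def by (rule moll_test1)
 define Ph where "Ph p = ph (fst (frame_coord p)) * om (snd (frame_coord p))" for p
 define gPh where "gPh p = (let z = frame_coord p; y = om (snd z) *R ga (fst z) in (fst y, snd y *R et + (ph (fst z) * grad om (snd z)) *R \<xi>))" for p
 have "test1 half_space Ph (%p. (%y. (fst (fst y), snd (fst y) *R et + snd y *R \<xi>)) (om (snd (frame_coord p)) *R ga (fst (frame_coord p)), ph (fst (frame_coord p)) *R grad om (snd (frame_coord p))))"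
  unfolding Ph_def
 proof (rule test1_linear_iso[OF test1_time_space[OF t om]])
  show "bounded_linear frame_coord" unfolding frame_coord_def[abs_def] by (intro bounded_linear_intros)
  show "bounded_linear pt" unfolding pt_def[abs_def] by (intro bounded_linear_intros)
  show "bounded_linear (%y::(R2) \<times> real. (fst (fst y), snd (fst y) *R et + snd y *R \<xi>))" by (intro bounded_linear_intros)
  show "(fst (fst y), snd (fst y) *R et + snd y *R \<xi>) \<bullet> x = y \<bullet> frame_coord x" for y :: "(R2) \<times> real" and x
  by (simp add: frame_coord_def inner_prod_def inner_left_distrib inner_right_distrib inner_commute)
  show "pt y : half_space" if "y : ({0<..} \<times> UNIV) \<times> UNIV" for y using that by (auto simp: pt_def half_space_def)
 qed (rule pt_frame_coord)
 then have T: "test1 half_space Ph gPh" by (simp add: gPh_def[abs_def] Let_def)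
 have bX: "bdb (%p. (max (V p) k, G (max (V p) k)))"
  by (rule bdb_comp_continuous[OF bdb_max[OF bdb_V bdb_const] continuous_pair_G])
 have bXW: "bdb X" unfolding X_def[abs_def] by (rule bdb_comp_continuous[OF bdb_max[OF bdb_W bdb_const] continuous_pair_G])
 have bG: "bdb (%z. v \<bullet> snd (X z))" for v by (rule bdb_inner[OF bdb_const]) (use bdb_comp_continuous[OF bdb_max[OF bdb_W bdb_const] G] in "simp add: X_def")
 define H1 where "H1 z = (fst (X z), et \<bullet> snd (X z)) \<bullet> ga z" for z
 define H2 where "H2 z = (\<xi> \<bullet> snd (X z)) * ph z" for z
 have bH1: "bdb H1" unfolding H1_def[abs_def]
 proof (rule bdb_inner[OF bdb_Pair[OF _ bG] test1_bdb(2)[OF t]])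
  show "bdb (%z. fst (X z))" unfolding X_def fst_conv by (rule bdb_max[OF bdb_W bdb_const])
 qed
 have bH2: "bdb H2" unfolding H2_def[abs_def] by (intro bdb_mult bG test1_bdb(1)[OF t])
 have bH: "bdb (%z::(R2) \<times> real. om (snd z) * H1 (fst z) + H2 (fst z) * grad om (snd z))"
  by (rule bdb_add[OF bdb_mult[OF bdb_snd bdb_fst] bdb_mult[OF bdb_fst bdb_snd]]) (rule bH1 bH2 test1_bdb[OF om])+
 have "0 <= (LBINT p. (max (V p) k, G (max (V p) k)) \<bullet> gPh p)"
  by (rule nonpos_divD[OF sub_V T], unfold Ph_def om_def) (intro mult_nonneg_nonneg moll_nonneg pos[rule_format])
 also have "... = (LBINT z. (max (V (pt z)) k, G (max (V (pt z)) k)) \<bullet> gPh (pt z))"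
  by (rule pt_integral[OF borel_measurable_integrable[OF test1_int[OF bX T], simplified]])
 also have "... = (LBINT z. om (snd z) * H1 (fst z) + H2 (fst z) * grad om (snd z))"
 proof (rule B_cong_AE)
  show "(%z. (max (V (pt z)) k, G (max (V (pt z)) k)) \<bullet> gPh (pt z)) : lmeas"
  using measurable_compose[OF pt_measurable borel_measurable_integrable[OF test1_int[OF bX T], simplified]] by simp
  show "(%z::(R2) \<times> real. om (snd z) * H1 (fst z) + H2 (fst z) * grad om (snd z)) : lmeas"
  using bdb_measurable[OF bH] by simp
  show "AE z in lborel. (max (V (pt z)) k, G (max (V (pt z)) k)) \<bullet> gPh (pt z) = om (snd z) * H1 (fst z) + H2 (fst z) * grad om (snd z)"
  using V_pt_eq_W by eventually_elim
  (simp add: gPh_def frame_coord_pt H1_def H2_def X_def inner_prod_def inner_right_distrib inner_commute algebra_simps)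
 qed
 also have "... = (LBINT z. H1 z)"
 proof -
  obtain K where K: "compact K" "!!p. p ~: K ==> ph p = 0" "!!p. p ~: K ==> ga p = 0"
  using test1D[OF t] by metis
  obtain L where L: "compact L" "!!p. p ~: L ==> om p = 0" "!!p. p ~: L ==> grad om p = 0"
  using test1D[OF om] by metis
  obtain C where C: "!!z. (abs (om (snd z) * H1 (fst z) + H2 (fst z) * grad om (snd z))) <= C"
  using bdb_abs_bound[OF bH] by metis
  have Z: "om (snd z) * H1 (fst z) + H2 (fst z) * grad om (snd z) = 0" if "z ~: K \<times> L" for z
  using that K L by (cases "fst z : K") (auto simp: H1_def H2_def mem_Times_iff)
  note omi = test1_integrable[OF om]
  have w: "(LBINT s. om s) = 1" "(LBINT s. grad om s) = 0"
  using test1_integral_const[OF om, of 1] by (simp_all add: om_def moll_integral)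
  have "(LBINT z. om (snd z) * H1 (fst z) + H2 (fst z) * grad om (snd z))
  = (LBINT z. LBINT s. om s * H1 z + H2 z * grad om s)"
  using fubini_bounded_support(7)[OF bdb_measurable[OF bH] C compact_Times[OF K(1) L(1)] Z] by simp
  also have "... = (LBINT z. H1 z)"
  proof (rule B_cong[OF refl])
  show "(LBINT s. om s * H1 z + H2 z * grad om s) = H1 z" for z
  using omi w by (subst B_add) auto
  qed
  finally show ?thesis .
 qed
 finally show "0 <= (LBINT z. (max (W z) k, et \<bullet> G (max (W z) k)) \<bullet> ga z)" by (simp add: H1_def X_def)
qed

lemma window_shift:
 fixes f :: "R2 => real"
 assumes f: "integ f"
 shows "integ (%z. ind {0..1} (snd z - q) * f z)"
  and "integ (%z. ind {0..1} (snd z) * f (fst z, snd z + q))"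
  and "(LBINT z. ind {0..1} (snd z) * f (fst z, snd z + q)) = (LBINT z. ind {0..1} (snd z - q) * f z)"
proof -
 have c: "(%z::R2. snd z - q) : bmeas" by (intro borel_measurable_continuous_onI continuous_intros)
 have m: "(%z::R2. ind {0..1} (snd z - q) :: real) : bmeas"
  using measurable_compose[OF c, of "ind {0..1} :: real => real" borel] by simp
 show i: "integ (%z. ind {0..1} (snd z - q) * f z)"
  by (rule B_ibound[OF f])
  (use m borel_measurable_integrable[OF f] in "auto intro!: borel_measurable_times AE_I2 simp: indicator_def")
 have e: "z + (0, q) = (fst z, snd z + q)" for z :: "R2" by (simp add: prod_eq_iff)
 show "integ (%z. ind {0..1} (snd z) * f (fst z, snd z + q))"
  using lborel_integrable_shift[OF i, of "(0, q)"] by (simp add: e)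
 show "(LBINT z. ind {0..1} (snd z) * f (fst z, snd z + q)) = (LBINT z. ind {0..1} (snd z - q) * f z)"
  using lborel_integral_shift[OF borel_measurable_integrable[OF i, simplified], of "(0, q)"] by (simp add: e)
qed

text \<open>Over a unit window, the maximum of the translates in \<open>grid n\<close> is at most
  one far translate plus the increments of mesh 2^-n. Each increment has integral at most B / 2^n
  and is counted at most 2^n + 1 times, so the mass is at most 2 B up to the far term, which tends
  to 0. Monotone convergence passes to the supremum.\<close>

lemma mass_W_slice:
 assumes i: "integ (%x. U (t, x))"
  and bv: "!!n::nat. (LBINT x. (abs (U (t, x + (1 / 2 ^ n) *R \<xi>) - U (t, x)))) <= B * (1 / 2 ^ n)"
 shows "integ (%y. max 0 (W (t, y))) & (LBINT y. max 0 (W (t, y))) <= 2 * B"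
proof -
 define P where "P z = pt ((t, fst z), snd z)" for z :: "R2"
 have Pm: "P : bmeas"
  unfolding P_def pt_def by (intro borel_measurable_continuous_onI continuous_intros)
 define u where "u z = U (P z)" for z
 have Ut: "(%x. U (t, x)) : bmeas" using borel_measurable_integrable[OF i] by simp
 have iu: "integ u"
  using plane_integral(1)[OF Ut] i by (simp add: u_def[abs_def] P_def pt_def)
 define D where "D n z = (abs (u (fst z, snd z + 1 / 2 ^ n) - u z))" for n :: nat and z
 have D: "integ (D n)" "(LBINT z. D n z) <= B * (1 / 2 ^ n)" "0 <= D n z" for n z
 proof -
  let ?F = "%x. (abs (U (t, x + (1 / 2 ^ n) *R \<xi>) - U (t, x)))"
  have iF: "integ ?F"
  using integrable_abs[OF B_idiff[OF lborel_integrable_shift[OF i] i]] by simp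
  have e: "D n = (%z. ?F (snd z *R \<xi> + fst z *R et))"
  by (auto simp: D_def u_def P_def pt_def algebra_simps)
  have m: "?F : bmeas" using borel_measurable_integrable[OF iF] by simp
  show "integ (D n)" unfolding e using plane_integral(1)[OF m] iF by blast
  show "(LBINT z. D n z) <= B * (1 / 2 ^ n)" unfolding e plane_integral(2)[OF m] by (rule bv)
  show "0 <= D n z" by (simp add: D_def)
 qed
 define N where "N n z = ind {0..1} (snd z) * max 0 (Max (translates (P z) ` grid n))" for n z
 \<comment> \<open>The contribution of the first grid point -n, moved to a window that escapes to
   infinity as n grows; it vanishes in the limit because \<open>u\<close> is integrable.\<close>
 define tail where "tail n = (LBINT z. ind {0..1} (snd z + real n) * (abs (u z)))" for n
 have N: "integ (N n)" "(LBINT z. N n z) <= tail n + 2 * B" for n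
 proof -
  define m where "m = 2 * n * 2 ^ n"
  define R where "R z = ind {0..1} (snd z) * (abs (u (fst z, snd z + (- real n)))) +
  (\<Sum>i<m. ind {0..1} (snd z) * D n (fst z, snd z + (real i / 2 ^ n - real n)))" for z
  have NR: "0 <= N n z" "N n z <= R z" for z
  proof -
  define a where "a i = u (fst z, snd z + (real i / 2 ^ n - real n))" for i
  have "translates (P z) ` grid n = a ` {..m}"
  by (simp add: grid_def image_image m_def a_def u_def translates_def P_def pt_shift[symmetric])
  then have "Max (translates (P z) ` grid n) <= (abs (a 0)) + (\<Sum>i<m. (abs (a (Suc i) - a i)))"
  using Max_chain_bound by metis
  moreover have "(abs (a (Suc i) - a i)) = D n (fst z, snd z + (real i / 2 ^ n - real n))" for i
  by (simp add: a_def D_def add_divide_distrib algebra_simps)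
  ultimately have "max 0 (Max (translates (P z) ` grid n)) <= (abs (a 0)) + (\<Sum>i<m. D n (fst z, snd z + (real i / 2 ^ n - real n)))"
  using D(3) by (auto intro!: add_nonneg_nonneg sum_nonneg)
  from mult_left_mono[OF this, of "ind {0..1} (snd z)"]
  show "N n z <= R z" by (simp add: N_def R_def a_def distrib_left sum_distrib_left)
  show "0 <= N n z" by (simp add: N_def)
  qed
  have iR: "integ R" unfolding R_def[abs_def]
  by (intro B_iadd B_isum window_shift(2)[OF D(1)] window_shift(2)[OF integrable_abs[OF iu]])
  obtain M where M: "!!p. (abs (U p)) <= M" using bdb_abs_bound[OF U] by metis
  have "bdb (%z. Max (translates (P z) ` grid n))"
  using nonpos_div_Max[OF finite_grid grid_nonempty M] by (intro bdb_comp[OF _ Pm]) blast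
  then have bN: "bdb (N n)" unfolding N_def[abs_def]
  using bdb_max[OF bdb_const[of 0], of "%z. Max (translates (P z) ` grid n)"] bdb_snd[OF bdb_indicator[of "{0..1::real}"]]
  by (intro bdb_mult) auto
  show iN: "integ (N n)"
  by (rule B_ibound[OF iR]) (use bdb_measurable[OF bN] NR in "auto intro!: AE_I2 order_trans[OF NR(2)]")
  define S where "S = (LBINT z. (\<Sum>i<m. ind {0..1} (snd z) * D n (fst z, snd z + (real i / 2 ^ n - real n))))"
  have "(LBINT z. N n z) <= (LBINT z. R z)" by (rule integral_mono[OF iN iR NR(2)])
  also have "... = (LBINT z. ind {0..1} (snd z) * (abs (u (fst z, snd z + (- real n))))) + S"
  unfolding R_def S_def
  by (intro B_add B_isum window_shift(2)[OF D(1)] window_shift(2)[OF integrable_abs[OF iu]])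
  also have "(LBINT z. ind {0..1} (snd z) * (abs (u (fst z, snd z + (- real n))))) = tail n"
  using window_shift(3)[OF integrable_abs[OF iu], of "- real n"] by (simp add: tail_def)
  finally have 1: "(LBINT z. N n z) <= tail n + S" .
  \<comment> \<open>Moving the shifts from the increments to the windows makes all summands share
    the same increment, so only the overlap of the windows matters.\<close>
  have "S = (\<Sum>i<m. LBINT z. ind {0..1} (snd z - (real i / 2 ^ n - real n)) * D n z)"
  unfolding S_def
  by (subst B_sum) (intro window_shift(2)[OF D(1)], simp only: window_shift(3)[OF D(1)])
  also have "... = (LBINT z. (\<Sum>i<m. ind {0..1} (snd z - (real i / 2 ^ n - real n)) * D n z))"
  by (rule B_sum[symmetric]) (rule window_shift(1)[OF D(1)])
  also have "... <= (LBINT z. (2 ^ n + 1) * D n z)"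
  proof (rule integral_mono)
  show "(\<Sum>i<m. ind {0..1} (snd z - (real i / 2 ^ n - real n)) * D n z) <= (2 ^ n + 1) * D n z" for z
  proof -
  have "(\<Sum>i<m. ind {0..1} (snd z - (real i / 2 ^ n - real n)) :: real) <= 2 ^ n + 1"
  using card_window[of "snd z" "real n" n m] by (simp add: algebra_simps)
  from mult_right_mono[OF this D(3)] show ?thesis by (simp only: sum_distrib_right)
  qed
  qed (intro B_isum window_shift(1)[OF D(1)] integrable_mult_right D(1))+
  also have "... <= (2 ^ n + 1) * (B * (1 / 2 ^ n))"
  unfolding integral_mult_right_zero by (intro mult_left_mono D(2)) simp
  also have "... <= 2 * B"
  proof -
  have "0 <= (LBINT z. D n z)" by (intro B_nonneg D(3))
  then have "0 <= B * (1 / 2 ^ n)" using D(2)[of n] by linarith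
  then have "0 <= B * (1 / 2 ^ n) * 2 ^ n" by (rule mult_nonneg_nonneg) simp
  then have "0 <= B" by simp
  then have "B * 1 <= B * 2 ^ n" by (intro mult_left_mono) auto
  then show ?thesis by (simp add: field_simps)
  qed
  finally show "(LBINT z. N n z) <= tail n + 2 * B" using 1 by linarith
 qed
 have Nm: "m <= n ==> N m z <= N n z" for m n z
  unfolding N_def using Max_grid_mono[of m n "P z"] by (intro mult_left_mono) auto
 have "tail ~~> (LINT z|(lborel :: (R2) measure). 0)" unfolding tail_def[abs_def]
 proof (rule integral_dominated_convergence[where w = "%z. (abs (u z))"])
  have "\<forall>\<^sub>F n in sequentially. 0 = ind {0..1} (snd z + real n) * (abs (u z))" for z :: "R2"
  proof -
  obtain k :: nat where "1 - snd z < real k" using reals_Archimedean2 by blast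
  then have "0 = ind {0..1} (snd z + real n) * (abs (u z))" if "k <= n" for n using that by (simp add: indicator_def)
  then show ?thesis unfolding eventually_sequentially by blast
  qed
  then show "AE z in lborel. (%n. ind {0..1} (snd z + real n) * (abs (u z))) ~~> 0"
  by (intro AE_I2 Lim_transform_eventually[OF tendsto_const])
  show "(%z. ind {0..1} (snd z + real n) * (abs (u z))) : lmeas" for n
  using borel_measurable_integrable[OF window_shift(1)[OF integrable_abs[OF iu], of "- real n"]] by simp
 qed (use iu in "auto simp: indicator_def")
 then have "(%n. tail n + 2 * B) ~~> 0 + 2 * B" by (intro tendsto_add tendsto_const) simp
 then have JB: "(LBINT z. N n z) <= 0 + 2 * B" for n
 proof (rule LIMSEQ_le_const)
  have "(LBINT z. N n z) <= tail k + 2 * B" if "n <= k" for k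
  using integral_mono[OF N(1) N(1) Nm[OF that]] N(2)[of k] by (rule order_trans)
  then show "EX k. \<forall>m\<ge>k. (LBINT z. N n z) <= tail m + 2 * B" by blast
 qed
 have "incseq (%n. LBINT z. N n z)" by (intro incseq_SucI integral_mono N(1) Nm) simp
 then obtain J where J: "(%n. LBINT z. N n z) ~~> J" using JB incseq_convergent by blast
 have JB': "J <= 2 * B" by (rule LIMSEQ_le_const2[OF J]) (use JB in auto)
 define H where "H z = ind {0..1} (snd z) * max 0 (V (P z))" for z
 have lim: "(%n. N n z) ~~> H z" for z
  unfolding N_def H_def by (intro tendsto_mult tendsto_const tendsto_max Max_grid_tendsto)
 have Hm: "H : lmeas"
  by (rule borel_measurable_LIMSEQ_real[OF lim]) (rule borel_measurable_integrable[OF N(1)])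
 have mono: "AE z in lborel. mono (%n. N n z)" by (intro AE_I2 monoI Nm)
 have iH: "integrable (lborel \<Otimes>\<^sub>M lborel) H" and IH: "(LINT z|(lborel \<Otimes>\<^sub>M lborel). H z) = J"
  unfolding lborel_prod
  using integrable_monotone_convergence[OF N(1) mono AE_I2[OF lim] J Hm] integral_monotone_convergence[OF N(1) mono AE_I2[OF lim] J Hm] by blast+
 have sl: "(LBINT s. H (y, s)) = max 0 (W (t, y))" for y
 proof -
  have "(LBINT s. H (y, s)) = (LBINT s. ind {0..1::real} s * max 0 (W (t, y)))"
  proof (rule B_cong_AE)
  have "bdb (%s. max 0 (V (pt ((t, y), s))))" by (rule bdb_max[OF bdb_const bdb_V_pt'])
  then show "(%s. H (y, s)) : lmeas"
  using bdb_measurable[of "%s. max 0 (V (pt ((t, y), s)))"] by (simp add: H_def P_def)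
  show "AE s in lborel. H (y, s) = ind {0..1} s * max 0 (W (t, y))"
  using V_eq_W[of "(t, y)"] by eventually_elim (simp add: H_def P_def)
  qed simp
  then show ?thesis by simp
 qed
 show ?thesis using lborel_pair.integrable_fst'[OF iH] lborel_pair.integral_fst'[OF iH] JB' unfolding sl IH by simp
qed

lemma mass_W: "AE t in lborel. 0 < t --> integ (%y. max 0 (W (t, y))) & (LBINT y. max 0 (W (t, y))) <= 2 * B"
proof -
 have "AE t in lborel. \<forall>n::nat. 0 < t --> (LBINT x. (abs (U (t, x + (1 / 2 ^ n) *R \<xi>) - U (t, x)))) <= B * (abs (1 / 2 ^ n))"
  unfolding AE_all_countable using BV by blast
 with L1 show ?thesis
 proof eventually_elim
  case (elim t)
  then show ?case using mass_W_slice[of t] by simp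
 qed
qed

text \<open>For the cubic transversal flux the wedge equals (al/2 + be (w + k + k')/3) (k' - k) (w -
  k) (w - k'), so the condition on \<open>c\<close>, read at s = w + k + k', is the convexity
  required by \<open>subsolution_1d\<close>. The bound for \<open>W\<close> passes to
  \<open>U\<close> because \<open>U <= V\<close>.\<close>

theorem U_upper_bound:
 assumes k0: "0 <= k0" and c: "0 < c" "!!s. k0 <= s ==> c <= al / 2 + be * s / 3"
  and T: "0 < T" and K: "0 < K" and M: "0 <= B" "32768 * (2 * B) <= c * T * K\<^sup>2"
 shows "AE p in lborel. T < fst p --> U p <= k0 + K"
proof -
 have Gc: "contU (%w. et \<bullet> G w)" by (intro continuous_on_inner continuous_on_const G)
 interpret W: subsolution_1d W "%w. et \<bullet> G w" k0 c "2 * B"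
 proof
  show "\<exists>L\<ge>0. ALL a b. (abs a) <= R --> (abs b) <= R --> (abs (et \<bullet> G a - et \<bullet> G b)) <= L * (abs (a - b))" for R
  proof -
  have "(abs (et \<bullet> G a - et \<bullet> G b)) <= norm (G a - G b)" for a b
  using Cauchy_Schwarz_ineq2[of et "G a - G b"] norm_eta by (simp add: inner_diff_right)
  then show ?thesis using GL[of R] by (meson order_trans)
  qed
  show "c * (k' - k) * ((w - k) * (w - k')) <= (w - k) * (et \<bullet> G w - et \<bullet> G k') - (w - k') * (et \<bullet> G w - et \<bullet> G k)"
  if "k0 <= k" "k < k'" "k' <= w" for k k' w
  proof -
  have "c * ((k' - k) * ((w - k) * (w - k'))) <= (al / 2 + be * (w + k + k') / 3) * ((k' - k) * ((w - k) * (w - k')))"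
  using that k0 by (intro mult_right_mono c) auto
  also have "... = (w - k) * (et \<bullet> G w - et \<bullet> G k') - (w - k') * (et \<bullet> G w - et \<bullet> G k)"
  unfolding g by (simp add: field_simps power2_eq_square power3_eq_cube)
  finally show ?thesis by (simp only: mult.assoc)
  qed
 qed (use bdb_W Gc sub_W c k0 mass_W in auto)
 have "AE z in lborel. T < fst z --> W z <= k0 + K" by (rule W.upper_bound[OF T K _ M(2)]) (use M in simp)
 from AE_fst[OF this] have "AE z in lborel. T < fst (fst z) --> W (fst z) <= k0 + K" .
 with V_pt_eq_W have "AE z in lborel. T < fst (pt z) --> U (pt z) <= k0 + K"
 proof eventually_elim
  case (elim z)
  then show ?case using U_le_V[of "pt z"] by (auto simp: pt_def)
 qed
 then show ?thesis
 proof (rule pt_AE)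
  have [measurable]: "U : bmeas" by (rule bdb_measurable[OF U])
  have f: "(fst :: spacetime => real) : bmeas" by (intro borel_measurable_continuous_onI continuous_intros)
  have "{p. T < fst p} \<inter> {p. k0 + K < U p} : sets borel"
  using measurable_sets[OF f, of "{T<..}"] measurable_sets[OF bdb_measurable[OF U], of "{k0 + K<..}"] by (auto simp: vimage_def)
  then show "{p. ~ (T < fst p --> U p <= k0 + K)} : sets borel"
  by (simp add: Collect_conj_eq[symmetric] not_le)
 qed
qed

end

section \<open>Sup bounds uniform over the class of solutions\<close>

lemma inner_flux: "et \<bullet> flux w = et $ 1 * w\<^sup>2 / 2 + et $ 2 * w ^ 3 / 3"
 by (simp add: flux_def inner_vec_def UNIV_2)

lemma orthogonal_frame:
 fixes \<xi> :: plane
 assumes "norm \<xi> = 1" "(abs e) = 1"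
 shows "plane_frame \<xi> (vector [- e * \<xi> $ 2, e * \<xi> $ 1])"
proof
 have x: "\<xi> $ 1 * \<xi> $ 1 + \<xi> $ 2 * \<xi> $ 2 = 1"
  using assms(1) by (simp add: norm_eq_1 inner_vec_def UNIV_2)
 have e: "e * e = 1" using assms(2) by (auto simp: abs_if split: if_splits)
 have "(- e * \<xi> $ 2) * (- e * \<xi> $ 2) + (e * \<xi> $ 1) * (e * \<xi> $ 1) = (e * e) * (\<xi> $ 1 * \<xi> $ 1 + \<xi> $ 2 * \<xi> $ 2)"
  by (simp add: algebra_simps)
 then show "norm (vector [- e * \<xi> $ 2, e * \<xi> $ 1] :: plane) = 1"
  by (simp add: norm_eq_1 inner_vec_def UNIV_2 x e)
 show "\<xi> \<bullet> vector [- e * \<xi> $ 2, e * \<xi> $ 1] = 0" by (simp add: inner_vec_def UNIV_2)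
qed (rule assms(1))

text \<open>The case \<open>sg = 1\<close> treats \<open>U\<close> and \<open>sg = -1\<close> treats
  its negative. The normal direction is oriented so that the transversal flux is convex for large
  positive values: positive cubic coefficient if \<xi> has a nonzero first component, positive
  quadratic coefficient otherwise.\<close>

lemma one_sided_bound:
 fixes \<xi> :: plane
 assumes \<xi>: "norm \<xi> = 1" and B: "0 <= B" and T: "0 < T" and sg: "sg : {1, -1::real}"
 obtains M where "!!U. bdb U ==> (!!k. nonpos_div half_space (%p. (max (U p) k, sg *R flux (sg * max (U p) k)))) ==>
  AE t in lborel. 0 < t --> integ (%x. U (t, x)) ==>
  (!!h. AE t in lborel. 0 < t --> (LBINT x. (abs (U (t, x + h *R \<xi>) - U (t, x)))) <= B * (abs h)) ==>
  AE p in lborel. T < fst p --> U p <= M"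
proof -
 have x: "\<xi> $ 1 * \<xi> $ 1 + \<xi> $ 2 * \<xi> $ 2 = 1"
  using \<xi> by (simp add: norm_eq_1 inner_vec_def UNIV_2)
 define e where "e = (if \<xi> $ 1 = 0 then - sg * sgn (\<xi> $ 2) else sgn (\<xi> $ 1))"
 have e: "(abs e) = 1" using x sg by (auto simp: e_def sgn_if)
 define al where "al = - sg * e * \<xi> $ 2"
 define be where "be = e * \<xi> $ 1"
 have albe: "0 < be | be = 0 & 0 < al"
  using x sg by (auto simp: al_def be_def e_def sgn_if)
 \<comment> \<open>In the cubic case \<open>k0\<close> is the value beyond which be s / 3 exceeds 1
   + |al|, so that c = 1 works; in the quadratic case the convexity is uniform from level 0
   on.\<close>
 define c where "c = (if 0 < be then 1 else al / 2)"
 define k0 where "k0 = (if 0 < be then 3 * (1 + (abs al)) / be else 0)"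
 have c: "0 < c" and k0: "0 <= k0" using albe by (auto simp: c_def k0_def)
 have ck: "c <= al / 2 + be * s / 3" if s: "k0 <= s" for s
 proof (cases "0 < be")
  case True
  then have "3 * (1 + (abs al)) <= be * s" using s by (simp add: k0_def field_simps)
  then show ?thesis using True by (simp add: c_def)
 qed (use albe in "auto simp: c_def")
 \<comment> \<open>Solves the smallness condition 32768 (2 B) <= c T K^2 of the iteration; the
   summand 1 keeps \<open>K\<close> positive when B = 0.\<close>
 define K where "K = sqrt (65536 * B / (c * T)) + 1"
 have q: "0 <= 65536 * B / (c * T)" using B c T by simp
 have K: "0 < K" using q by (simp add: K_def add_nonneg_pos)
 have "65536 * B / (c * T) = (sqrt (65536 * B / (c * T)))\<^sup>2" using q by simp
 also have "... <= K\<^sup>2" using q unfolding K_def by (intro power_mono) auto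
 finally have KB: "32768 * (2 * B) <= c * T * K\<^sup>2" using c T by (simp add: field_simps)
 show ?thesis
 proof (rule that[of "k0 + K"])
  fix U :: "spacetime => real"
  assume U: "bdb U" "!!k. nonpos_div half_space (%p. (max (U p) k, sg *R flux (sg * max (U p) k)))"
  "AE t in lborel. 0 < t --> integ (%x. U (t, x))"
  "!!h. AE t in lborel. 0 < t --> (LBINT x. (abs (U (t, x + h *R \<xi>) - U (t, x)))) <= B * (abs h)"
  interpret plane_frame \<xi> "vector [- e * \<xi> $ 2, e * \<xi> $ 1]" by (rule orthogonal_frame[OF \<xi> e])
  interpret directional_subsolution \<xi> "vector [- e * \<xi> $ 2, e * \<xi> $ 1]" U "%a. sg *R flux (sg * a)" B al be
  proof
  show "contU (%a. sg *R flux (sg * a))" by (intro continuous_intros continuous_flux)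
  show "\<exists>L\<ge>0. ALL a b. (abs a) <= R --> (abs b) <= R --> norm (sg *R flux (sg * a) - sg *R flux (sg * b)) <= L * (abs (a - b))" for R
  proof -
  have "norm (sg *R flux (sg * a) - sg *R flux (sg * b)) <= ((abs R) + R\<^sup>2) * (abs (a - b))" if "(abs a) <= R" "(abs b) <= R" for a b
  using flux_Lipschitz[of "sg * a" "R" "sg * b"] that sg
  by (auto simp: norm_minus_commute abs_minus_commute)
  then show ?thesis by (intro exI[of _ "(abs R) + R\<^sup>2"]) auto
  qed
  show "vector [- e * \<xi> $ 2, e * \<xi> $ 1] \<bullet> (sg *R flux (sg * w)) = al * w\<^sup>2 / 2 + be * w ^ 3 / 3" for w
  using sg by (auto simp: inner_flux al_def be_def)
  qed (use U in auto)
  show "AE p in lborel. T < fst p --> U p <= k0 + K"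
  by (rule U_upper_bound[OF k0 c ck T K B KB])
 qed
qed

theorem regular_solution_bound:
 assumes \<xi>: "norm \<xi> = 1" and B: "0 <= B" and T: "0 < T"
 obtains M where "M > 0" "!!U. regular_solution \<xi> B U ==> AE p in lborel. T < fst p --> (abs (U p)) <= M"
proof -
 obtain M1 where M1: "!!U. bdb U ==> (!!k. nonpos_div half_space (%p. (max (U p) k, 1 *R flux (1 * max (U p) k)))) ==>
  AE t in lborel. 0 < t --> integ (%x. U (t, x)) ==>
  (!!h. AE t in lborel. 0 < t --> (LBINT x. (abs (U (t, x + h *R \<xi>) - U (t, x)))) <= B * (abs h)) ==>
  AE p in lborel. T < fst p --> U p <= M1"
  using one_sided_bound[OF \<xi> B T, of 1] by auto
 obtain M2 where M2: "!!U. bdb U ==> (!!k. nonpos_div half_space (%p. (max (U p) k, (-1) *R flux ((-1) * max (U p) k)))) ==>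
  AE t in lborel. 0 < t --> integ (%x. U (t, x)) ==>
  (!!h. AE t in lborel. 0 < t --> (LBINT x. (abs (U (t, x + h *R \<xi>) - U (t, x)))) <= B * (abs h)) ==>
  AE p in lborel. T < fst p --> U p <= M2"
  using one_sided_bound[OF \<xi> B T, of "-1"] by auto
 show ?thesis
 proof (rule that[of "(abs M1) + (abs M2) + 1"])
  fix U assume "regular_solution \<xi> B U"
  then have U: "bdb U" "!!k. nonpos_div half_space (%p. Gam (max (U p) k))" "!!k. nonpos_div half_space (%p. - Gam (min (U p) k))"
  "AE t in lborel. 0 < t --> integ (%x. U (t, x))"
  "!!h. AE t in lborel. 0 < t --> (LBINT x. (abs (U (t, x + h *R \<xi>) - U (t, x)))) <= B * (abs h)"
  unfolding regular_solution_def by blast+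
  have 1: "AE p in lborel. T < fst p --> U p <= M1"
  by (rule M1[OF U(1) _ U(4,5)]) (use U(2) in "simp add: Gam_def")
  have 2: "AE p in lborel. T < fst p --> - U p <= M2"
  proof (rule M2[OF bdb_minus[OF U(1)]])
  have e: "max (- U p) k = - min (U p) (- k)" for p k by (auto simp: max_def min_def)
  show "nonpos_div half_space (%p. (max (- U p) k, (-1) *R flux ((-1) * max (- U p) k)))" for k
  using U(3)[of "- k"] by (simp add: e Gam_def)
  show "AE t in lborel. 0 < t --> integ (%x. - U (t, x))" using U(4) by eventually_elim auto
  show "AE t in lborel. 0 < t --> (LBINT x. \<bar>- U (t, x + h *R \<xi>) - - U (t, x)\<bar>) <= B * (abs h)" for h
  using U(5)[of h] by eventually_elim (simp add: abs_minus_commute)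
  qed
  from 1 2 show "AE p in lborel. T < fst p --> (abs (U p)) <= (abs M1) + (abs M2) + 1" by eventually_elim auto
 qed simp
qed

section \<open>Interaction of Kruzhkov entropies\<close>

text \<open>Integration by parts through difference quotients: \<open>f \<bullet> kg\<close> is
  replaced by (k (w + r f) - k w) / r, the shift is moved onto \<open>Ph\<close>, and its variation
  in \<open>q\<close> is bounded by that of \<open>u\<close> along \<open>f\<close>. The error of
  the replacement is an arbitrary multiple \<open>ep\<close> of a fixed constant.\<close>

lemma BV_kernel:
 fixes u :: "'a::euclidean_space => real" and Ph :: "'a \<times> 'a => real"
 assumes th: "bdb th" "!!p. 0 <= th p" "!!p. th p <= 1" "compact K" "!!p. p ~: K ==> th p = 0"
  and k: "test1 UNIV k kg" "!!w. 0 <= k w" "compact S" "!!w. w ~: S ==> k w = 0" "!!w. w ~: S ==> kg w = 0"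
  and Ph: "bdb Ph" "!!p q q'. (abs (Ph (p, q') - Ph (p, q))) <= L * (abs (u q' - u q))" "0 <= L"
  and u: "bdb u" and Q: "compact Q" "!!p s. p : K ==> s : S ==> p - s : Q"
  and N: "!!r. 0 < r ==> (LBINT q. ind Q q * (abs (u (q + r *R f) - u q))) <= N * r"
 shows "\<bar>LBINT p. LBINT q. th p * Ph (p, q) * (f \<bullet> kg (p - q))\<bar> <= L * N * (LBINT w. k w)"
proof -
 define h where "h = (LBINT w. k w)"
 have h: "0 <= h" unfolding h_def by (intro B_nonneg k)
 obtain C where C: "0 < C" "!!z. (abs (Ph z)) <= C" using bdb_abs_bound[OF Ph(1)] by metis
 have bk: "bdb k" and bkg: "bdb (%w. f \<bullet> kg w)"
  using test1_bdb[OF k(1)] by (auto intro!: bdb_inner)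
 note F = kernel_fubini[OF th(1,4,5) bkg k(3) _ Ph(1)]
 have iJ: "integ (%p. LBINT q. th p * Ph (p, q) * (f \<bullet> kg (p - q)))"
  by (rule F(4)) (simp_all add: k(5))
 define S1 where "S1 = {x + y |x y. x : S & y : cball 0 (norm f)}"
 have S1: "compact S1" unfolding S1_def by (rule compact_sums[OF k(3) compact_cball])
 have sub: "w : S1" if "w : S | w + r *R f : S" "0 < r" "r < 1" for w :: 'a and r :: real
  using that(1)
 proof
  assume "w : S"
  then show ?thesis unfolding S1_def by (intro CollectI exI[of _ w] exI[of _ 0]) simp
 next
  assume "w + r *R f : S"
  moreover have "norm (- (r *R f)) <= norm f" using that by (simp add: mult_left_le_one_le)
  ultimately show ?thesis unfolding S1_def by (intro CollectI exI[of _ "w + r *R f"] exI[of _ "- (r *R f)"]) simp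
 qed

 define V where "V = (LBINT w. ind S1 w :: real)"
 have iS1: "integ (%w. ind S1 w :: real)"
  by (rule bdb_integrable[OF bdb_indicator[OF S1] S1]) simp
 have V0: "0 <= V" unfolding V_def by (intro B_nonneg) simp
 have ith: "integ th" by (rule bdb_integrable[OF th(1,4,5)])
 have th0: "0 <= (LBINT p. th p)" by (intro B_nonneg th)
 have "\<bar>LBINT p. LBINT q. th p * Ph (p, q) * (f \<bullet> kg (p - q))\<bar> <= L * N * h + ep * (norm f * C * V * (LBINT p. th p))"
  if ep: "0 < ep" for ep
 proof -
  obtain d where d: "d > 0" "!!x y. dist x y < d ==> dist (kg x) (kg y) < ep" using test1_uniform[OF k(1) ep] by metis
  \<comment> \<open>The step \<open>r *R f\<close> stays in the range where the gradient of
    \<open>k\<close> varies by less than \<open>ep\<close>, and r < 1 keeps the shifted supports in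
    the fixed set \<open>S1\<close>.\<close>
  define r where "r = min (1 / 2) (d / (2 * (norm f + 1)))"
  have r: "0 < r" "r < 1" using d(1) by (auto simp: r_def add_nonneg_pos)
  have n0: "0 <= norm f" by (rule norm_ge_zero)
  have n1: "norm f < 2 * (norm f + 1)" "0 < 2 * (norm f + 1)" using n0 by argo+
  have "norm f / (2 * (norm f + 1)) < 1" using n1 by (simp only: divide_less_eq_1_pos)
  then have "d * (norm f / (2 * (norm f + 1))) < d * 1" by (rule mult_strict_left_mono[OF _ d(1)])
  moreover have "r * norm f <= d / (2 * (norm f + 1)) * norm f" by (rule mult_right_mono) (auto simp: r_def)
  ultimately have rd: "norm (r *R f) < d" using r by simp
  have tay: "(abs (k (w + r *R f) - k w - r * (f \<bullet> kg w))) <= ep * r * norm f * ind S1 w" for w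
  proof (cases "w : S1")
  case True
  have "(abs (k (w + r *R f) - k w - kg w \<bullet> (r *R f))) <= ep * norm (r *R f)" by (rule test1_taylor[OF k(1) d(2) rd])
  then show ?thesis using True r by (simp add: inner_commute mult.assoc)
  next
  case False
  then have "w ~: S" "w + r *R f ~: S" using sub r by blast+
  then show ?thesis using False by (simp add: k)
  qed
  define dk where "dk w = k (w + r *R f) - k w" for w
  define E where "E p = (LBINT q. (abs (u (q + r *R f) - u q)) * k (p - q))" for p
  define J where "J p = (LBINT q. Ph (p, q) * (f \<bullet> kg (p - q)))" for p
  have bP: "bdb (%q. Ph (p, q))" "bdb (%q. (abs (u (q + r *R f) - u q)))" for p
  proof -
  show "bdb (%q. Ph (p, q))" by (rule bdb_comp[OF Ph(1)]) (intro borel_measurable_continuous_onI continuous_intros)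
  have "bdb (%q. u (q + r *R f) - u q)" by (rule bdb_diff[OF bdb_comp[OF u] u]) simp
  then show "bdb (%q. (abs (u (q + r *R f) - u q)))" by (rule bdb_comp_continuous) (intro continuous_intros)
  qed
  have int: "integ (%q. b q * k' (p - q))" if "bdb b" "bdb k'" "compact S'" "!!w. w ~: S' ==> k' w = 0"
  for b k' :: "'a => real" and p S'
  proof (rule bdb_integrable[where K = "(%w. p - w) ` S'"])
  show "bdb (%q. b q * k' (p - q))" by (rule bdb_mult[OF that(1) bdb_comp[OF that(2)]]) simp
  show "compact ((%w. p - w) ` S')" by (intro compact_continuous_image that continuous_intros)
  show "b q * k' (p - q) = 0" if "q ~: (%w. p - w) ` S'" for q
  proof -
  have "p - q ~: S'" using that by force
  then show ?thesis using \<open>!!w. w ~: S' ==> k' w = 0\<close> by simp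
  qed
  qed
  have bkr: "bdb (%w. k (w + r *R f))" by (rule bdb_comp[OF bk]) simp
  have kS1: "k (w + r *R f) = 0" "k w = 0" "kg w = 0" if "w ~: S1" for w
  using sub[of w r] r that k(4,5) by blast+
  have Jp: "r * (abs (J p)) <= L * E p + ep * r * norm f * C * V" for p
  proof -
  have i1: "integ (%q. Ph (p, q) * k (p - q + r *R f))" using int[OF bP(1) bkr S1 kS1(1)] .
  have i2: "integ (%q. Ph (p, q) * k (p - q))" using int[OF bP(1) bk S1 kS1(2)] .
  have i3: "integ (%q. Ph (p, q) * (f \<bullet> kg (p - q)))" by (rule int[OF bP(1) bkg S1]) (simp add: kS1)
  have iE: "integ (%q. (abs (u (q + r *R f) - u q)) * k (p - q))" using int[OF bP(2) bk S1 kS1(2)] .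
  have sh: "(LBINT q. Ph (p, q) * k (p - q + r *R f)) = (LBINT q. Ph (p, q + r *R f) * k (p - q))"
  using lborel_integral_shift[OF borel_measurable_integrable[OF i1, simplified], of "r *R f"] by (simp add: algebra_simps)
  have i1': "integ (%q. Ph (p, q + r *R f) * k (p - q))"
  using lborel_integrable_shift[OF i1, of "r *R f"] by (simp add: algebra_simps)
  have "(abs ((LBINT q. Ph (p, q) * k (p - q + r *R f)) - (LBINT q. Ph (p, q) * k (p - q))))
  = \<bar>LBINT q. Ph (p, q + r *R f) * k (p - q) - Ph (p, q) * k (p - q)\<bar>"
  unfolding sh by (simp add: B_diff[OF i1' i2])
  also have "... <= (LBINT q. (abs (Ph (p, q + r *R f) * k (p - q) - Ph (p, q) * k (p - q))))" by (rule integral_abs_bound)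
  also have "... <= (LBINT q. L * ((abs (u (q + r *R f) - u q)) * k (p - q)))"
  proof (rule integral_mono[OF integrable_abs[OF B_idiff[OF i1' i2]] integrable_mult_right[OF iE]])
  show "(abs (Ph (p, q + r *R f) * k (p - q) - Ph (p, q) * k (p - q))) <= L * ((abs (u (q + r *R f) - u q)) * k (p - q))" for q
  using mult_right_mono[OF Ph(2)[of p "q + r *R f" q] k(2)[of "p - q"]]
  by (simp add: left_diff_distrib[symmetric] abs_mult k(2) mult.assoc)
  qed
  also have "... = L * E p" by (simp add: E_def)
  finally have a: "(abs ((LBINT q. Ph (p, q) * k (p - q + r *R f)) - (LBINT q. Ph (p, q) * k (p - q)))) <= L * E p" .
  have eq: "(LBINT q. Ph (p, q) * k (p - q + r *R f)) - (LBINT q. Ph (p, q) * k (p - q)) - r * J p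
  = (LBINT q. Ph (p, q) * k (p - q + r *R f) - Ph (p, q) * k (p - q) - r * (Ph (p, q) * (f \<bullet> kg (p - q))))"
  by (simp add: J_def B_diff i1 i2 i3)
  have "(abs ((LBINT q. Ph (p, q) * k (p - q + r *R f)) - (LBINT q. Ph (p, q) * k (p - q)) - r * J p))
  <= (LBINT q. (abs (Ph (p, q) * k (p - q + r *R f) - Ph (p, q) * k (p - q) - r * (Ph (p, q) * (f \<bullet> kg (p - q))))))"
  unfolding eq by (rule integral_abs_bound)
  also have "... <= (LBINT q. C * (ep * r * norm f) * ind S1 (p - q))"
  proof (rule integral_mono)
  show "integ (%q. C * (ep * r * norm f) * ind S1 (p - q) :: real)"
  by (intro integrable_mult_right lborel_integrable_reflect iS1)
  show "(abs (Ph (p, q) * k (p - q + r *R f) - Ph (p, q) * k (p - q) - r * (Ph (p, q) * (f \<bullet> kg (p - q)))))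
  <= C * (ep * r * norm f) * ind S1 (p - q)" for q
  proof -
  have "(abs (Ph (p, q))) * (abs (k (p - q + r *R f) - k (p - q) - r * (f \<bullet> kg (p - q)))) <= C * (ep * r * norm f * ind S1 (p - q))"
  using tay C by (intro mult_mono) auto
  then show ?thesis by (simp add: abs_mult[symmetric] algebra_simps)
  qed
  qed (intro integrable_abs B_idiff i1 i2 integrable_mult_right i3)
  also have "... = C * (ep * r * norm f) * (LBINT q. ind S1 (p - q))" by (rule integral_mult_right_zero)
  also have "(LBINT q. ind S1 (p - q)) = V" unfolding V_def
  by (rule lborel_integral_reflect) (use borel_measurable_integrable[OF iS1] in simp)
  also have "C * (ep * r * norm f) * V = ep * r * norm f * C * V" by (simp only: mult_ac)
  finally have b: "(abs ((LBINT q. Ph (p, q) * k (p - q + r *R f)) - (LBINT q. Ph (p, q) * k (p - q)) - r * J p)) <= ep * r * norm f * C * V" .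
  have "r * (abs (J p)) = (abs (r * J p))" using r by (simp add: abs_mult)
  with a b show ?thesis by linarith
  qed
  note FE = kernel_fubini[OF th(1,4,5) bk k(3) k(4) bdb_snd[OF bP(2)]]
  have eE: "(LBINT q. th p * (abs (u (snd (p, q) + r *R f) - u (snd (p, q)))) * k (p - q)) = th p * E p" for p
  by (simp add: E_def mult.assoc)
  have iE: "integ (%p. th p * E p)" using FE(4) unfolding eE by blast
  have "(LBINT p. th p * E p) = (LBINT q. LBINT p. th p * (abs (u (q + r *R f) - u q)) * k (p - q))"
  using FE(2,3) unfolding eE by simp
  also have "... <= (LBINT q. ind Q q * (abs (u (q + r *R f) - u q)) * h)"
  proof (rule integral_mono_AE)
  show "integ (%q. LBINT p. th p * (abs (u (q + r *R f) - u q)) * k (p - q))"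
  using lborel_pair.integrable_snd[of "%p q. th p * (abs (u (q + r *R f) - u q)) * k (p - q)"] FE(1)
  by (simp add: lborel_prod case_prod_beta')
  show "integ (%q. ind Q q * (abs (u (q + r *R f) - u q)) * h)"
  by (rule integrable_mult_left, rule bdb_integrable[OF bdb_mult[OF bdb_indicator[OF Q(1)] bP(2)] Q(1)]) simp
  show "AE q in lborel. (LBINT p. th p * (abs (u (q + r *R f) - u q)) * k (p - q)) <= ind Q q * (abs (u (q + r *R f) - u q)) * h"
  proof (intro AE_I2)
  fix q
  have ik: "integ (%p. k (p - q))" using lborel_integrable_shift[OF test1_integrable(1)[OF k(1)], of "- q"] by simp
  have hk: "(LBINT p. k (p - q)) = h" using lborel_integral_shift[OF test1_measurable(1)[OF k(1)], of "- q"] by (simp add: h_def)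
  have "(LBINT p. th p * (abs (u (q + r *R f) - u q)) * k (p - q)) <= (LBINT p. ind Q q * (abs (u (q + r *R f) - u q)) * k (p - q))"
  proof (rule integral_mono)
  have "integ (%p. k (p - q) *R (th p * (abs (u (q + r *R f) - u q))))"
  by (rule integrable_mult_bounded[OF ik, of _ "(abs (u (q + r *R f) - u q))"])
  (use bdb_measurable[OF th(1)] th(2,3) in "auto simp: abs_mult mult_left_le_one_le")
  then show "integ (%p. th p * (abs (u (q + r *R f) - u q)) * k (p - q))" by (simp add: mult.commute)
  show "integ (%p. ind Q q * (abs (u (q + r *R f) - u q)) * k (p - q))" by (intro integrable_mult_right ik)
  show "th p * (abs (u (q + r *R f) - u q)) * k (p - q) <= ind Q q * (abs (u (q + r *R f) - u q)) * k (p - q)" for p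
  proof (cases "p : K & p - q : S")
  case True
  then have "q : Q" using Q(2)[of p "p - q"] by simp
  then show ?thesis using th(2,3) k(2) by (intro mult_right_mono) auto
  next
  case False
  then have "th p * (abs (u (q + r *R f) - u q)) * k (p - q) = 0" using th(5) k(4) by auto
  moreover have "0 <= ind Q q * (abs (u (q + r *R f) - u q)) * k (p - q)"
  by (intro mult_nonneg_nonneg k(2)) auto
  ultimately show ?thesis by linarith
  qed
  qed
  then show "(LBINT p. th p * (abs (u (q + r *R f) - u q)) * k (p - q)) <= ind Q q * (abs (u (q + r *R f) - u q)) * h"
  by (simp add: hk)
  qed
  qed
  also have "... = (LBINT q. ind Q q * (abs (u (q + r *R f) - u q))) * h" by simp
  also have "... <= N * r * h" by (rule mult_right_mono[OF N[OF r(1)] h])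
  finally have E: "(LBINT p. th p * E p) <= N * r * h" .
  have eJ: "(LBINT q. th p * Ph (p, q) * (f \<bullet> kg (p - q))) = th p * J p" for p
  by (simp add: J_def mult.assoc)
  have iJ': "integ (%p. th p * J p)" using iJ unfolding eJ .
  have "r * \<bar>LBINT p. th p * J p\<bar> <= r * (LBINT p. (abs (th p * J p)))"
  using r by (intro mult_left_mono integral_abs_bound) auto
  also have "... = (LBINT p. r * (abs (th p * J p)))" by simp
  also have "... <= (LBINT p. L * (th p * E p) + ep * r * norm f * C * V * th p)"
  proof (rule integral_mono)
  show "r * (abs (th p * J p)) <= L * (th p * E p) + ep * r * norm f * C * V * th p" for p
  using mult_left_mono[OF Jp[of p] th(2)[of p]] by (simp add: abs_mult th(2) algebra_simps)
  qed (intro integrable_mult_right integrable_abs iJ' B_iadd iE ith)+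
  also have "... = L * (LBINT p. th p * E p) + ep * r * norm f * C * V * (LBINT p. th p)"
  by (simp add: B_add iE ith)
  also have "... <= L * (N * r * h) + ep * r * norm f * C * V * (LBINT p. th p)"
  using mult_left_mono[OF E Ph(3)] by simp
  finally have "r * \<bar>LBINT p. th p * J p\<bar> <= r * (L * N * h + ep * (norm f * C * V * (LBINT p. th p)))"
  by (simp add: algebra_simps)
  then show ?thesis using r unfolding eJ by simp
 qed
 note main = this
 show ?thesis unfolding h_def[symmetric]
 proof (rule field_le_epsilon)
  fix e :: real assume e: "0 < e"
  define X where "X = norm f * C * V * (LBINT p. th p)"
  have X: "0 <= X" unfolding X_def using C V0 th0 by (intro mult_nonneg_nonneg) auto
  have "e / (X + 1) * X <= e" using e X by (simp add: field_simps add_nonneg_pos)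
  with main[of "e / (X + 1)"] show "\<bar>LBINT p. LBINT q. th p * Ph (p, q) * (f \<bullet> kg (p - q))\<bar> <= L * N * h + e"
  using e X by (simp add: X_def[symmetric] add_nonneg_pos)
 qed
qed

locale bounded_solution = plane_frame +
 fixes ta M B :: real and u :: "spacetime => real"
 assumes u: "bdb u" and M: "0 < M" "!!p. (abs (u p)) <= M" and B: "0 <= B"
  and sub: "!!k. nonpos_div ({ta<..} \<times> UNIV) (%p. Gam (max (u p) k))"
  and div: "nonpos_div ({ta<..} \<times> UNIV) (%p. Gam (u p))" "nonpos_div ({ta<..} \<times> UNIV) (%p. - Gam (u p))"
  and BV: "!!Q T h. ta <= T ==> compact Q ==> Q \<subseteq> {ta<..T} \<times> UNIV ==>
  (LBINT p. ind Q p * (abs (u (p + h *R (0, \<xi>)) - u p))) <= B * (T - ta) * (abs h)"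
begin

text \<open>The truncated field \<open>Gam (max u k)\<close> interacts with \<open>Gam u\<close>
  itself. Adding \<open>C *R c\<close> to both makes the components along \<open>c\<close>
  nonnegative, and since \<open>Gam u\<close> is divergence free it may be taken with either sign,
  which turns the one-sided estimate into a bound on the absolute value. The direction \<xi> is
  handled by \<open>BV_kernel\<close>, and every error carries the kernel mass
  \<open>h\<close>.\<close>

lemma interaction_half:
 fixes A E D :: "real => real" and c e :: spacetime
 assumes dec: "!!a. Gam a = A a *R c + E a *R e + D a *R (0, \<xi>)"
  and cont: "contU A" "contU E" "contU D"
  and C: "!!a. (abs a) <= M ==> (abs (A a)) <= C" "!!a. (abs a) <= M ==> (abs (E a)) <= C" "!!a. (abs a) <= M ==> (abs (D a)) <= C"
  and L: "!!a b. (abs a) <= M ==> (abs b) <= M ==> (abs (A a - A b)) <= L * (abs (a - b))"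
  "!!a b. (abs a) <= M ==> (abs b) <= M ==> (abs (D a - D b)) <= L * (abs (a - b))"
  and ce: "norm c = 1" "norm e = 1"
  and t: "test1 UNIV th g" "!!p. 0 <= th p" "!!p. th p <= 1"
  and x: "!!p. r <= norm (p - x) ==> th p = 0"
  and G: "(LBINT p. norm (g p)) <= G"
  and r: "0 < r" "0 <= h" "h <= r / 4" "dist x x0 <= r / 4" "ta < fst x0 - 2 * r" "fst x0 + 2 * r <= T"
  and k: "(abs k) <= M"
 shows "\<bar>LBINT p. th p * (A (max (u p) k) * (E (u p) - E (u (p - h *R e)))
  - E (max (u p) k) * (A (u p) - A (u (p - h *R e))) + C * (E (u p) - E (u (p - h *R e))))\<bar>
  <= (8 * C\<^sup>2 * G + 3 * C * L * (B * (T - ta))) * h"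
proof -
 define Om where "Om = {ta<..} \<times> (UNIV :: plane set)"
 define K where "K = cball x r"
 define Q where "Q = cball x0 (2 * r)"
 have fst_le: "(abs (fst a - fst b)) <= dist a b" for a b :: spacetime
  using norm_fst_le[of "fst a - fst b" "snd a - snd b"] by (simp add: dist_norm minus_prod_def)
 have QOm: "Q \<subseteq> {ta<..T} \<times> UNIV"
 proof
  fix p assume "p : Q"
  then have "(abs (fst x0 - fst p)) <= 2 * r" using fst_le[of x0 p] by (auto simp: Q_def)
  then show "p : {ta<..T} \<times> UNIV" using r(5,6) by (auto simp: mem_Times_iff abs_le_iff)
 qed
 have QOm': "Q \<subseteq> Om" using QOm by (auto simp: Om_def)
 have KQ: "p - s *R e - a : Q" if "p : K" "0 <= s" "s <= h" "norm a <= r / 4" for p s a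
 proof -
  have "x0 - (p - s *R e - a) = (x0 - x) + (x - p) + s *R e + a" by simp
  also have "norm ... <= r / 4 + r + r / 4 + r / 4"
  by (intro norm_triangle_mono) (use that r ce in "auto simp: K_def dist_norm norm_minus_commute")
  finally show ?thesis using r by (simp add: Q_def dist_norm)
 qed
 have K: "compact K" "!!p. p ~: K ==> th p = 0" "K \<subseteq> Om"
  using x KQ[of _ 0 0] r QOm' by (auto simp: K_def dist_norm norm_minus_commute)
 have t': "test1 Om th g" by (rule test1_restrict[OF t(1) K(1,3,2)])
 obtain K' where K': "!!p. p ~: K' ==> g p = 0" and "!!p. p ~: K ==> g p = 0"
 proof -
  have "g p = 0" if "p ~: K" for p
  proof -
  have "open (- K)" using K(1) by (simp add: compact_imp_closed open_Compl)
  moreover have "p : - K" using that by simp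
  ultimately have "((%x. 0) has_derivative (%v. g p \<bullet> v)) (at p)"
  by (rule has_derivative_transform_within_open[OF test1_deriv[OF t(1)]]) (use K(2) in auto)
  then have "(%v. g p \<bullet> v) = (%v. 0)" using has_derivative_unique has_derivative_const by blast
  then show ?thesis by (metis inner_eq_zero_iff)
  qed
  then show ?thesis using that by blast
 qed
 note gK = \<open>!!p. p ~: K ==> g p = 0\<close>
 have km: "(abs (max (u p) k)) <= M" for p using M(2)[of p] k by (auto simp: max_def)
 have C0: "0 <= C" using C(1)[of 0] M by force
 have L0: "0 <= L" using order_trans[OF abs_ge_zero L(1)[of M 0]] M by (simp add: zero_le_mult_iff)
 note bm = bdb_comp_continuous[OF bdb_max[OF u bdb_const]]
 note bu = bdb_comp_continuous[OF u]
 have bth: "bdb th" "bdb g" using test1_bdb[OF t(1)] by auto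

 define X where "X p = Gam (max (u p) k) + C *R c" for p
 have Xeq: "X p = (C + A (max (u p) k)) *R c + E (max (u p) k) *R e + D (max (u p) k) *R (0, \<xi>)" for p
  by (simp add: X_def dec scaleR_left_distrib)
 have bX: "bdb X" unfolding X_def[abs_def] by (intro bdb_add bdb_Gamma bdb_max u bdb_const)
 have nX: "norm (X p) <= 4 * C" for p
 proof -
  have "norm (X p) <= norm ((C + A (max (u p) k)) *R c) + norm (E (max (u p) k) *R e) + norm (D (max (u p) k) *R ((0, \<xi>) :: spacetime))"
  unfolding Xeq by (intro norm_triangle_mono order_refl)
  also have "... <= 2 * C + C + C"
  using C(1)[OF km[of p]] C(2)[OF km[of p]] C(3)[OF km[of p]] C0
  by (intro add_mono) (auto simp: norm_Pair ce norm_xi)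
  finally show ?thesis by simp
 qed
 have Xg: "(LBINT p. (abs (X p \<bullet> g p))) <= 4 * C * G"
 proof -
  have "(LBINT p. (abs (X p \<bullet> g p))) <= (LBINT p. 4 * C * norm (g p))"
  proof (rule integral_mono[OF integrable_abs[OF test1_int[OF bX t(1)]] integrable_mult_right[OF integrable_norm[OF test1_integrable(2)[OF t(1)]]]])
  show "(abs (X p \<bullet> g p)) <= 4 * C * norm (g p)" for p
  using Cauchy_Schwarz_ineq2[of "X p" "g p"] mult_right_mono[OF nX norm_ge_zero] by (rule order_trans)
  qed
  also have "... <= 4 * C * G" using G C0 by (simp add: mult_left_mono)
  finally show ?thesis .
 qed
 define J where "J = (LBINT p. th p * (A (max (u p) k) * (E (u p) - E (u (p - h *R e)))
  - E (max (u p) k) * (A (u p) - A (u (p - h *R e))) + C * (E (u p) - E (u (p - h *R e)))))"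
 have half: "sg * J <= (8 * C\<^sup>2 * G + 3 * C * L * (B * (T - ta))) * h" if sg: "sg = 1 | sg = -1" for sg :: real
 proof -
  define x' where "x' p = C + A (max (u p) k)" for p
  define z where "z p = C + sg * A (u p)" for p
  define Xe where "Xe p = E (max (u p) k)" for p
  define Ze where "Ze p = sg * E (u p)" for p
  define Xf where "Xf p = D (max (u p) k)" for p
  define Zf where "Zf p = sg * D (u p)" for p
  note df = x'_def z_def Xe_def Ze_def Xf_def Zf_def
  have bd: "bdb x'" "bdb z" "bdb Xe" "bdb Ze" "bdb Xf" "bdb Zf"
  unfolding df[abs_def] by (intro bdb_add bdb_mult bdb_const bm bu cont)+
  have x'b: "0 <= x' p" "(abs (x' p)) <= 2 * C" for p using C(1)[OF km[of p]] by (auto simp: x'_def abs_le_iff)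
  have zb: "0 <= z p" "z p <= 2 * C" for p using C(1)[OF M(2)[of p]] sg by (auto simp: z_def abs_le_iff)
  have XX: "nonpos_div Om (%p. x' p *R c + Xe p *R e + Xf p *R (0, \<xi>))"
  proof -
  have "nonpos_div Om X" unfolding X_def[abs_def] Om_def
  by (intro nonpos_div_add sub nonpos_div_const bdb_Gamma bdb_max u bdb_const)
  then show ?thesis by (simp add: Xeq[abs_def] df)
  qed
  have ZZ: "nonpos_div Om (%p. z p *R c + Ze p *R e + Zf p *R (0, \<xi>))"
  proof -
  have "nonpos_div Om (%p. sg *R Gam (u p) + C *R c)" unfolding Om_def
  using sg div by (intro nonpos_div_add nonpos_div_const bdb_scaleR bdb_Gamma u bdb_const) auto
  moreover have "sg *R Gam (u p) + C *R c = z p *R c + Ze p *R e + Zf p *R (0, \<xi>)" for p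
  by (simp add: dec df scaleR_left_distrib scaleR_right_distrib)
  ultimately show ?thesis by simp
  qed
  obtain N0 where N0: "!!n. n \<ge> N0 ==> 1 / real (Suc n) < r / 4" using Suc_inverse_small[of "r / 4"] r by (metis divide_pos_pos zero_less_numeral)
  have KS: "p - s : Q" if pK: "p : K" and sS: "s : ksupp (r / 4) h e" for p s
  proof -
  obtain a y where a: "s = a + y" "a : cball 0 (r / 4)" and "y : (%r. r *R e) ` {0..h}"
  using sS unfolding ksupp_def by blast
  then obtain b where "y = b *R e" "b : {0..h}" by blast
  with a have "s = a + b *R e" "norm a <= r / 4" "0 <= b" "b <= h" by (simp_all only: mem_cball_0 atLeastAtMost_iff)
  then show ?thesis using KQ[OF pK, of b a] by (simp add: algebra_simps)
  qed
  have "(LBINT p. th p * (x' p * Ze p - z p * Xe p)) <=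
  (LBINT p. th p * (x' p * Ze (p - h *R e) - z (p - h *R e) * Xe p)) +
  (2 * C * h) * (LBINT p. (abs ((x' p *R c + Xe p *R e + Xf p *R (0, \<xi>)) \<bullet> g p))) + 3 * C * L * (B * (T - ta)) * h"
  proof (rule interaction[OF _ t' t(2) K(1,2) gK r(2) _ bd x'b(1) zb(1) XX ZZ])
  show "open Om" unfolding Om_def by (intro open_Times) auto
  show "p - s *R e : Om" if "p : K" "0 <= s" "s <= h" for p s using KQ[OF that, of 0] r QOm' by auto
  show "(LBINT q. z q * kap n h e (p - q)) <= 2 * C * h" for n p
  proof -
  have ik: "integ (%q. kap n h e (p - q))" by (rule lborel_integrable_reflect[OF kap_integrable])
  have "integ (%q. kap n h e (p - q) *R z q)"
  by (rule integrable_mult_bounded[OF ik, of _ "2 * C"]) (use zb bdb_measurable[OF bd(2)] in "auto simp: abs_of_nonneg")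
  then have "(LBINT q. z q * kap n h e (p - q)) <= (LBINT q. (2 * C) * kap n h e (p - q))"
  by (intro integral_mono integrable_mult_right ik mult_right_mono zb kap_nonneg) (simp add: mult.commute)
  then show ?thesis by (simp add: kap_integral_reflect[OF r(2)])
  qed
  fix n assume n: "N0 <= n"
  have "\<bar>LBINT p. LBINT q. th p * (%w. z (snd w) * Xf (fst w) - x' (fst w) * Zf (snd w)) (p, q) * ((0, \<xi>) \<bullet> kapg n h e (p - q))\<bar>
  <= (3 * C * L) * (B * (T - ta)) * (LBINT w. kap n h e w)"
  proof (rule BV_kernel[OF bth(1) t(2,3) K(1,2) kap_test1 kap_nonneg compact_ksupp[of "r / 4" h e]])
  show "kap n h e w = 0" "kapg n h e w = 0" if "w ~: ksupp (r / 4) h e" for w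
  using kap_eq_0[OF N0[OF n] that] kapg_eq_0[OF N0[OF n] that] .
  show "bdb (%w. z (snd w) * Xf (fst w) - x' (fst w) * Zf (snd w))"
  by (intro bdb_diff bdb_mult bdb_fst bdb_snd bd)
  \<comment> \<open>The constant 3 C L collects C L from the variation of \<open>z\<close> and 2 C L
    from that of \<open>Zf\<close>, the latter multiplied by \<open>x'\<close>, which is at most 2
    C.\<close>
  show "(abs ((%w. z (snd w) * Xf (fst w) - x' (fst w) * Zf (snd w)) (p, q') - (%w. z (snd w) * Xf (fst w) - x' (fst w) * Zf (snd w)) (p, q)))
  <= 3 * C * L * (abs (u q' - u q))" for p q q'
  proof -
  have "(abs ((z q' - z q) * Xf p)) <= (L * (abs (u q' - u q))) * C"
  unfolding abs_mult using sg L(1)[OF M(2) M(2), of q' q] C(3)[OF km] C0 L0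
  by (intro mult_mono) (auto simp: df abs_minus_commute)
  moreover have "(abs (x' p * (Zf q' - Zf q))) <= (2 * C) * (L * (abs (u q' - u q)))"
  unfolding abs_mult using sg L(2)[OF M(2) M(2), of q' q] x'b(2)[of p] C0 L0
  by (intro mult_mono) (auto simp: df abs_minus_commute)
  moreover have "z q' * Xf p - x' p * Zf q' - (z q * Xf p - x' p * Zf q) = (z q' - z q) * Xf p - x' p * (Zf q' - Zf q)"
  by (simp add: algebra_simps)
  ultimately show ?thesis by (simp add: algebra_simps)
  qed
  show "0 <= 3 * C * L" using C0 L0 by simp
  show "compact Q" by (simp add: Q_def)
  show "(LBINT q. ind Q q * (abs (u (q + s *R (0, \<xi>)) - u q))) <= B * (T - ta) * s" if "0 < s" for s
  using BV[OF _ _ QOm, of s] that r by (simp add: Q_def)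
  qed (use u KS in auto)
  then show "\<bar>LBINT p. LBINT q. th p * (z q * Xf p - x' p * Zf q) * ((0, \<xi>) \<bullet> kapg n h e (p - q))\<bar>
  <= 3 * C * L * (B * (T - ta)) * h" by (simp add: kap_integral[OF r(2)])
  qed
  moreover have "(LBINT p. (abs ((x' p *R c + Xe p *R e + Xf p *R (0, \<xi>)) \<bullet> g p))) <= 4 * C * G"
  using Xg by (simp add: Xeq df)
  then have "(2 * C * h) * (LBINT p. (abs ((x' p *R c + Xe p *R e + Xf p *R (0, \<xi>)) \<bullet> g p))) <= (2 * C * h) * (4 * C * G)"
  using C0 r by (intro mult_left_mono) auto
  moreover have "(LBINT p. th p * (x' p * Ze p - z p * Xe p)) - (LBINT p. th p * (x' p * Ze (p - h *R e) - z (p - h *R e) * Xe p)) = sg * J"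
  proof -
  have bs: "bdb (%p. Ze (p - h *R e))" "bdb (%p. z (p - h *R e))" by (rule bdb_comp[OF bd(4)] bdb_comp[OF bd(2)]; simp)+
  have i: "integ (%p. th p * (x' p * Ze p - z p * Xe p))"
  "integ (%p. th p * (x' p * Ze (p - h *R e) - z (p - h *R e) * Xe p))"
  by (rule bdb_integrable[OF bdb_mult[OF bth(1) bdb_diff[OF bdb_mult bdb_mult]] K(1)]; (rule bd bs)?; simp add: K(2))+
  show ?thesis unfolding B_diff[OF i, symmetric] J_def integral_mult_right_zero[symmetric]
  by (rule B_cong[OF refl]) (simp add: df algebra_simps)
  qed
  ultimately show ?thesis by (simp add: algebra_simps power2_eq_square)
 qed
 show ?thesis using half[of 1] half[of "-1"] unfolding J_def[symmetric] by (simp add: abs_le_iff)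
qed

end

section \<open>Averaging over Kruzhkov's parameter\<close>

lemma clamped_weight_integral:
 fixes w W h Q :: "real => real"
 assumes W: "!!v. (W has_real_derivative w v) (at v)" and Q: "!!v. (Q has_real_derivative w v * h v) (at v)"
  and a: "- M <= a" "a <= M"
 shows "((%k. w k * h (max a k)) has_integral (W a - W (- M)) * h a + (Q M - Q a)) {- M..M}"
proof (rule has_integral_combine[OF a])
 have "((%k. w k * h a) has_integral W a * h a - W (- M) * h a) {- M..a}"
  by (rule fundamental_theorem_of_calculus[OF a(1)])
  (auto intro!: derivative_eq_intros has_field_derivative_at_within[OF W] simp: has_real_derivative_iff_has_vector_derivative[symmetric])
 then show "((%k. w k * h (max a k)) has_integral (W a - W (- M)) * h a) {- M..a}"
  unfolding left_diff_distrib by (rule has_integral_eq[rotated]) (auto simp: max_def)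
 have "((%k. w k * h k) has_integral Q M - Q a) {a..M}"
  by (rule fundamental_theorem_of_calculus[OF a(2)])
  (auto intro!: has_field_derivative_at_within[OF Q] simp: has_real_derivative_iff_has_vector_derivative[symmetric])
 then show "((%k. w k * h (max a k)) has_integral Q M - Q a) {a..M}"
  by (rule has_integral_eq[rotated]) (auto simp: max_def)
qed

text \<open>The determinant of two increments between b and a: that of the curve (v, g v), and that
  of its truncation at level k.\<close>

definition kruzhkov_commutator :: "(real => real) => real => real => real => real" where
 "kruzhkov_commutator g k a b = (a - b) * (g (max a k) - g (max b k)) - (g a - g b) * (max a k - max b k)"

text \<open>The right-hand side is \<open>(a - b) \<integral> g'\<^sup>2 - (\<integral> g')\<^sup>2\<close> with integrals from \<open>b\<close> to \<open>a\<close>.\<close>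

lemma commutator_integral:
 fixes al be M a b :: real
 defines "g == %v. al * v\<^sup>2 / 2 + be * v ^ 3 / 3"
 assumes a: "(abs a) <= M" and b: "(abs b) <= M"
 shows "(LBINT k. ind {- M..M} k * ((al + 2 * be * k) * kruzhkov_commutator g k a b))
  = (a - b)\<^sup>2 * ((al + be * (a + b))\<^sup>2 * (a - b)\<^sup>2 / 12 + be\<^sup>2 * (a - b) ^ 4 / 180)"
proof -
 \<comment> \<open>Here \<open>w\<close> is the second and \<open>W\<close> the first derivative of
   g, while \<open>Q1\<close> and \<open>Q2\<close> are primitives of w v and w g. All terms that
   depend on \<open>M\<close> cancel in the combination below.\<close>
 define w where "w k = al + 2 * be * k" for k
 define W where "W v = al * v + be * v\<^sup>2" for v
 define Q1 where "Q1 v = al * v\<^sup>2 / 2 + 2 * be * v ^ 3 / 3" for v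
 define Q2 where "Q2 v = al\<^sup>2 * v ^ 3 / 6 + al * be * v ^ 4 / 3 + 2 * be\<^sup>2 * v ^ 5 / 15" for v
 have W: "(W has_real_derivative w v) (at v)" for v
  unfolding W_def[abs_def] w_def by (auto intro!: derivative_eq_intros)
 have Q1: "(Q1 has_real_derivative w v * v) (at v)" for v
  unfolding Q1_def[abs_def] w_def by (auto intro!: derivative_eq_intros simp: field_simps power2_eq_square)
 have Q2: "(Q2 has_real_derivative w v * g v) (at v)" for v
  unfolding Q2_def[abs_def] w_def g_def by (auto intro!: derivative_eq_intros simp: field_simps eval_nat_numeral)
 have ab: "- M <= a" "a <= M" "- M <= b" "b <= M" using a b by auto
 note I = clamped_weight_integral[OF W Q1 ab(1,2)] clamped_weight_integral[OF W Q1 ab(3,4)]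
  clamped_weight_integral[OF W Q2 ab(1,2)] clamped_weight_integral[OF W Q2 ab(3,4)]
 have "((%k. (a - b) * (w k * g (max a k) - w k * g (max b k)) - (g a - g b) * (w k * max a k - w k * max b k)) has_integral
  (a - b) * (((W a - W (- M)) * g a + (Q2 M - Q2 a)) - ((W b - W (- M)) * g b + (Q2 M - Q2 b)))
  - (g a - g b) * (((W a - W (- M)) * a + (Q1 M - Q1 a)) - ((W b - W (- M)) * b + (Q1 M - Q1 b)))) {- M..M}"
  by (intro has_integral_diff has_integral_mult_right I)
 moreover have "(%k. (a - b) * (w k * g (max a k) - w k * g (max b k)) - (g a - g b) * (w k * max a k - w k * max b k))
  = (%k. w k * kruzhkov_commutator g k a b)"
  by (rule ext) (simp add: kruzhkov_commutator_def algebra_simps)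
 moreover have "(a - b) * (((W a - W (- M)) * g a + (Q2 M - Q2 a)) - ((W b - W (- M)) * g b + (Q2 M - Q2 b)))
  - (g a - g b) * (((W a - W (- M)) * a + (Q1 M - Q1 a)) - ((W b - W (- M)) * b + (Q1 M - Q1 b)))
  = (a - b) * ((W a * g a - Q2 a) - (W b * g b - Q2 b)) - (g a - g b) * ((W a * a - Q1 a) - (W b * b - Q1 b))"
  by (simp add: algebra_simps)
 moreover have "... = (a - b)\<^sup>2 * ((al + be * (a + b))\<^sup>2 * (a - b)\<^sup>2 / 12 + be\<^sup>2 * (a - b) ^ 4 / 180)"
 proof -
  have "180 * ((a - b) * ((W a * g a - Q2 a) - (W b * g b - Q2 b)) - (g a - g b) * ((W a * a - Q1 a) - (W b * b - Q1 b)))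
  = 180 * ((a - b)\<^sup>2 * ((al + be * (a + b))\<^sup>2 * (a - b)\<^sup>2 / 12 + be\<^sup>2 * (a - b) ^ 4 / 180))"
  unfolding W_def g_def Q1_def Q2_def by (simp add: field_simps eval_nat_numeral)
  then show ?thesis by simp
 qed
 ultimately have I: "((%k. w k * kruzhkov_commutator g k a b) has_integral (a - b)\<^sup>2 * ((al + be * (a + b))\<^sup>2 * (a - b)\<^sup>2 / 12 + be\<^sup>2 * (a - b) ^ 4 / 180)) {- M..M}"
  by simp
 have "continuous_on {- M..M} (%k. w k * kruzhkov_commutator g k a b)"
  unfolding w_def kruzhkov_commutator_def g_def by (intro continuous_intros) auto
 then have "set_integrable lborel {- M..M} (%k. w k * kruzhkov_commutator g k a b)" by (rule borel_integrable_atLeastAtMost')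
 from set_borel_integral_eq_integral(2)[OF this] integral_unique[OF I]
 show ?thesis by (simp add: set_lebesgue_integral_def w_def)
qed

context bounded_solution
begin

text \<open>\<open>interaction_half\<close> is used twice: at \<open>x0\<close> in direction
  \<open>e\<close>, and at the centre moved by \<open>- h *R e\<close> in direction
  \<open>- e\<close> with the sign of \<open>E\<close> reversed. After translating the second
  integrand, the difference of the two contains only increments between p and p - h e, and the terms
  with \<open>C\<close> cancel.\<close>

lemma interaction_full:
 fixes A E D :: "real => real" and c e :: spacetime
 assumes dec: "!!a. Gam a = A a *R c + E a *R e + D a *R (0, \<xi>)"
  and cont: "contU A" "contU E" "contU D"
  and C: "!!a. (abs a) <= M ==> (abs (A a)) <= C" "!!a. (abs a) <= M ==> (abs (E a)) <= C" "!!a. (abs a) <= M ==> (abs (D a)) <= C"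
  and L: "!!a b. (abs a) <= M ==> (abs b) <= M ==> (abs (A a - A b)) <= L * (abs (a - b))"
  "!!a b. (abs a) <= M ==> (abs b) <= M ==> (abs (D a - D b)) <= L * (abs (a - b))"
  and ce: "norm c = 1" "norm e = 1"
  and r: "0 < r" "0 <= h" "h <= r / 4" "ta < fst x0 - 2 * r" "fst x0 + 2 * r <= T"
  and k: "(abs k) <= M"
 shows "\<bar>LBINT p. cutoff r (p - x0) *
  ((A (u p) - A (u (p - h *R e))) * (E (max (u p) k) - E (max (u (p - h *R e)) k))
  - (E (u p) - E (u (p - h *R e))) * (A (max (u p) k) - A (max (u (p - h *R e)) k)))\<bar>
  <= 2 * ((8 * C\<^sup>2 * (LBINT p. norm (cutoff_grad r (p :: spacetime))) + 3 * C * L * (B * (T - ta))) * h)"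
proof -
 define G where "G = (LBINT p. norm (cutoff_grad r (p :: spacetime)))"
 define R where "R = (8 * C\<^sup>2 * G + 3 * C * L * (B * (T - ta))) * h"
 define F1 where "F1 p = cutoff r (p - x0) * (A (max (u p) k) * (E (u p) - E (u (p - h *R e)))
  - E (max (u p) k) * (A (u p) - A (u (p - h *R e))) + C * (E (u p) - E (u (p - h *R e))))" for p
 define F2 where "F2 p = cutoff r (p - (x0 - h *R e)) * (A (max (u p) k) * (- E (u p) - - E (u (p - h *R (- e))))
  - - E (max (u p) k) * (A (u p) - A (u (p - h *R (- e)))) + C * (- E (u p) - - E (u (p - h *R (- e)))))" for p
 have t: "test1 UNIV (%p. cutoff r (p - x)) (%p. cutoff_grad r (p - x))" for x :: spacetime
  by (rule test1_shift[OF cutoff_test1(1)[OF r(1)]]) simp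
 have G: "(LBINT p. norm (cutoff_grad r (p - x))) <= G" for x :: spacetime
  using lborel_integral_shift[of "%p::spacetime. norm (cutoff_grad r p)" "- x"] test1_measurable(2)[OF cutoff_test1(1)[OF r(1)], where 'a = spacetime]
  by (simp add: G_def)
 have 1: "\<bar>LBINT p. F1 p\<bar> <= R" unfolding F1_def R_def
  by (rule interaction_half[OF dec cont C L ce t _ _ _ G r(1,2,3) _ r(4,5) k]) (use r cutoff_test1[OF r(1)] in auto)
 have "x0 - h *R e - x0 = - (h *R e)" by simp
 then have hx: "dist (x0 - h *R e) x0 <= r / 4" using r ce by (simp only: dist_norm norm_minus_cancel norm_scaleR)
 have 2: "\<bar>LBINT p. F2 p\<bar> <= R" unfolding F2_def R_def
  by (rule interaction_half[of A c "%a. - E a" "- e" D C L, OF _ cont(1) continuous_on_minus[OF cont(2)] cont(3) C(1) _ C(3) L ce(1) _ t _ _ _ G r(1,2,3) hx r(4,5) k])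
  (use r ce dec C(2) cutoff_test1[OF r(1)] in auto)
 note bm = bdb_comp_continuous[OF bdb_max[OF u bdb_const]]
 note bu = bdb_comp_continuous[OF u]
 have bs: "bdb (%p. f (u (p - v)))" if "contU f" for f :: "real => real" and v
  by (rule bdb_comp[OF bu[OF that]]) simp
 have K: "cutoff r (p - x) = 0" if "p ~: cball x r" for p x :: spacetime
  using that by (intro cutoff_test1(5) r) (simp add: dist_norm norm_minus_commute)
 note fs = bm[OF cont(1)] bm[OF cont(2)] bu[OF cont(1)] bu[OF cont(2)] bs[OF cont(1)] bs[OF cont(2)]
 have i1: "integ F1"
 proof (rule bdb_integrable[OF _ compact_cball])
  show "bdb F1" unfolding F1_def[abs_def] by (intro fs bdb_mult bdb_diff bdb_add bdb_const test1_bdb(1)[OF t])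
  show "F1 p = 0" if "p ~: cball x0 r" for p using K[OF that] by (simp add: F1_def)
 qed
 have i2: "integ F2"
 proof (rule bdb_integrable[OF _ compact_cball])
  show "bdb F2" unfolding F2_def[abs_def] by (intro fs bdb_mult bdb_diff bdb_add bdb_minus bdb_const test1_bdb(1)[OF t])
  show "F2 p = 0" if "p ~: cball (x0 - h *R e) r" for p using K[OF that] by (simp add: F2_def)
 qed
 have i2': "integ (%p. F2 (p - h *R e))" using lborel_integrable_shift[OF i2, of "- (h *R e)"] by simp
 have "(LBINT p. F2 (p - h *R e)) = (LBINT p. F2 p)"
  using lborel_integral_shift[OF borel_measurable_integrable[OF i2, simplified], of "- (h *R e)"] by simp
 moreover have "(LBINT p. F2 (p - h *R e)) - (LBINT p. F1 p) = (LBINT p. cutoff r (p - x0) *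
  ((A (u p) - A (u (p - h *R e))) * (E (max (u p) k) - E (max (u (p - h *R e)) k))
  - (E (u p) - E (u (p - h *R e))) * (A (max (u p) k) - A (max (u (p - h *R e)) k))))"
  unfolding B_diff[OF i2' i1, symmetric]
  by (rule B_cong[OF refl]) (simp add: F1_def F2_def algebra_simps)
 ultimately show ?thesis using 1 2 unfolding G_def[symmetric] R_def[symmetric] by linarith
qed

end

context bounded_solution
begin

abbreviation gflux :: "real => real" where
 "gflux v == et $ 1 * v\<^sup>2 / 2 + et $ 2 * v ^ 3 / 3"

text \<open>\<open>Gam\<close> is split along time, \<open>et\<close> and \<xi>. The transversal and
  the time shift differ only in which of the first two components plays the role of \<open>A\<close>
  and which that of \<open>E\<close>; exchanging them reverses the sign of the commutator.\<close>

lemma commutator_estimate: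
 assumes e: "e = (0, et) | e = (1, 0)"
  and r: "0 < r" "0 <= h" "h <= r / 4" "ta < fst x0 - 2 * r" "fst x0 + 2 * r <= T"
  and k: "(abs k) <= M" and C: "C = M + (M + M\<^sup>2) * M"
 shows "\<bar>LBINT p. cutoff r (p - x0) * kruzhkov_commutator gflux k (u p) (u (p - h *R e))\<bar>
  <= 2 * ((8 * C\<^sup>2 * (LBINT p. norm (cutoff_grad r (p :: spacetime))) + 3 * C * (1 + M + M\<^sup>2) * (B * (T - ta))) * h)"
proof -
 have g: "gflux a = et \<bullet> flux a" for a by (simp add: inner_flux)
 have dec: "Gam a = a *R (1, 0) + gflux a *R (0, et) + (\<xi> \<bullet> flux a) *R (0, \<xi>)" for a
  using frame_expand[of "flux a"] by (simp add: Gam_def g inner_commute add.commute)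
 have nv: "(abs (v \<bullet> w)) <= norm w" if "norm v = 1" for v w :: plane
  using Cauchy_Schwarz_ineq2[of v w] that by simp
 have fl: "norm (flux a) <= (M + M\<^sup>2) * M" if "(abs a) <= M" for a
 proof -
  have "norm (flux a - flux 0) <= (M + M\<^sup>2) * (abs (a - 0))" using that M by (intro flux_Lipschitz) auto
  also have "... <= (M + M\<^sup>2) * M" using that M by (intro mult_left_mono) auto
  finally show ?thesis by (simp add: flux_eq)
 qed
 have M2: "0 <= (M + M\<^sup>2) * M" using M by simp
 have bd: "(abs a) <= C" "(abs (gflux a)) <= C" "(abs (\<xi> \<bullet> flux a)) <= C" if "(abs a) <= M" for a
  using that nv[OF norm_eta, of "flux a"] nv[OF norm_xi, of "flux a"] fl[OF that] M M2 unfolding g C by linarith+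
 have Lp: "(abs (v \<bullet> flux a - v \<bullet> flux b)) <= (1 + M + M\<^sup>2) * (abs (a - b))" if "norm v = 1" "(abs a) <= M" "(abs b) <= M" for v a b
 proof -
  have "(abs (v \<bullet> flux a - v \<bullet> flux b)) <= (M + M\<^sup>2) * (abs (a - b))"
  using nv[OF that(1), of "flux a - flux b"] flux_Lipschitz[OF that(2,3)] by (simp add: inner_diff_right)
  then show ?thesis by (simp add: algebra_simps)
 qed
 have L1: "(abs (a - b)) <= (1 + M + M\<^sup>2) * (abs (a - b))" for a b :: real
  using M mult_right_mono[of 1 "1 + M + M\<^sup>2" "(abs (a - b))"] by simp
 have c: "contU (%a::real. a)" "contU gflux" "contU (%a. \<xi> \<bullet> flux a)"
  by (intro continuous_intros continuous_flux; simp)+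
 have n: "norm ((1, 0) :: spacetime) = 1" "norm ((0, et) :: spacetime) = 1" by (simp_all add: norm_Pair norm_eta)
 show ?thesis
 proof (cases "e = (0, et)")
  case True
  show ?thesis unfolding True kruzhkov_commutator_def
  by (rule interaction_full[OF dec c bd L1 Lp[OF norm_xi] n r k]; assumption)
 next
  case False
  have dec': "Gam a = gflux a *R (0, et) + a *R (1, 0) + (\<xi> \<bullet> flux a) *R (0, \<xi>)" for a
  using dec[of a] by (simp add: add.commute)
  have "kruzhkov_commutator gflux k a b = - ((gflux a - gflux b) * (max a k - max b k) - (a - b) * (gflux (max a k) - gflux (max b k)))" for a b
  by (simp add: kruzhkov_commutator_def)
  moreover have "e = (1, 0)" using False e by simp
  moreover have "\<bar>LBINT p. cutoff r (p - x0) * ((gflux (u p) - gflux (u (p - h *R (1, 0)))) * (max (u p) k - max (u (p - h *R (1, 0))) k)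
  - (u p - u (p - h *R (1, 0))) * (gflux (max (u p) k) - gflux (max (u (p - h *R (1, 0))) k)))\<bar>
  <= 2 * ((8 * C\<^sup>2 * (LBINT p. norm (cutoff_grad r (p :: spacetime))) + 3 * C * (1 + M + M\<^sup>2) * (B * (T - ta))) * h)"
  by (rule interaction_full[OF dec' c(2,1,3) bd(2,1,3) Lp[OF norm_eta, folded g] Lp[OF norm_xi] n(2,1) r k]; assumption)
  ultimately show ?thesis by (simp only: mult_minus_right B_minus abs_minus_cancel)
 qed
qed

text \<open>The commutator estimate is uniform in k, so it can be integrated over k in [-M, M]
  against the second derivative of the transversal flux, a weight bounded by 1 + 2 M. After Fubini,
  \<open>commutator_integral\<close> evaluates the integral over k pointwise, and \<open>ka\<close>
  compares it with the sixth power.\<close>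

lemma sixth_power_estimate:
 assumes e: "e = (0, et) | e = (1, 0)"
  and r: "0 < r" "0 <= h" "h <= r / 4" "ta < fst x0 - 2 * r" "fst x0 + 2 * r <= T"
  and C: "C = M + (M + M\<^sup>2) * M"
  and ka: "0 < ka" "!!a b. (abs a) <= M ==> (abs b) <= M ==>
  ka * (abs (a - b)) ^ 6 <= (a - b)\<^sup>2 * ((et $ 1 + et $ 2 * (a + b))\<^sup>2 * (a - b)\<^sup>2 / 12 + (et $ 2)\<^sup>2 * (a - b) ^ 4 / 180)"
 shows "ka * (LBINT p. cutoff r (p - x0) * (abs (u p - u (p - h *R e))) ^ 6)
  <= 4 * M * (1 + 2 * M) * (8 * C\<^sup>2 * (LBINT p. norm (cutoff_grad r (p :: spacetime))) + 3 * C * (1 + M + M\<^sup>2) * (B * (T - ta))) * h"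
proof -
 define R where "R = 2 * ((8 * C\<^sup>2 * (LBINT p. norm (cutoff_grad r (p :: spacetime))) + 3 * C * (1 + M + M\<^sup>2) * (B * (T - ta))) * h)"
 define v where "v p = u (p - h *R e)" for p
 \<comment> \<open>Clamping changes nothing on the interval of integration but makes the integrand
   bounded for all real k, as the Fubini lemma asks.\<close>
 define cl where "cl k = max (- M) (min M k)" for k
 define w where "w k = et $ 1 + 2 * et $ 2 * cl k" for k
 define I where "I = {- M..M}"
 define S where "S k p = kruzhkov_commutator gflux (cl k) (u p) (v p)" for k p
 define F where "F z = ind I (fst z) * w (fst z) * (cutoff r (snd z - x0) * S (fst z) (snd z))" for z :: "real \<times> spacetime"
 have cl: "(abs (cl k)) <= M" "k : I ==> cl k = k" for k using M by (auto simp: cl_def I_def abs_le_iff max_def min_def)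
 have bcl: "bdb cl" by (rule bdbI[of _ M]) (use cl(1) in "auto simp: cl_def[abs_def]")
 have bv: "bdb v" unfolding v_def[abs_def] by (rule bdb_comp[OF u]) simp
 have t: "test1 UNIV (%p. cutoff r (p - x0)) (%p. cutoff_grad r (p - x0))"
  by (rule test1_shift[OF cutoff_test1(1)[OF r(1)]]) simp
 have cg: "contU gflux" by (intro continuous_intros) auto
 have K: "cutoff r (p - x0) = 0" if "p ~: cball x0 r" for p
  using that by (intro cutoff_test1(5) r) (simp add: dist_norm norm_minus_commute)
 have bmx: "bdb (%z::real \<times> spacetime. max (u (snd z)) (cl (fst z)))" "bdb (%z::real \<times> spacetime. max (v (snd z)) (cl (fst z)))"
  by (intro bdb_max bdb_fst[OF bcl] bdb_snd[OF u] bdb_snd[OF bv])+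
 have bI: "bdb (ind I :: real => real)" unfolding I_def by (rule bdb_indicator) simp
 have bw: "bdb w" unfolding w_def[abs_def] by (intro bdb_add bdb_mult bdb_const bcl)
 have bF: "bdb F" unfolding F_def[abs_def] S_def kruzhkov_commutator_def
  by (rule bdb_mult[OF bdb_mult[OF bdb_fst[OF bI] bdb_fst[OF bw]] bdb_mult[OF bdb_snd[OF test1_bdb(1)[OF t]] bdb_diff[OF bdb_mult bdb_mult]]];
  intro bdb_diff bdb_comp_continuous[OF bmx(1) cg] bdb_comp_continuous[OF bmx(2) cg] bmx bdb_snd[OF u] bdb_snd[OF bv]
  bdb_comp_continuous[OF bdb_snd[OF u] cg] bdb_comp_continuous[OF bdb_snd[OF bv] cg])
 obtain D where D: "!!z. (abs (F z)) <= D" using bdb_abs_bound[OF bF] by metis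
 have Z: "F z = 0" if "z ~: I \<times> cball x0 r" for z
  using that K[of "snd z"] by (cases "fst z : I") (auto simp: F_def mem_Times_iff)
 have cI: "compact (I \<times> cball x0 r)" unfolding I_def by (intro compact_Times) auto
 note Fub = fubini_bounded_support[OF bdb_measurable[OF bF] D cI Z]
 have inner: "(LBINT p. F (k, p)) = ind I k * w k * (LBINT p. cutoff r (p - x0) * S k p)" for k
  unfolding F_def by simp
 have w: "(abs (w k)) <= 1 + 2 * M" for k
 proof -
  have "(abs (et $ 1)) <= 1" "(abs (et $ 2)) <= 1" using component_le_norm_cart[of et] norm_eta by metis+
  then have "(abs (et $ 1)) + 2 * ((abs (et $ 2)) * (abs (cl k))) <= 1 + 2 * (1 * M)" using cl(1)[of k] by (intro add_mono mult_left_mono mult_mono) auto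
  then show ?thesis unfolding w_def using abs_triangle_ineq[of "et $ 1" "2 * et $ 2 * cl k"] by (simp add: abs_mult)
 qed
 have "(LBINT k. LBINT p. F (k, p)) <= (LBINT k. ind I k * ((1 + 2 * M) * R))"
 proof (rule integral_mono)
  show "integ (%k. LBINT p. F (k, p))" by (rule Fub(4))
  show "integ (%k. ind I k * ((1 + 2 * M) * R))" unfolding I_def by (rule Icc_integrable)
  show "(LBINT p. F (k, p)) <= ind I k * ((1 + 2 * M) * R)" for k
  proof -
  have "\<bar>LBINT p. cutoff r (p - x0) * S k p\<bar> <= R"
  unfolding S_def v_def R_def by (rule commutator_estimate[OF e r cl(1) C])
  then have "(abs (w k)) * \<bar>LBINT p. cutoff r (p - x0) * S k p\<bar> <= (1 + 2 * M) * R" using w M by (intro mult_mono) auto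
  then have "w k * (LBINT p. cutoff r (p - x0) * S k p) <= (1 + 2 * M) * R" by (simp only: abs_mult[symmetric] abs_le_iff)
  then show ?thesis unfolding inner mult.assoc by (intro mult_left_mono) auto
  qed
 qed
 also have "... = 2 * M * ((1 + 2 * M) * R)" using M unfolding I_def by simp
 finally have "(LBINT k. LBINT p. F (k, p)) <= 2 * M * ((1 + 2 * M) * R)" .
 moreover have "(LBINT p. LBINT k. F (k, p)) = (LBINT k. LBINT p. F (k, p))" by (rule Fub(6)[symmetric])
 ultimately have up: "(LBINT p. LBINT k. F (k, p)) <= 2 * M * ((1 + 2 * M) * R)" by simp
 have vM: "(abs (v p)) <= M" for p unfolding v_def by (rule M)
 have low: "ka * (cutoff r (p - x0) * (abs (u p - v p)) ^ 6) <= (LBINT k. F (k, p))" for p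
 proof -
  have "F (k, p) = cutoff r (p - x0) * (ind {- M..M} k * ((et $ 1 + 2 * et $ 2 * k) * kruzhkov_commutator gflux k (u p) (v p)))" for k
  using cl(2)[of k] by (cases "k : I") (auto simp: F_def S_def w_def I_def)
  then have "(LBINT k. F (k, p)) = cutoff r (p - x0) * ((u p - v p)\<^sup>2 * ((et $ 1 + et $ 2 * (u p + v p))\<^sup>2 * (u p - v p)\<^sup>2 / 12 + (et $ 2)\<^sup>2 * (u p - v p) ^ 4 / 180))"
  by (simp only: integral_mult_right_zero commutator_integral[OF M(2) vM])
  moreover have "cutoff r (p - x0) * (ka * (abs (u p - v p)) ^ 6) <= ..."
  by (rule mult_left_mono[OF ka(2)[OF M(2) vM] cutoff_test1(2)[OF r(1)]])
  ultimately show ?thesis by (simp only: mult.left_commute)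
 qed
 have "ka * (LBINT p. cutoff r (p - x0) * (abs (u p - v p)) ^ 6) = (LBINT p. ka * (cutoff r (p - x0) * (abs (u p - v p)) ^ 6))" by simp
 also have "... <= (LBINT p. LBINT k. F (k, p))"
 proof (rule integral_mono[OF _ Fub(5) low])
  have "contU (%x::real. (abs x) ^ 6)" by (intro continuous_intros)
  from bdb_comp_continuous[OF bdb_diff[OF u bv] this]
  have "bdb (%p. cutoff r (p - x0) * (abs (u p - v p)) ^ 6)" by (intro bdb_mult test1_bdb(1)[OF t])
  then have "integ (%p. cutoff r (p - x0) * (abs (u p - v p)) ^ 6)"
  by (rule bdb_integrable[OF _ compact_cball[of x0 r]]) (simp add: K)
  then show "integ (%p. ka * (cutoff r (p - x0) * (abs (u p - v p)) ^ 6))" by (rule integrable_mult_right)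
 qed
 also note up
 finally show ?thesis unfolding v_def R_def by (simp add: algebra_simps)
qed

end

section \<open>Equicontinuity\<close>

lemma nonpos_div_mono: "nonpos_div Om X ==> Om' \<subseteq> Om ==> nonpos_div Om' X"
 unfolding nonpos_div_def test1_def by (meson subset_trans)

text \<open>\<open>V\<close> stands for a truncation of \<open>U\<close>, whose increments are no
  larger. The bound for each time is integrated over the slab, giving the factor T - ta.\<close>

lemma slab_translation:
 fixes U V :: "spacetime => real"
 assumes U: "bdb U" and V: "bdb V" "!!p q. (abs (V p - V q)) <= (abs (U p - U q))"
  and L1: "AE t in lborel. 0 < t --> integ (%x. U (t, x))"
  and BV: "AE t in lborel. 0 < t --> (LBINT x. (abs (U (t, x + h *R \<xi>) - U (t, x)))) <= B * (abs h)"
  and Q: "compact Q" "Q \<subseteq> {ta<..T} \<times> UNIV" "0 <= ta" "ta <= T" and B: "0 <= B"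
 shows "(LBINT p. ind Q p * (abs (V (p + h *R (0, \<xi>)) - V p))) <= B * (T - ta) * (abs h)"
proof -
 define f where "f p = ind Q p * (abs (V (p + h *R (0, \<xi>)) - V p))" for p
 have "bdb (%p. V (p + h *R (0, \<xi>)) - V p)" by (rule bdb_diff[OF bdb_comp[OF V(1)] V(1)]) simp
 then have "bdb (%p. (abs (V (p + h *R (0, \<xi>)) - V p)))" by (rule bdb_comp_continuous) (intro continuous_intros)
 then have bf: "bdb f" unfolding f_def[abs_def] by (intro bdb_mult bdb_indicator Q)
 obtain C where C: "!!p. (abs (f p)) <= C" using bdb_abs_bound[OF bf] by metis
 have Z: "f p = 0" if "p ~: Q" for p using that by (simp add: f_def)
 note F = fubini_bounded_support[OF bdb_measurable[OF bf] C Q(1) Z]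
 have "(LBINT p. f p) = (LBINT t. LBINT x. f (t, x))" by (rule F(7)[symmetric])
 also have "... <= (LBINT t. ind {ta..T} t * (B * (abs h)))"
 proof (rule integral_mono_AE[OF F(4) Icc_integrable])
  show "AE t in lborel. (LBINT x. f (t, x)) <= ind {ta..T} t * (B * (abs h))"
  using L1 BV
  proof eventually_elim
  case (elim t)
  show ?case
  proof (cases "ta < t & t <= T")
  case True
  then have t: "0 < t" using Q(3) by simp
  have i: "integ (%x. (abs (U (t, x + h *R \<xi>) - U (t, x))))"
  using elim(1) t lborel_integrable_shift[of "%x. U (t, x)" "h *R \<xi>"] by simp
  have "(LBINT x. f (t, x)) <= (LBINT x. (abs (U (t, x + h *R \<xi>) - U (t, x))))"
  proof (rule integral_mono[OF F(2) i])
  show "f (t, x) <= (abs (U (t, x + h *R \<xi>) - U (t, x)))" for x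
  using V(2)[of "(t, x + h *R \<xi>)" "(t, x)"] by (simp add: f_def indicator_def)
  qed
  also have "... <= B * (abs h)" using elim(2) t by simp
  finally show ?thesis using True by simp
  next
  case False
  then have "f (t, x) = 0" for x using Q(2) by (intro Z) auto
  then show ?thesis using B by simp
  qed
  qed
 qed
 also have "... = B * (T - ta) * (abs h)" using Q(4) by simp
 finally show ?thesis by (simp only: f_def)
qed

lemma regular_solutionD:
 assumes "regular_solution \<xi> B U"
 shows "bdb U" "nonpos_div half_space (%p. Gam (max (U p) k))" "nonpos_div half_space (%p. - Gam (min (U p) k))"
  "AE t in lborel. 0 < t --> integ (%x. U (t, x))"
  "AE t in lborel. 0 < t --> (LBINT x. (abs (U (t, x + h *R \<xi>) - U (t, x)))) <= B * (abs h)"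
 using assms unfolding regular_solution_def by blast+

text \<open>Clipping at the almost sure bound changes \<open>U\<close> only on a null set after time
  \<open>ta\<close> and makes the bound hold at every point, so the local theory of
  \<open>bounded_solution\<close> applies with constants shared by the whole class.\<close>

lemma clipped_bounded_solution:
 assumes U: "regular_solution \<xi> B U" and fr: "plane_frame \<xi> et" and ta: "0 < ta" and M: "0 < M" and B: "0 <= B"
  and bd: "AE p in lborel. ta < fst p --> (abs (U p)) <= M"
 defines "u == %p. max (- M) (min M (U p))"
 shows "bounded_solution \<xi> et ta M B u" "AE p in lborel. ta < fst p --> u p = U p"
proof -
 interpret plane_frame \<xi> et by (rule fr)
 note R = regular_solutionD[OF U]
 show ae: "AE p in lborel. ta < fst p --> u p = U p" using bd by eventually_elim (auto simp: u_def)
 have bu: "bdb u" unfolding u_def by (intro bdb_max bdb_min bdb_const R)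
 have uM: "(abs (u p)) <= M" for p using M by (auto simp: u_def abs_le_iff max_def min_def)
 have sb: "{ta<..} \<times> UNIV \<subseteq> half_space" using ta by (auto simp: half_space_def)
 have sub: "nonpos_div ({ta<..} \<times> UNIV) (%p. Gam (max (u p) k))" for k
  by (rule nonpos_div_AE_cong[OF nonpos_div_mono[OF R(2)[of k] sb]])
  (use ae in "auto intro!: bdb_Gamma bdb_max bu R bdb_const elim!: eventually_mono")
 have super: "nonpos_div ({ta<..} \<times> UNIV) (%p. - Gam (min (u p) k))" for k
  by (rule nonpos_div_AE_cong[OF nonpos_div_mono[OF R(3)[of k] sb]])
  (use ae in "auto intro!: bdb_minus bdb_Gamma bdb_min bu R bdb_const elim!: eventually_mono")
 \<comment> \<open>Truncation at the levels -M and M is void, so the two entropy conditions at these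
   levels give the equation itself as two opposite inequalities.\<close>
 have uk: "max (u p) (- M) = u p" "min (u p) M = u p" for p using uM[of p] by (auto simp: abs_le_iff)
 show "bounded_solution \<xi> et ta M B u"
 proof (intro bounded_solution.intro bounded_solution_axioms.intro fr bu M uM B sub)
  show "nonpos_div ({ta<..} \<times> UNIV) (%p. Gam (u p))" "nonpos_div ({ta<..} \<times> UNIV) (%p. - Gam (u p))"
  using sub[of "- M"] super[of M] unfolding uk .
  show "(LBINT p. ind Q p * (abs (u (p + h *R (0, \<xi>)) - u p))) <= B * (T - ta) * (abs h)"
  if "ta <= T" "compact Q" "Q \<subseteq> {ta<..T} \<times> UNIV" for Q T h
  by (rule slab_translation[OF R(1) bu _ R(4) R(5) that(2,3) _ that(1) B]) (use ta in "auto simp: u_def max_def min_def")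
 qed
qed

definition equicontinuous_along :: "(spacetime => real) set => spacetime set => bool" where
 "equicontinuous_along \<F> A \<longleftrightarrow> (ALL K. compact K --> K \<subseteq> half_space --> (\<forall>ep>0. \<exists>de>0. \<forall>U\<in>\<F>. \<forall>v\<in>A. norm v < de -->
  (LBINT p. ind K p * (abs (U (p + v) - U p))) <= ep))"

lemma increment_bdb:
 assumes "bdb U" shows "bdb (%p. (abs (U (p + v) - U (p + w :: 'a::euclidean_space))) :: real)"
proof -
 have "bdb (%p. U (p + v) - U (p + w))" by (intro bdb_diff bdb_comp[OF assms]) simp_all
 then show ?thesis by (rule bdb_comp_continuous) (intro continuous_intros)
qed

lemma increment_integrable:
 assumes "bdb U" "compact K" shows "integ (%p. ind K p * (abs (U (p + v) - U (p + w :: 'a::euclidean_space))) :: real)"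
 by (rule bdb_integrable[OF bdb_mult[OF bdb_indicator[OF assms(2)] increment_bdb[OF assms(1)]] assms(2)]) simp

lemma increment_shift_le:
 assumes U: "bdb U" and K: "compact K" "compact K'" and sub: "!!p. p : K ==> p + w : K'"
 shows "(LBINT p. ind K p * (abs (U (p + v + w) - U (p + w :: 'a::euclidean_space))) :: real)
  <= (LBINT p. ind K' p * (abs (U (p + v) - U p)))"
proof -
 have i: "integ (%p. ind K' p * (abs (U (p + v) - U p)))" using increment_integrable[OF U K(2), of v 0] by simp
 have "(LBINT p. ind K p * (abs (U (p + (v + w)) - U (p + w)))) <= (LBINT p. ind K' (p + w) * (abs (U (p + w + v) - U (p + w))))"
  by (rule integral_mono[OF increment_integrable[OF U K(1)] lborel_integrable_shift[OF i]]) (use sub in "auto simp: indicator_def ac_simps")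
 also have "... = (LBINT p. ind K' p * (abs (U (p + v) - U p)))"
  using lborel_integral_shift[OF borel_measurable_integrable[OF i, simplified], of w] by simp
 finally show ?thesis by (simp add: add.assoc)
qed

text \<open>A shift by a + b is a shift by b followed by one by a at the moved point. The compact
  set is enlarged first so that the moved points stay in a compact subset of the half space.\<close>

lemma equicontinuous_along_add:
 assumes \<F>: "!!U. U : \<F> ==> bdb U" and A: "equicontinuous_along \<F> A" and B: "equicontinuous_along \<F> B"
  and C: "!!v. v : C ==> \<exists>a\<in>A. \<exists>b\<in>B. v = a + b & norm a <= norm v & norm b <= norm v"
 shows "equicontinuous_along \<F> C"
 unfolding equicontinuous_along_def
proof (intro allI impI)
 fix K :: "spacetime set" and ep :: real assume K: "compact K" "K \<subseteq> half_space" and ep: "0 < ep"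
 obtain d where d: "d > 0" "{x + y |x y. x : K & y : cball 0 d} \<subseteq> half_space"
  using compact_cball_subset_open[OF K(1) open_half_space K(2)] .
 define K' where "K' = {x + y |x y. x : K & y : cball (0 :: spacetime) d}"
 have K': "compact K'" "K' \<subseteq> half_space" unfolding K'_def by (rule compact_sums[OF K(1) compact_cball], rule d(2))
 note h = half_gt_zero[OF ep]
 obtain de1 where de1: "de1 > 0" "\<forall>U\<in>\<F>. \<forall>a\<in>A. norm a < de1 --> (LBINT p. ind K' p * (abs (U (p + a) - U p))) <= ep / 2"
  using A[unfolded equicontinuous_along_def, rule_format, OF K' h] by blast
 obtain de2 where de2: "de2 > 0" "\<forall>U\<in>\<F>. \<forall>b\<in>B. norm b < de2 --> (LBINT p. ind K p * (abs (U (p + b) - U p))) <= ep / 2"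
  using B[unfolded equicontinuous_along_def, rule_format, OF K h] by blast
 show "\<exists>de>0. \<forall>U\<in>\<F>. \<forall>v\<in>C. norm v < de --> (LBINT p. ind K p * (abs (U (p + v) - U p))) <= ep"
 proof (intro exI[of _ "min d (min de1 de2)"] conjI ballI impI)
  fix U v assume U: "U : \<F>" and v: "v : C" "norm v < min d (min de1 de2)"
  obtain a b where ab: "a : A" "b : B" "v = a + b" "norm a <= norm v" "norm b <= norm v" using C[OF v(1)] by blast
  have bU: "bdb U" by (rule \<F>[OF U])
  have i: "integ (%p. ind K p * (abs (U (p + a + b) - U (p + b))))" "integ (%p. ind K p * (abs (U (p + b) - U p)))"
  "integ (%p. ind K p * (abs (U (p + v) - U p)))"
  using increment_integrable[OF bU K(1), of "a + b" b] increment_integrable[OF bU K(1), of b 0] increment_integrable[OF bU K(1), of v 0] by (simp_all add: add.assoc)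
  have "(LBINT p. ind K p * (abs (U (p + v) - U p))) <= (LBINT p. ind K p * (abs (U (p + a + b) - U (p + b))) + ind K p * (abs (U (p + b) - U p)))"
  by (rule integral_mono[OF i(3) B_iadd[OF i(1,2)]]) (auto simp: ab(3) indicator_def add.assoc)
  also have "... = (LBINT p. ind K p * (abs (U (p + a + b) - U (p + b)))) + (LBINT p. ind K p * (abs (U (p + b) - U p)))"
  by (rule B_add[OF i(1,2)])
  also have "... <= (LBINT p. ind K' p * (abs (U (p + a) - U p))) + (LBINT p. ind K p * (abs (U (p + b) - U p)))"
  proof (intro add_right_mono increment_shift_le[OF bU K(1) K'(1)])
  show "p + b : K'" if "p : K" for p unfolding K'_def using that ab(5) v(2) by (intro CollectI exI[of _ p] exI[of _ b]) auto
  qed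
  also have "... <= ep / 2 + ep / 2" using ab v by (intro add_mono de1(2)[rule_format] de2(2)[rule_format] U) auto
  finally show "(LBINT p. ind K p * (abs (U (p + v) - U p))) <= ep" by simp
 qed (use d de1 de2 in auto)
qed

text \<open>The radius of the balls may depend on the centre; compactness selects finitely many
  balls, and the tolerance is divided by their number.\<close>

lemma equicontinuous_along_local:
 assumes \<F>: "!!U. U : \<F> ==> bdb U"
  and loc: "!!x ep. x : half_space ==> 0 < ep ==> \<exists>de>0. \<forall>U\<in>\<F>. \<forall>v\<in>A. norm v < de -->
  (LBINT p. ind (cball x (rh x)) p * (abs (U (p + v) - U p))) <= ep"
  and rh: "!!x. x : half_space ==> 0 < rh x"
 shows "equicontinuous_along \<F> A"
 unfolding equicontinuous_along_def
proof (intro allI impI)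
 fix K :: "spacetime set" and ep :: real assume K: "compact K" "K \<subseteq> half_space" and ep: "0 < ep"
 have "K \<subseteq> (\<Union>x\<in>K. ball x (rh x))"
 proof
  fix p assume "p : K"
  then show "p : (\<Union>x\<in>K. ball x (rh x))" using rh[of p] K(2) by (intro UN_I[of p]) auto
 qed
 then obtain X where X: "X \<subseteq> K" "finite X" "K \<subseteq> (\<Union>x\<in>X. ball x (rh x))"
  by (rule compactE_image[OF K(1), rotated]) simp_all
 define ep' where "ep' = ep / (real (card X) + 1)"
 have ep': "0 < ep'" using ep by (simp add: ep'_def)
 have "\<forall>x\<in>X. \<exists>de>0. \<forall>U\<in>\<F>. \<forall>v\<in>A. norm v < de --> (LBINT p. ind (cball x (rh x)) p * (abs (U (p + v) - U p))) <= ep'"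
  using loc[OF _ ep'] X(1) K(2) by blast
 then have "EX de. \<forall>x\<in>X. 0 < de x & (\<forall>U\<in>\<F>. \<forall>v\<in>A. norm v < de x --> (LBINT p. ind (cball x (rh x)) p * (abs (U (p + v) - U p))) <= ep')"
  by (rule bchoice)
 then obtain de where de: "!!x. x : X ==> 0 < de x"
  "!!x U v. x : X ==> U : \<F> ==> v : A ==> norm v < de x ==> (LBINT p. ind (cball x (rh x)) p * (abs (U (p + v) - U p))) <= ep'"
  by blast
 define d where "d = Min (insert 1 (de ` X))"
 have d: "0 < d" "!!x. x : X ==> d <= de x" using X(2) de(1) by (auto simp: d_def)
 show "\<exists>de>0. \<forall>U\<in>\<F>. \<forall>v\<in>A. norm v < de --> (LBINT p. ind K p * (abs (U (p + v) - U p))) <= ep"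
 proof (intro exI[of _ d] conjI ballI impI d(1))
  fix U v assume U: "U : \<F>" "v : A" "norm v < d"
  note bU = \<F>[OF U(1)]
  have i: "integ (%p. ind K p * (abs (U (p + v) - U p)))" if "compact K" for K using increment_integrable[OF bU that, of v 0] by simp
  have "(LBINT p. ind K p * (abs (U (p + v) - U p))) <= (LBINT p. (\<Sum>x\<in>X. ind (cball x (rh x)) p * (abs (U (p + v) - U p))))"
  proof (rule integral_mono[OF i[OF K(1)] B_isum[OF i[OF compact_cball]]])
  show "ind K p * (abs (U (p + v) - U p)) <= (\<Sum>x\<in>X. ind (cball x (rh x)) p * (abs (U (p + v) - U p)))" for p
  proof (cases "p : K")
  case True
  then obtain x where x: "x : X" "p : ball x (rh x)" using X(3) by blast
  have "ind (cball x (rh x)) p * (abs (U (p + v) - U p)) <= (\<Sum>x\<in>X. ind (cball x (rh x)) p * (abs (U (p + v) - U p)))"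
  by (rule member_le_sum[OF x(1) _ X(2)]) simp
  then show ?thesis using True x(2) by simp
  qed (auto intro!: sum_nonneg)
  qed
  also have "... = (\<Sum>x\<in>X. LBINT p. ind (cball x (rh x)) p * (abs (U (p + v) - U p)))"
  by (rule B_sum) (rule i[OF compact_cball])
  also have "... <= (\<Sum>x\<in>X. ep')" by (intro sum_mono de(2) U(1,2)) (use U(3) d(2) in force)+
  also have "... <= ep" using ep by (simp add: ep'_def field_simps)
  finally show "(LBINT p. ind K p * (abs (U (p + v) - U p))) <= ep" .
 qed
qed

text \<open>If d > e, then d is at most d (d / e)^5. With a small \<open>e\<close> this converts the
  bound on integrals of sixth powers into an L1 bound on sets of finite measure.\<close>

lemma power_split:
 fixes d e :: real assumes "0 <= d" "0 < e" shows "d <= e + d ^ 6 / e ^ 5"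
proof (cases "d <= e")
 case False
 then have "e ^ 5 * d <= d ^ 5 * d" using assms by (intro mult_right_mono power_mono) auto
 then have "d * e ^ 5 <= d * d ^ 5" by (simp only: mult.commute)
 also have "... = d ^ 6" by (simp add: eval_nat_numeral)
 finally have "d * e ^ 5 <= d ^ 6" .
 then have "d <= d ^ 6 / e ^ 5" using assms by (simp add: pos_le_divide_eq)
 then show ?thesis using assms by simp
qed (use assms in "simp add: add_increasing2")

text \<open>If be is nonzero, the second summand alone is a multiple of the sixth power. If be = 0,
  only a fourth power is available, and |a - b| <= 2 M trades the missing square for the constant 48
  M^2 = 12 (2 M)^2.\<close>

lemma sextic_lower_bound:
 fixes al be M :: real
 assumes "al ~= 0 | be ~= 0" "0 < M"
 obtains ka where "0 < ka" "!!a b. (abs a) <= M ==> (abs b) <= M ==>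
  ka * (abs (a - b)) ^ 6 <= (a - b)\<^sup>2 * ((al + be * (a + b))\<^sup>2 * (a - b)\<^sup>2 / 12 + be\<^sup>2 * (a - b) ^ 4 / 180)"
proof (cases "be = 0")
 case False
 show ?thesis
 proof (rule that[of "be\<^sup>2 / 180"])
  fix a b :: real
  have "be\<^sup>2 / 180 * (abs (a - b)) ^ 6 = (a - b)\<^sup>2 * (0 + be\<^sup>2 * (a - b) ^ 4 / 180)"
  by (simp add: power_even_abs eval_nat_numeral)
  also have "... <= (a - b)\<^sup>2 * ((al + be * (a + b))\<^sup>2 * (a - b)\<^sup>2 / 12 + be\<^sup>2 * (a - b) ^ 4 / 180)"
  by (intro mult_left_mono add_right_mono) auto
  finally show "be\<^sup>2 / 180 * (abs (a - b)) ^ 6 <= (a - b)\<^sup>2 * ((al + be * (a + b))\<^sup>2 * (a - b)\<^sup>2 / 12 + be\<^sup>2 * (a - b) ^ 4 / 180)" .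
 qed (use False in simp)
next
 case True
 then have al: "al ~= 0" using assms by simp
 show ?thesis
 proof (rule that[of "al\<^sup>2 / (48 * M\<^sup>2)"])
  fix a b :: real assume ab: "(abs a) <= M" "(abs b) <= M"
  have "(a - b)\<^sup>2 <= (2 * M)\<^sup>2" unfolding abs_le_square_iff[symmetric] using ab by auto
  then have "al\<^sup>2 * (a - b) ^ 4 * (a - b)\<^sup>2 / (48 * M\<^sup>2) <= al\<^sup>2 * (a - b) ^ 4 * (4 * M\<^sup>2) / (48 * M\<^sup>2)"
  by (intro divide_right_mono mult_left_mono) (auto simp: power_mult_distrib)
  also have "... = al\<^sup>2 * (a - b) ^ 4 / 12" using assms(2) by simp
  finally have "al\<^sup>2 * (a - b) ^ 4 * (a - b)\<^sup>2 / (48 * M\<^sup>2) <= al\<^sup>2 * (a - b) ^ 4 / 12" .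
  moreover have "al\<^sup>2 / (48 * M\<^sup>2) * (abs (a - b)) ^ 6 = al\<^sup>2 * (a - b) ^ 4 * (a - b)\<^sup>2 / (48 * M\<^sup>2)"
  by (simp add: power_even_abs power_add[symmetric])
  moreover have "(a - b)\<^sup>2 * ((al + be * (a + b))\<^sup>2 * (a - b)\<^sup>2 / 12 + be\<^sup>2 * (a - b) ^ 4 / 180) = al\<^sup>2 * (a - b) ^ 4 / 12"
  using True by (simp add: eval_nat_numeral)
  ultimately show "al\<^sup>2 / (48 * M\<^sup>2) * (abs (a - b)) ^ 6 <= (a - b)\<^sup>2 * ((al + be * (a + b))\<^sup>2 * (a - b)\<^sup>2 / 12 + be\<^sup>2 * (a - b) ^ 4 / 180)" by simp
 qed (use al assms in simp)
qed

text \<open>The sup bound, the constant \<open>ka\<close> and the right-hand side of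
  \<open>sixth_power_estimate\<close> depend only on the frame, \<open>B\<close> and
  \<open>x0\<close>, so the resulting \<open>de\<close> serves all solutions of the class at
  once.\<close>

lemma local_translation_estimate:
 fixes \<xi> et :: plane
 assumes fr: "plane_frame \<xi> et" and B: "0 <= B" and e: "e = (0, et) | e = (1, 0)" and x0: "0 < fst x0"
  and ep: "0 < ep"
 shows "\<exists>de>0. \<forall>U\<in>{U. regular_solution \<xi> B U}. \<forall>v\<in>range (%h. h *R e). norm v < de -->
  (LBINT p. ind (cball x0 (fst x0 / 32)) p * (abs (U (p + v) - U p))) <= ep"
proof -
 interpret plane_frame \<xi> et by (rule fr)
 \<comment> \<open>With this radius, x0 - 2 r is at time 3/4 of that of \<open>x0\<close>, still
   after \<open>ta\<close>, which is at one half of it.\<close>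
 define r where "r = fst x0 / 8"
 define ta where "ta = fst x0 / 2"
 define T where "T = 2 * fst x0"
 have r: "0 < r" "ta < fst x0 - 2 * r" "fst x0 + 2 * r <= T" and ta: "0 < ta" using x0 by (auto simp: r_def ta_def T_def)
 obtain M where M: "M > 0" "!!U. regular_solution \<xi> B U ==> AE p in lborel. ta < fst p --> (abs (U p)) <= M"
 proof (rule regular_solution_bound[OF norm_xi B ta])
 qed (rule that)
 have ne0: "et $ 1 ~= 0 | et $ 2 ~= 0" using norm_eta by (auto simp: norm_eq_1 inner_vec_def UNIV_2)
 obtain ka where ka: "0 < ka" "!!a b. (abs a) <= M ==> (abs b) <= M ==>
  ka * (abs (a - b)) ^ 6 <= (a - b)\<^sup>2 * ((et $ 1 + et $ 2 * (a + b))\<^sup>2 * (a - b)\<^sup>2 / 12 + (et $ 2)\<^sup>2 * (a - b) ^ 4 / 180)"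
 proof (rule sextic_lower_bound[OF ne0 M(1)])
 qed (rule that)
 define C where "C = M + (M + M\<^sup>2) * M"
 define R where "R = 4 * M * (1 + 2 * M) * (8 * C\<^sup>2 * (LBINT p. norm (cutoff_grad r (p :: spacetime))) + 3 * C * (1 + M + M\<^sup>2) * (B * (T - ta)))"
 define V where "V = (LBINT p. ind (cball x0 (r / 2)) p :: real)"
 have V: "0 <= V" unfolding V_def by (intro B_nonneg) simp
 define d where "d = ep / (2 * (V + 1))"
 have d: "0 < d" "d * V <= ep / 2" using ep V by (auto simp: d_def divide_simps)
 \<comment> \<open>The second entry makes (2 / d^5) (R h / ka) at most ep / 2, the other half of the
   tolerance being spent on d V. The first entry is the limit on the shift in
   \<open>sixth_power_estimate\<close>.\<close>
 define h0 where "h0 = min (r / 4) (ka * d ^ 5 * ep / (4 * ((abs R) + 1)))"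
 have h0: "0 < h0" using r d ka ep by (simp add: h0_def add_nonneg_pos)
 have ne: "norm e = 1" using e norm_eta by (auto simp: norm_Pair)
 have fst_le: "(abs (fst a - fst b)) <= dist a b" for a b :: spacetime
  using norm_fst_le[of "fst a - fst b" "snd a - snd b"] by (simp add: dist_norm minus_prod_def)
 have main: "(LBINT p. ind (cball x0 (r / 2)) p * (abs (U p - U (p - h *R e)))) <= ep"
  if U: "regular_solution \<xi> B U" and h: "0 <= h" "h < h0" for U h
 proof -
  define u where "u p = max (- M) (min M (U p))" for p
  have bs: "bounded_solution \<xi> et ta M B u" and ae: "AE p in lborel. ta < fst p --> u p = U p"
  using clipped_bounded_solution[OF U fr ta M(1) B M(2)[OF U]] unfolding u_def[abs_def] by blast+
  interpret u: bounded_solution \<xi> et ta M B u by (rule bs)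
  have h4: "h <= r / 4" using h by (simp add: h0_def)
  have six: "ka * (LBINT p. cutoff r (p - x0) * (abs (u p - u (p - h *R e))) ^ 6) <= R * h"
  using u.sixth_power_estimate[OF e r(1) h(1) h4 r(2,3) C_def ka] by (simp add: R_def)
  have K: "cutoff r (p - x0) = 0" if "p ~: cball x0 r" for p
  using that by (intro cutoff_test1(5) r) (simp add: dist_norm norm_minus_commute)
  have b1: "bdb (%p. (abs (u p - u (p - h *R e))))" using increment_bdb[OF u.u, of 0 "- (h *R e)"] by simp
  have b6: "bdb (%p. (abs (u p - u (p - h *R e))) ^ 6)" using bdb_comp_continuous[OF b1, of "%x. x ^ 6"] by (simp add: continuous_intros)
  have i6: "integ (%p. cutoff r (p - x0) * (abs (u p - u (p - h *R e))) ^ 6)"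
  by (rule bdb_integrable[OF bdb_mult[OF test1_bdb(1)[OF test1_shift[OF cutoff_test1(1)[OF r(1)], of "x0" UNIV]] b6] compact_cball[of x0 r]]) (use K in auto)
  have iV: "integ (%p. ind (cball x0 (r / 2)) p :: real)"
  by (rule bdb_integrable[OF bdb_indicator compact_cball[of x0 "r / 2"]]) auto
  have "(LBINT p. ind (cball x0 (r / 2)) p * (abs (U p - U (p - h *R e))))
  = (LBINT p. ind (cball x0 (r / 2)) p * (abs (u p - u (p - h *R e))))"
  proof (rule B_cong_AE)
  have b2: "bdb (%p. (abs (U p - U (p - h *R e))))" using increment_bdb[OF regular_solutionD(1)[OF U], of 0 "- (h *R e)"] by simp
  show "(%p. ind (cball x0 (r / 2)) p * (abs (U p - U (p - h *R e)))) : lmeas"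
  "(%p. ind (cball x0 (r / 2)) p * (abs (u p - u (p - h *R e)))) : lmeas"
  using bdb_measurable[OF bdb_mult[OF bdb_indicator[OF compact_cball[of x0 "r / 2"]] b2]]
  bdb_measurable[OF bdb_mult[OF bdb_indicator[OF compact_cball[of x0 "r / 2"]] b1]] by simp_all
  have "AE p in lborel. ta < fst (p + - (h *R e)) --> u (p + - (h *R e)) = U (p + - (h *R e))" by (rule AE_lborel_shift[OF ae])
  with ae show "AE p in lborel. ind (cball x0 (r / 2)) p * (abs (U p - U (p - h *R e))) = ind (cball x0 (r / 2)) p * (abs (u p - u (p - h *R e)))"
  proof eventually_elim
  case (elim p)
  show ?case
  proof (cases "p : cball x0 (r / 2)")
  case True
  have "(abs (fst x0 - fst p)) <= r / 2" using fst_le[of x0 p] True by simp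
  note 1 = abs_le_D1[OF this]
  have "(abs (fst e)) <= 1" using e by auto
  then have "(abs (h * fst e)) <= r / 4 * 1" unfolding abs_mult using h h4 r by (intro mult_mono) auto
  note 2 = abs_le_D1[OF this]
  have "ta < fst p" "ta < fst p - h * fst e" using 1 2 r(1,2) by linarith+
  then have "ta < fst p" "ta < fst (p + - (h *R e))" by simp_all
  then show ?thesis using elim by simp
  qed simp
  qed
  qed
  also have "... <= (LBINT p. d * ind (cball x0 (r / 2)) p + 2 / d ^ 5 * (cutoff r (p - x0) * (abs (u p - u (p - h *R e))) ^ 6))"
  proof (rule integral_mono)
  show "integ (%p. ind (cball x0 (r / 2)) p * (abs (u p - u (p - h *R e))))"
  using increment_integrable[OF u.u compact_cball, of x0 "r / 2" 0 "- (h *R e)"] by simp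
  show "integ (%p. d * ind (cball x0 (r / 2)) p + 2 / d ^ 5 * (cutoff r (p - x0) * (abs (u p - u (p - h *R e))) ^ 6))"
  by (intro B_iadd integrable_mult_right iV i6)
  show "ind (cball x0 (r / 2)) p * (abs (u p - u (p - h *R e)))
  <= d * ind (cball x0 (r / 2)) p + 2 / d ^ 5 * (cutoff r (p - x0) * (abs (u p - u (p - h *R e))) ^ 6)" for p
  proof (cases "p : cball x0 (r / 2)")
  case True
  then have "norm (p - x0) <= r / 2" by (simp add: dist_norm norm_minus_commute)
  then have "(norm (p - x0))\<^sup>2 <= (r / 2)\<^sup>2" by (intro power_mono) auto
  then have "((p - x0) \<bullet> (p - x0)) <= 1 / 4 * r\<^sup>2" by (simp add: power2_norm_eq_inner power_divide)
  then have "((p - x0) \<bullet> (p - x0)) / r\<^sup>2 <= 1 / 4" using r by (simp add: pos_divide_le_eq)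
  then have "3 / 4 <= max 0 (1 - ((p - x0) \<bullet> (p - x0)) / r\<^sup>2)" by (intro max.coboundedI2) linarith
  then have "(3 / 4)\<^sup>2 <= cutoff r (p - x0)" unfolding cutoff_def by (rule power_mono) simp
  then have c: "1 / 2 <= cutoff r (p - x0)" by (simp add: power2_eq_square)
  have "(abs (u p - u (p - h *R e))) <= d + (abs (u p - u (p - h *R e))) ^ 6 / d ^ 5" by (rule power_split[OF abs_ge_zero d(1)])
  also have "(abs (u p - u (p - h *R e))) ^ 6 / d ^ 5 = 2 / d ^ 5 * (1 / 2 * (abs (u p - u (p - h *R e))) ^ 6)" by simp
  also have "... <= 2 / d ^ 5 * (cutoff r (p - x0) * (abs (u p - u (p - h *R e))) ^ 6)"
  using c d by (intro mult_left_mono mult_right_mono) auto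
  finally show ?thesis using True by simp
  next
  case False
  then show ?thesis using d cutoff_test1(2)[OF r(1), of "p - x0"] by simp
  qed
  qed
  also have "... = d * V + 2 / d ^ 5 * (LBINT p. cutoff r (p - x0) * (abs (u p - u (p - h *R e))) ^ 6)"
  unfolding V_def using iV i6 by (subst B_add) (auto intro: integrable_mult_right)
  also have "... <= ep / 2 + 2 / d ^ 5 * (R * h / ka)"
  using d six ka by (intro add_mono mult_left_mono) (auto simp: pos_le_divide_eq mult.commute)
  also have "2 / d ^ 5 * (R * h / ka) <= ep / 2"
  proof -
  have "R * h <= ((abs R) + 1) * (ka * d ^ 5 * ep / (4 * ((abs R) + 1)))" using h by (intro mult_mono) (auto simp: h0_def)
  also have "... = ka * d ^ 5 * ep / 4" by (simp add: field_simps)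
  finally have "2 / d ^ 5 * (R * h / ka) <= 2 / d ^ 5 * ((ka * d ^ 5 * ep / 4) / ka)" using d ka by (intro mult_left_mono divide_right_mono) auto
  then show ?thesis using d ka by simp
  qed
  finally show ?thesis by simp
 qed
 show ?thesis
 proof (intro exI[of _ h0] conjI ballI impI h0)
  fix U v assume "U : {U. regular_solution \<xi> B U}" "v : range (%h. h *R e)" "norm v < h0"
  then obtain h where U: "regular_solution \<xi> B U" and v: "v = h *R e" and "norm (h *R e) < h0" by blast
  then have h: "(abs h) < h0" using ne by simp
  note bU = regular_solutionD(1)[OF U]
  have rr: "fst x0 / 32 = r / 4" by (simp add: r_def)
  have i: "integ (%p. ind (cball x0 s) p * (abs (U p - U (p - k *R e))))" for s k
  using increment_integrable[OF bU compact_cball, of x0 s 0 "- (k *R e)"] by simp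
  show "(LBINT p. ind (cball x0 (fst x0 / 32)) p * (abs (U (p + v) - U p))) <= ep"
  proof (cases "0 <= h")
  case True
  \<comment> \<open>The estimate \<open>main\<close> is for backward shifts. A forward shift is a
    backward one seen from the moved point, at the price of enlarging the ball from r / 4 to r /
    2.\<close>
  have "(LBINT p. ind (cball x0 (r / 4)) p * (abs (U (p + v) - U p)))
  = (LBINT p. ind (cball x0 (r / 4)) p * (abs (U (p + - v + v) - U (p + v))))"
  by (simp add: abs_minus_commute)
  also have "... <= (LBINT p. ind (cball x0 (r / 2)) p * (abs (U (p + - v) - U p)))"
  proof (rule increment_shift_le[OF bU])
  show "p + v : cball x0 (r / 2)" if "p : cball x0 (r / 4)" for p
  proof -
  have "norm v <= r / 4" using h ne by (simp add: v h0_def)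
  moreover have "dist x0 (p + v) <= dist x0 p + norm v" using dist_triangle[of x0 "p + v" p] by (simp add: dist_norm)
  ultimately show ?thesis using that by simp
  qed
  qed auto
  also have "... <= ep" using main[OF U True] h True by (simp add: v abs_minus_commute)
  finally show ?thesis unfolding rr .
  next
  case False
  have "(LBINT p. ind (cball x0 (r / 4)) p * (abs (U p - U (p - (- h) *R e)))) <= (LBINT p. ind (cball x0 (r / 2)) p * (abs (U p - U (p - (- h) *R e))))"
  by (rule integral_mono[OF i i]) (use r in "auto simp: indicator_def")
  also have "... <= ep" using main[OF U, of "- h"] h False by simp
  finally show ?thesis unfolding rr by (simp add: v abs_minus_commute)
  qed
 qed
qed

theorem regular_solutions_equicontinuous:
 fixes \<xi> :: plane
 assumes \<xi>: "norm \<xi> = 1" and B: "0 <= B"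
 shows "equicontinuous_along {U. regular_solution \<xi> B U} UNIV"
proof -
 define et :: plane where "et = vector [- 1 * \<xi> $ 2, 1 * \<xi> $ 1]"
 have fr: "plane_frame \<xi> et" unfolding et_def by (rule orthogonal_frame[OF \<xi>]) simp
 interpret plane_frame \<xi> et by (rule fr)
 let ?F = "{U. regular_solution \<xi> B U}"
 have b: "!!U. U : ?F ==> bdb U" using regular_solutionD(1) by auto
 have loc: "equicontinuous_along ?F (range (%h. h *R e))" if e: "e = (0, et) | e = (1, 0)" for e :: spacetime
 proof (rule equicontinuous_along_local[OF b])
  fix x :: spacetime and ep :: real assume "x : half_space" "0 < ep"
  then show "\<exists>de>0. \<forall>U\<in>?F. \<forall>v\<in>range (%h. h *R e). norm v < de --> (LBINT p. ind (cball x (fst x / 32)) p * (abs (U (p + v) - U p))) <= ep"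
  by (intro local_translation_estimate[OF fr B e]) (auto simp: half_space_def)
 qed (auto simp: half_space_def)
 have xi: "equicontinuous_along ?F (range (%h. h *R (0, \<xi>)))"
  unfolding equicontinuous_along_def
 proof (intro allI impI)
  fix K :: "spacetime set" and ep :: real assume K: "compact K" "K \<subseteq> half_space" and ep: "0 < ep"
  obtain T where T: "T > 0" "!!p. p : K ==> norm p <= T" using compact_imp_bounded[OF K(1)] bounded_pos by metis
  have KT: "K \<subseteq> {0<..T} \<times> UNIV"
  proof
  fix p assume p: "p : K"
  have "(abs (fst p)) <= norm p" using norm_fst_le[of "fst p" "snd p"] by simp
  then show "p : {0<..T} \<times> UNIV" using T(2)[OF p] K(2) p by (auto simp: half_space_def mem_Times_iff)
  qed
  show "\<exists>de>0. \<forall>U\<in>?F. \<forall>v\<in>range (%h. h *R (0, \<xi>)). norm v < de --> (LBINT p. ind K p * (abs (U (p + v) - U p))) <= ep"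
  proof (intro exI[of _ "ep / (B * T + 1)"] conjI ballI impI)
  show "0 < ep / (B * T + 1)" using B T ep by (simp add: add_nonneg_pos)
  fix U and v :: spacetime assume U: "U : ?F" and v: "v : range (%h. h *R (0, \<xi>))" "norm v < ep / (B * T + 1)"
  obtain h where h: "v = h *R (0, \<xi>)" using v(1) by auto
  have nh: "(abs h) < ep / (B * T + 1)" using v(2) norm_xi by (simp add: h norm_Pair)
  have R: "regular_solution \<xi> B U" using U by simp
  have "(LBINT p. ind K p * (abs (U (p + v) - U p))) <= B * (T - 0) * (abs h)" unfolding h
  by (rule slab_translation[OF _ _ _ regular_solutionD(4)[OF R] regular_solutionD(5)[OF R] K(1) KT]) (use B T b[OF U] in auto)
  also have "... <= (B * T + 1) * (ep / (B * T + 1))" using nh B T by (intro mult_mono) auto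
  also have "... = ep" using B T by (simp add: add_nonneg_pos less_imp_neq[symmetric])
  finally show "(LBINT p. ind K p * (abs (U (p + v) - U p))) <= ep" .
  qed
 qed
 \<comment> \<open>Spatial shifts are decomposed orthogonally along \<xi>, where the variation bound
   applies, and along \<open>et\<close>; the time direction is added afterwards. Orthogonality keeps
   each part no longer than the whole.\<close>
 have s: "equicontinuous_along ?F (range (Pair 0))"
 proof (rule equicontinuous_along_add[OF b xi loc[of "(0, et)"]])
  fix v :: spacetime assume "v : range (Pair 0)"
  then obtain x where v: "v = (0, x)" by auto
  have le: "norm ((0, (x \<bullet> w) *R w) :: spacetime) <= norm v" if "norm w = 1" for w
  using Cauchy_Schwarz_ineq2[of x w] that by (simp add: v norm_Pair)
  have "v = (x \<bullet> \<xi>) *R (0, \<xi>) + (x \<bullet> et) *R (0, et)" using frame_expand[of x] by (simp add: v)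
  then show "\<exists>a\<in>range (%h. h *R (0, \<xi>)). \<exists>b\<in>range (%h. h *R (0, et)). v = a + b & norm a <= norm v & norm b <= norm v"
  using le[OF norm_xi] le[OF norm_eta] by (intro bexI[of _ "(x \<bullet> \<xi>) *R (0, \<xi>)"] bexI[of _ "(x \<bullet> et) *R (0, et)"]) auto
 qed simp_all
 show ?thesis
 proof (rule equicontinuous_along_add[OF b loc[of "(1, 0)"] s])
  fix v :: spacetime
  have "v = fst v *R (1, 0) + (0, snd v)" by (simp add: prod_eq_iff)
  moreover have "norm (fst v *R (1, 0) :: spacetime) <= norm v" "norm ((0, snd v) :: spacetime) <= norm v"
  using norm_fst_le[of "fst v" "snd v"] norm_snd_le[of "snd v" "fst v"] by (simp_all add: norm_Pair)
  ultimately show "\<exists>a\<in>range (%h. h *R (1, 0)). \<exists>b\<in>range (Pair 0). v = a + b & norm a <= norm v & norm b <= norm v"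
  by (intro bexI[of _ "fst v *R (1, 0)"] bexI[of _ "(0, snd v)"]) auto
 qed simp_all
qed

section \<open>Compactness\<close>

lemma compact_half_space_lower:
 assumes "compact K" "K \<subseteq> half_space"
 obtains ta where "0 < ta" "!!p. p : K ==> ta < fst p"
proof (cases "K = {}")
 case False
 obtain p0 where p0: "p0 : K" "\<forall>p\<in>K. fst p0 <= fst p"
  using continuous_attains_inf[OF assms(1) False continuous_on_fst[OF continuous_on_id]] by blast
 have "0 < fst p0" using p0(1) assms(2) by (auto simp: half_space_def)
 then show ?thesis using p0(2) by (intro that[of "fst p0 / 2"]) force+
qed (use that[of 1] in simp)

text \<open>Kolmogorov-Riesz: mollification at a fixed small scale moves all solutions by at most ep
  / 4 in L1, uniformly by equicontinuity, and the mollified functions are bounded and equicontinuous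
  on \<open>K\<close>, so Arzela-Ascoli gives a uniformly convergent subsequence.\<close>

lemma L1_precompact:
 assumes \<xi>: "norm \<xi> = 1" and B: "0 <= B" and U: "!!n::nat. regular_solution \<xi> B (U n)"
  and K: "compact K" "K \<subseteq> half_space" and ep: "0 < ep"
 shows "EX k. strict_mono (k :: nat => nat) & (EX N. \<forall>m\<ge>N. \<forall>n\<ge>N. (LBINT p. ind K p * (abs (U (k m) p - U (k n) p))) <= ep)"
proof -
 note bU = regular_solutionD(1)[OF U]
 have ep4: "0 < ep / 4" using ep by simp
 obtain de where de: "de > 0" "!!n v. norm v < de ==> (LBINT p. ind K p * (abs (U n (p + v) - U n p))) <= ep / 4"
  using regular_solutions_equicontinuous[OF \<xi> B, unfolded equicontinuous_along_def, rule_format, OF K ep4] U by blast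
 obtain d where d: "d > 0" "{x + y |x y. x : K & y : cball 0 d} \<subseteq> half_space"
  using compact_cball_subset_open[OF K(1) open_half_space K(2)] .
 define K' where "K' = {x + y |x y. x : K & y : cball (0 :: spacetime) d}"
 have K': "compact K'" "K' \<subseteq> half_space" unfolding K'_def by (rule compact_sums[OF K(1) compact_cball], rule d(2))
 obtain ta where ta: "0 < ta" "!!p. p : K' ==> ta < fst p" using compact_half_space_lower[OF K'] by metis
 obtain M where M: "M > 0" "!!U. regular_solution \<xi> B U ==> AE p in lborel. ta < fst p --> (abs (U p)) <= M"
 proof (rule regular_solution_bound[OF \<xi> B ta(1)])
 qed (rule that)
 have "0 < min de d" using de(1) d(1) by simp
 \<comment> \<open>The mollification radius lies below \<open>de\<close>, where the L1 modulus is at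
   most ep / 4, and below \<open>d\<close>, so that on \<open>K\<close> the convolution sees only
   values on \<open>K'\<close>, where the common bound \<open>M\<close> holds.\<close>
 then obtain m where m: "1 / real (Suc m) < min de d" by (rule Suc_inverse_small) blast
 define rh where "rh = (moll m :: spacetime => real)"
 have trh: "test1 UNIV rh (grad rh)" unfolding rh_def by (rule moll_test1)
 have rh0: "0 <= rh w" "(LBINT w. rh w) = 1" for w by (simp_all add: rh_def moll_nonneg moll_integral)
 have rhz: "norm w < de" "norm w <= d" if "rh w ~= 0" for w
  using moll_eq_0[of m w] that m by (force simp: rh_def)+
 have rhc: "w ~: cball 0 1 ==> rh w = 0" for w unfolding rh_def by (rule moll_eq_0_1)
 have irh: "integ rh" and brh: "bdb rh" using test1_integrable(1)[OF trh] test1_bdb(1)[OF trh] .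
 define V where "V n p = (LBINT q. U n q * rh (p - q))" for n p
 have iq: "integ (%q. rh (p - q))" for p by (rule lborel_integrable_reflect[OF irh])
 have iV: "integ (%q. U n q * rh (p - q))" for n p
 proof -
  obtain C where "!!p. (abs (U n p)) <= C" using bdb_abs_bound[OF bU] by metis
  then have "integ (%q. rh (p - q) *R U n q)"
  using bdb_measurable[OF bU] by (intro integrable_mult_bounded[OF iq, of _ C]) auto
  then show ?thesis by (simp add: mult.commute)
 qed
 have absorb: "AE q in lborel. (abs (U n q)) * c q <= M * c q" if "!!q. 0 <= c q" "!!q. c q ~= 0 ==> q : K'" for n and c :: "spacetime => real"
  using M(2)[OF U[of n]]
 proof eventually_elim
  case (elim q)
  show ?case
  proof (cases "c q = 0")
  case False
  then have "(abs (U n q)) <= M" using elim ta(2) that(2) by blast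
  then show ?thesis using that(1) by (rule mult_right_mono)
  qed simp
 qed
 have inK': "q : K'" if "p : K" "rh (p - q) ~= 0" for p q
  unfolding K'_def using that(1) rhz(2)[OF that(2)] by (intro CollectI exI[of _ p] exI[of _ "q - p"]) (simp add: norm_minus_commute)
 have VM: "norm (V n p) <= M" if "p : K" for n p
 proof -
  have "(abs (V n p)) <= (LBINT q. (abs (U n q * rh (p - q))))" unfolding V_def by (rule integral_abs_bound)
  also have "... <= (LBINT q. M * rh (p - q))"
  proof (rule integral_mono_AE[OF integrable_abs[OF iV] integrable_mult_right[OF iq]])
  show "AE q in lborel. (abs (U n q * rh (p - q))) <= M * rh (p - q)"
  using absorb[of "%q. rh (p - q)" n] inK'[OF that] rh0(1) by (simp add: abs_mult)
  qed
  also have "... = M" using lborel_integral_reflect[of rh p] bdb_measurable[OF brh] by (simp add: rh0)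
  finally show ?thesis by simp
 qed
 \<comment> \<open>Only the kernel moves with the point, so the increment is at most
   \<open>M\<close> times the L1 modulus of translation of \<open>rh\<close>, the same for all
   n.\<close>
 have Vc: "\<exists>d>0. ALL n y. y : K & norm (x - y) < d --> norm (V n x - V n y) < e" if x: "x : K" and e: "0 < e" for x e
 proof -
  have eM: "0 < e / M" using e M(1) by simp
  obtain d' where d': "d' > 0" "!!v. norm v < d' ==> (LBINT w. (abs (rh (w + v) - rh w))) < e / M"
  proof (rule translation_L1[OF irh eM])
  qed (rule that)
  have "norm (V n x - V n y) < e" if y: "y : K" "norm (x - y) < d'" for n y
  proof -
  have id: "integ (%q. (abs (rh (x - q) - rh (y - q))))" by (intro integrable_abs B_idiff iq)
  have "(abs (V n x - V n y)) = \<bar>LBINT q. U n q * rh (x - q) - U n q * rh (y - q)\<bar>"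
  unfolding V_def by (simp add: B_diff[OF iV iV])
  also have "... <= (LBINT q. (abs (U n q * rh (x - q) - U n q * rh (y - q))))" by (rule integral_abs_bound)
  also have "... <= (LBINT q. M * (abs (rh (x - q) - rh (y - q))))"
  proof (rule integral_mono_AE[OF integrable_abs[OF B_idiff[OF iV iV]] integrable_mult_right[OF id]])
  have "AE q in lborel. (abs (U n q)) * (abs (rh (x - q) - rh (y - q))) <= M * (abs (rh (x - q) - rh (y - q)))"
  by (rule absorb) (use inK'[OF x] inK'[OF y(1)] in force)+
  then show "AE q in lborel. (abs (U n q * rh (x - q) - U n q * rh (y - q))) <= M * (abs (rh (x - q) - rh (y - q)))"
  by (simp add: right_diff_distrib[symmetric] abs_mult)
  qed
  also have "... = M * (LBINT q. (abs (rh (x - q) - rh (y - q))))" by simp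
  also have "(LBINT q. (abs (rh (x - q) - rh (y - q)))) = (LBINT w. (abs (rh (w + (x - y)) - rh w)))"
  proof -
  have "(%w. (abs (rh (w + (x - y)) - rh w))) : bmeas"
  using bdb_measurable[OF increment_bdb[OF brh, of "x - y" 0]] by simp
  from lborel_integral_reflect[OF this, of y] show ?thesis by (simp add: algebra_simps)
  qed
  also have "M * ... < M * (e / M)" by (rule mult_strict_left_mono[OF d'(2)[OF y(2)] M(1)])
  finally show ?thesis using M(1) by simp
  qed
  then show ?thesis using d'(1) by blast
 qed
 obtain g k where k: "strict_mono (k :: nat => nat)" "!!e. 0 < e ==> EX N. ALL n x. n \<ge> N & x : K --> norm (V (k n) x - g x) < e"
  using Arzela_Ascoli[OF K(1) VM Vc] by metis
 define vol where "vol = (LBINT p. ind K p :: real)"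
 have vol: "0 <= vol" unfolding vol_def by (intro B_nonneg) simp
 \<comment> \<open>The uniform error costs 2 e vol <= ep / 4; with the two mollification errors the
   total is at most 3/4 of \<open>ep\<close>.\<close>
 define e where "e = ep / (4 * (2 * vol + 1))"
 have e: "0 < e" "2 * e * vol <= ep / 4" using ep vol by (auto simp: e_def divide_simps)
 obtain N where N: "!!n x. n \<ge> N ==> x : K ==> norm (V (k n) x - g x) < e" using k(2)[OF e(1)] by metis
 have mollify: "EX f. integ f & (LBINT p. f p) <= ep / 4 & (ALL p. ind K p * (abs (V n p - U n p)) <= f p)" for n
 proof -
  define F where "F z = ind K (fst z) * ((abs (U n (fst z - snd z) - U n (fst z))) * rh (snd z))" for z :: "spacetime \<times> spacetime"
  have c: "(%z::spacetime \<times> spacetime. fst z - snd z) : bmeas" by (intro borel_measurable_continuous_onI continuous_intros)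
  have "bdb (%z::spacetime \<times> spacetime. (abs (U n (fst z - snd z) - U n (fst z))))"
  by (rule bdb_comp_continuous[OF bdb_diff[OF bdb_comp[OF bU c] bdb_fst[OF bU]], of abs]) (intro continuous_intros)
  then have bF: "bdb F" unfolding F_def[abs_def] by (intro bdb_mult bdb_fst[OF bdb_indicator[OF K(1)]] bdb_snd[OF brh])
  obtain C where C: "!!z. (abs (F z)) <= C" using bdb_abs_bound[OF bF] by metis
  have Z: "F z = 0" if "z ~: K \<times> cball 0 1" for z
  using that rhc[of "snd z"] by (cases "fst z : K") (auto simp: F_def mem_Times_iff)
  note Fub = fubini_bounded_support[OF bdb_measurable[OF bF] C compact_Times[OF K(1) compact_cball] Z]
  have "(LBINT p. LBINT w. F (p, w)) = (LBINT w. LBINT p. F (p, w))" by (rule Fub(6))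
  also have "... <= (LBINT w. ep / 4 * rh w)"
  proof (rule integral_mono[OF Fub(5) integrable_mult_right[OF irh]])
  fix w
  have "(LBINT p. F (p, w)) = (LBINT p. ind K p * (abs (U n (p + - w) - U n p))) * rh w"
  unfolding F_def by (simp add: mult.assoc[symmetric])
  also have "... <= ep / 4 * rh w" using de(2)[of "- w" n] rhz(1)[of w] rh0(1)[of w] by (cases "rh w = 0") (auto intro: mult_right_mono)
  finally show "(LBINT p. F (p, w)) <= ep / 4 * rh w" .
  qed
  finally have 1: "(LBINT p. LBINT w. F (p, w)) <= ep / 4" by (simp add: rh0)
  have 2: "ind K p * (abs (V n p - U n p)) <= (LBINT w. F (p, w))" for p
  proof (cases "p : K")
  case True
  have m1: "(%q. U n q * rh (p - q)) : bmeas" using borel_measurable_integrable[OF iV] by simp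
  have e1: "V n p = (LBINT w. U n (p - w) * rh w)" using lborel_integral_reflect[OF m1, of p] by (simp add: V_def)
  have i1: "integ (%w. U n (p - w) * rh w)" using lborel_integrable_reflect[OF iV[of n p], of p] by simp
  have "V n p - U n p = (LBINT w. U n (p - w) * rh w - U n p * rh w)"
  using B_diff[OF i1 integrable_mult_right[OF irh, of "U n p"]] by (simp add: e1 rh0)
  then have "(abs (V n p - U n p)) <= (LBINT w. (abs (U n (p - w) * rh w - U n p * rh w)))" by (simp only: integral_abs_bound)
  also have "... = (LBINT w. F (p, w))" using True rh0(1) by (simp add: F_def left_diff_distrib[symmetric] abs_mult)
  finally show ?thesis using True by simp
  qed (simp add: F_def)
  show ?thesis by (rule exI[of _ "%p. LBINT w. F (p, w)"], intro conjI allI 1 2) (rule Fub(4))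
 qed
 then obtain f where f: "!!n. integ (f n)" "!!n. (LBINT p. f n p) <= ep / 4" "!!n p. ind K p * (abs (V n p - U n p)) <= f n p"
  by metis
 have ivol: "integ (%p. ind K p :: real)" by (rule bdb_integrable[OF bdb_indicator[OF K(1)] K(1)]) simp
 have "(LBINT p. ind K p * (abs (U (k i) p - U (k j) p))) <= ep" if ij: "N <= i" "N <= j" for i j
 proof -
  have "(LBINT p. ind K p * (abs (U (k i) p - U (k j) p))) <= (LBINT p. f (k i) p + f (k j) p + 2 * e * ind K p)"
  proof (rule integral_mono)
  have "bdb (%p. (abs (U (k i) p - U (k j) p)))" by (rule bdb_comp_continuous[OF bdb_diff[OF bU bU]]) (intro continuous_intros)
  then show "integ (%p. ind K p * (abs (U (k i) p - U (k j) p)))"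
  by (intro bdb_integrable[OF bdb_mult[OF bdb_indicator[OF K(1)]] K(1)]) auto
  show "ind K p * (abs (U (k i) p - U (k j) p)) <= f (k i) p + f (k j) p + 2 * e * ind K p" for p
  proof (cases "p : K")
  case True
  have "(abs (V (k i) p - g p)) < e" "(abs (V (k j) p - g p)) < e" using N[OF ij(1) True] N[OF ij(2) True] by simp_all
  then show ?thesis using f(3)[of p "k i"] f(3)[of p "k j"] True by (simp add: abs_if split: if_splits)
  next
  case False
  then show ?thesis using f(3)[of p "k i"] f(3)[of p "k j"] by simp
  qed
  qed (intro B_iadd f integrable_mult_right ivol)
  also have "... = (LBINT p. f (k i) p) + (LBINT p. f (k j) p) + 2 * e * vol"
  using f(1) ivol by (simp add: vol_def)
  also have "... <= ep" using f(2)[of "k i"] f(2)[of "k j"] e(2) ep by simp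
  finally show ?thesis .
 qed
 then show ?thesis using k(1) by blast
qed

text \<open>The stability condition of the diagonal argument: the diagonal sequence is a subsequence
  of each stage only from some index on.\<close>

lemma Cauchy_eventual_subsequence:
 fixes x :: "nat => real"
 assumes "Cauchy (%n. x (k1 n))" "!!j. N <= j ==> EX j'. j <= j' & k2 j = k1 j'"
 shows "Cauchy (%n. x (k2 n))"
proof (rule metric_CauchyI)
 fix e :: real assume "0 < e"
 then obtain M where M: "\<forall>m\<ge>M. \<forall>n\<ge>M. dist (x (k1 m)) (x (k1 n)) < e" using metric_CauchyD[OF assms(1)] by blast
 have "dist (x (k2 m)) (x (k2 n)) < e" if "max M N <= m" "max M N <= n" for m n
 proof -
  have mn: "N <= m" "N <= n" using that by simp_all
  obtain m' where m': "m <= m'" "k2 m = k1 m'" using assms(2)[OF mn(1)] by blast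
  obtain n' where n': "n <= n'" "k2 n = k1 n'" using assms(2)[OF mn(2)] by blast
  have "M <= m'" "M <= n'" using that m' n' by simp_all
  then show ?thesis using M m' n' by simp
 qed
 then show "EX M. \<forall>m\<ge>M. \<forall>n\<ge>M. dist (x (k2 m)) (x (k2 n)) < e" by blast
qed

text \<open>A diagonal sequence over the tolerances 1/(l + 1) is Cauchy in L1 on \<open>K\<close>,
  and a Cauchy sequence in L1 has a subsequence that is Cauchy almost everywhere.\<close>

lemma AE_Cauchy_subsequence_on:
 assumes \<xi>: "norm \<xi> = 1" and B: "0 <= B" and U: "!!n::nat. regular_solution \<xi> B (U n)"
  and K: "compact K" "K \<subseteq> half_space"
 shows "EX k. strict_mono (k :: nat => nat) & (AE p in lborel. p : K --> Cauchy (%n. U (k n) p))"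
proof -
 define P where "P l r = (EX N. \<forall>m\<ge>N. \<forall>n\<ge>N. (LBINT p. ind K p * (abs (U (r m) p - U (r n) p))) <= 1 / real (Suc l))" for l and r :: "nat => nat"
 obtain k where k: "strict_mono (k :: nat => nat)" "!!l. P l (id \<circ> k)"
 proof (rule subsequence_diagonalization_lemma[of P id])
  show "EX k. strict_mono (k :: nat => nat) & P l (r \<circ> k)" for l r
  using L1_precompact[OF \<xi> B U K, of "1 / real (Suc l)" r] by (simp add: P_def)
  show "P l (r \<circ> k2)" if h: "P l (r \<circ> k1)" "!!j. N <= j ==> EX j'. j <= j' & k2 j = k1 j'" for l and r k1 k2 :: "nat => nat" and N
  proof -
  obtain N' where N': "\<forall>m\<ge>N'. \<forall>n\<ge>N'. (LBINT p. ind K p * (abs (U (r (k1 m)) p - U (r (k1 n)) p))) <= 1 / real (Suc l)"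
  using h(1) unfolding P_def o_def by blast
  have "(LBINT p. ind K p * (abs (U (r (k2 m)) p - U (r (k2 n)) p))) <= 1 / real (Suc l)" if "max N N' <= m" "max N N' <= n" for m n
  proof -
  have mn: "N <= m" "N <= n" using that by simp_all
  obtain m' where m': "m <= m'" "k2 m = k1 m'" using h(2)[OF mn(1)] by blast
  obtain n' where n': "n <= n'" "k2 n = k1 n'" using h(2)[OF mn(2)] by blast
  have "N' <= m'" "N' <= n'" using that m' n' by simp_all
  then show ?thesis unfolding m'(2) n'(2) using N' by blast
  qed
  then show ?thesis unfolding P_def o_def by blast
  qed
 qed (rule that)
 define s where "s n p = ind K p * U (k n) p" for n p
 have int: "integ (s n)" for n unfolding s_def[abs_def]
  by (rule bdb_integrable[OF bdb_mult[OF bdb_indicator[OF K(1)] regular_solutionD(1)[OF U]] K(1)]) simp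
 obtain j where j: "strict_mono j" "AE p in lborel. Cauchy (%i. s (j i) p)"
 proof (rule cauchy_L1_AE_cauchy_subseq[of lborel s, OF int])
  fix e :: real assume "0 < e"
  obtain l where l: "1 / real (Suc l) < e" using Suc_inverse_small[OF \<open>0 < e\<close>] by blast
  obtain N where N: "\<forall>m\<ge>N. \<forall>n\<ge>N. (LBINT p. ind K p * (abs (U (k m) p - U (k n) p))) <= 1 / real (Suc l)"
  using k(2)[of l] unfolding P_def by auto
  have "(LBINT p. norm (s m p - s n p)) < e" if "N <= m" "N <= n" for m n
  proof -
  have "(LBINT p. norm (s m p - s n p)) = (LBINT p. ind K p * (abs (U (k m) p - U (k n) p)))"
  by (simp add: s_def right_diff_distrib[symmetric] abs_mult)
  also have "... <= 1 / real (Suc l)" using N that by blast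
  finally show ?thesis using l by linarith
  qed
  then show "EX N. \<forall>i\<ge>N. \<forall>j\<ge>N. (LBINT p. norm (s i p - s j p)) < e" by blast
 qed (rule that)
 show ?thesis
 proof (intro exI[of _ "k \<circ> j"] conjI)
  show "strict_mono (k \<circ> j)" by (rule strict_mono_o[OF k(1) j(1)])
  show "AE p in lborel. p : K --> Cauchy (%n. U ((k \<circ> j) n) p)"
  using j(2) by eventually_elim (auto simp: s_def)
 qed
qed

definition exhaustion :: "nat => spacetime set" where
 "exhaustion i = {1 / real (Suc i)..real (Suc i)} \<times> cball 0 (real (Suc i))"

lemma exhaustion: "compact (exhaustion i)" "exhaustion i \<subseteq> half_space" "p : half_space ==> EX i. p : exhaustion i"
proof -
 show "compact (exhaustion i)" unfolding exhaustion_def by (intro compact_Times) auto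
 show "exhaustion i \<subseteq> half_space"
 proof
  fix p assume "p : exhaustion i"
  then have "1 / real (Suc i) <= fst p" unfolding exhaustion_def mem_Times_iff by simp
  moreover have "0 < 1 / real (Suc i)" by simp
  ultimately show "p : half_space" unfolding half_space_def mem_Times_iff by (metis UNIV_I greaterThan_iff less_le_trans)
 qed
 assume p: "p : half_space"
 then have t: "0 < fst p" by (auto simp: half_space_def)
 obtain N where N: "!!n. n \<ge> N ==> 1 / real (Suc n) < fst p" using Suc_inverse_small[OF t] by metis
 obtain m :: nat where m: "fst p + norm (snd p) <= real m" using real_arch_simple by blast
 define i where "i = max N m"
 have "1 / real (Suc i) < fst p" by (rule N) (simp add: i_def)
 moreover have "real m <= real (Suc i)" by (simp add: i_def)
 moreover from this have "fst p <= real (Suc i)" "norm (snd p) <= real (Suc i)" using m t norm_ge_zero[of "snd p"] by linarith+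
 ultimately have "p : exhaustion i" unfolding exhaustion_def mem_Times_iff by simp
 then show "EX i. p : exhaustion i" by blast
qed

text \<open>A second diagonal argument, now over the compact sets that exhaust the half
  space.\<close>

theorem AE_Cauchy_subsequence:
 assumes \<xi>: "norm \<xi> = 1" and B: "0 <= B" and U: "!!n::nat. regular_solution \<xi> B (U n)"
 obtains k where "strict_mono (k :: nat => nat)" "AE p in lborel. p : half_space --> Cauchy (%n. U (k n) p)"
proof -
 define P where "P i r = (AE p in lborel. p : exhaustion i --> Cauchy (%n. U (r n) p))" for i and r :: "nat => nat"
 obtain k where k: "strict_mono (k :: nat => nat)" "!!i. P i (id \<circ> k)"
 proof (rule subsequence_diagonalization_lemma[of P id])
  show "EX k. strict_mono (k :: nat => nat) & P i (r \<circ> k)" for i r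
  using AE_Cauchy_subsequence_on[OF \<xi> B U exhaustion(1,2), of i r] by (simp add: P_def)
  show "P i (r \<circ> k2)" if h: "P i (r \<circ> k1)" "!!j. N <= j ==> EX j'. j <= j' & k2 j = k1 j'" for i and r k1 k2 :: "nat => nat" and N
  using h(1) unfolding P_def
  proof eventually_elim
  case (elim p)
  then show ?case using Cauchy_eventual_subsequence[of "%n. U (r n) p" k1 N k2, OF _ h(2)] by simp
  qed
 qed (rule that)
 have "AE p in lborel. ALL i. p : exhaustion i --> Cauchy (%n. U (k n) p)"
  unfolding AE_all_countable using k(2) by (simp add: P_def)
 then have "AE p in lborel. p : half_space --> Cauchy (%n. U (k n) p)"
  by eventually_elim (use exhaustion(3) in blast)
 then show ?thesis by (rule that[OF k(1)])
qed

section \<open>Passage to the limit under local bounds\<close>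

lemma half_space_measurable:
 assumes "set_borel_measurable lborel half_space w" "K \<subseteq> half_space" "K : sets borel"
  and c: "contU (c :: real => 'b::euclidean_space)"
 shows "(%p. ind K p *R c (w p)) : lmeas"
proof -
 have "(%p. ind K p *R c (ind half_space p *R w p)) : lmeas"
  by (intro borel_measurable_scaleR borel_measurable_indicator measurable_compose[OF assms(1)[unfolded set_borel_measurable_def] borel_measurable_continuous_onI[OF c]])
  (use assms(3) in simp)
 moreover have "ind K p *R c (ind half_space p *R w p) = ind K p *R c (w p)" for p
  using assms(2) by (auto simp: indicator_def)
 ultimately show ?thesis by (simp only:)
qed

lemma continuous_powr_abs: "1 <= q ==> contU (%x::real. (abs x) powr q)"
 by (intro continuous_on_powr' continuous_intros) auto

text \<open>Almost everywhere convergence with a common bound after each positive time: compact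
  subsets of the half space stay away from time 0, so dominated convergence applies to Lp distances
  and to entropy inequalities alike.\<close>

locale bounded_family =
 fixes w :: "nat => spacetime => real" and v :: "spacetime => real"
 assumes wm: "!!n. set_borel_measurable lborel half_space (w n)" and vm: "set_borel_measurable lborel half_space v"
  and wv: "AE p in lborel. p : half_space --> (%n. w n p) ~~> v p"
  and bd: "!!ta. 0 < ta ==> EX M. ALL n. AE p in lborel. ta < fst p --> (abs (w n p)) <= M"
begin

lemma bounds:
 assumes "0 < ta"
 obtains M where "0 <= M" "AE p in lborel. ta < fst p --> (ALL n. (abs (w n p)) <= M) & (abs (v p)) <= M"
proof -
 obtain M where M: "ALL n. AE p in lborel. ta < fst p --> (abs (w n p)) <= M" using bd[OF assms] by blast
 then have "AE p in lborel. ALL n. ta < fst p --> (abs (w n p)) <= M" unfolding AE_all_countable by blast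
 with wv have "AE p in lborel. ta < fst p --> (ALL n. (abs (w n p)) <= (abs M)) & (abs (v p)) <= (abs M)"
 proof eventually_elim
  case (elim p)
  show ?case
  proof
  assume p: "ta < fst p"
  then have "p : half_space" using assms by (cases p) (auto simp: half_space_def)
  then have l: "(%n. (abs (w n p))) ~~> (abs (v p))" using elim by (intro tendsto_rabs) blast
  have b: "(abs (w n p)) <= (abs M)" for n using elim p by (meson abs_ge_self order_trans)
  have "(abs (v p)) <= (abs M)" by (rule LIMSEQ_le_const2[OF l]) (use b in blast)
  then show "(ALL n. (abs (w n p)) <= (abs M)) & (abs (v p)) <= (abs M)" using b by blast
  qed
 qed
 then show ?thesis by (intro that[of "(abs M)"]) auto
qed

lemma field_limit:
 fixes Y :: "real => spacetime"
 assumes Y: "contU Y" and t: "test1 half_space ph g"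
 shows "(%n. LBINT p. ind half_space p *R (Y (w n p) \<bullet> g p)) ~~> (LBINT p. ind half_space p *R (Y (v p) \<bullet> g p))"
proof -
 obtain K where K: "compact K" "K \<subseteq> half_space" "!!p. p ~: K ==> g p = 0" using test1D[OF t] by metis
 obtain ta where ta: "0 < ta" "!!p. p : K ==> ta < fst p" using compact_half_space_lower[OF K(1,2)] by metis
 obtain M where M: "0 <= M" "AE p in lborel. ta < fst p --> (ALL n. (abs (w n p)) <= M) & (abs (v p)) <= M"
 proof (rule bounds[OF ta(1)])
 qed (rule that)
 have "bounded (Y ` cball 0 M)" by (intro compact_imp_bounded compact_continuous_image continuous_on_subset[OF Y]) auto
 then obtain C where "\<forall>y\<in>Y ` cball 0 M. norm y <= C" unfolding bounded_iff by blast
 then have C: "norm (Y x) <= C" if "(abs x) <= M" for x using that by simp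
 have gm: "g : lmeas" using test1_measurable(2)[OF t] by simp
 have hm: "half_space : sets borel" using open_half_space by simp
 have m: "(%p. ind half_space p *R (Y (f p) \<bullet> g p)) : lmeas"
  if "set_borel_measurable lborel half_space f" for f
  using borel_measurable_inner[OF half_space_measurable[OF that order_refl hm Y] gm] by simp
 show ?thesis
 proof (rule integral_dominated_convergence[where w = "%p. C * norm (g p)"])
  show "integ (%p. C * norm (g p))" by (intro integrable_mult_right integrable_norm test1_integrable(2)[OF t])
  show "AE p in lborel. (%n. ind half_space p *R (Y (w n p) \<bullet> g p)) ~~> ind half_space p *R (Y (v p) \<bullet> g p)"
  using wv
  proof eventually_elim
  case (elim p)
  show ?case
  proof (cases "p : half_space")
  case True
  then have "(%n. Y (w n p)) ~~> Y (v p)" using elim by (intro continuous_on_tendsto_compose[OF Y]) auto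
  then show ?thesis by (intro tendsto_intros)
  qed simp
  qed
  show "AE p in lborel. norm (ind half_space p *R (Y (w n p) \<bullet> g p)) <= C * norm (g p)" for n
  using M(2)
  proof eventually_elim
  case (elim p)
  show ?case
  proof (cases "p : K")
  case True
  then have "norm (Y (w n p)) <= C" using elim ta(2) C by blast
  then have "(abs (Y (w n p) \<bullet> g p)) <= C * norm (g p)"
  using Cauchy_Schwarz_ineq2[of "Y (w n p)" "g p"] mult_right_mono[OF _ norm_ge_zero[of "g p"]] by (meson order_trans)
  then show ?thesis using True K(2) by auto
  qed (simp add: K(3))
  qed
 qed (rule m wm vm)+
qed

lemma Lp_limit:
 assumes q: "1 <= q"
 shows "Lp_loc_converges q w v"
proof -
 have main: "set_integrable lborel K (%p. (abs (w n p)) powr q) & set_integrable lborel K (%p. (abs (v p)) powr q) &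
  (%n. LBINT p:K. (abs (w n p - v p)) powr q) ~~> 0" if K: "compact K" "K \<subseteq> half_space" for K n
 proof -
  obtain ta where ta: "0 < ta" "!!p. p : K ==> ta < fst p" using compact_half_space_lower[OF K] by metis
  obtain M where M: "0 <= M" "AE p in lborel. ta < fst p --> (ALL n. (abs (w n p)) <= M) & (abs (v p)) <= M"
  proof (rule bounds[OF ta(1)])
  qed (rule that)
  have Kb: "K : sets borel" using K(1) by (simp add: compact_imp_closed)
  have ind: "integ (%p. ind K p * c :: real)" for c
  by (intro integrable_mult_left bdb_integrable[OF bdb_indicator[OF K(1)] K(1)]) simp
  have si: "set_integrable lborel K (%p. (abs (f p)) powr q)"
  if f: "set_borel_measurable lborel half_space f" and b: "AE p in lborel. ta < fst p --> (abs (f p)) <= M" for f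
  unfolding set_integrable_def
  proof (rule B_ibound[OF ind[of "M powr q"]])
  show "(%p. ind K p *R (abs (f p)) powr q) : lmeas"
  by (rule half_space_measurable[OF f K(2) Kb continuous_powr_abs[OF q]])
  show "AE p in lborel. norm (ind K p *R (abs (f p)) powr q) <= norm (ind K p * M powr q)"
  using b by eventually_elim (use ta(2) q in "auto simp: indicator_def intro!: powr_mono2")
  qed
  have dm: "set_borel_measurable lborel half_space (%p. w n p - v p)" for n
  using borel_measurable_diff[OF wm[of n, unfolded set_borel_measurable_def] vm[unfolded set_borel_measurable_def]]
  by (simp add: set_borel_measurable_def right_diff_distrib)
  have "(%n. LBINT p. ind K p *R (abs (w n p - v p)) powr q) ~~> (LINT p|(lborel :: spacetime measure). 0)"
  proof (rule integral_dominated_convergence[where w = "%p. ind K p * (2 * M) powr q"])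
  show "(%p. ind K p *R (abs (w n p - v p)) powr q) : lmeas" for n
  by (rule half_space_measurable[OF dm K(2) Kb continuous_powr_abs[OF q]])
  show "AE p in lborel. (%n. ind K p *R (abs (w n p - v p)) powr q) ~~> 0"
  using wv
  proof eventually_elim
  case (elim p)
  show ?case
  proof (cases "p : K")
  case True
  then have "(%n. w n p - v p) ~~> v p - v p" using elim K(2) by (intro tendsto_diff tendsto_const) blast
  from continuous_on_tendsto_compose[OF continuous_powr_abs[OF q] this]
  have "(%n. (abs (w n p - v p)) powr q) ~~> (abs (v p - v p)) powr q" by simp
  then show ?thesis using True q by simp
  qed simp
  qed
  show "AE p in lborel. norm (ind K p *R (abs (w n p - v p)) powr q) <= ind K p * (2 * M) powr q" for n
  using M(2)
  proof eventually_elim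
  case (elim p)
  show ?case
  proof (cases "p : K")
  case True
  then have "(abs (w n p)) <= M" "(abs (v p)) <= M" using elim ta(2) by blast+
  then have "(abs (w n p - v p)) <= 2 * M" by linarith
  then have "(abs (w n p - v p)) powr q <= (2 * M) powr q" using q by (intro powr_mono2) auto
  then show ?thesis using True by simp
  qed simp
  qed
  qed (use ind in auto)
  moreover have "AE p in lborel. ta < fst p --> (abs (w n p)) <= M" "AE p in lborel. ta < fst p --> (abs (v p)) <= M" for n
  using M(2) by (eventually_elim, blast)+
  ultimately show ?thesis using si[OF wm] si[OF vm] by (simp add: set_lebesgue_integral_def)
 qed
 then show ?thesis unfolding Lp_loc_converges_def Lp_loc_def using wm vm by blast
qed

lemma entropy_limit:
 assumes ent: "!!n. entropy_solution (w n)"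
 shows "entropy_solution v"
 unfolding entropy_solution_def
proof (intro conjI allI impI ballI)
 show "set_borel_measurable lborel half_space v" by (rule vm)
 show "EX M. AE p in lborel. ta < fst p --> (abs (v p)) <= M" if "ta > 0" for ta
 proof (rule bounds[OF that])
  fix M assume "AE p in lborel. ta < fst p --> (ALL n. (abs (w n p)) <= M) & (abs (v p)) <= M"
  then have "AE p in lborel. ta < fst p --> (abs (v p)) <= M" by eventually_elim blast
  then show ?thesis by blast
 qed
 fix ph assume ph: "ph : test_functions half_space"
 note t = test_functions_test1[OF ph]
 note d = dt_grad_x_eq[OF t]
 have e1: "a * dt ph p + flux a \<bullet> grad_x ph p = Gam a \<bullet> grad ph p" for a p
  by (simp add: Gam_def inner_prod_def d)
 have c1: "contU Gam" using continuous_Gamma[OF continuous_on_id] by simp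
 note E = conjunct2[OF conjunct2[OF ent[unfolded entropy_solution_def]]]
 have "(LBINT p. ind half_space p *R (Gam (w n p) \<bullet> grad ph p)) = 0" for n
  using bspec[OF conjunct1[OF E] ph, of n] unfolding set_lebesgue_integral_def e1 .
 then show "(LBINT p:half_space. v p * dt ph p + flux (v p) \<bullet> grad_x ph p) = 0"
  using field_limit[OF c1 t] unfolding set_lebesgue_integral_def e1 by (simp only: LIMSEQ_const_iff)
 fix k assume pos: "ALL p. 0 <= ph p"
 define Y where "Y a = Gam (max a k) + - Gam (min a k)" for a
 have e2: "(abs (a - k)) * dt ph p + (sgn (a - k) *R (flux a - flux k)) \<bullet> grad_x ph p = Y a \<bullet> grad ph p" for a p
  unfolding Y_def entropy_field[symmetric] by (simp add: inner_prod_def d)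
 have c2: "contU Y" unfolding Y_def
  by (intro continuous_intros continuous_Gamma continuous_on_max continuous_on_min continuous_on_id continuous_on_const)
 have "0 <= (LBINT p. ind half_space p *R (Y (w n p) \<bullet> grad ph p))" for n
  using conjunct2[OF E, rule_format, OF ph pos[rule_format], of n k] unfolding set_lebesgue_integral_def e2 .
 then show "0 <= (LBINT p:half_space. (abs (v p - k)) * dt ph p + (sgn (v p - k) *R (flux (v p) - flux k)) \<bullet> grad_x ph p)"
  unfolding set_lebesgue_integral_def e2 by (intro LIMSEQ_le_const[OF field_limit[OF c2 t]]) blast
qed

end

lemma powr_triangle:
 fixes x y z q :: real
 assumes "1 <= q" shows "(abs (x - y)) powr q <= 2 powr q * ((abs (z - x)) powr q + (abs (z - y)) powr q)"
proof -
 have "(abs (x - y)) <= (abs (z - y)) + (abs (z - x))" using abs_triangle_ineq4[of "z - y" "z - x"] by simp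
 then have "(abs (x - y)) <= 2 * max (abs (z - x)) (abs (z - y))" by (auto simp: max_def)
 then have "(abs (x - y)) powr q <= (2 * max (abs (z - x)) (abs (z - y))) powr q" using assms by (intro powr_mono2) auto
 also have "... = 2 powr q * max (abs (z - x)) (abs (z - y)) powr q" by (rule powr_mult)
 also have "... <= 2 powr q * ((abs (z - x)) powr q + (abs (z - y)) powr q)" by (intro mult_left_mono) (auto simp: max_def)
 finally show ?thesis .
qed

lemma Lp_loc_diff_integrable:
 assumes q: "1 <= q" and f: "f : Lp_loc q" and g: "g : Lp_loc q" and K: "compact K" "K \<subseteq> half_space"
 shows "integ (%p. ind K p *R (abs (f p - g p)) powr q)"
proof (rule B_ibound)
 have i: "integ (%p. ind K p *R (abs (f p)) powr q)" "integ (%p. ind K p *R (abs (g p)) powr q)"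
  using f g K by (auto simp: Lp_loc_def set_integrable_def)
 show "integ (%p. 2 powr q * (ind K p *R (abs (f p)) powr q + ind K p *R (abs (g p)) powr q))"
  by (intro integrable_mult_right B_iadd i)
 have m: "set_borel_measurable lborel half_space (%p. f p - g p)"
  using f g borel_measurable_diff[of "%p. ind half_space p *R f p" lborel "%p. ind half_space p *R g p"]
  by (simp add: Lp_loc_def set_borel_measurable_def right_diff_distrib)
 show "(%p. ind K p *R (abs (f p - g p)) powr q) : lmeas"
  by (rule half_space_measurable[OF m K(2) _ continuous_powr_abs[OF q]]) (simp add: K(1) compact_imp_closed)
 show "AE p in lborel. norm (ind K p *R (abs (f p - g p)) powr q) <= norm (2 powr q * (ind K p *R (abs (f p)) powr q + ind K p *R (abs (g p)) powr q))"
  using powr_triangle[OF q, of _ _ 0] by (intro AE_I2) (auto simp: indicator_def)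
qed

text \<open>Identifies a limit prescribed in \<open>Lp_loc\<close> with the almost everywhere limit
  of a further subsequence, through the quasi-triangle inequality for powers on each set of the
  exhaustion.\<close>

lemma Lp_loc_limit_unique:
 assumes q: "1 <= q" and f: "Lp_loc_converges q w f" and g: "Lp_loc_converges q w g"
 shows "AE p in lborel. p : half_space --> f p = g p"
proof -
 have L: "w n : Lp_loc q" "f : Lp_loc q" "g : Lp_loc q" for n using f g by (auto simp: Lp_loc_converges_def)
 have "AE p in lborel. p : exhaustion i --> f p = g p" for i
 proof -
  note K = exhaustion(1,2)[of i]
  let ?I = "%a b. LBINT p. ind (exhaustion i) p *R (abs (a p - b p)) powr q"
  note int = Lp_loc_diff_integrable[OF q _ _ K]
  have le: "?I f g <= 2 powr q * (?I (w n) f + ?I (w n) g)" for n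
  proof -
  have "?I f g <= (LBINT p. 2 powr q * (ind (exhaustion i) p *R (abs (w n p - f p)) powr q + ind (exhaustion i) p *R (abs (w n p - g p)) powr q))"
  by (rule integral_mono[OF int[OF L(2,3)] integrable_mult_right[OF B_iadd[OF int[OF L(1,2)] int[OF L(1,3)]]]])
  (use powr_triangle[OF q] in "auto simp: indicator_def")
  also have "... = 2 powr q * (?I (w n) f + ?I (w n) g)"
  by (simp only: integral_mult_right_zero B_add[OF int[OF L(1,2)] int[OF L(1,3)]])
  finally show ?thesis .
  qed
  have lim: "(%n. 2 powr q * (?I (w n) f + ?I (w n) g)) ~~> 2 powr q * (0 + 0)"
  using f g K by (intro tendsto_mult tendsto_const tendsto_add) (auto simp: Lp_loc_converges_def set_lebesgue_integral_def)
  have "?I f g <= 2 powr q * (0 + 0)" by (rule LIMSEQ_le_const[OF lim]) (intro exI allI impI le)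
  also have "... = 0" by simp
  finally have "?I f g = 0" by (rule antisym) (intro B_nonneg, auto)
  then have "AE p in lborel. ind (exhaustion i) p *R (abs (f p - g p)) powr q = 0"
  by (subst (asm) integral_nonneg_eq_0_iff_AE[OF int[OF L(2,3)]]) auto
  then show ?thesis by eventually_elim auto
 qed
 then have "AE p in lborel. ALL i. p : exhaustion i --> f p = g p" unfolding AE_all_countable by blast
 then show ?thesis by eventually_elim (use exhaustion(3) in blast)
qed

theorem theorem6p1:
  fixes \<xi> :: plane
    and a :: "plane set \<Rightarrow> real"
    and a_seq :: "nat \<Rightarrow> plane \<Rightarrow> real"
    and u :: "nat \<Rightarrow> spacetime \<Rightarrow> real"
  assumes "norm \<xi> = 1"
    and "signed_measure a"
    and "is_measure_distr (dir_deriv \<xi> (measure_distr a))"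
    and "\<And>m. in_L1_Linf (a_seq m)"
    and "narrowly_converges a_seq a"
    and "(SUP m. distr_norm (dir_deriv \<xi> (fun_distr (a_seq m)))) < \<infinity>"
    and "\<And>m. kruzhkov_solution (a_seq m) (u m)"
  shows "(\<forall>p\<ge>1. precompact_Lp_loc p (range u)) \<and>
    (\<forall>p\<ge>1. \<forall>r v. strict_mono r \<and> Lp_loc_converges p (u \<circ> r) v \<longrightarrow>
       entropy_solution v \<and>
       (\<exists>s. strict_mono s \<and> converges_boundedly_ae (u \<circ> r \<circ> s) v))"
proof -
 note \<xi> = assms(1)
 obtain R where R: "0 <= R" "(SUP m. distr_norm (dir_deriv \<xi> (fun_distr (a_seq m)))) = ennreal R"
  using assms(6) by (cases "SUP m. distr_norm (dir_deriv \<xi> (fun_distr (a_seq m)))") auto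
 \<comment> \<open>The norms are at most \<open>R\<close>, hence strictly below \<open>S\<close>;
   the strict inequality yields a representing measure of total variation below
   \<open>S\<close>.\<close>
 define S where "S = R + 1"
 have S: "0 <= S" using R by (simp add: S_def)
 \<comment> \<open>One factor 2 comes from the two Jordan parts of the derivative of the data, the
   other from the L1 contraction in its averaged form.\<close>
 have "EX U. regular_solution \<xi> (2 * (2 * S)) U & (AE p in lborel. p : half_space --> U p = u m p)" for m
 proof -
  have a: "integ (a_seq m)" "EX M. AE x in lborel. (abs (a_seq m x)) <= M" using assms(4)[of m] by (auto simp: in_L1_Linf_def)
  then obtain M where M: "AE x in lborel. (abs (a_seq m x)) <= M" by blast
  have "distr_norm (dir_deriv \<xi> (fun_distr (a_seq m))) <= ennreal R" unfolding R(2)[symmetric] by (rule SUP_upper) simp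
  also have "... < ennreal S" using R(1) by (simp add: S_def ennreal_lessI)
  finally have d: "distr_norm (dir_deriv \<xi> (fun_distr (a_seq m))) < ennreal S" .
  have "(LBINT x. (abs (a_seq m (x + h *R \<xi>) - a_seq m x))) <= 2 * S * (abs h)" for h
  by (rule distr_norm_translation[OF a(1) M d S])
  then show ?thesis by (rule regular_version[OF assms(7) assms(4)]) blast
 qed
 then have "ALL m. EX U. regular_solution \<xi> (2 * (2 * S)) U & (AE p in lborel. p : half_space --> U p = u m p)" by blast
 from choice[OF this] obtain U where U0: "ALL m. regular_solution \<xi> (2 * (2 * S)) (U m) & (AE p in lborel. p : half_space --> U m p = u m p)" by blast
 have U: "regular_solution \<xi> (2 * (2 * S)) (U m)" "AE p in lborel. p : half_space --> U m p = u m p" for m using U0 by blast+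
 have S4: "0 <= 2 * (2 * S)" using S by simp
 have um: "set_borel_measurable lborel half_space (u m)" and ent: "entropy_solution (u m)" for m
  using assms(7)[of m] by (auto simp: kruzhkov_solution_def entropy_solution_def)
 have bd: "EX M. ALL m. AE p in lborel. ta < fst p --> (abs (u m p)) <= M" if ta: "0 < ta" for ta
 proof (rule regular_solution_bound[OF \<xi> S4 ta])
  fix M assume M: "!!U. regular_solution \<xi> (2 * (2 * S)) U ==> AE p in lborel. ta < fst p --> (abs (U p)) <= M"
  have "AE p in lborel. ta < fst p --> (abs (u m p)) <= M" for m
  using M[OF U(1)[of m]] U(2)[of m] by eventually_elim (use ta in "auto simp: half_space_def")
  then show ?thesis by blast
 qed
 \<comment> \<open>Stated for an arbitrary index map, because a sequence in the range of
   \<open>u\<close> may repeat or reorder the solutions.\<close>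
 have conv: "EX k v. strict_mono (k :: nat => nat) & bounded_family (%n. u (idx (k n))) v" for idx :: "nat => nat"
 proof -
  obtain k where k: "strict_mono (k :: nat => nat)" "AE p in lborel. p : half_space --> Cauchy (%n. U (idx (k n)) p)"
  proof (rule AE_Cauchy_subsequence[OF \<xi> S4 U(1), of idx])
  qed (rule that)
  \<comment> \<open>Defined at every point by \<open>lim\<close>, which is measurable whether or not
    the sequence converges; the value matters only where it does.\<close>
  define v where "v p = lim (%n. ind half_space p *R u (idx (k n)) p)" for p
  have "v : lmeas" unfolding v_def[abs_def]
  by (rule borel_measurable_lim_metric) (rule um[unfolded set_borel_measurable_def])
  then have vm: "set_borel_measurable lborel half_space v"
  unfolding set_borel_measurable_def using open_half_space by (intro borel_measurable_scaleR borel_measurable_indicator) auto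
  have "AE p in lborel. ALL m. p : half_space --> U m p = u m p" unfolding AE_all_countable using U(2) by blast
  with k(2) have "AE p in lborel. p : half_space --> (%n. u (idx (k n)) p) ~~> v p"
  proof eventually_elim
  case (elim p)
  show ?case
  proof
  assume p: "p : half_space"
  then have "Cauchy (%n. u (idx (k n)) p)" using elim by simp
  then show "(%n. u (idx (k n)) p) ~~> v p"
  using p by (simp add: v_def Cauchy_convergent_iff convergent_LIMSEQ_iff)
  qed
  qed
  then have "bounded_family (%n. u (idx (k n))) v"
  by unfold_locales (use um vm bd in blast)+
  then show ?thesis using k(1) by blast
 qed
 have Lp: "u m : Lp_loc q" if "1 <= q" for m q
 proof -
  \<comment> \<open>The constant sequence: membership in \<open>Lp_loc\<close> is contained in the
    convergence statement \<open>Lp_limit\<close>.\<close>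
  have "bounded_family (%n. u m) (u m)"
  proof
  show "EX M. \<forall>n::nat. AE p in lborel. ta < fst p --> (abs (u m p)) <= M" if "0 < ta" for ta
  using bd[OF that] by blast
  qed (use um in simp_all)
  from bounded_family.Lp_limit[OF this that] show ?thesis by (simp add: Lp_loc_converges_def)
 qed
 show ?thesis
 proof (intro conjI allI impI)
  fix q :: real assume q: "1 <= q"
  show "precompact_Lp_loc q (range u)" unfolding precompact_Lp_loc_def
  proof (intro conjI allI impI)
  show "range u \<subseteq> Lp_loc q" using Lp[OF q] by blast
  fix w :: "nat => spacetime => real" assume "range w \<subseteq> range u"
  then have "ALL n. EX m. w n = u m" by blast
  then obtain idx where idx: "!!n. w n = u (idx n)" by metis
  obtain k v where k: "strict_mono (k :: nat => nat)" "bounded_family (%n. u (idx (k n))) v" using conv by blast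
  have "w \<circ> k = (%n. u (idx (k n)))" by (auto simp: idx)
  then show "EX r v. strict_mono r & Lp_loc_converges q (w \<circ> r) v"
  using k(1) bounded_family.Lp_limit[OF k(2) q] by metis
  qed
 next
  fix q :: real and r :: "nat => nat" and v
  assume q: "1 <= q" and rv: "strict_mono r & Lp_loc_converges q (u \<circ> r) v"
  obtain k v' where k: "strict_mono (k :: nat => nat)" "bounded_family (%n. u (r (k n))) v'" using conv by blast
  interpret w: bounded_family "%n. u (r (k n))" v' by (rule k(2))
  have "Lp_loc_converges q (%n. u (r (k n))) v" unfolding Lp_loc_converges_def
  proof (intro conjI allI impI)
  fix K :: "spacetime set" assume "compact K & K \<subseteq> half_space"
  then have "(%n. LBINT p:K. (abs ((u \<circ> r) n p - v p)) powr q) ~~> 0" using rv unfolding Lp_loc_converges_def by blast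
  from LIMSEQ_subseq_LIMSEQ[OF this k(1)] show "(%n. LBINT p:K. (abs (u (r (k n)) p - v p)) powr q) ~~> 0" by (simp add: o_def)
  qed (use rv Lp[OF q] in "auto simp: Lp_loc_converges_def")
  \<comment> \<open>The given limit and the almost everywhere limit of the further subsequence
    agree, so the latter's bounds and entropy inequalities can be claimed for
    \<open>v\<close>.\<close>
  then have vv: "AE p in lborel. p : half_space --> v p = v' p" by (rule Lp_loc_limit_unique[OF q _ w.Lp_limit[OF q]])
  have wv: "AE p in lborel. p : half_space --> (%n. u (r (k n)) p) ~~> v p" using w.wv vv by eventually_elim simp
  interpret v: bounded_family "%n. u (r (k n))" v
  by unfold_locales (use w.wm wv w.bd rv in "auto simp: Lp_loc_converges_def Lp_loc_def")
  show "entropy_solution v" by (rule v.entropy_limit[OF ent])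
  show "EX s. strict_mono s & converges_boundedly_ae (u \<circ> r \<circ> s) v"
  using k(1) wv v.bd unfolding converges_boundedly_ae_def by (intro exI[of _ k]) auto
 qed
qed

end
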